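(* Assume that the convolutions $f\mapsto f*|L^\alpha\phi|$ and $f\mapsto f*|R^\alpha\phi|$ are continuous $B\to B$ for all multi-indices $\alpha$ with $|\alpha|\le\dim(G)$. Then one can choose $\epsilon>0$ and $U_\epsilon$-relatively separated points $\{x_i\}_{i\in I}$ such that for any $U_\epsilon$-BUPU $\{\psi_i\}$ with $\mathrm{supp}(\psi_i)\subseteq x_iU_\epsilon$ the operator on $B_\phi$ given by $$T_3f=\sum_i c_i f(x_i)\,\ell_{x_i}\phi,\qquad c_i=\int_G\psi_i(x)\,dx,$$ is invertible. The convergence of the sum is pointwise, and if $C_c(G)$ is dense in $B$ then the convergence is also in norm. Further, the functionals $f\mapsto c_i(T_3^{-1}f)(x_i)$ together with the vectors $\ell_{x_i}\phi$ form an atomic decomposition for $B_\phi$ (with respect to $B^\#$), and $\{c_i\ell_{x_i}\phi\}_{i\in I}$ is a frame for $B_\phi$, i.e. the functionals $f\mapsto c_if(x_i)$ form a Banach frame for $B_\phi$ with respect to $B^\#$.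
   Context: $G$ is a Lie group of dimension $n=\dim(G)$ with Lie algebra $\mathfrak g$, exponential map $\exp$, and left Haar measure $dx$; $X_1,\dots,X_n$ is a fixed basis of $\mathfrak g$. For $X\in\mathfrak g$, $R(X)f(x)=\lim_{t\to0}\frac{f(x\exp(tX))-f(x)}{t}$ and $L(X)f(x)=\lim_{t\to0}\frac{f(\exp(tX)x)-f(x)}{t}$. For a multi-index $\alpha$ of length $|\alpha|=k$ with entries in $\{1,\dots,n\}$, $R^\alpha f=R(X_{\alpha(k)})\cdots R(X_{\alpha(1)})f$ and $L^\alpha f=L(X_{\alpha(k)})\cdots L(X_{\alpha(1)})f$ (and $R^\alpha f=L^\alpha f=f$ if $|\alpha|=0$). For $\epsilon>0$, $U_\epsilon=\{\exp(t_1X_1)\cdots\exp(t_nX_n): -\epsilon\le t_k\le\epsilon\}$. $C_c(G)$ denotes the compactly supported continuous functions. Translations: $\ell_xf(y)=f(x^{-1}y)$, $r_xf(y)=f(yx)$. Convolution: $f*g(y)=\int_G f(x)g(x^{-1}y)\,dx$. Standing assumptions: $B$ is a Banach space of (measurable) functions on $G$ that is solid ($|f|\le|g|$ and $g\in B$ imply $f\in B$), left and right translation invariant with, for each compact $U\subseteq G$, a constant $C_U$ such that $\sup_{y\in U}\|\ell_yf\|_B\le C_U\|f\|_B$ and $\sup_{y\in U}\|r_yf\|_B\le C_U\|f\|_B$ for all $f\in B$; convergence in $B$ implies convergence locally in measure. There is a non-zero $\phi\in B$ with $\left|\int_G f(y)\phi(y^{-1})\,dy\right|\le C\|f\|_B$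 for all $f\in B$ and $\phi*\phi=\phi$. Put $B_\phi=\{f\in B: f=f*\phi\}$, a reproducing kernel Banach space with the norm of $B$. For a compact neighbourhood $U$ of the identity, $\{x_i\}_{i\in I}$ is $U$-relatively separated if $G\subseteq\bigcup_i x_iU$ and there is $N$ with $\sup_i\#\{j: x_iU\cap x_jU\ne\emptyset\}\le N$. For such a sequence, $B^\#$ is the space of sequences $\{\lambda_i\}_{i\in I}$ with $\sum_i|\lambda_i|1_{x_iU}\in B$ (pointwise sum), normed by $\|\{\lambda_i\}\|_{B^\#}=\|\sum_i|\lambda_i|1_{x_iU}\|_B$; here $U=U_\epsilon$. A $U$-BUPU is a family of non-negative functions $\psi_i$ for which there is a $U$-relatively separated sequence $\{x_i\}$ with $\mathrm{supp}(\psi_i)\subseteq x_iU$ and $\sum_i\psi_i=1$. Atomic decomposition: for a Banach space $E$ with associated Banach sequence space $E^\#$ over the index set $I$, a family $\{(\lambda_i,\phi_i)\}_{i\in I}$ with $\lambda_i\in E^*$, $\phi_i\in E$ is an atomic decomposition of $E$ with respect to $E^\#$ if (a) $\{\lambda_i(f)\}\in E^\#$ for all $f\in E$, (b) the norms $\|\{\lambda_i(f)\}\|_{E^\#}$ and $\|f\|_E$ are equivalent, (c) every $f\in E$ can be written $f=\sum_i\lambda_i(f)\phi_i$. A family $\{\lambda_i\}\subseteq E^*$ is a Banach frame for $E$ with respect to $E^\#$ if (a) and (b) hold and there is a bounded operator $S:E^\#\to E$ with $S(\{\lambda_i(f)\})=f$ for all $f\in E$. *)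

theory Defs
  imports "HOL-Analysis.Analysis"
begin

section \<open>Lie groups\<close>

text \<open>
  The group operation is written additively throughout, because the library class of topological
  groups is \<^class>\<open>topological_group_add\<close>, which does \<^emph>\<open>not\<close> assume commutativity: the product
  of \<open>x\<close> and \<open>y\<close> is \<open>x + y\<close>, the inverse of \<open>x\<close> is \<open>- x\<close>, the identity is \<open>0\<close>, and the left coset
  of a set \<open>U\<close> by \<open>x\<close> is \<open>(+) x ` U\<close>. The order of summands matters everywhere.
\<close>

subsection \<open>Smooth functions and manifolds\<close>

text \<open>
  For open \<open>S\<close> in a Euclidean space this is the usual class of \<open>k\<close> times continuously
  differentiable functions; all directional derivatives of \<open>f\<close> are required to be of class \<open>k - 1\<close>.
\<close>
primrec Ck_on :: "nat \<Rightarrow> ('a::euclidean_space \<Rightarrow> 'b::real_normed_vector) \<Rightarrow> 'a set \<Rightarrow> bool" where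
  "Ck_on 0 f S \<longleftrightarrow> continuous_on S f"
| "Ck_on (Suc k) f S \<longleftrightarrow>
     (\<forall>x\<in>S. f differentiable (at x)) \<and> (\<forall>v. Ck_on k (\<lambda>x. frechet_derivative f (at x) v) S)"

definition smooth_on :: "('a::euclidean_space \<Rightarrow> 'b::real_normed_vector) \<Rightarrow> 'a set \<Rightarrow> bool" where
  "smooth_on f S \<longleftrightarrow> (\<forall>k. Ck_on k f S)"

type_synonym ('g, 'e) chart = "'g set \<times> ('g \<Rightarrow> 'e)"

definition is_chart :: "('g::topological_space, 'e::euclidean_space) chart \<Rightarrow> bool" where
  "is_chart c \<longleftrightarrow> (case c of (U, \<kappa>) \<Rightarrow>
     open U \<and> open (\<kappa> ` U) \<and> homeomorphism U (\<kappa> ` U) \<kappa> (inv_into U \<kappa>))"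

definition compatible_charts ::
    "('g, 'e::euclidean_space) chart \<Rightarrow> ('g, 'e) chart \<Rightarrow> bool" where
  "compatible_charts c d \<longleftrightarrow> (case c of (U, \<kappa>) \<Rightarrow> case d of (V, \<eta>) \<Rightarrow>
     smooth_on (\<lambda>a. \<eta> (inv_into U \<kappa> a)) (\<kappa> ` (U \<inter> V)))"

text \<open>
  Euclidean spaces in HOL have positive dimension. An \<open>n\<close>-dimensional manifold with \<open>n > 0\<close> has
  charts in a Euclidean space of dimension \<open>n\<close>; a zero-dimensional manifold is a discrete space,
  represented by the empty atlas (so that, below, every function on it is smooth).
\<close>
definition smooth_atlas ::
    "('g::topological_space, 'e::euclidean_space) chart set \<Rightarrow> nat \<Rightarrow> bool" where
  "smooth_atlas A n \<longleftrightarrow>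
     (\<forall>c\<in>A. is_chart c) \<and> (\<forall>c\<in>A. \<forall>d\<in>A. compatible_charts c d) \<and>
     (if n = 0 then A = {} \<and> (\<forall>x::'g. open {x})
      else n = DIM('e) \<and> (\<Union>c\<in>A. fst c) = UNIV)"

definition smooth_addition :: "('g::group_add, 'e::euclidean_space) chart set \<Rightarrow> bool" where
  "smooth_addition A \<longleftrightarrow> (\<forall>(U, \<kappa>)\<in>A. \<forall>(V, \<eta>)\<in>A. \<forall>(W, \<zeta>)\<in>A.
     smooth_on (\<lambda>(a, b). \<zeta> (inv_into U \<kappa> a + inv_into V \<eta> b))
       {(a, b). a \<in> \<kappa> ` U \<and> b \<in> \<eta> ` V \<and> inv_into U \<kappa> a + inv_into V \<eta> b \<in> W})"

definition smooth_inversion :: "('g::group_add, 'e::euclidean_space) chart set \<Rightarrow> bool" where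
  "smooth_inversion A \<longleftrightarrow> (\<forall>(U, \<kappa>)\<in>A. \<forall>(V, \<eta>)\<in>A.
     smooth_on (\<lambda>a. \<eta> (- inv_into U \<kappa> a)) {a \<in> \<kappa> ` U. - inv_into U \<kappa> a \<in> V})"

text \<open>Hausdorff and second countable, as usual for manifolds, by the type class constraint.\<close>
definition lie_group ::
    "('g::{topological_group_add, t2_space, second_countable_topology}, 'e::euclidean_space) chart set
      \<Rightarrow> nat \<Rightarrow> bool" where
  "lie_group A n \<longleftrightarrow> smooth_atlas A n \<and> smooth_addition A \<and> smooth_inversion A"

definition smooth_fun :: "('g, 'e::euclidean_space) chart set \<Rightarrow> ('g \<Rightarrow> real) \<Rightarrow> bool" where
  "smooth_fun A f \<longleftrightarrow> (\<forall>(U, \<kappa>)\<in>A. smooth_on (\<lambda>a. f (inv_into U \<kappa> a)) (\<kappa> ` U))"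

subsection \<open>Translations, Lie algebra and exponential map\<close>

definition left_transl :: "'g::group_add \<Rightarrow> ('g \<Rightarrow> 'b) \<Rightarrow> 'g \<Rightarrow> 'b" where
  "left_transl x f = (\<lambda>y. f (- x + y))"

definition right_transl :: "'g::group_add \<Rightarrow> ('g \<Rightarrow> 'b) \<Rightarrow> 'g \<Rightarrow> 'b" where
  "right_transl x f = (\<lambda>y. f (y + x))"

type_synonym 'g vfield = "('g \<Rightarrow> real) \<Rightarrow> 'g \<Rightarrow> real"

text \<open>
  The Lie algebra consists of the left invariant vector fields, i.e. the derivations of the algebra
  of smooth functions that commute with left translations. A field is set to \<open>0\<close> on non-smooth
  functions to make it a unique object; the vector space operations are pointwise.
\<close>
definition lie_algebra :: "('g::group_add, 'e::euclidean_space) chart set \<Rightarrow> 'g vfield set" where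
  "lie_algebra A = {X.
     (\<forall>f. \<not> smooth_fun A f \<longrightarrow> X f = (\<lambda>_. 0)) \<and>
     (\<forall>f. smooth_fun A f \<longrightarrow> smooth_fun A (X f)) \<and>
     (\<forall>f g a b. smooth_fun A f \<longrightarrow> smooth_fun A g \<longrightarrow>
        X (\<lambda>x. a * f x + b * g x) = (\<lambda>x. a * X f x + b * X g x)) \<and>
     (\<forall>f g. smooth_fun A f \<longrightarrow> smooth_fun A g \<longrightarrow>
        X (\<lambda>x. f x * g x) = (\<lambda>x. f x * X g x + X f x * g x)) \<and>
     (\<forall>f y. smooth_fun A f \<longrightarrow> X (left_transl y f) = left_transl y (X f))}"

definition lie_algebra_basis ::
    "('g::group_add, 'e::euclidean_space) chart set \<Rightarrow> nat \<Rightarrow> (nat \<Rightarrow> 'g vfield) \<Rightarrow> bool" where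
  "lie_algebra_basis A n X \<longleftrightarrow>
     (\<forall>k\<in>{1..n}. X k \<in> lie_algebra A) \<and>
     (\<forall>a::nat \<Rightarrow> real. (\<forall>f x. (\<Sum>k=1..n. a k * X k f x) = 0) \<longrightarrow> (\<forall>k\<in>{1..n}. a k = 0)) \<and>
     (\<forall>Y\<in>lie_algebra A. \<exists>a::nat \<Rightarrow> real. \<forall>f x. Y f x = (\<Sum>k=1..n. a k * X k f x))"

definition vf_scale :: "real \<Rightarrow> 'g vfield \<Rightarrow> 'g vfield" where
  "vf_scale t X = (\<lambda>f x. t * X f x)"

text \<open>The (complete) integral curve of \<open>X\<close> starting at the identity.\<close>
definition integral_curve ::
    "('g::{group_add, topological_space}, 'e::euclidean_space) chart set
      \<Rightarrow> 'g vfield \<Rightarrow> (real \<Rightarrow> 'g) \<Rightarrow> bool" where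
  "integral_curve A X \<gamma> \<longleftrightarrow> \<gamma> 0 = 0 \<and> continuous_on UNIV \<gamma> \<and>
     (\<forall>f t. smooth_fun A f \<longrightarrow> ((\<lambda>s. f (\<gamma> s)) has_real_derivative X f (\<gamma> t)) (at t))"

definition lie_exp ::
    "('g::{group_add, topological_space}, 'e::euclidean_space) chart set \<Rightarrow> 'g vfield \<Rightarrow> 'g" where
  "lie_exp A X = (THE \<gamma>. integral_curve A X \<gamma>) 1"

subsection \<open>Right and left differential operators\<close>

definition right_quot ::
    "('g::{group_add, topological_space}, 'e::euclidean_space) chart set
      \<Rightarrow> 'g vfield \<Rightarrow> ('g \<Rightarrow> complex) \<Rightarrow> 'g \<Rightarrow> real \<Rightarrow> complex" where
  "right_quot A X f x t = (f (x + lie_exp A (vf_scale t X)) - f x) / of_real t"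

definition left_quot ::
    "('g::{group_add, topological_space}, 'e::euclidean_space) chart set
      \<Rightarrow> 'g vfield \<Rightarrow> ('g \<Rightarrow> complex) \<Rightarrow> 'g \<Rightarrow> real \<Rightarrow> complex" where
  "left_quot A X f x t = (f (lie_exp A (vf_scale t X) + x) - f x) / of_real t"

definition right_deriv ::
    "('g::{group_add, topological_space}, 'e::euclidean_space) chart set
      \<Rightarrow> 'g vfield \<Rightarrow> ('g \<Rightarrow> complex) \<Rightarrow> 'g \<Rightarrow> complex" where
  "right_deriv A X f x = Lim (at 0) (right_quot A X f x)"

definition left_deriv ::
    "('g::{group_add, topological_space}, 'e::euclidean_space) chart set
      \<Rightarrow> 'g vfield \<Rightarrow> ('g \<Rightarrow> complex) \<Rightarrow> 'g \<Rightarrow> complex" where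
  "left_deriv A X f x = Lim (at 0) (left_quot A X f x)"

text \<open>
  A multi-index is a list over \<open>{1..n}\<close>, and its first entry is differentiated first:
  for \<open>\<alpha> = [a, b]\<close> the operator is \<open>R(X b) (R(X a) f)\<close>.
\<close>
definition multi_indices :: "nat \<Rightarrow> nat list set" where
  "multi_indices n = {\<alpha>. set \<alpha> \<subseteq> {1..n}}"

definition right_derivs ::
    "('g::{group_add, topological_space}, 'e::euclidean_space) chart set
      \<Rightarrow> (nat \<Rightarrow> 'g vfield) \<Rightarrow> nat list \<Rightarrow> ('g \<Rightarrow> complex) \<Rightarrow> 'g \<Rightarrow> complex" where
  "right_derivs A X \<alpha> f = fold (\<lambda>k. right_deriv A (X k)) \<alpha> f"

definition left_derivs ::
    "('g::{group_add, topological_space}, 'e::euclidean_space) chart set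
      \<Rightarrow> (nat \<Rightarrow> 'g vfield) \<Rightarrow> nat list \<Rightarrow> ('g \<Rightarrow> complex) \<Rightarrow> 'g \<Rightarrow> complex" where
  "left_derivs A X \<alpha> f = fold (\<lambda>k. left_deriv A (X k)) \<alpha> f"

text \<open>
  All limits defining the right (left) derivatives of \<open>f\<close> of order at most \<open>m\<close> exist, at every point.
\<close>
definition right_differentiable ::
    "('g::{group_add, topological_space}, 'e::euclidean_space) chart set
      \<Rightarrow> nat \<Rightarrow> (nat \<Rightarrow> 'g vfield) \<Rightarrow> nat \<Rightarrow> ('g \<Rightarrow> complex) \<Rightarrow> bool" where
  "right_differentiable A n X m f \<longleftrightarrow>
     (\<forall>\<alpha>\<in>multi_indices n. length \<alpha> < m \<longrightarrow>
        (\<forall>k\<in>{1..n}. \<forall>x. \<exists>l. (right_quot A (X k) (right_derivs A X \<alpha> f) x \<longlongrightarrow> l) (at 0)))"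

definition left_differentiable ::
    "('g::{group_add, topological_space}, 'e::euclidean_space) chart set
      \<Rightarrow> nat \<Rightarrow> (nat \<Rightarrow> 'g vfield) \<Rightarrow> nat \<Rightarrow> ('g \<Rightarrow> complex) \<Rightarrow> bool" where
  "left_differentiable A n X m f \<longleftrightarrow>
     (\<forall>\<alpha>\<in>multi_indices n. length \<alpha> < m \<longrightarrow>
        (\<forall>k\<in>{1..n}. \<forall>x. \<exists>l. (left_quot A (X k) (left_derivs A X \<alpha> f) x \<longlongrightarrow> l) (at 0)))"

text \<open>The \<^const>\<open>sum_list\<close> is the ordered product of the \<open>n\<close> exponentials.\<close>
definition exp_box ::
    "('g::{group_add, topological_space}, 'e::euclidean_space) chart set
      \<Rightarrow> nat \<Rightarrow> (nat \<Rightarrow> 'g vfield) \<Rightarrow> real \<Rightarrow> 'g set" where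
  "exp_box A n X \<epsilon> =
     {sum_list (map (\<lambda>k. lie_exp A (vf_scale (t k) (X k))) [1..<Suc n]) | t::nat \<Rightarrow> real.
        \<forall>k\<in>{1..n}. - \<epsilon> \<le> t k \<and> t k \<le> \<epsilon>}"

section \<open>Function spaces on the group\<close>

text \<open>
  On a second countable locally compact group, Borel measures that are finite on compact sets are
  automatically regular.
\<close>
definition left_haar_measure :: "'g::{topological_space, group_add} measure \<Rightarrow> bool" where
  "left_haar_measure \<mu> \<longleftrightarrow>
     sets \<mu> = sets borel \<and>
     (\<forall>x. distr \<mu> borel ((+) x) = \<mu>) \<and>
     (\<forall>K. compact K \<longrightarrow> emeasure \<mu> K < \<infinity>) \<and>
     emeasure \<mu> UNIV \<noteq> 0"

definition conv ::
    "'g::group_add measure \<Rightarrow> ('g \<Rightarrow> complex) \<Rightarrow> ('g \<Rightarrow> complex) \<Rightarrow> 'g \<Rightarrow> complex" where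
  "conv \<mu> f g y = (\<integral>x. f x * g (- x + y) \<partial>\<mu>)"

text \<open>
  A solid Banach space \<open>B\<close> of measurable functions with norm \<open>N\<close>. As usual functions that agree
  almost everywhere are identified, which here means that \<open>B\<close> is a set of actual functions,
  (by solidity) closed under equality almost everywhere, and \<open>N\<close> vanishes exactly on null functions.
\<close>
locale solid_translation_invariant_space =
  fixes \<mu> :: "'g::{topological_group_add, t2_space, second_countable_topology} measure"
    and B :: "('g \<Rightarrow> complex) set"
    and N :: "('g \<Rightarrow> complex) \<Rightarrow> real"
  assumes measurable: "f \<in> B \<Longrightarrow> f \<in> borel_measurable borel"
    and zero_mem: "(\<lambda>_. 0) \<in> B"
    and add_mem: "f \<in> B \<Longrightarrow> g \<in> B \<Longrightarrow> (\<lambda>x. f x + g x) \<in> B"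
    and scale_mem: "f \<in> B \<Longrightarrow> (\<lambda>x. a * f x) \<in> B"
    and norm_nonneg: "f \<in> B \<Longrightarrow> 0 \<le> N f"
    and norm_eq_zero: "f \<in> B \<Longrightarrow> N f = 0 \<longleftrightarrow> (AE x in \<mu>. f x = 0)"
    and norm_triangle: "f \<in> B \<Longrightarrow> g \<in> B \<Longrightarrow> N (\<lambda>x. f x + g x) \<le> N f + N g"
    and norm_scale: "f \<in> B \<Longrightarrow> N (\<lambda>x. a * f x) = norm a * N f"
    and complete:
      "(\<And>m. F m \<in> B) \<Longrightarrow>
       (\<And>e. 0 < e \<Longrightarrow> \<exists>M. \<forall>m\<ge>M. \<forall>k\<ge>M. N (\<lambda>x. F m x - F k x) < e) \<Longrightarrow>
       \<exists>f\<in>B. (\<lambda>m. N (\<lambda>x. F m x - f x)) \<longlonglongrightarrow> 0"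
    and solid:
      "g \<in> B \<Longrightarrow> f \<in> borel_measurable borel \<Longrightarrow> (AE x in \<mu>. norm (f x) \<le> norm (g x)) \<Longrightarrow> f \<in> B"
    and left_transl_mem: "f \<in> B \<Longrightarrow> left_transl y f \<in> B"
    and right_transl_mem: "f \<in> B \<Longrightarrow> right_transl y f \<in> B"
    and left_transl_bound:
      "compact U \<Longrightarrow> \<exists>C. \<forall>y\<in>U. \<forall>f\<in>B. N (left_transl y f) \<le> C * N f"
    and right_transl_bound:
      "compact U \<Longrightarrow> \<exists>C. \<forall>y\<in>U. \<forall>f\<in>B. N (right_transl y f) \<le> C * N f"
    and converges_locally_in_measure:
      "(\<And>m. F m \<in> B) \<Longrightarrow> f \<in> B \<Longrightarrow> (\<lambda>m. N (\<lambda>x. F m x - f x)) \<longlonglongrightarrow> 0 \<Longrightarrow>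
       compact K \<Longrightarrow> 0 < \<delta> \<Longrightarrow> (\<lambda>m. measure \<mu> {x \<in> K. \<delta> \<le> norm (F m x - f x)}) \<longlonglongrightarrow> 0"

text \<open>
  The integrals are required to exist, since the Bochner integral of a non-integrable function is
  \<open>0\<close> by convention. They then exist for all translates of \<open>f\<close> too, so \<^term>\<open>conv \<mu> f \<phi>\<close> is defined
  at every point, and \<open>conv \<mu> \<phi> \<phi> = \<phi>\<close> is an identity at every point.
\<close>
definition reproducing_kernel ::
    "'g::group_add measure \<Rightarrow> ('g \<Rightarrow> complex) set \<Rightarrow> (('g \<Rightarrow> complex) \<Rightarrow> real)
      \<Rightarrow> ('g \<Rightarrow> complex) \<Rightarrow> bool" where
  "reproducing_kernel \<mu> B N \<phi> \<longleftrightarrow>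
     \<phi> \<in> B \<and> \<not> (AE x in \<mu>. \<phi> x = 0) \<and>
     (\<forall>f\<in>B. integrable \<mu> (\<lambda>y. f y * \<phi> (- y))) \<and>
     (\<exists>C. \<forall>f\<in>B. norm (\<integral>y. f y * \<phi> (- y) \<partial>\<mu>) \<le> C * N f) \<and>
     conv \<mu> \<phi> \<phi> = \<phi>"

definition reproducing_space ::
    "'g::group_add measure \<Rightarrow> ('g \<Rightarrow> complex) set \<Rightarrow> ('g \<Rightarrow> complex) \<Rightarrow> ('g \<Rightarrow> complex) set" where
  "reproducing_space \<mu> B \<phi> = {f \<in> B. f = conv \<mu> f \<phi>}"

text \<open>
  Convolution with \<open>g\<close> is well defined (the integral converges almost everywhere) and is a
  continuous, i.e. bounded, operator from \<open>B\<close> to \<open>B\<close>.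
\<close>
definition conv_continuous ::
    "'g::group_add measure \<Rightarrow> ('g \<Rightarrow> complex) set \<Rightarrow> (('g \<Rightarrow> complex) \<Rightarrow> real)
      \<Rightarrow> ('g \<Rightarrow> complex) \<Rightarrow> bool" where
  "conv_continuous \<mu> B N g \<longleftrightarrow>
     (\<forall>f\<in>B. (AE y in \<mu>. integrable \<mu> (\<lambda>x. f x * g (- x + y))) \<and> conv \<mu> f g \<in> B) \<and>
     (\<exists>C. \<forall>f\<in>B. N (conv \<mu> f g) \<le> C * N f)"

definition compactly_supported_continuous :: "('g::topological_space \<Rightarrow> complex) set" where
  "compactly_supported_continuous =
     {f. continuous_on UNIV f \<and> compact (closure {x. f x \<noteq> 0})}"

definition dense_in_space ::
    "('g \<Rightarrow> complex) set \<Rightarrow> ('g \<Rightarrow> complex) set \<Rightarrow> (('g \<Rightarrow> complex) \<Rightarrow> real) \<Rightarrow> bool" where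
  "dense_in_space D B N \<longleftrightarrow> D \<subseteq> B \<and> (\<forall>f\<in>B. \<forall>e>0. \<exists>g\<in>D. N (\<lambda>x. f x - g x) < e)"

section \<open>Sampling points, sequence spaces and partitions of unity\<close>

definition relatively_separated ::
    "'g::{topological_space, group_add} set \<Rightarrow> 'i set \<Rightarrow> ('i \<Rightarrow> 'g) \<Rightarrow> bool" where
  "relatively_separated U I x \<longleftrightarrow>
     compact U \<and> 0 \<in> interior U \<and>
     (\<Union>i\<in>I. (+) (x i) ` U) = UNIV \<and>
     (\<exists>M::nat. \<forall>i\<in>I.
        finite {j\<in>I. (+) (x i) ` U \<inter> (+) (x j) ` U \<noteq> {}} \<and>
        card {j\<in>I. (+) (x i) ` U \<inter> (+) (x j) ` U \<noteq> {}} \<le> M)"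

text \<open>Families over \<open>I\<close> are represented by functions that vanish outside \<open>I\<close>.\<close>
definition family :: "'i set \<Rightarrow> ('i \<Rightarrow> complex) \<Rightarrow> 'i \<Rightarrow> complex" where
  "family I a = (\<lambda>i. if i \<in> I then a i else 0)"

definition seq_envelope ::
    "'g::group_add set \<Rightarrow> 'i set \<Rightarrow> ('i \<Rightarrow> 'g) \<Rightarrow> ('i \<Rightarrow> complex) \<Rightarrow> 'g \<Rightarrow> complex" where
  "seq_envelope U I x a y = (\<Sum>\<^sub>\<infinity>i\<in>I. of_real (norm (a i)) * indicator ((+) (x i) ` U) y)"

definition seq_space ::
    "('g::group_add \<Rightarrow> complex) set \<Rightarrow> 'g set \<Rightarrow> 'i set \<Rightarrow> ('i \<Rightarrow> 'g) \<Rightarrow> ('i \<Rightarrow> complex) set" where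
  "seq_space B U I x = {a. (\<forall>i. i \<notin> I \<longrightarrow> a i = 0) \<and> seq_envelope U I x a \<in> B}"

definition seq_norm ::
    "(('g::group_add \<Rightarrow> complex) \<Rightarrow> real) \<Rightarrow> 'g set \<Rightarrow> 'i set \<Rightarrow> ('i \<Rightarrow> 'g)
      \<Rightarrow> ('i \<Rightarrow> complex) \<Rightarrow> real" where
  "seq_norm N U I x a = N (seq_envelope U I x a)"

definition bupu ::
    "'g::{topological_space, group_add} set \<Rightarrow> 'i set \<Rightarrow> ('i \<Rightarrow> 'g) \<Rightarrow> ('i \<Rightarrow> 'g \<Rightarrow> real) \<Rightarrow> bool" where
  "bupu U I x \<psi> \<longleftrightarrow>
     relatively_separated U I x \<and>
     (\<forall>i\<in>I. \<psi> i \<in> borel_measurable borel \<and> (\<forall>y. 0 \<le> \<psi> i y) \<and>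
        closure {y. \<psi> i y \<noteq> 0} \<subseteq> (+) (x i) ` U) \<and>
     (\<forall>y. ((\<lambda>i. \<psi> i y) has_sum 1) I)"

section \<open>Operators, atomic decompositions and Banach frames\<close>

text \<open>
  Both function spaces and sequence spaces are sets of complex valued functions with pointwise
  operations, carrying a norm.
\<close>
definition bounded_operator ::
    "('a \<Rightarrow> complex) set \<Rightarrow> (('a \<Rightarrow> complex) \<Rightarrow> real) \<Rightarrow>
     ('b \<Rightarrow> complex) set \<Rightarrow> (('b \<Rightarrow> complex) \<Rightarrow> real) \<Rightarrow>
     (('a \<Rightarrow> complex) \<Rightarrow> 'b \<Rightarrow> complex) \<Rightarrow> bool" where
  "bounded_operator E NE F NF T \<longleftrightarrow>
     (\<forall>f\<in>E. T f \<in> F) \<and>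
     (\<forall>f\<in>E. \<forall>g\<in>E. T (\<lambda>x. f x + g x) = (\<lambda>y. T f y + T g y)) \<and>
     (\<forall>f\<in>E. \<forall>a. T (\<lambda>x. a * f x) = (\<lambda>y. a * T f y)) \<and>
     (\<exists>C. \<forall>f\<in>E. NF (T f) \<le> C * NE f)"

definition invertible_operator ::
    "('a \<Rightarrow> complex) set \<Rightarrow> (('a \<Rightarrow> complex) \<Rightarrow> real) \<Rightarrow>
     (('a \<Rightarrow> complex) \<Rightarrow> 'a \<Rightarrow> complex) \<Rightarrow> bool" where
  "invertible_operator E NE T \<longleftrightarrow>
     bounded_operator E NE E NE T \<and>
     (\<exists>S. bounded_operator E NE E NE S \<and> (\<forall>f\<in>E. S (T f) = f \<and> T (S f) = f))"

definition dual_space ::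
    "('a \<Rightarrow> complex) set \<Rightarrow> (('a \<Rightarrow> complex) \<Rightarrow> real) \<Rightarrow> (('a \<Rightarrow> complex) \<Rightarrow> complex) set" where
  "dual_space E NE = {l.
     (\<forall>f\<in>E. \<forall>g\<in>E. l (\<lambda>x. f x + g x) = l f + l g) \<and>
     (\<forall>f\<in>E. \<forall>a. l (\<lambda>x. a * f x) = a * l f) \<and>
     (\<exists>C. \<forall>f\<in>E. norm (l f) \<le> C * NE f)}"

definition pointwise_sum ::
    "'i set \<Rightarrow> ('i \<Rightarrow> 'a \<Rightarrow> complex) \<Rightarrow> ('a \<Rightarrow> complex) \<Rightarrow> bool" where
  "pointwise_sum I u f \<longleftrightarrow> (\<forall>y. ((\<lambda>i. u i y) has_sum f y) I)"

definition norm_sum ::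
    "(('a \<Rightarrow> complex) \<Rightarrow> real) \<Rightarrow> 'i set \<Rightarrow> ('i \<Rightarrow> 'a \<Rightarrow> complex) \<Rightarrow> ('a \<Rightarrow> complex) \<Rightarrow> bool" where
  "norm_sum NE I u f \<longleftrightarrow>
     ((\<lambda>F. NE (\<lambda>y. f y - (\<Sum>i\<in>F. u i y))) \<longlongrightarrow> 0) (finite_subsets_at_top I)"

definition norm_equivalent_coefficients ::
    "('a \<Rightarrow> complex) set \<Rightarrow> (('a \<Rightarrow> complex) \<Rightarrow> real) \<Rightarrow>
     ('i \<Rightarrow> complex) set \<Rightarrow> (('i \<Rightarrow> complex) \<Rightarrow> real) \<Rightarrow>
     'i set \<Rightarrow> ('i \<Rightarrow> ('a \<Rightarrow> complex) \<Rightarrow> complex) \<Rightarrow> bool" where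
  "norm_equivalent_coefficients E NE D ND I l \<longleftrightarrow>
     (\<forall>f\<in>E. family I (\<lambda>i. l i f) \<in> D) \<and>
     (\<exists>a>0. \<exists>b>0. \<forall>f\<in>E. a * NE f \<le> ND (family I (\<lambda>i. l i f)) \<and>
        ND (family I (\<lambda>i. l i f)) \<le> b * NE f)"

text \<open>
  The parameter \<open>sums_to\<close> is the mode of convergence of the expansion
  (\<^const>\<open>pointwise_sum\<close> or \<^const>\<open>norm_sum\<close>).
\<close>
definition atomic_decomposition ::
    "(('i \<Rightarrow> 'a \<Rightarrow> complex) \<Rightarrow> ('a \<Rightarrow> complex) \<Rightarrow> bool) \<Rightarrow>
     ('a \<Rightarrow> complex) set \<Rightarrow> (('a \<Rightarrow> complex) \<Rightarrow> real) \<Rightarrow>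
     ('i \<Rightarrow> complex) set \<Rightarrow> (('i \<Rightarrow> complex) \<Rightarrow> real) \<Rightarrow>
     'i set \<Rightarrow> ('i \<Rightarrow> ('a \<Rightarrow> complex) \<Rightarrow> complex) \<Rightarrow> ('i \<Rightarrow> 'a \<Rightarrow> complex) \<Rightarrow> bool" where
  "atomic_decomposition sums_to E NE D ND I l v \<longleftrightarrow>
     (\<forall>i\<in>I. l i \<in> dual_space E NE \<and> v i \<in> E) \<and>
     norm_equivalent_coefficients E NE D ND I l \<and>
     (\<forall>f\<in>E. sums_to (\<lambda>i y. l i f * v i y) f)"

definition banach_frame ::
    "('a \<Rightarrow> complex) set \<Rightarrow> (('a \<Rightarrow> complex) \<Rightarrow> real) \<Rightarrow>
     ('i \<Rightarrow> complex) set \<Rightarrow> (('i \<Rightarrow> complex) \<Rightarrow> real) \<Rightarrow>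
     'i set \<Rightarrow> ('i \<Rightarrow> ('a \<Rightarrow> complex) \<Rightarrow> complex) \<Rightarrow> bool" where
  "banach_frame E NE D ND I l \<longleftrightarrow>
     (\<forall>i\<in>I. l i \<in> dual_space E NE) \<and>
     norm_equivalent_coefficients E NE D ND I l \<and>
     (\<exists>S. bounded_operator D ND E NE S \<and> (\<forall>f\<in>E. S (family I (\<lambda>i. l i f)) = f))"

definition weight :: "'g measure \<Rightarrow> ('i \<Rightarrow> 'g \<Rightarrow> real) \<Rightarrow> 'i \<Rightarrow> complex" where
  "weight \<mu> \<psi> i = of_real (\<integral>y. \<psi> i y \<partial>\<mu>)"

definition T3 ::
    "'g::group_add measure \<Rightarrow> ('g \<Rightarrow> complex) \<Rightarrow> 'i set \<Rightarrow> ('i \<Rightarrow> 'g) \<Rightarrow> ('i \<Rightarrow> 'g \<Rightarrow> real)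
      \<Rightarrow> ('g \<Rightarrow> complex) \<Rightarrow> 'g \<Rightarrow> complex" where
  "T3 \<mu> \<phi> I x \<psi> f y = (\<Sum>\<^sub>\<infinity>i\<in>I. weight \<mu> \<psi> i * f (x i) * left_transl (x i) \<phi> y)"

end

theory Submission
  imports Defs
begin

text \<open>
  Why the operator is invertible. Every f in the reproducing space satisfies f = f * phi, so T3 f is
  a Riemann sum for the integral of H w = f w * phi (- w + y), whose value is f y. The error is
  therefore the mean oscillation of H on the pieces of the cover. Since f is itself an integral of
  translates of phi, H is a superposition of products phi (- z + w) * phi (- w + y), and these are
  differentiable in w: the right derivatives of the first factor and the left derivatives of the
  second factor enter. A Poincare inequality along the boxes bounds the oscillation by eps times an
  integral of the derivatives, and after summation over the pieces the error is pointwise at most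
  a constant times eps times the two-fold convolution of |f| with sums of derivatives of phi
  (\<open>sampling_error\<close>). Those convolutions are bounded on B, so for small eps the operator is within
  one half of the identity and the Neumann series inverts it (\<open>near_identity_invertible\<close>).

  Boundedness of analysis and synthesis comes from the same local estimates: a Sobolev inequality on
  boxes replaces point values by averages (\<open>local_estimates\<close>), and averages are bounded on B because
  |phi| * |phi| is bounded below on some open set (\<open>dominated_average\<close>). The atomic decomposition
  and the frame property then follow by composing with the inverse.

  Two points need preparation. The geometry: exponentials are flows of vector fields in a chart, the
  product of the n exponentials is bi-Lipschitz near zero, and Haar measure is comparable with
  Lebesgue measure in the chart; this gives constants independent of eps, in particular a uniform
  bound for the overlaps of the cover (\<open>sampling_points\<close>). The space B: its norm need not be
  monotone, but by Zabreiko's lemma it is monotone up to a constant (\<open>solid_norm\<close>), which allows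
  all estimates to be carried out for extended non-negative functions.
\<close>

abbreviation "Bmeas == borel_measurable borel"
abbreviation enorm :: "'a::real_normed_vector => ennreal" where "enorm z == ennreal (norm z)"
abbreviation "cplx == complex_of_real"

section \<open>Calculus of the classes C^k\<close>

lemma Ck_on_subset: "Ck_on k f S ==> T <= S ==> Ck_on k f T"
 by (induction k arbitrary: f) (auto intro: continuous_on_subset)

lemma Ck_on_cong:
 assumes "open S" "Ck_on k f S" "!!x. x : S ==> f x = g x"
 shows "Ck_on k g S"
 using assms(2,3)
proof (induction k arbitrary: f g)
 case 0
 then show ?case by (metis Ck_on.simps(1) continuous_on_cong)
next
 case (Suc k)
 have D: "g differentiable (at x)" "frechet_derivative f (at x) = frechet_derivative g (at x)"
  if x: "x : S" for x
 proof -
  have f: "f differentiable (at x)" using Suc.prems x by simp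
  then show "frechet_derivative f (at x) = frechet_derivative g (at x)"
   by (rule frechet_derivative_transform_within_open[OF _ assms(1) x Suc.prems(2)])
  from f obtain D where "(f has_derivative D) (at x)" by (auto simp: differentiable_def)
  then have "(g has_derivative D) (at x)"
   by (rule has_derivative_transform_within_open[OF _ assms(1) x Suc.prems(2)])
  then show "g differentiable (at x)" by (auto simp: differentiable_def)
 qed
 show ?case
 proof (simp, intro conjI ballI allI)
  fix v
  have "Ck_on k (%x. frechet_derivative f (at x) v) S" using Suc.prems by simp
  then show "Ck_on k (%x. frechet_derivative g (at x) v) S"
   by (rule Suc.IH) (simp add: D)
 qed (use D in auto)
qed

lemma Ck_on_SucI:
 assumes "open S" "!!x. x : S ==> (f has_derivative f' x) (at x)"
  and "!!v. Ck_on k (%x. f' x v) S"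
 shows "Ck_on (Suc k) f S"
proof (simp, intro conjI ballI allI)
 fix v
 show "Ck_on k (%x. frechet_derivative f (at x) v) S"
  using assms(3)[of v]
  by (rule Ck_on_cong[OF assms(1)]) (metis assms(2) frechet_derivative_at)
qed (use assms(2) in \<open>auto simp: differentiable_def\<close>)

lemma Ck_on_Suc_has_derivative:
 "Ck_on (Suc k) f S ==> x : S ==> (f has_derivative frechet_derivative f (at x)) (at x)"
 by (simp add: frechet_derivative_works)

lemma Ck_on_Suc_D: "Ck_on (Suc k) f S ==> Ck_on k f S"
proof (induction k arbitrary: f)
 case 0
 then show ?case
  by (auto intro!: continuous_at_imp_continuous_on differentiable_imp_continuous_within)
qed auto

lemma Ck_on_mono: "Ck_on k f S ==> j <= k ==> Ck_on j f S"
 by (induction k) (auto simp: le_Suc_eq dest: Ck_on_Suc_D simp del: Ck_on.simps(2))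

lemma Ck_on_const: "Ck_on k (%_. c) S"
 by (induction k arbitrary: c) auto

lemma Ck_on_linear:
 assumes "bounded_linear L" "open S"
 shows "Ck_on k L S"
proof (cases k)
 case 0
 then show ?thesis
  using assms by (simp add: linear_continuous_on)
next
 case (Suc j)
 show ?thesis
  unfolding Suc
  by (rule Ck_on_SucI[OF assms(2) bounded_linear_imp_has_derivative[OF assms(1)]])
   (rule Ck_on_const)
qed

lemma Ck_on_add:
 assumes "open S" "Ck_on k f S" "Ck_on k g S"
 shows "Ck_on k (%x. f x + g x) S"
 using assms(2,3)
proof (induction k arbitrary: f g)
 case 0
 then show ?case by (simp add: continuous_on_add)
next
 case (Suc k)
 show ?case
 proof (rule Ck_on_SucI[OF assms(1)])
  show "((%x. f x + g x) has_derivative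
    (%v. frechet_derivative f (at x) v + frechet_derivative g (at x) v)) (at x)"
   if "x : S" for x
   using that Suc.prems by (intro has_derivative_add Ck_on_Suc_has_derivative)
  show "Ck_on k (%x. frechet_derivative f (at x) v + frechet_derivative g (at x) v) S" for v
   by (rule Suc.IH) (use Suc.prems in auto)
 qed
qed

lemma Ck_on_sum:
 assumes "open S" "!!i. i : I ==> Ck_on k (f i) S"
 shows "Ck_on k (%x. \<Sum>i\<in>I. f i x) S"
proof (cases "finite I")
 case True
 then show ?thesis
  using assms(2) by induction (auto intro!: Ck_on_const Ck_on_add[OF assms(1)])
qed (simp add: Ck_on_const)

lemma Ck_on_bounded_linear_comp:
 assumes L: "bounded_linear L" and "open S" "Ck_on k f S"
 shows "Ck_on k (%x. L (f x)) S"
 using assms(3)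
proof (induction k arbitrary: f)
 case 0
 then show ?case using L by (auto intro: linear_continuous_on_compose simp: bounded_linear.linear
    intro: continuous_on_compose2[OF linear_continuous_on[OF L]])
next
 case (Suc k)
 show ?case
 proof (rule Ck_on_SucI[OF assms(2)])
  show "((%x. L (f x)) has_derivative (%v. L (frechet_derivative f (at x) v))) (at x)"
   if "x : S" for x
   using that Suc.prems by (intro bounded_linear.has_derivative[OF L] Ck_on_Suc_has_derivative)
  show "Ck_on k (%x. L (frechet_derivative f (at x) v)) S" for v
   by (rule Suc.IH) (use Suc.prems in auto)
 qed
qed

lemma Ck_on_scaleR:
 fixes f :: "'a::euclidean_space => real" and g :: "'a => 'b::real_normed_vector"
 assumes "open S" "Ck_on k f S" "Ck_on k g S"
 shows "Ck_on k (%x. f x *\<^sub>R g x) S"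
 using assms(2,3)
proof (induction k arbitrary: f g)
 case 0
 then show ?case by (simp add: continuous_on_scaleR)
next
 case (Suc k)
 show ?case
 proof (rule Ck_on_SucI[OF assms(1)])
  show "((%x. f x *\<^sub>R g x) has_derivative
    (%v. f x *\<^sub>R frechet_derivative g (at x) v + frechet_derivative f (at x) v *\<^sub>R g x)) (at x)"
   if "x : S" for x
   using that Suc.prems by (intro has_derivative_scaleR Ck_on_Suc_has_derivative)
  show "Ck_on k (%x. f x *\<^sub>R frechet_derivative g (at x) v
    + frechet_derivative f (at x) v *\<^sub>R g x) S" for v
   using Suc.prems by (intro Ck_on_add Suc.IH assms(1)) (auto intro: Ck_on_Suc_D)
 qed
qed

lemma Ck_on_mult:
 fixes f g :: "'a::euclidean_space => real"
 shows "open S ==> Ck_on k f S ==> Ck_on k g S ==> Ck_on k (%x. f x * g x) S"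
 using Ck_on_scaleR[of S k f g] by simp

text \<open>
 The derivative of a composition is expanded in the standard basis of the middle space, so that it
 is again a sum of products of functions of class one less.
\<close>
lemma Ck_on_compose:
 fixes f :: "'a::euclidean_space => 'b::euclidean_space" and g :: "'b => 'c::real_normed_vector"
 assumes "open S" "open T" "f ` S <= T" "Ck_on k f S" "Ck_on k g T"
 shows "Ck_on k (%x. g (f x)) S"
 using assms(4,5)
proof (induction k arbitrary: g)
 case 0
 then show ?case
  using assms(3) by (auto intro: continuous_on_compose2)
next
 case (Suc k)
 have f: "(f has_derivative frechet_derivative f (at x)) (at x)" if "x : S" for x
  using Suc.prems(1) that by (rule Ck_on_Suc_has_derivative)
 have g: "(g has_derivative frechet_derivative g (at y)) (at y)" if "y : T" for y
  using Suc.prems(2) that by (rule Ck_on_Suc_has_derivative)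
 show ?case
 proof (rule Ck_on_SucI[OF assms(1)])
  fix x assume x: "x : S"
  then have fx: "f x : T" using assms(3) by auto
  have "((%x. g (f x)) has_derivative
    (%v. frechet_derivative g (at (f x)) (frechet_derivative f (at x) v))) (at x)"
   using has_derivative_compose[OF f[OF x] g[OF fx]] by simp
  moreover have "frechet_derivative g (at (f x)) (frechet_derivative f (at x) v)
   = (\<Sum>b\<in>Basis. (frechet_derivative f (at x) v \<bullet> b) *\<^sub>R frechet_derivative g (at (f x)) b)" for v
  proof -
   have l: "linear (frechet_derivative g (at (f x)))"
    using g[OF fx] by (simp add: has_derivative_linear)
   have "frechet_derivative g (at (f x)) (frechet_derivative f (at x) v)
    = frechet_derivative g (at (f x)) (\<Sum>b\<in>Basis. (frechet_derivative f (at x) v \<bullet> b) *\<^sub>R b)"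
    by (simp add: euclidean_representation)
   then show ?thesis
    by (simp add: linear_sum[OF l] linear_scale[OF l])
  qed
  ultimately show "((%x. g (f x)) has_derivative
   (%v. \<Sum>b\<in>Basis. (frechet_derivative f (at x) v \<bullet> b) *\<^sub>R frechet_derivative g (at (f x)) b)) (at x)"
   by simp
 next
  fix v
  show "Ck_on k (%x. \<Sum>b\<in>Basis. (frechet_derivative f (at x) v \<bullet> b)
    *\<^sub>R frechet_derivative g (at (f x)) b) S"
  proof (intro Ck_on_sum Ck_on_scaleR assms(1))
   fix b :: 'b
   show "Ck_on k (%x. frechet_derivative f (at x) v \<bullet> b) S"
    by (rule Ck_on_bounded_linear_comp[OF bounded_linear_inner_left assms(1)])
     (use Suc.prems in auto)
   show "Ck_on k (%x. frechet_derivative g (at (f x)) b) S"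
    by (rule Suc.IH) (use Suc.prems in \<open>auto simp del: Ck_on.simps(2) dest: Ck_on_Suc_D\<close>, simp)
  qed
 qed
qed

lemma Ck_on_UN:
 assumes "!!i. i : I ==> open (S i)" "!!i. i : I ==> Ck_on k f (S i)"
 shows "Ck_on k f (\<Union>i\<in>I. S i)"
 using assms(2)
proof (induction k arbitrary: f)
 case 0
 then show ?case using assms(1) by (auto intro: continuous_on_open_UN)
qed auto

lemma smooth_on_UN:
 "(!!i. i : I ==> open (S i)) ==> (!!i. i : I ==> smooth_on f (S i)) ==> smooth_on f (\<Union>i\<in>I. S i)"
 by (simp add: smooth_on_def Ck_on_UN)

lemma smooth_on_cong:
 "open S ==> smooth_on f S ==> (!!x. x : S ==> f x = g x) ==> smooth_on g S"
 unfolding smooth_on_def using Ck_on_cong by blast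

lemma smooth_on_subset: "smooth_on f S ==> T <= S ==> smooth_on f T"
 unfolding smooth_on_def using Ck_on_subset by blast

lemma smooth_on_compose:
 fixes f :: "'a::euclidean_space => 'b::euclidean_space" and g :: "'b => 'c::real_normed_vector"
 shows "open S ==> open T ==> f ` S <= T ==> smooth_on f S ==> smooth_on g T ==>
  smooth_on (%x. g (f x)) S"
 unfolding smooth_on_def using Ck_on_compose by blast

lemma smooth_on_mult:
 fixes f g :: "'a::euclidean_space => real"
 shows "open S ==> smooth_on f S ==> smooth_on g S ==> smooth_on (%x. f x * g x) S"
 unfolding smooth_on_def using Ck_on_mult by blast

lemma smooth_on_add:
 "open S ==> smooth_on f S ==> smooth_on g S ==> smooth_on (%x. f x + g x) S"
 unfolding smooth_on_def using Ck_on_add by blast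

lemma smooth_on_has_derivative:
 "smooth_on f S ==> x : S ==> (f has_derivative frechet_derivative f (at x)) (at x)"
 unfolding smooth_on_def using Ck_on_Suc_has_derivative by blast

subsection \<open>Bump functions and Hadamard's lemma\<close>

text \<open>
 The functions \<open>x\<^sup>-\<^sup>m exp (- 1 / x)\<close>, extended by zero to the left half line, are closed under
 differentiation up to linear combinations; this gives all derivatives of the case \<open>m = 0\<close>.
\<close>
definition flat_exp :: "nat => real => real" where
 "flat_exp m x = (if x > 0 then inverse x ^ m * exp (- inverse x) else 0)"

lemma flat_exp_tendsto_0: "(flat_exp m \<longlongrightarrow> 0) (at_right 0)"
proof -
 have "((%y. y ^ m / exp y) \<longlongrightarrow> 0) (at_top :: real filter)"
  by (rule tendsto_power_div_exp_0)
 then have "((%x::real. inverse x ^ m / exp (inverse x)) \<longlongrightarrow> 0) (at_right 0)"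
  by (rule filterlim_compose[OF _ filterlim_inverse_at_top_right])
 then show ?thesis
  by (rule Lim_transform_eventually)
   (auto simp: eventually_at_filter flat_exp_def exp_minus divide_inverse)
qed

lemma flat_exp_has_derivative:
 "(flat_exp m has_real_derivative (flat_exp (m + 2) x - m * flat_exp (m + 1) x)) (at x)"
proof -
 consider "x > 0" | "x < 0" | "x = 0" by linarith
 then show ?thesis
 proof cases
  case 1
  have "((%x. inverse x ^ m * exp (- inverse x)) has_real_derivative
    (flat_exp (m + 2) x - m * flat_exp (m + 1) x)) (at x)"
  proof -
   have "((%x. inverse x ^ m * exp (- inverse x)) has_real_derivative
    inverse x ^ m * (exp (- inverse x) * inverse x ^ 2)
    + real m * inverse x ^ (m - 1) * (- (inverse x ^ 2)) * exp (- inverse x)) (at x)"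
    using 1 by (auto intro!: derivative_eq_intros simp: power2_eq_square)
   moreover have "inverse x ^ m * (exp (- inverse x) * inverse x ^ 2)
    + real m * inverse x ^ (m - 1) * (- (inverse x ^ 2)) * exp (- inverse x)
    = flat_exp (m + 2) x - m * flat_exp (m + 1) x"
    using 1 by (cases m) (auto simp: flat_exp_def power_add power2_eq_square)
   ultimately show ?thesis
    by simp
  qed
  then show ?thesis
   by (rule has_field_derivative_transform_within_open[where S = "{0<..}"])
    (use 1 in \<open>auto simp: flat_exp_def\<close>)
 next
  case 2
  have "((%_. 0) has_real_derivative (flat_exp (m + 2) x - m * flat_exp (m + 1) x)) (at x)"
   using 2 by (simp add: flat_exp_def)
  then show ?thesis
   by (rule has_field_derivative_transform_within_open[where S = "{..<0}"])
    (use 2 in \<open>auto simp: flat_exp_def\<close>)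
 next
  case 3
  have "((%h. flat_exp m h / h) \<longlongrightarrow> 0) (at_right 0)"
   by (rule Lim_transform_eventually[OF flat_exp_tendsto_0[of "Suc m"]])
    (auto simp: eventually_at_filter flat_exp_def field_simps)
  moreover have "((%h. flat_exp m h / h) \<longlongrightarrow> 0) (at_left 0)"
   by (rule Lim_transform_eventually[OF tendsto_const])
    (auto simp: eventually_at_filter flat_exp_def)
  ultimately have "((%h. flat_exp m h / h) \<longlongrightarrow> 0) (at 0)"
   by (simp add: filterlim_split_at)
  then show ?thesis
   using 3 by (simp add: has_field_derivative_def DERIV_def[unfolded has_field_derivative_def] flat_exp_def)
 qed
qed

lemma Ck_on_flat_exp: "Ck_on k (flat_exp m) UNIV"
proof (induction k arbitrary: m)
 case 0
 then show ?case
  using DERIV_isCont[OF flat_exp_has_derivative]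
  by (auto intro: continuous_at_imp_continuous_on)
next
 case (Suc k)
 show ?case
 proof (rule Ck_on_SucI)
  show "(flat_exp m has_derivative
    (%v. (flat_exp (m + 2) x + - real m * flat_exp (m + 1) x) * v)) (at x)" for x
   using flat_exp_has_derivative[of m x] by (simp add: has_field_derivative_def)
  show "Ck_on k (%x. (flat_exp (m + 2) x + - real m * flat_exp (m + 1) x) * v) UNIV" for v
   by (intro Ck_on_mult Ck_on_add Ck_on_const Suc) auto
 qed simp
qed

definition bump :: "'a::euclidean_space => real => 'a => real" where
 "bump c r a = flat_exp 0 (r\<^sup>2 - (a - c) \<bullet> (a - c))"

lemma bump_eq: "bump c r a = flat_exp 0 (r\<^sup>2 - (dist c a)\<^sup>2)"
 by (simp only: bump_def dist_norm norm_minus_commute[of c a] power2_norm_eq_inner)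

lemma bump_eq_0: "r > 0 ==> a ~: ball c r ==> bump c r a = 0"
 using power_mono[of r "dist c a" 2] by (simp add: bump_eq flat_exp_def not_less)

lemma bump_pos: "a : ball c r ==> bump c r a > 0"
 using power_strict_mono[of "dist c a" r 2] by (simp add: bump_eq flat_exp_def)

lemma Ck_on_bump: "Ck_on k (bump c r) UNIV"
proof -
 have lin: "Ck_on k (%a. (a - c) \<bullet> b) UNIV" for b :: 'a
 proof -
  have "Ck_on k (%a. a \<bullet> b + - (c \<bullet> b)) UNIV"
   by (intro Ck_on_add Ck_on_const Ck_on_linear bounded_linear_inner_left) auto
  then show ?thesis by (simp add: inner_diff_left)
 qed
 have "Ck_on k (%a. r\<^sup>2 + - 1 * (\<Sum>b\<in>Basis. ((a - c) \<bullet> b) * ((a - c) \<bullet> b))) UNIV"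
  by (intro Ck_on_add Ck_on_const Ck_on_mult Ck_on_sum lin) auto
 then have "Ck_on k (%a. r\<^sup>2 - (a - c) \<bullet> (a - c)) UNIV"
  by (simp add: euclidean_inner[symmetric])
 from Ck_on_compose[OF _ _ _ this Ck_on_flat_exp[of k 0]] show ?thesis
  by (simp add: bump_def[abs_def])
qed

text \<open>
 Differentiation under the integral sign reproduces an integral of the same shape with the weight
 \<open>t ^ Suc j\<close>; this is why the powers of \<open>t\<close> are carried along.
\<close>
lemma Ck_on_radial_average:
 fixes F :: "'a::euclidean_space => real"
 assumes "open S" "convex S" "!!a t. a : S ==> t : {0..1} ==> t *\<^sub>R a : S" "Ck_on k F S"
 shows "Ck_on k (%a. integral {0..1} (%t. t ^ j * F (t *\<^sub>R a))) S"
 using assms(4)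
proof (induction k arbitrary: F j)
 case 0
 have "continuous_on (S \<times> cbox 0 1) (%(a, t). t ^ j * F (t *\<^sub>R a))"
  using 0 assms(3) by (auto intro!: continuous_intros continuous_on_compose2[of S F] simp: split_beta)
 from integral_continuous_on_param[OF this] show ?case by simp
next
 case (Suc k)
 have cont: "continuous_on S F" using Suc.prems Ck_on_mono[of "Suc k" F S 0] by simp
 have contD: "continuous_on S (%x. frechet_derivative F (at x) v)" for v
  using Ck_on_mono[of k "%x. frechet_derivative F (at x) v" S 0] Suc.prems by simp
 have D: "(F has_derivative frechet_derivative F (at x)) (at x)" if "x : S" for x
  using Suc.prems that by (rule Ck_on_Suc_has_derivative)
 define B where "B a = Blinfun (frechet_derivative F (at a))" for a
 have B: "blinfun_apply (B a) = frechet_derivative F (at a)" if "a : S" for a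
  unfolding B_def by (rule bounded_linear_Blinfun_apply)
   (rule has_derivative_bounded_linear[OF D[OF that]])
 have contB: "continuous_on S B"
  by (rule continuous_on_blinfun_componentwise)
   (use contD in \<open>simp cong: continuous_on_cong add: B\<close>)
 show ?case
 proof (rule Ck_on_SucI[OF assms(1)])
  fix a assume a: "a : S"
  have "((%a. integral (cbox 0 1) (%t. t ^ j * F (t *\<^sub>R a))) has_derivative
    blinfun_apply (integral (cbox 0 1) (%t. t ^ Suc j *\<^sub>R B (t *\<^sub>R a)))) (at a within S)"
  proof (rule leibniz_rule[where fx = "%a t. t ^ Suc j *\<^sub>R B (t *\<^sub>R a)"])
   fix x and t :: real assume x: "x : S" and t: "t : cbox 0 1"
   then have tx: "t *\<^sub>R x : S" using assms(3) by auto
   have "((%x. t ^ j * F (t *\<^sub>R x)) has_derivative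
     (%v. t ^ j * frechet_derivative F (at (t *\<^sub>R x)) (t *\<^sub>R v))) (at x within S)"
    by (rule has_derivative_mult_right, rule has_derivative_compose[where f = "%x. t *\<^sub>R x", OF _ D[OF tx]])
     (auto intro!: derivative_eq_intros)
   moreover have "t ^ j * frechet_derivative F (at (t *\<^sub>R x)) (t *\<^sub>R v)
    = blinfun_apply (t ^ Suc j *\<^sub>R B (t *\<^sub>R x)) v" for v
    using linear_scale[OF has_derivative_linear[OF D[OF tx]], of t v]
    by (simp add: B[OF tx] scaleR_blinfun.rep_eq)
   ultimately show "((%x. t ^ j * F (t *\<^sub>R x)) has_derivative
     blinfun_apply (t ^ Suc j *\<^sub>R B (t *\<^sub>R x))) (at x within S)"
    by simp
  next
   fix x assume "x : S"
   then show "(%t. t ^ j * F (t *\<^sub>R x)) integrable_on cbox 0 1"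
    by (intro integrable_continuous continuous_intros continuous_on_compose2[OF cont])
     (use assms(3) in auto)
  next
   show "continuous_on (S \<times> cbox 0 1) (%(x, t). t ^ Suc j *\<^sub>R B (t *\<^sub>R x))"
    using assms(3)
    by (auto intro!: continuous_intros continuous_on_compose2[OF contB] simp: split_beta)
  qed (use a assms in auto)
  moreover have "blinfun_apply (integral (cbox 0 1) (%t. t ^ Suc j *\<^sub>R B (t *\<^sub>R a)))
   = (%v. integral {0..1} (%t. t ^ Suc j * frechet_derivative F (at (t *\<^sub>R a)) v))"
  proof
   fix v
   have "(%t. t ^ Suc j *\<^sub>R B (t *\<^sub>R a)) integrable_on cbox 0 1"
    by (intro integrable_continuous continuous_intros continuous_on_compose2[OF contB])
     (use assms(3) a in auto)
   then have "blinfun_apply (integral (cbox 0 1) (%t. t ^ Suc j *\<^sub>R B (t *\<^sub>R a))) v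
    = integral (cbox 0 1) (%t. blinfun_apply (t ^ Suc j *\<^sub>R B (t *\<^sub>R a)) v)"
    by (simp add: blinfun_apply_integral)
   also have "... = integral (cbox 0 1) (%t. t ^ Suc j * frechet_derivative F (at (t *\<^sub>R a)) v)"
    by (rule integral_cong) (use assms(3) a in \<open>auto simp: B scaleR_blinfun.rep_eq\<close>)
   finally show "blinfun_apply (integral (cbox 0 1) (%t. t ^ Suc j *\<^sub>R B (t *\<^sub>R a))) v
     = integral {0..1} (%t. t ^ Suc j * frechet_derivative F (at (t *\<^sub>R a)) v)" by simp
  qed
  ultimately show "((%a. integral {0..1} (%t. t ^ j * F (t *\<^sub>R a))) has_derivative
    (%v. integral {0..1} (%t. t ^ Suc j * frechet_derivative F (at (t *\<^sub>R a)) v))) (at a)"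
   using at_within_open[OF a assms(1)] by (simp only: cbox_interval)
 next
  show "Ck_on k (%a. integral {0..1} (%t. t ^ Suc j * frechet_derivative F (at (t *\<^sub>R a)) v)) S" for v
   by (rule Suc.IH) (use Suc.prems in auto)
 qed
qed

text \<open>Hadamard's lemma, centred at \<open>c\<close>.\<close>
lemma hadamard:
 fixes F :: "'a::euclidean_space => real"
 assumes "smooth_on F (ball c r)" "r > 0"
 obtains g where "!!b. smooth_on (g b) (ball c r)"
  and "!!a. a : ball c r ==> F a = F c + (\<Sum>b\<in>Basis. ((a - c) \<bullet> b) * g b a)"
  and "!!b. g b c = frechet_derivative F (at c) b"
proof -
 define g where "g b a = integral {0..1} (%t. t ^ 0 * frechet_derivative F (at (c + t *\<^sub>R (a - c))) b)" for b a
 have Ck: "Ck_on k F (ball c r)" for k using assms by (simp add: smooth_on_def)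
 have trans: "Ck_on k (%x. x + d) UNIV" for k and d :: 'a
  by (intro Ck_on_add Ck_on_const Ck_on_linear[of "%x. x", simplified]) (auto simp: bounded_linear_ident)
 have D: "(F has_derivative frechet_derivative F (at x)) (at x)" if "x : ball c r" for x
  using Ck_on_Suc_has_derivative[OF Ck that] .
 have "smooth_on (g b) (ball c r)" for b
  unfolding smooth_on_def
 proof
  fix k
  have "Ck_on k (%x. frechet_derivative F (at x) b) (ball c r)"
   using Ck[of "Suc k"] by simp
  then have "Ck_on k (%x. frechet_derivative F (at (x + c)) b) (ball 0 r)"
   by (rule Ck_on_compose[where f = "%x. x + c" and T = "ball c r", rotated 4])
    (auto simp: dist_norm intro: Ck_on_subset[OF trans])
  then have "Ck_on k (%a. integral {0..1} (%t. t ^ 0 * frechet_derivative F (at (t *\<^sub>R a + c)) b)) (ball 0 r)"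
   by (rule Ck_on_radial_average[of "ball 0 r" k "%x. frechet_derivative F (at (x + c)) b", rotated 3])
    (auto intro: order.strict_trans1[OF mult_left_le_one_le])
  then have "Ck_on k (%a. integral {0..1} (%t. t ^ 0 * frechet_derivative F (at (t *\<^sub>R (a + - c) + c)) b)) (ball c r)"
   by (rule Ck_on_compose[where f = "%x. x + - c" and T = "ball 0 r", rotated 4])
    (auto simp: dist_norm norm_minus_commute intro: Ck_on_subset[OF trans[of _ "- c", simplified]])
  then show "Ck_on k (g b) (ball c r)" by (simp add: g_def[abs_def] add.commute)
 qed
 moreover have "F a = F c + (\<Sum>b\<in>Basis. ((a - c) \<bullet> b) * g b a)" if a: "a : ball c r" for a
 proof -
  have seg: "c + t *\<^sub>R (a - c) : ball c r" if "t : {0..1}" for t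
   using a that by (auto simp: dist_norm norm_minus_commute
     intro: order.strict_trans1[OF mult_left_le_one_le])
  have "((%t. frechet_derivative F (at (c + t *\<^sub>R (a - c))) (a - c)) has_integral
    F (c + 1 *\<^sub>R (a - c)) - F (c + 0 *\<^sub>R (a - c))) {0..1}"
  proof (rule fundamental_theorem_of_calculus)
   fix t :: real assume t: "t : {0..1}"
   have "((%t. F (c + t *\<^sub>R (a - c))) has_derivative
    (%h. frechet_derivative F (at (c + t *\<^sub>R (a - c))) (h *\<^sub>R (a - c)))) (at t within {0..1})"
    by (rule has_derivative_compose[where f = "%t. c + t *\<^sub>R (a - c)", OF _ D[OF seg[OF t]]]) (auto intro!: derivative_eq_intros)
   then show "((%t. F (c + t *\<^sub>R (a - c))) has_vector_derivative
    frechet_derivative F (at (c + t *\<^sub>R (a - c))) (a - c)) (at t within {0..1})"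
    by (simp add: has_vector_derivative_def linear_scale[OF has_derivative_linear[OF D[OF seg[OF t]]]])
  qed simp
  then have "F a - F c = integral {0..1} (%t. frechet_derivative F (at (c + t *\<^sub>R (a - c))) (a - c))"
   by (simp add: integral_unique)
  also have "... = integral {0..1} (%t. \<Sum>b\<in>Basis. ((a - c) \<bullet> b) * frechet_derivative F (at (c + t *\<^sub>R (a - c))) b)"
  proof (rule integral_cong)
   fix t :: real assume t: "t : {0..1}"
   have l: "linear (frechet_derivative F (at (c + t *\<^sub>R (a - c))))"
    by (rule has_derivative_linear[OF D[OF seg[OF t]]])
   show "frechet_derivative F (at (c + t *\<^sub>R (a - c))) (a - c)
    = (\<Sum>b\<in>Basis. ((a - c) \<bullet> b) * frechet_derivative F (at (c + t *\<^sub>R (a - c))) b)"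
    using linear_sum[OF l, of "%b. ((a - c) \<bullet> b) *\<^sub>R b" Basis]
    by (simp add: linear_scale[OF l] euclidean_representation)
  qed
  also have "... = (\<Sum>b\<in>Basis. ((a - c) \<bullet> b) * g b a)"
  proof -
   have cont: "continuous_on (ball c r) (%x. frechet_derivative F (at x) b)" for b
    using Ck[of "Suc 0"] by simp
   have int: "(%t. frechet_derivative F (at (c + t *\<^sub>R (a - c))) b) integrable_on {0..1}" for b
    by (rule integrable_continuous_interval, rule continuous_on_compose2[where f = "%t. c + t *\<^sub>R (a - c)", OF cont])
     (use seg in \<open>auto intro!: continuous_intros\<close>)
   show ?thesis
    by (subst integral_sum) (auto simp: g_def int intro!: integrable_on_mult_right)
  qed
  finally show ?thesis by simp
 qed
 moreover have "g b c = frechet_derivative F (at c) b" for b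
  by (simp add: g_def)
 ultimately show ?thesis by (rule that)
qed

section \<open>The Lie algebra in a chart\<close>

lemma smooth_fun_const: "smooth_fun A (%_. c)"
 by (auto simp: smooth_fun_def smooth_on_def Ck_on_const)

locale lie_chart =
 fixes A :: "('g::{topological_group_add, t2_space, second_countable_topology},
   'e::euclidean_space) chart set"
  and n :: nat and U :: "'g set" and kap :: "'g => 'e"
 assumes lie: "lie_group A n" and chart: "(U, kap) : A" and zero_U: "0 : U"
begin

abbreviation "sig == inv_into U kap"
abbreviation "Om == kap ` U"
abbreviation "oc == kap 0"

definition mult :: "'e \<times> 'e => 'e" where
 "mult p = kap (sig (fst p) + sig (snd p))"

definition mult_dom :: "('e \<times> 'e) set" where
 "mult_dom = {p : Om \<times> Om. sig (fst p) + sig (snd p) : U}"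

lemma charts: "(V, eta) : A ==> is_chart (V, eta)"
 using lie by (auto simp: lie_group_def smooth_atlas_def)

lemma chart_facts:
 assumes "(V, eta) : A"
 shows "open V" "open (eta ` V)" "continuous_on V eta" "continuous_on (eta ` V) (inv_into V eta)"
  "!!x. x : V ==> inv_into V eta (eta x) = x" "!!a. a : eta ` V ==> inv_into V eta a : V"
  "!!a. a : eta ` V ==> eta (inv_into V eta a) = a"
 using charts[OF assms] by (auto simp: is_chart_def homeomorphism_def f_inv_into_f inv_into_into)

lemmas chart_U = chart_facts[OF chart]

lemma chart_preimage_open:
 assumes "(V, eta) : A" "open W" "continuous_on UNIV h"
 shows "open {a : eta ` V. h (inv_into V eta a) : W}"
proof -
 have "continuous_on (eta ` V) (%a. h (inv_into V eta a))"
  using assms(3) chart_facts(4)[OF assms(1)] by (rule continuous_on_compose2) auto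
 from continuous_open_preimage[OF this chart_facts(2)[OF assms(1)] assms(2)]
 show ?thesis by (simp add: vimage_def Collect_conj_eq)
qed

lemma open_mult_dom: "open mult_dom"
proof -
 have "continuous_on (Om \<times> Om) (%p. sig (fst p) + sig (snd p))"
  by (intro continuous_on_add continuous_on_compose2[OF chart_U(4)] continuous_intros) auto
 from continuous_open_preimage[OF this open_Times[OF chart_U(2) chart_U(2)] chart_U(1)]
 show ?thesis by (simp add: mult_dom_def vimage_def Collect_conj_eq)
qed

lemma smooth_mult: "smooth_on mult mult_dom"
proof -
 have "smooth_on (%(a, b). kap (sig a + sig b)) {(a, b). a : Om & b : Om & sig a + sig b : U}"
  using lie chart by (force simp: lie_group_def smooth_addition_def)
 moreover have "{(a, b). a : Om & b : Om & sig a + sig b : U} = mult_dom"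
  by (auto simp: mult_dom_def)
 ultimately show ?thesis
  by (simp add: mult_def[abs_def] case_prod_beta')
qed

lemma in_mult_dom: "a : Om ==> (a, oc) : mult_dom" "a : Om ==> (oc, a) : mult_dom"
 using zero_U by (auto simp: mult_dom_def chart_U)

lemma mult_unit: "a : Om ==> mult (a, oc) = a" "a : Om ==> mult (oc, a) = a"
 using zero_U by (auto simp: mult_def chart_U)

lemma smooth_fun_chart:
 "smooth_fun A f ==> (V, eta) : A ==> smooth_on (%a. f (inv_into V eta a)) (eta ` V)"
 by (auto simp: smooth_fun_def)

lemma smooth_fun_mult:
 "smooth_fun A f ==> smooth_fun A g ==> smooth_fun A (%x. f x * g x)"
 unfolding smooth_fun_def using chart_facts by (fastforce intro: smooth_on_mult)

lemma smooth_fun_add: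
 "smooth_fun A f ==> smooth_fun A g ==> smooth_fun A (%x. f x + g x)"
 unfolding smooth_fun_def using chart_facts by (fastforce intro: smooth_on_add)

lemma smooth_fun_sum:
 "(!!i. i : I ==> smooth_fun A (f i)) ==> smooth_fun A (%x. \<Sum>i\<in>I. f i x)"
 by (induction I rule: infinite_finite_induct) (auto intro: smooth_fun_const smooth_fun_add)

lemma atlas_cover: "EX V eta. (V, eta) : A & x : V"
proof -
 have "(\<Union>c\<in>A. fst c) = UNIV"
  using lie chart by (auto simp: lie_group_def smooth_atlas_def split: if_splits)
 then obtain c where "c : A" "x : fst c" by blast
 then show ?thesis by (metis prod.collapse)
qed

lemma smooth_fun_left_transl:
 assumes f: "smooth_fun A f"
 shows "smooth_fun A (left_transl y f)"
 unfolding smooth_fun_def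
proof safe
 fix V eta assume V: "(V, eta) : A"
 obtain Y \<theta> where Y: "(Y, \<theta>) : A" "- y : Y" using atlas_cover by blast
 define S where "S W = {a : eta ` V. - y + inv_into V eta a : W}" for W
 have openS: "open (S W)" if "(W, zet) : A" for W zet
  unfolding S_def using chart_facts(1)[OF that]
  by (intro chart_preimage_open[OF V]) (auto intro!: continuous_intros)
 have smoothS: "smooth_on (%a. left_transl y f (inv_into V eta a)) (S W)" if W: "(W, zet) : A" for W zet
 proof -
  define D where "D = {(a, b). a : \<theta> ` Y & b : eta ` V & inv_into Y \<theta> a + inv_into V eta b : W}"
  have add: "smooth_on (%(a, b). zet (inv_into Y \<theta> a + inv_into V eta b)) D"
   using lie Y(1) V W unfolding lie_group_def smooth_addition_def D_def by fast
  have openD: "open D"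
  proof -
   have "continuous_on (\<theta> ` Y \<times> eta ` V) (%p. inv_into Y \<theta> (fst p) + inv_into V eta (snd p))"
    by (intro continuous_on_add continuous_on_compose2[OF chart_facts(4)[OF Y(1)]]
      continuous_on_compose2[OF chart_facts(4)[OF V]] continuous_intros) auto
   from continuous_open_preimage[OF this open_Times[OF chart_facts(2)[OF Y(1)] chart_facts(2)[OF V]]
     chart_facts(1)[OF W]]
   show ?thesis by (rule back_subst[of "open"]) (auto simp: D_def)
  qed
  have pair: "smooth_on (%b. (\<theta> (- y), b)) (S W)"
  proof -
   have "(%b::'e. (\<theta> (- y), b)) = (%b. (\<theta> (- y), 0) + (0, b))" by (simp add: fun_eq_iff)
   moreover have "bounded_linear (%b::'e. (0::'e, b))"
    by (intro bounded_linear_Pair bounded_linear_zero bounded_linear_ident)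
   then have "smooth_on (%b. (\<theta> (- y), 0) + (0, b)) (S W)"
    unfolding smooth_on_def
    by (intro allI Ck_on_add Ck_on_const Ck_on_linear openS[OF W])
   ultimately show ?thesis by simp
  qed
  have "(%b. (\<theta> (- y), b)) ` S W <= D"
   using Y chart_facts(5)[OF Y(1)] by (auto simp: S_def D_def)
  from smooth_on_compose[OF openS[OF W] openD this pair add]
  have "smooth_on (%b. (%(a, b). zet (inv_into Y \<theta> a + inv_into V eta b)) (\<theta> (- y), b)) (S W)" .
  then have tr: "smooth_on (%b. zet (- y + inv_into V eta b)) (S W)"
   using Y chart_facts(5)[OF Y(1)] by simp
  have "smooth_on (%b. f (inv_into W zet (zet (- y + inv_into V eta b)))) (S W)"
   by (rule smooth_on_compose[OF openS[OF W] chart_facts(2)[OF W] _ tr smooth_fun_chart[OF f W]])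
    (auto simp: S_def)
  then show ?thesis
   by (rule smooth_on_cong[OF openS[OF W]])
    (auto simp: S_def left_transl_def chart_facts(5)[OF W])
 qed
 have "smooth_on (%a. left_transl y f (inv_into V eta a)) (\<Union>c\<in>A. S (fst c))"
  by (intro smooth_on_UN) (use openS smoothS in auto)
 moreover have "eta ` V <= (\<Union>c\<in>A. S (fst c))"
 proof
  fix a assume "a : eta ` V"
  moreover obtain W zet where "(W, zet) : A" "- y + inv_into V eta a : W" using atlas_cover by blast
  ultimately show "a : (\<Union>c\<in>A. S (fst c))" by (force simp: S_def)
 qed
 ultimately show "smooth_on (%a. left_transl y f (inv_into V eta a)) (eta ` V)"
  by (rule smooth_on_subset)
qed

text \<open>A function given near the unit is damped by a bump and extended by zero.\<close>
definition ext :: "real => ('e => real) => 'g => real" where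
 "ext r h x = (if x : U & kap x : ball oc r then bump oc (r / 2) (kap x) * h (kap x) else 0)"

lemma smooth_fun_ext:
 assumes r: "r > 0" "ball oc r <= Om" and h: "smooth_on h (ball oc r)"
 shows "smooth_fun A (ext r h)"
 unfolding smooth_fun_def
proof safe
 fix V eta assume V: "(V, eta) : A"
 define K where "K = sig ` cball oc (r / 2)"
 have sub: "cball oc (r / 2) <= ball oc r" using r by auto
 have "compact K"
  unfolding K_def using sub r(2)
  by (intro compact_continuous_image continuous_on_subset[OF chart_U(4)]) auto
 then have closedK: "closed K" by (rule compact_imp_closed)
 define S1 where "S1 = {a : eta ` V. inv_into V eta a : sig ` ball oc r}"
 define S2 where "S2 = {a : eta ` V. inv_into V eta a : - K}"
 have img: "sig ` ball oc r = {x : U. kap x : ball oc r}"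
 proof (intro equalityI subsetI)
  fix x assume "x : {x : U. kap x : ball oc r}"
  then have "x = sig (kap x)" "kap x : ball oc r" by (simp_all add: chart_U)
  then show "x : sig ` ball oc r" by (rule image_eqI)
 next
  fix x assume "x : sig ` ball oc r"
  then obtain a where "x = sig a" "a : ball oc r" by blast
  moreover from this r(2) have "a : Om" by blast
  ultimately show "x : {x : U. kap x : ball oc r}" using chart_U(6,7)[of a] by simp
 qed
 have "open (sig ` ball oc r)"
  using continuous_open_preimage[OF chart_U(3) chart_U(1) open_ball, of "oc" r]
  by (simp add: img vimage_def Collect_conj_eq)
 then have openS: "open S1" "open S2"
  unfolding S1_def S2_def using closedK
  by (intro chart_preimage_open[OF V, where h = "%x. x"] continuous_on_id; simp add: open_Compl)+
 have smooth_bump: "smooth_on (%a. bump oc (r / 2) a * h a) (ball oc r)"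
  by (intro smooth_on_mult h) (auto simp: smooth_on_def intro: Ck_on_subset[OF Ck_on_bump])
 have transition: "smooth_on (%a. kap (inv_into V eta a)) S1"
 proof -
  have "compatible_charts (V, eta) (U, kap)"
   using lie V chart by (auto simp: lie_group_def smooth_atlas_def)
  then have "smooth_on (%a. kap (inv_into V eta a)) (eta ` (V Int U))"
   by (simp add: compatible_charts_def)
  moreover have "S1 <= eta ` (V Int U)"
  proof
   fix a assume "a : S1"
   then have "inv_into V eta a : V Int U" "a = eta (inv_into V eta a)"
    using chart_facts(6,7)[OF V, of a] by (simp_all add: S1_def img)
   then show "a : eta ` (V Int U)" by (rule image_eqI[rotated])
  qed
  ultimately show ?thesis by (rule smooth_on_subset)
 qed
 have "(%a. kap (inv_into V eta a)) ` S1 <= ball oc r"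
  by (auto simp: S1_def img)
 from smooth_on_compose[OF openS(1) open_ball this transition smooth_bump]
 have "smooth_on (%a. bump oc (r / 2) (kap (inv_into V eta a)) * h (kap (inv_into V eta a))) S1" .
 then have s1: "smooth_on (%a. ext r h (inv_into V eta a)) S1"
  by (rule smooth_on_cong[OF openS(1)]) (auto simp: S1_def img ext_def)
 have "smooth_on (%a. 0 :: real) S2" by (simp add: smooth_on_def Ck_on_const)
 then have s2: "smooth_on (%a. ext r h (inv_into V eta a)) S2"
 proof (rule smooth_on_cong[OF openS(2)])
  fix a assume a: "a : S2"
  show "0 = ext r h (inv_into V eta a)"
  proof (cases "inv_into V eta a : U")
   case True
   have "kap (inv_into V eta a) ~: ball oc (r / 2)"
   proof
    assume *: "kap (inv_into V eta a) : ball oc (r / 2)"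
    then have "kap (inv_into V eta a) : cball oc (r / 2)" by simp
    then have "sig (kap (inv_into V eta a)) : K" unfolding K_def by blast
    then show False using a True by (simp add: S2_def chart_U)
   qed
   then show ?thesis using bump_eq_0[of "r / 2" "kap (inv_into V eta a)" "oc"] r by (auto simp: ext_def)
  qed (simp add: ext_def)
 qed
 have "smooth_on (%a. ext r h (inv_into V eta a)) (\<Union>S\<in>{S1, S2}. S)"
  using openS s1 s2 by (intro smooth_on_UN) auto
 moreover have "eta ` V <= (\<Union>S\<in>{S1, S2}. S)"
  using sub by (auto simp: S1_def S2_def K_def)
 ultimately show "smooth_on (%a. ext r h (inv_into V eta a)) (eta ` V)"
  by (rule smooth_on_subset)
qed

lemma lie_algebraD:
 assumes "X : lie_algebra A" "smooth_fun A f" "smooth_fun A g"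
 shows "X (%x. a * f x + b * g x) = (%x. a * X f x + b * X g x)"
  "X (%x. f x * g x) = (%x. f x * X g x + X f x * g x)"
  "X (left_transl y f) = left_transl y (X f)"
 using assms by (simp_all add: lie_algebra_def)

lemma lie_algebra_const:
 assumes X: "X : lie_algebra A"
 shows "X (%_. c) = (%_. 0)"
proof -
 have 1: "X (%_. 1 * 1) = (%x. 1 * X (%_. 1) x + X (%_. 1) x * 1)"
  by (rule lie_algebraD(2)[OF X]) (rule smooth_fun_const)+
 have one: "X (%_. 1) x = 0" for x
  using fun_cong[OF 1, of x] by simp
 have "X (%_. c * 1 + 0 * 1) = (%x. c * X (%_. 1) x + 0 * X (%_. 1) x)"
  by (rule lie_algebraD(1)[OF X]) (rule smooth_fun_const)+
 then show ?thesis using one by simp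
qed

lemma lie_algebra_sum:
 assumes X: "X : lie_algebra A" and f: "!!i. i : I ==> smooth_fun A (f i)"
 shows "X (%x. \<Sum>i\<in>I. f i x) = (%x. \<Sum>i\<in>I. X (f i) x)"
 using f
proof (induction I rule: infinite_finite_induct)
 case (insert i I)
 have "X (%x. 1 * f i x + 1 * (\<Sum>i\<in>I. f i x)) = (%x. 1 * X (f i) x + 1 * X (%x. \<Sum>i\<in>I. f i x) x)"
  by (rule lie_algebraD(1)[OF X]) (use insert.prems in \<open>auto intro: smooth_fun_sum\<close>)
 then show ?case using insert by simp
qed (simp_all add: lie_algebra_const[OF X])

text \<open>
 A derivation at the unit is a directional derivative: with a bump \<open>e\<close> and Hadamard's
 decomposition \<open>f = f(0) + \<Sum>\<^sub>b \<pi>\<^sub>b gb\<close>, apply the Leibniz rule to both sides of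
 \<open>e\<^sup>2 (f - f(0)) = \<Sum>\<^sub>b (e \<pi>\<^sub>b) (e gb)\<close>, all of whose factors are globally smooth. The square is
 needed to have one bump for each factor.
\<close>
lemma derivation_at_unit:
 assumes X: "X : lie_algebra A"
 shows "EX v. ALL f. smooth_fun A f --> X f 0 = frechet_derivative (%a. f (sig a)) (at oc) v"
proof -
 obtain r where r: "r > 0" "ball oc r <= Om"
  using chart_U(2) zero_U by (metis imageI open_contains_ball)
 define e where "e = ext r (%_. 1)"
 define p where "p b = ext r (%a. (a - oc) \<bullet> b)" for b
 have e: "smooth_fun A e"
  unfolding e_def by (intro smooth_fun_ext r) (simp add: smooth_on_def Ck_on_const)
 have p: "smooth_fun A (p b)" for b
  unfolding p_def
 proof (intro smooth_fun_ext r)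
  have "smooth_on (%a. a \<bullet> b + - (oc \<bullet> b)) (ball oc r)"
   unfolding smooth_on_def
   by (intro allI Ck_on_add Ck_on_const Ck_on_linear bounded_linear_inner_left open_ball)
  then show "smooth_on (%a. (a - oc) \<bullet> b) (ball oc r)"
   by (simp add: inner_diff_left)
 qed
 have e0: "e 0 > 0"
  using r zero_U bump_pos[of "oc" "oc" "r / 2"] by (simp add: e_def ext_def)
 define v where "v = (\<Sum>b\<in>Basis. (X (p b) 0 / e 0) *\<^sub>R b)"
 show ?thesis
 proof (intro exI allI impI)
  fix f :: "'g => real" assume f: "smooth_fun A f"
  have fs: "smooth_on (%a. f (sig a)) Om" using smooth_fun_chart[OF f chart] .
  obtain g where g: "!!b. smooth_on (g b) (ball oc r)"
   "!!a. a : ball oc r ==> f (sig a) = f (sig oc) + (\<Sum>b\<in>Basis. ((a - oc) \<bullet> b) * g b a)"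
   "!!b. g b oc = frechet_derivative (%a. f (sig a)) (at oc) b"
   using hadamard[OF smooth_on_subset[OF fs r(2)] r(1)] by blast
  define q where "q b = ext r (g b)" for b
  have q: "smooth_fun A (q b)" for b unfolding q_def by (intro smooth_fun_ext r g)
  define f' where "f' x = f x + - f 0" for x
  have f': "smooth_fun A f'"
   unfolding f'_def[abs_def] by (intro smooth_fun_add f smooth_fun_const)
  have "X (%x. 1 * f x + (- f 0) * 1) = (%x. 1 * X f x + (- f 0) * X (%_. 1) x)"
   by (rule lie_algebraD(1)[OF X f smooth_fun_const])
  then have Xf': "X f' = X f"
   by (simp add: f'_def[abs_def] lie_algebra_const[OF X])
  have "(%x. e x * (e x * f' x)) = (%x. \<Sum>b\<in>Basis. p b x * q b x)"
  proof
   fix x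
   show "e x * (e x * f' x) = (\<Sum>b\<in>Basis. p b x * q b x)"
   proof (cases "x : U & kap x : ball oc r")
    case True
    then have "f x = f 0 + (\<Sum>b\<in>Basis. ((kap x - oc) \<bullet> b) * g b (kap x))"
     using g(2)[of "kap x"] zero_U by (simp add: chart_U)
    then show ?thesis
     using True by (simp add: e_def p_def q_def ext_def f'_def sum_distrib_left mult_ac)
   qed (auto simp: e_def p_def q_def ext_def)
  qed
  then have "X (%x. e x * (e x * f' x)) 0 = X (%x. \<Sum>b\<in>Basis. p b x * q b x) 0"
   by simp
  also have "... = (\<Sum>b\<in>Basis. X (%x. p b x * q b x) 0)"
   by (subst lie_algebra_sum[OF X]) (auto intro: smooth_fun_mult p q)
  also have "... = (\<Sum>b\<in>Basis. X (p b) 0 * (e 0 * frechet_derivative (%a. f (sig a)) (at oc) b))"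
  proof (rule sum.cong)
   fix b :: 'e
   have "X (%x. p b x * q b x) 0 = p b 0 * X (q b) 0 + X (p b) 0 * q b 0"
    by (simp add: lie_algebraD(2)[OF X p q])
   moreover have "p b 0 = 0" "q b 0 = e 0 * frechet_derivative (%a. f (sig a)) (at oc) b"
    using r zero_U by (simp_all add: p_def q_def e_def ext_def g(3))
   ultimately show "X (%x. p b x * q b x) 0
     = X (p b) 0 * (e 0 * frechet_derivative (%a. f (sig a)) (at oc) b)" by simp
  qed simp
  also have "... = e 0 * e 0 * (\<Sum>b\<in>Basis. X (p b) 0 / e 0 * frechet_derivative (%a. f (sig a)) (at oc) b)"
   using e0 by (simp add: sum_distrib_left mult_ac)
  finally have "e 0 * e 0 * X f 0
   = e 0 * e 0 * (\<Sum>b\<in>Basis. X (p b) 0 / e 0 * frechet_derivative (%a. f (sig a)) (at oc) b)"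
   by (simp add: lie_algebraD(2)[OF X e] smooth_fun_mult e f' Xf') (simp add: f'_def)
  moreover have "linear (frechet_derivative (%a. f (sig a)) (at oc))"
   using smooth_on_has_derivative[OF fs] zero_U by (blast intro: has_derivative_linear)
  then have "frechet_derivative (%a. f (sig a)) (at oc) v
   = (\<Sum>b\<in>Basis. X (p b) 0 / e 0 * frechet_derivative (%a. f (sig a)) (at oc) b)"
   by (simp add: v_def linear_sum linear_scale)
  ultimately show "X f 0 = frechet_derivative (%a. f (sig a)) (at oc) v"
   using e0 by simp
 qed
qed

definition tangent :: "'g vfield => 'e" where
 "tangent X = (SOME v. ALL f. smooth_fun A f --> X f 0 = frechet_derivative (%a. f (sig a)) (at oc) v)"

lemma tangent:
 assumes "X : lie_algebra A" "smooth_fun A f"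
 shows "X f 0 = frechet_derivative (%a. f (sig a)) (at oc) (tangent X)"
proof -
 from someI_ex[OF derivation_at_unit[OF assms(1)]] show ?thesis using assms(2) by (auto simp: tangent_def)
qed

text \<open>The left invariant vector field with value \<open>v\<close> at the unit, read in the chart.\<close>
definition field :: "'e => 'e => 'e" where
 "field v c = frechet_derivative mult (at (c, oc)) (0, v)"

lemma lie_algebra_eq_field:
 assumes X: "X : lie_algebra A" and f: "smooth_fun A f" and x: "x : U"
 shows "X f x = frechet_derivative (%a. f (sig a)) (at (kap x)) (field (tangent X) (kap x))"
proof -
 have "X f x = left_transl (- x) (X f) 0" by (simp add: left_transl_def)
 also have "... = X (left_transl (- x) f) 0" by (simp add: lie_algebraD(3)[OF X f f])
 also have "... = frechet_derivative (%a. f (x + sig a)) (at oc) (tangent X)"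
  using tangent[OF X smooth_fun_left_transl[OF f, of "- x"]] by (simp add: left_transl_def)
 also have "frechet_derivative (%a. f (x + sig a)) (at oc)
  = (%w. frechet_derivative (%a. f (sig a)) (at (kap x)) (frechet_derivative mult (at (kap x, oc)) (0, w)))"
 proof (rule frechet_derivative_at[symmetric])
  have kx: "kap x : Om" using x by simp
  have 1: "((%a. (kap x, a)) has_derivative (%w. (0, w))) (at oc)"
   by (auto intro!: derivative_eq_intros)
  have 2: "(mult has_derivative frechet_derivative mult (at (kap x, oc))) (at (kap x, oc))"
   by (rule smooth_on_has_derivative[OF smooth_mult in_mult_dom(1)[OF kx]])
  have 3: "((%a. f (sig a)) has_derivative frechet_derivative (%a. f (sig a)) (at (mult (kap x, oc))))
    (at (mult (kap x, oc)))"
   using smooth_on_has_derivative[OF smooth_fun_chart[OF f chart]] x by (simp add: mult_unit)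
  have "((%a. f (sig (mult (kap x, a)))) has_derivative
   (%w. frechet_derivative (%a. f (sig a)) (at (mult (kap x, oc)))
     (frechet_derivative mult (at (kap x, oc)) (0, w)))) (at oc)"
   using has_derivative_compose[OF has_derivative_compose[OF 1 2] 3] .
  then have "((%a. f (sig (mult (kap x, a)))) has_derivative
   (%w. frechet_derivative (%a. f (sig a)) (at (kap x))
     (frechet_derivative mult (at (kap x, oc)) (0, w)))) (at oc)"
   using x by (simp add: mult_unit)
  moreover have "continuous_on UNIV (%z. x + z)" by (intro continuous_intros)
  from chart_preimage_open[OF chart chart_U(1) this] have "open {a : Om. x + sig a : U}" .
  ultimately show "((%a. f (x + sig a)) has_derivative
   (%w. frechet_derivative (%a. f (sig a)) (at (kap x))
     (frechet_derivative mult (at (kap x, oc)) (0, w)))) (at oc)"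
   by (rule has_derivative_transform_within_open) (use x zero_U in \<open>auto simp: mult_def chart_U\<close>)
 qed
 finally show ?thesis by (simp add: field_def)
qed

end

section \<open>Strict derivatives and ordinary differential equations\<close>

text \<open>
 Strict differentiability at one point is what is needed for bi-Lipschitz estimates, and unlike
 continuous differentiability it composes without any reference to neighbouring points.
\<close>
definition strict_deriv ::
  "('a::real_normed_vector => 'b::real_normed_vector) => ('a => 'b) => 'a => bool" where
 "strict_deriv f D c \<longleftrightarrow> bounded_linear D &
  (ALL e>0. EX d>0. ALL x:ball c d. ALL y:ball c d. norm (f x - f y - D (x - y)) <= e * norm (x - y))"

lemma strict_derivD:
 assumes "strict_deriv f D c" "e > 0"
 shows "EX d>0. ALL x:ball c d. ALL y:ball c d. norm (f x - f y - D (x - y)) <= e * norm (x - y)"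
 using assms unfolding strict_deriv_def by blast

lemma strict_deriv_linear: "bounded_linear D ==> strict_deriv D D c"
 by (auto simp: strict_deriv_def linear_diff bounded_linear.linear intro!: exI[of _ 1])

lemma strict_deriv_cong:
 assumes "strict_deriv f D c" "open S" "c : S" "!!x. x : S ==> f x = g x"
 shows "strict_deriv g D c"
 unfolding strict_deriv_def
proof (intro conjI allI impI)
 show "bounded_linear D" using assms(1) by (simp add: strict_deriv_def)
 fix e :: real assume "e > 0"
 then obtain d where d: "d > 0"
  "!!x y. x : ball c d ==> y : ball c d ==> norm (f x - f y - D (x - y)) <= e * norm (x - y)"
  using strict_derivD[OF assms(1)] by blast
 obtain r where r: "r > 0" "ball c r <= S" using assms(2,3) open_contains_ball by blast
 show "EX d>0. ALL x:ball c d. ALL y:ball c d. norm (g x - g y - D (x - y)) <= e * norm (x - y)"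
 proof (intro exI[of _ "min d r"] conjI ballI)
  fix x y assume "x : ball c (min d r)" "y : ball c (min d r)"
  then have "x : ball c d" "y : ball c d" "x : S" "y : S" using r by auto
  then show "norm (g x - g y - D (x - y)) <= e * norm (x - y)"
   using d(2)[of x y] assms(4)[of x] assms(4)[of y] by simp
 qed (use d r in auto)
qed

lemma strict_deriv_lipschitz:
 assumes "strict_deriv f D c"
 obtains K d where "K > 0" "d > 0"
  "!!x y. x : ball c d ==> y : ball c d ==> norm (f x - f y) <= K * norm (x - y)"
proof -
 have D: "bounded_linear D" using assms by (simp add: strict_deriv_def)
 then obtain B where B: "B > 0" "!!x. norm (D x) <= norm x * B"
  using bounded_linear.pos_bounded by blast
 obtain d where d: "d > 0"
  "!!x y. x : ball c d ==> y : ball c d ==> norm (f x - f y - D (x - y)) <= 1 * norm (x - y)"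
  using strict_derivD[OF assms zero_less_one] by blast
 show ?thesis
 proof (rule that[of "B + 1" d])
  fix x y assume xy: "x : ball c d" "y : ball c d"
  have "norm (f x - f y) <= norm (f x - f y - D (x - y)) + norm (D (x - y))"
   using norm_triangle_ineq[of "f x - f y - D (x - y)" "D (x - y)"] by simp
  also have "... <= 1 * norm (x - y) + norm (x - y) * B"
   using d(2)[OF xy] B(2) by (intro add_mono) auto
  finally show "norm (f x - f y) <= (B + 1) * norm (x - y)" by (simp add: algebra_simps)
 qed (use B d in auto)
qed

lemma strict_deriv_compose:
 assumes f: "strict_deriv f D c" and g: "strict_deriv g E (f c)"
 shows "strict_deriv (%x. g (f x)) (%x. E (D x)) c"
 unfolding strict_deriv_def
proof (intro conjI allI impI)
 have D: "bounded_linear D" and E: "bounded_linear E"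
  using f g by (simp_all add: strict_deriv_def)
 then show "bounded_linear (%x. E (D x))" by (rule bounded_linear_compose[rotated])
 fix e :: real assume e: "e > 0"
 obtain B where B: "B > 0" "!!x. norm (E x) <= norm x * B"
  using bounded_linear.pos_bounded[OF E] by blast
 obtain K d0 where K: "K > 0" "d0 > 0"
  "!!x y. x : ball c d0 ==> y : ball c d0 ==> norm (f x - f y) <= K * norm (x - y)"
  using strict_deriv_lipschitz[OF f] by blast
 have "e / (2 * K) > 0" using e K by simp
 then obtain d1 where d1: "d1 > 0" "!!x y. x : ball (f c) d1 ==> y : ball (f c) d1 ==>
   norm (g x - g y - E (x - y)) <= e / (2 * K) * norm (x - y)"
  using strict_derivD[OF g] by blast
 have "e / (2 * B) > 0" using e B by simp
 then obtain d2 where d2: "d2 > 0" "!!x y. x : ball c d2 ==> y : ball c d2 ==>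
   norm (f x - f y - D (x - y)) <= e / (2 * B) * norm (x - y)"
  using strict_derivD[OF f] by blast
 define d where "d = min d0 (min d2 (d1 / K))"
 show "EX d>0. ALL x:ball c d. ALL y:ball c d.
  norm (g (f x) - g (f y) - E (D (x - y))) <= e * norm (x - y)"
 proof (intro exI[of _ d] conjI ballI)
  show "d > 0" using K d1 d2 by (simp add: d_def)
  fix x y assume x: "x : ball c d" and y: "y : ball c d"
  have fz: "f z : ball (f c) d1" if "z : ball c d" for z
  proof -
   have "norm (f c - f z) <= K * norm (c - z)"
    using that K(2) by (intro K(3)) (auto simp: d_def)
   also have "... < K * (d1 / K)"
    using that K(1) by (intro mult_strict_left_mono) (auto simp: d_def dist_norm)
   finally show ?thesis using K(1) by (simp add: dist_norm)
  qed
  have 1: "norm (g (f x) - g (f y) - E (f x - f y)) <= e / (2 * K) * norm (f x - f y)"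
   by (rule d1(2)) (use x y fz in auto)
  have "norm (f x - f y) <= K * norm (x - y)"
   using x y by (intro K(3)) (auto simp: d_def)
  then have "e / (2 * K) * norm (f x - f y) <= e / (2 * K) * (K * norm (x - y))"
   using e K by (intro mult_left_mono) auto
  with 1 have 1: "norm (g (f x) - g (f y) - E (f x - f y)) <= e / 2 * norm (x - y)"
   using K by simp
  have "norm (E (f x - f y - D (x - y))) <= norm (f x - f y - D (x - y)) * B" by (rule B)
  also have "... <= e / (2 * B) * norm (x - y) * B"
   using x y B by (intro mult_right_mono d2(2)) (auto simp: d_def)
  finally have 2: "norm (E (f x - f y - D (x - y))) <= e / 2 * norm (x - y)"
   using B by simp
  have "g (f x) - g (f y) - E (D (x - y))
   = (g (f x) - g (f y) - E (f x - f y)) + E (f x - f y - D (x - y))"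
   using linear_diff[OF bounded_linear.linear[OF E], of "f x - f y" "D (x - y)"] by simp
  then have "norm (g (f x) - g (f y) - E (D (x - y)))
   <= norm (g (f x) - g (f y) - E (f x - f y)) + norm (E (f x - f y - D (x - y)))"
   by (metis norm_triangle_ineq)
  then show "norm (g (f x) - g (f y) - E (D (x - y))) <= e * norm (x - y)"
   using 1 2 by linarith
 qed
qed

lemma strict_deriv_Pair:
 assumes f: "strict_deriv f D c" and g: "strict_deriv g E c"
 shows "strict_deriv (%x. (f x, g x)) (%x. (D x, E x)) c"
 unfolding strict_deriv_def
proof (intro conjI allI impI)
 show "bounded_linear (%x. (D x, E x))"
  using f g by (intro bounded_linear_Pair) (simp_all add: strict_deriv_def)
 fix e :: real assume "e > 0"
 then have e: "e / 2 > 0" by simp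
 obtain d1 where d1: "d1 > 0" "!!x y. x : ball c d1 ==> y : ball c d1 ==>
   norm (f x - f y - D (x - y)) <= e / 2 * norm (x - y)"
  using strict_derivD[OF f e] by blast
 obtain d2 where d2: "d2 > 0" "!!x y. x : ball c d2 ==> y : ball c d2 ==>
   norm (g x - g y - E (x - y)) <= e / 2 * norm (x - y)"
  using strict_derivD[OF g e] by blast
 show "EX d>0. ALL x:ball c d. ALL y:ball c d.
  norm ((f x, g x) - (f y, g y) - (D (x - y), E (x - y))) <= e * norm (x - y)"
 proof (intro exI[of _ "min d1 d2"] conjI ballI)
  fix x y assume "x : ball c (min d1 d2)" "y : ball c (min d1 d2)"
  then have "norm (f x - f y - D (x - y)) <= e / 2 * norm (x - y)"
   "norm (g x - g y - E (x - y)) <= e / 2 * norm (x - y)"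
   using d1(2)[of x y] d2(2)[of x y] by simp_all
  then show "norm ((f x, g x) - (f y, g y) - (D (x - y), E (x - y))) <= e * norm (x - y)"
   using norm_Pair_le[of "f x - f y - D (x - y)" "g x - g y - E (x - y)"] by simp
 qed (use d1 d2 in auto)
qed

lemma C1_strict_deriv:
 fixes f :: "'a::euclidean_space => 'b::real_normed_vector"
 assumes S: "open S" "c : S" and f: "Ck_on 1 f S"
 shows "strict_deriv f (frechet_derivative f (at c)) c"
 unfolding strict_deriv_def
proof (intro conjI allI impI)
 let ?D = "%x. frechet_derivative f (at x)"
 have D: "(f has_derivative ?D x) (at x)" if "x : S" for x
  using Ck_on_Suc_has_derivative[of 0 f S x] f that by simp
 have lin: "linear (?D x)" if "x : S" for x using D[OF that] by (rule has_derivative_linear)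
 show blc: "bounded_linear (?D c)" using D[OF S(2)] by (rule has_derivative_bounded_linear)
 fix e :: real assume e: "e > 0"
 have cont: "continuous_on S (%x. ?D x b)" for b using f by simp
 have "continuous_on S (%x. \<Sum>b\<in>Basis. norm (?D x b - ?D c b))"
  by (intro continuous_intros cont)
 then have "isCont (%x. \<Sum>b\<in>Basis. norm (?D x b - ?D c b)) c"
  using S by (simp add: continuous_on_eq_continuous_at)
 from this[unfolded continuous_at_eps_delta, rule_format, OF e] obtain d1 where d1: "d1 > 0"
  "!!x. dist x c < d1 ==> (\<Sum>b\<in>Basis. norm (?D x b - ?D c b)) < e"
  by (auto simp: dist_real_def sum_nonneg)
 obtain r where r: "r > 0" "ball c r <= S" using S open_contains_ball by blast
 define d where "d = min d1 r"
 show "EX d>0. ALL x:ball c d. ALL y:ball c d. norm (f x - f y - ?D c (x - y)) <= e * norm (x - y)"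
 proof (intro exI[of _ d] conjI ballI)
  show "d > 0" using d1 r by (simp add: d_def)
  fix x y assume x: "x : ball c d" and y: "y : ball c d"
  have "norm ((f x - ?D c x) - (f y - ?D c y)) <= e * norm (x - y)"
  proof (rule differentiable_bound[where S = "ball c d"])
   fix z assume z: "z : ball c d"
   then have zS: "z : S" using r by (auto simp: d_def)
   show "((%x. f x - ?D c x) has_derivative (%v. ?D z v - ?D c v)) (at z within ball c d)"
    by (intro has_derivative_diff has_derivative_at_withinI[OF D[OF zS]]
      bounded_linear_imp_has_derivative[OF blc])
   show "onorm (%v. ?D z v - ?D c v) <= e"
   proof (rule onorm_le)
    fix v
    have l: "linear (%v. ?D z v - ?D c v)"
     by (rule linear_compose_sub[OF lin[OF zS] lin[OF S(2)]])
    have "?D z v - ?D c v = (%v. ?D z v - ?D c v) (\<Sum>b\<in>Basis. (v \<bullet> b) *\<^sub>R b)"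
     by (simp add: euclidean_representation)
    also have "... = (\<Sum>b\<in>Basis. (v \<bullet> b) *\<^sub>R (?D z b - ?D c b))"
     by (simp only: linear_sum[OF l] linear_scale[OF l])
    finally have "norm (?D z v - ?D c v) <= (\<Sum>b\<in>Basis. norm ((v \<bullet> b) *\<^sub>R (?D z b - ?D c b)))"
     by (simp only: norm_sum)
    also have "... <= (\<Sum>b\<in>Basis. norm v * norm (?D z b - ?D c b))"
     by (intro sum_mono) (auto intro!: mult_right_mono Basis_le_norm)
    also have "... = norm v * (\<Sum>b\<in>Basis. norm (?D z b - ?D c b))" by (simp add: sum_distrib_left)
    also have "... <= norm v * e"
     using d1(2)[of z] z by (intro mult_left_mono) (auto simp: d_def dist_commute)
    finally show "norm (?D z v - ?D c v) <= e * norm v" by (simp add: mult.commute)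
   qed
  qed (use x y in auto)
  then show "norm (f x - f y - ?D c (x - y)) <= e * norm (x - y)"
   by (simp add: linear_diff[OF lin[OF S(2)]] algebra_simps)
 qed
qed

text \<open>
 The right hand side is composed with the nearest point retraction onto the ball; it is then
 bounded and Lipschitz everywhere, and the Picard operator contracts all bounded continuous curves.
\<close>
lemma picard:
 fixes \<xi> :: "'e::euclidean_space => 'e"
 assumes r: "r > 0"
  and lip: "!!x y. x : cball c r ==> y : cball c r ==> norm (\<xi> x - \<xi> y) <= L * norm (x - y)"
 obtains d u where "d > 0" "u 0 = c" "!!t. t : {0..d} ==> u t : cball c r"
  "!!t. t : {0..d} ==> (u has_vector_derivative \<xi> (u t)) (at t within {0..d})"
proof -
 define L' where "L' = max L 0"
 define p where "p x = closest_point (cball c r) x" for x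
 define eta where "eta x = \<xi> (p x)" for x
 have pin: "p x : cball c r" for x
  unfolding p_def using r by (intro closest_point_in_set) auto
 have pid: "p x = x" if "x : cball c r" for x
  unfolding p_def using that by (rule closest_point_self)
 have plip: "norm (p x - p y) <= norm (x - y)" for x y
  using closest_point_lipschitz[of "cball c r" x y] r by (simp add: p_def dist_norm)
 have etalip: "norm (eta x - eta y) <= L' * norm (x - y)" for x y
 proof -
  have "norm (eta x - eta y) <= L * norm (p x - p y)" unfolding eta_def by (rule lip[OF pin pin])
  also have "... <= L' * norm (p x - p y)" by (intro mult_right_mono) (auto simp: L'_def)
  also have "... <= L' * norm (x - y)" by (intro mult_left_mono plip) (auto simp: L'_def)
  finally show ?thesis .
 qed
 define M where "M = norm (\<xi> c) + L' * r"
 have M0: "M >= 0" using r by (simp add: M_def L'_def)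
 have etaM: "norm (eta x) <= M" for x
 proof -
  have "norm (eta x) <= norm (\<xi> c) + norm (\<xi> (p x) - \<xi> c)"
   unfolding eta_def by (rule norm_triangle_sub)
  also have "norm (\<xi> (p x) - \<xi> c) <= L * norm (p x - c)" using r by (intro lip pin) auto
  also have "... <= L' * r"
   using pin[of x] by (intro mult_mono) (auto simp: L'_def dist_norm norm_minus_commute)
  finally show ?thesis by (simp add: M_def)
 qed
 have conteta: "continuous_on UNIV eta"
 proof (rule lipschitz_on_continuous_on)
  show "L'-lipschitz_on UNIV eta"
   using etalip by (auto intro!: lipschitz_onI simp: dist_norm L'_def)
 qed
 define d where "d = min (1 / (2 * (L' + 1))) (r / (M + 1))"
 have L'0: "L' >= 0" by (simp add: L'_def)
 have d: "d > 0" "d * L' <= 1 / 2" "d * M <= r"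
 proof -
  show "d > 0" using r L'0 M0 by (simp add: d_def)
  have "d * L' <= 1 / (2 * (L' + 1)) * L'" using L'0 by (intro mult_right_mono) (auto simp: d_def)
  also have "... <= 1 / 2" using L'0 by (simp add: field_simps)
  finally show "d * L' <= 1 / 2" .
  have "d * M <= r / (M + 1) * M" using M0 by (intro mult_right_mono) (auto simp: d_def)
  also have "... <= r" using M0 r by (simp add: field_simps)
  finally show "d * M <= r" .
 qed
 define clamp where "clamp t = max 0 (min d t)" for t :: real
 have clamp: "clamp t : {0..d}" for t using d by (auto simp: clamp_def)
 define P where "P u t = c + integral {0..clamp t} (%s. eta (apply_bcontfun u s))" for u and t :: real
 have contetau: "continuous_on S (%s. eta (apply_bcontfun u s))" for S and u :: "real \<Rightarrow>\<^sub>C 'e"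
  by (rule continuous_on_compose2[OF conteta]) auto
 have intg: "(%s. eta (apply_bcontfun u s)) integrable_on {a..b}" for u :: "real \<Rightarrow>\<^sub>C 'e" and a b
  by (rule integrable_continuous_interval[OF contetau])
 have bound: "norm (integral {0..clamp t} (%s. eta (apply_bcontfun u s))) <= d * M"
  for t and u :: "real \<Rightarrow>\<^sub>C 'e"
 proof -
  have "norm (integral {0..clamp t} (%s. eta (apply_bcontfun u s))) <= M * (clamp t - 0)"
   using clamp[of t] by (intro integral_bound contetau) (auto intro: etaM)
  also have "... <= M * d" using clamp[of t] M0 by (intro mult_left_mono) auto
  finally show ?thesis by (simp add: mult.commute)
 qed
 have P: "P u : bcontfun" for u
 proof -
  have "continuous_on {0..d} (%t. integral {0..t} (%s. eta (apply_bcontfun u s)))"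
   by (rule indefinite_integral_continuous_1[OF intg])
  moreover have "continuous_on UNIV clamp" unfolding clamp_def by (intro continuous_intros)
  ultimately have "continuous_on UNIV (%t. integral {0..clamp t} (%s. eta (apply_bcontfun u s)))"
   by (rule continuous_on_compose2) (use clamp in auto)
  then have "continuous_on UNIV (P u)" unfolding P_def by (intro continuous_intros)
  moreover have "bounded (range (P u))"
   unfolding bounded_iff
  proof (intro exI[of _ "norm c + d * M"] ballI, clarify)
   fix t show "norm (P u t) <= norm c + d * M"
    unfolding P_def using bound[of t u] by (intro norm_triangle_le add_left_mono)
  qed
  ultimately show ?thesis by (simp add: bcontfun_def)
 qed
 have "\<exists>!u. Bcontfun (P u) = u"
 proof (rule banach_fix_type[where c = "1 / 2"])
  show "ALL u w. dist (Bcontfun (P u)) (Bcontfun (P w)) <= 1 / 2 * dist u w"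
  proof (intro allI dist_bound)
   fix u w :: "real \<Rightarrow>\<^sub>C 'e" and t
   have "P u t - P w t = integral {0..clamp t} (%s. eta (apply_bcontfun u s) - eta (apply_bcontfun w s))"
    by (simp add: P_def integral_diff intg)
   also have "norm ... <= (L' * dist u w) * (clamp t - 0)"
   proof (rule integral_bound)
    fix s
    have "norm (eta (apply_bcontfun u s) - eta (apply_bcontfun w s))
     <= L' * norm (apply_bcontfun u s - apply_bcontfun w s)" by (rule etalip)
    also have "... <= L' * dist u w"
     using dist_bounded[of u s w] L'0 by (intro mult_left_mono) (auto simp: dist_norm)
    finally show "norm (eta (apply_bcontfun u s) - eta (apply_bcontfun w s)) <= L' * dist u w" .
   qed (use clamp[of t] in \<open>auto intro!: continuous_intros contetau\<close>)
   also have "... <= (L' * dist u w) * d"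
    using clamp[of t] L'0 by (intro mult_left_mono) auto
   also have "... = (d * L') * dist u w" by simp
   also have "... <= 1 / 2 * dist u w" using d by (intro mult_right_mono) auto
   finally show "dist (apply_bcontfun (Bcontfun (P u)) t) (apply_bcontfun (Bcontfun (P w)) t)
     <= 1 / 2 * dist u w"
    by (simp add: Bcontfun_inverse[OF P] dist_norm)
  qed
 qed auto
 then obtain u where u: "Bcontfun (P u) = u" by blast
 have ueq: "apply_bcontfun u t = P u t" for t
  using Bcontfun_inverse[OF P[of u]] u by simp
 show ?thesis
 proof (rule that[of d "apply_bcontfun u"])
  show "d > 0" by (rule d)
  show "apply_bcontfun u 0 = c" using d by (subst ueq) (simp add: P_def clamp_def)
  show in_ball: "apply_bcontfun u t : cball c r" for t
   using bound[of t u] d(3) by (subst ueq) (simp add: P_def dist_norm)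
  fix t assume t: "t : {0..d}"
  have "((%t. c + integral {0..t} (%s. eta (apply_bcontfun u s))) has_vector_derivative
    0 + eta (apply_bcontfun u t)) (at t within {0..d})"
   by (intro has_vector_derivative_add has_vector_derivative_const
     integral_has_vector_derivative contetau t)
  moreover have "apply_bcontfun u s = c + integral {0..s} (%s. eta (apply_bcontfun u s))"
   if "s : {0..d}" for s
   using that by (subst ueq) (simp add: P_def clamp_def)
  ultimately have "(apply_bcontfun u has_vector_derivative 0 + eta (apply_bcontfun u t)) (at t within {0..d})"
   by (rule has_vector_derivative_transform[OF t, rotated])
  then show "(apply_bcontfun u has_vector_derivative \<xi> (apply_bcontfun u t)) (at t within {0..d})"
   using in_ball[of t] by (simp add: eta_def pid)
 qed
qed

text \<open>Two solutions that agree at one time agree nearby: their largest distance is halved.\<close>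
lemma ode_unique_local:
 fixes u w :: "real => 'e::real_normed_vector"
 assumes d: "d > 0" "L * d < 1" "L >= 0"
  and u: "!!t. t : cball t0 d ==> (u has_vector_derivative u' t) (at t)"
  and w: "!!t. t : cball t0 d ==> (w has_vector_derivative w' t) (at t)"
  and lip: "!!t. t : cball t0 d ==> norm (u' t - w' t) <= L * norm (u t - w t)"
  and t0: "u t0 = w t0" and t: "t : cball t0 d"
 shows "u t = w t"
proof -
 define D where "D t = u t - w t" for t
 have D: "(D has_vector_derivative u' t - w' t) (at t within cball t0 d)" if "t : cball t0 d" for t
  unfolding D_def using u[OF that] w[OF that]
  by (intro has_vector_derivative_diff) (auto intro: has_vector_derivative_at_within)
 have "continuous_on (cball t0 d) D"
  unfolding continuous_on_eq_continuous_within
  using D has_vector_derivative_continuous by blast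
 then have "continuous_on (cball t0 d) (%t. norm (D t))" by (rule continuous_on_norm)
 from continuous_attains_sup[OF compact_cball _ this] obtain s where s: "s : cball t0 d"
  "!!t. t : cball t0 d ==> norm (D t) <= norm (D s)"
  using d by (auto simp del: mem_cball)
 have "norm (D s - D t0) <= (L * norm (D s)) * norm (s - t0)"
 proof (rule differentiable_bound[where S = "cball t0 d"])
  fix x assume x: "x : cball t0 d"
  show "(D has_derivative (%h. h *\<^sub>R (u' x - w' x))) (at x within cball t0 d)"
   using D[OF x] by (simp add: has_vector_derivative_def)
  have "norm (u' x - w' x) <= L * norm (D x)" using lip[OF x] by (simp add: D_def)
  also have "... <= L * norm (D s)" using s(2)[OF x] d by (intro mult_left_mono) auto
  finally show "onorm (%h. h *\<^sub>R (u' x - w' x)) <= L * norm (D s)"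
   by (intro onorm_le) (simp add: mult_left_mono mult.commute[of _ "\<bar>_\<bar>"])
 qed (use s d in auto)
 also have "... <= (L * norm (D s)) * d"
  using s(1) d by (intro mult_left_mono) (auto simp: dist_real_def)
 finally have "norm (D s) <= (L * d) * norm (D s)" using t0 by (simp add: D_def mult_ac)
 then have "norm (D s) * (1 - L * d) <= 0" by (simp add: algebra_simps)
 then have "norm (D s) <= 0" using d by (simp add: mult_le_0_iff)
 then have "norm (D t) <= 0" using s(2)[OF t] by linarith
 then show ?thesis by (simp add: D_def)
qed

lemma has_real_derivative_left_right:
 fixes f :: "real => real"
 assumes "a < t" "t < b"
  and "(f has_real_derivative D) (at t within {a..t})"
  and "(f has_real_derivative D) (at t within {t..b})"
 shows "(f has_real_derivative D) (at t)"
proof -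
 have "((%y. (f y - f t) / (y - t)) \<longlongrightarrow> D) (at t within {a..t} Un {t..b})"
  using assms(3,4) by (simp only: has_field_derivative_iff at_within_union filterlim_sup)
 then have "(f has_real_derivative D) (at t within {a..t} Un {t..b})"
  by (simp only: has_field_derivative_iff)
 moreover have "{a..t} Un {t..b} = {a..b}" using assms(1,2) by auto
 moreover have "at t within {a..b} = at t"
  using assms(1,2) by (intro at_within_interior) auto
 ultimately show ?thesis by simp
qed

section \<open>One-parameter subgroups\<close>

text \<open>Integral curves on an interval, not necessarily starting at the unit.\<close>
definition (in lie_chart) flows_on :: "'g vfield => real set => (real => 'g) => bool" where
 "flows_on X S gam \<longleftrightarrow> continuous_on S gam & (ALL f. ALL t:S. smooth_fun A f -->
  ((%s. f (gam s)) has_real_derivative X f (gam t)) (at t within S))"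

context lie_chart
begin

lemma Ck_field: "Ck_on k (field v) Om"
proof -
 have 1: "Ck_on k (%p. frechet_derivative mult (at p) (0, v)) mult_dom"
  using smooth_mult by (simp add: smooth_on_def) (metis Ck_on.simps(2))
 have "Ck_on k (%c. (c, 0) + (0, oc)) Om"
  by (intro Ck_on_add Ck_on_const Ck_on_linear chart_U bounded_linear_Pair
    bounded_linear_zero bounded_linear_ident)
 then have 2: "Ck_on k (%c. (c, oc)) Om" by simp
 have "(%c. (c, oc)) ` Om <= mult_dom" using in_mult_dom(1) by auto
 from Ck_on_compose[OF chart_U(2) open_mult_dom this 2 1] show ?thesis
  by (simp add: field_def[abs_def])
qed

lemma field_at_unit: "field v oc = v"
proof -
 have o: "oc : Om" using zero_U by simp
 have 1: "((%a. (oc, a)) has_derivative (%w. (0, w))) (at oc)"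
  by (auto intro!: derivative_eq_intros)
 have 2: "(mult has_derivative frechet_derivative mult (at (oc, oc))) (at (oc, oc))"
  by (rule smooth_on_has_derivative[OF smooth_mult in_mult_dom(1)[OF o]])
 have "((%a. mult (oc, a)) has_derivative (%w. frechet_derivative mult (at (oc, oc)) (0, w))) (at oc)"
  using has_derivative_compose[OF 1 2] .
 then have "((%a. a) has_derivative (%w. frechet_derivative mult (at (oc, oc)) (0, w))) (at oc)"
  by (rule has_derivative_transform_within_open[OF _ chart_U(2) o]) (rule mult_unit(2))
 from has_derivative_unique[OF this has_derivative_ident] show ?thesis
  by (simp add: field_def fun_eq_iff)
qed

lemma field_lipschitz:
 obtains r L where "r > 0" "L >= 0" "cball oc r <= Om"
  "!!x y. x : cball oc r ==> y : cball oc r ==> norm (field v x - field v y) <= L * norm (x - y)"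
proof -
 have o: "oc : Om" using zero_U by simp
 obtain K d where K: "K > 0" "d > 0"
  "!!x y. x : ball oc d ==> y : ball oc d ==> norm (field v x - field v y) <= K * norm (x - y)"
  using strict_deriv_lipschitz[OF C1_strict_deriv[OF chart_U(2) o Ck_field[of 1 v]]] by blast
 obtain r where r: "r > 0" "cball oc r <= Om" using chart_U(2) o open_contains_cball by blast
 show ?thesis
 proof (rule that[of "min r (d / 2)" K])
  show "cball oc (min r (d / 2)) <= Om" using r by (auto simp: subset_iff)
  fix x y assume "x : cball oc (min r (d / 2))" "y : cball oc (min r (d / 2))"
  then have "x : ball oc d" "y : ball oc d" using K by auto
  then show "norm (field v x - field v y) <= K * norm (x - y)" by (rule K)
 qed (use r K in auto)
qed

lemma flows_on_left_transl:
 assumes X: "X : lie_algebra A" and "flows_on X S gam"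
 shows "flows_on X S (%t. y + gam t)"
 unfolding flows_on_def
proof (intro conjI allI ballI impI)
 show "continuous_on S (%t. y + gam t)"
  using assms(2) by (intro continuous_on_add continuous_on_const) (simp add: flows_on_def)
 fix f t assume t: "t : S" and f: "smooth_fun A f"
 have "((%s. left_transl (- y) f (gam s)) has_real_derivative X (left_transl (- y) f) (gam t)) (at t within S)"
  using assms(2) t smooth_fun_left_transl[OF f] by (simp add: flows_on_def)
 then show "((%s. f (y + gam s)) has_real_derivative X f (y + gam t)) (at t within S)"
  by (simp only: lie_algebraD(3)[OF X f f]) (simp add: left_transl_def)
qed

lemma flows_on_local:
 assumes X: "X : lie_algebra A"
 obtains d gam where "d > 0" "gam 0 = 0" "flows_on X {0..d} gam"
proof -
 obtain r L where r: "r > 0" "L >= 0" "cball oc r <= Om"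
  "!!x y. x : cball oc r ==> y : cball oc r ==>
   norm (field (tangent X) x - field (tangent X) y) <= L * norm (x - y)"
  using field_lipschitz[of "tangent X"] by blast
 obtain d u where u: "d > 0" "u 0 = oc" "!!t. t : {0..d} ==> u t : cball oc r"
  "!!t. t : {0..d} ==> (u has_vector_derivative field (tangent X) (u t)) (at t within {0..d})"
  using picard[OF r(1,4)] by blast
 have uO: "u t : Om" if "t : {0..d}" for t using u(3)[OF that] r(3) by blast
 show ?thesis
 proof (rule that[of d "%t. sig (u t)"])
  show "sig (u 0) = 0" using u(2) zero_U by (simp add: chart_U)
  show "flows_on X {0..d} (%t. sig (u t))"
   unfolding flows_on_def
  proof (intro conjI allI ballI impI)
   have "continuous_on {0..d} u"
    unfolding continuous_on_eq_continuous_within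
    using u(4) has_vector_derivative_continuous by blast
   then show "continuous_on {0..d} (%t. sig (u t))"
    by (rule continuous_on_compose2[OF chart_U(4)]) (use uO in auto)
   fix f t assume t: "t : {0..d}" and f: "smooth_fun A f"
   have 1: "(u has_derivative (%h. h *\<^sub>R field (tangent X) (u t))) (at t within {0..d})"
    using u(4)[OF t] by (simp add: has_vector_derivative_def)
   have 2: "((%a. f (sig a)) has_derivative frechet_derivative (%a. f (sig a)) (at (u t))) (at (u t))"
    by (rule smooth_on_has_derivative[OF smooth_fun_chart[OF f chart] uO[OF t]])
   have "X f (sig (u t)) = frechet_derivative (%a. f (sig a)) (at (u t)) (field (tangent X) (u t))"
    using lie_algebra_eq_field[OF X f, of "sig (u t)"] uO[OF t] by (simp add: chart_U)
   moreover have "((%s. f (sig (u s))) has_derivative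
    (%h. frechet_derivative (%a. f (sig a)) (at (u t)) (h *\<^sub>R field (tangent X) (u t)))) (at t within {0..d})"
    using has_derivative_compose[OF 1 2] .
   ultimately show "((%s. f (sig (u s))) has_real_derivative X f (sig (u t))) (at t within {0..d})"
    by (simp add: has_field_derivative_def linear_scale[OF has_derivative_linear[OF 2]] mult.commute[of _ "X f _"]
      mult_commute_abs)
  qed
 qed (rule u)
qed

text \<open>
 Translated copies of a short integral curve are joined end to end. The two one-sided derivatives
 at a joint agree because both are given by the field.
\<close>
lemma integral_curve_exists:
 assumes X: "X : lie_algebra A"
 shows "EX gam. integral_curve A X gam"
proof -
 obtain d gam where gam: "d > 0" "gam 0 = 0" "flows_on X {0..d} gam"
  using flows_on_local[OF X] by blast
 define p where "p j = (if 0 <= j then ((%x. x + gam d) ^^ nat j) 0 else ((%x. x - gam d) ^^ nat (- j)) 0)" for j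
 have p_step: "p j + gam d = p (j + 1)" for j
 proof (cases "0 <= j")
  case True
  then show ?thesis by (simp add: p_def nat_add_distrib)
 next
  case False
  then have "nat (- j) = Suc (nat (- j - 1))" by simp
  then have "p j = ((%x. x - gam d) ^^ nat (- j - 1)) 0 - gam d" using False by (simp add: p_def)
  moreover have "- j - 1 = - (j + 1)" by simp
  then have "((%x. x - gam d) ^^ nat (- j - 1)) 0 = p (j + 1)"
   using False by (cases "j + 1 = 0") (simp_all only: p_def, auto)
  ultimately show ?thesis by simp
 qed
 define \<Gamma> where "\<Gamma> t = p \<lfloor>t / d\<rfloor> + gam (t - of_int \<lfloor>t / d\<rfloor> * d)" for t
 have piece: "\<Gamma> t = p j + gam (t - of_int j * d)" if "t : {of_int j * d..of_int (j + 1) * d}" for t j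
 proof (cases "t = of_int (j + 1) * d")
  case True
  then have "t / d = of_int (j + 1)" using gam(1) by simp
  then have "\<Gamma> t = p (j + 1)" using True gam(2) by (simp add: \<Gamma>_def)
  moreover have "t - of_int j * d = d" using True by (simp add: algebra_simps)
  ultimately show ?thesis using p_step[of j] by simp
 next
  case False
  then have "\<lfloor>t / d\<rfloor> = j"
   using that gam(1) by (intro floor_unique) (auto simp: field_simps)
  then show ?thesis by (simp add: \<Gamma>_def)
 qed
 have flow: "flows_on X {of_int j * d..of_int (j + 1) * d} \<Gamma>" for j
 proof -
  let ?S = "{of_int j * d..of_int (j + 1) * d}"
  have img: "(%t. t - of_int j * d) ` ?S <= {0..d}" by (auto simp: algebra_simps)
  have tr: "flows_on X {0..d} (%t. p j + gam t)" by (rule flows_on_left_transl[OF X gam(3)])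
  show ?thesis
   unfolding flows_on_def
  proof (intro conjI allI ballI impI)
   have "continuous_on ?S (%t. p j + gam (t - of_int j * d))"
    by (rule continuous_on_compose2[where g = "%t. p j + gam t" and t = "{0..d}"])
     (use tr img in \<open>auto simp: flows_on_def intro!: continuous_intros\<close>)
   then show "continuous_on ?S \<Gamma>" by (rule continuous_on_eq) (simp only: piece)
   fix f t assume t: "t : ?S" and f: "smooth_fun A f"
   have "((%s. f (p j + gam s)) has_real_derivative X f (p j + gam (t - of_int j * d)))
     (at (t - of_int j * d) within {0..d})"
    using tr t f img by (auto simp: flows_on_def)
   then have 1: "((%s. f (p j + gam s)) has_real_derivative X f (p j + gam (t - of_int j * d)))
     (at (t - of_int j * d) within (%t. t - of_int j * d) ` ?S)"
    by (rule DERIV_subset[OF _ img])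
   have 2: "((%t. t - of_int j * d) has_real_derivative 1) (at t within ?S)"
    by (auto intro!: derivative_eq_intros)
   have "((%s. f (p j + gam (s - of_int j * d))) has_real_derivative
     X f (p j + gam (t - of_int j * d)) * 1) (at t within ?S)"
    using DERIV_image_chain[of "%s. f (p j + gam s)" _ "%t. t - of_int j * d", OF 1 2] by (simp only: o_def)
   then show "((%s. f (\<Gamma> s)) has_real_derivative X f (\<Gamma> t)) (at t within ?S)"
    unfolding has_field_derivative_def mult_1_right piece[OF t]
    by (rule has_derivative_transform[OF t, rotated]) (simp only: piece)
  qed
 qed
 have two_sides: "EX i j. of_int i * d < t & t : {of_int i * d..of_int (i + 1) * d}
   & t < of_int (j + 1) * d & t : {of_int j * d..of_int (j + 1) * d}" for t
 proof -
  define i where "i = \<lceil>t / d\<rceil> - 1"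
  define j where "j = \<lfloor>t / d\<rfloor>"
  have "of_int i < t / d" "t / d <= of_int i + 1" "of_int j <= t / d" "t / d < of_int j + 1"
   unfolding i_def j_def by linarith+
  then show ?thesis
   using gam(1) by (intro exI[of _ i] exI[of _ j]) (simp add: field_simps)
 qed
 have "integral_curve A X \<Gamma>"
  unfolding integral_curve_def
 proof (intro conjI allI impI)
  show "\<Gamma> 0 = 0" using piece[of 0 0] gam by (simp add: p_def)
  have cont: "isCont \<Gamma> t" for t
  proof -
   obtain i j where ij: "of_int i * d < t" "t : {of_int i * d..of_int (i + 1) * d}"
    "t < of_int (j + 1) * d" "t : {of_int j * d..of_int (j + 1) * d}" using two_sides by blast
   have "(\<Gamma> \<longlongrightarrow> \<Gamma> t) (at t within {of_int i * d..t})"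
    using flow[of i] ij(2) unfolding flows_on_def continuous_on_def
    by (meson atLeastatMost_subset_iff atLeastAtMost_iff order_refl tendsto_within_subset)
   moreover have "(\<Gamma> \<longlongrightarrow> \<Gamma> t) (at t within {t..of_int (j + 1) * d})"
    using flow[of j] ij(4) unfolding flows_on_def continuous_on_def
    by (meson atLeastatMost_subset_iff atLeastAtMost_iff order_refl tendsto_within_subset)
   ultimately have "(\<Gamma> \<longlongrightarrow> \<Gamma> t) (at t within {of_int i * d..t} Un {t..of_int (j + 1) * d})"
    by (simp only: at_within_union filterlim_sup)
   moreover have "{of_int i * d..t} Un {t..of_int (j + 1) * d} = {of_int i * d..of_int (j + 1) * d}"
    using ij by auto
   moreover have "at t within {of_int i * d..of_int (j + 1) * d} = at t"
    using ij by (intro at_within_interior) auto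
   ultimately show ?thesis by (simp add: isCont_def)
  qed
  then show "continuous_on UNIV \<Gamma>" by (intro continuous_at_imp_continuous_on) auto
  fix f t assume f: "smooth_fun A f"
  obtain i j where ij: "of_int i * d < t" "t : {of_int i * d..of_int (i + 1) * d}"
   "t < of_int (j + 1) * d" "t : {of_int j * d..of_int (j + 1) * d}" using two_sides by blast
  show "((%s. f (\<Gamma> s)) has_real_derivative X f (\<Gamma> t)) (at t)"
  proof (rule has_real_derivative_left_right[OF ij(1,3)])
   have "((%s. f (\<Gamma> s)) has_real_derivative X f (\<Gamma> t)) (at t within {of_int i * d..of_int (i + 1) * d})"
    using flow[of i] ij(2) f by (simp only: flows_on_def)
   then show "((%s. f (\<Gamma> s)) has_real_derivative X f (\<Gamma> t)) (at t within {of_int i * d..t})"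
    by (rule DERIV_subset) (use ij in auto)
   have "((%s. f (\<Gamma> s)) has_real_derivative X f (\<Gamma> t)) (at t within {of_int j * d..of_int (j + 1) * d})"
    using flow[of j] ij(4) f by (simp only: flows_on_def)
   then show "((%s. f (\<Gamma> s)) has_real_derivative X f (\<Gamma> t)) (at t within {t..of_int (j + 1) * d})"
    by (rule DERIV_subset) (use ij in auto)
  qed
 qed
 then show ?thesis by blast
qed

lemma chart_ball:
 assumes "ball oc r <= Om"
 shows "sig ` ball oc r = U Int kap -` ball oc r"
proof (intro equalityI subsetI)
 fix x assume "x : U Int kap -` ball oc r"
 then have "x = sig (kap x)" "kap x : ball oc r" by (simp_all add: chart_U)
 then show "x : sig ` ball oc r" by (rule image_eqI)
next
 fix x assume "x : sig ` ball oc r"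
 then obtain c where "x = sig c" "c : ball oc r" by blast
 moreover from this assms have "c : Om" by blast
 ultimately show "x : U Int kap -` ball oc r" using chart_U(6,7)[of c] by simp
qed

lemma open_chart_ball: "ball oc r <= Om ==> open (sig ` ball oc r)"
 using continuous_open_preimage[OF chart_U(3) chart_U(1) open_ball] by (simp add: chart_ball)

lemma zero_in_chart_ball: "r > 0 ==> 0 : sig ` ball oc r"
 by (rule image_eqI[of _ _ "oc"]) (simp_all add: chart_U(5) zero_U)

text \<open>
 Near the unit the chart coordinates along an integral curve are quotients of the damped
 coordinates by the bump, both of which are globally smooth functions.
\<close>
lemma flow_in_chart:
 assumes X: "X : lie_algebra A" and gam: "flows_on X UNIV gam"
  and r: "r > 0" "ball oc r <= Om" and t: "gam t : U" "kap (gam t) : ball oc (r / 2)"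
 shows "((%s. kap (gam s)) has_vector_derivative field (tangent X) (kap (gam t))) (at t)"
proof -
 let ?\<xi> = "field (tangent X) (kap (gam t))" and ?B = "bump oc (r / 2)"
 define e where "e = ext r (%_. 1)"
 define q where "q b = ext r (%a. a \<bullet> b)" for b
 have e: "smooth_fun A e"
  unfolding e_def by (intro smooth_fun_ext r) (simp add: smooth_on_def Ck_on_const)
 have q: "smooth_fun A (q b)" for b
  unfolding q_def
  by (intro smooth_fun_ext r) (auto simp: smooth_on_def intro!: Ck_on_linear bounded_linear_inner_left)
 have a: "kap (gam t) : ball oc r" using t r by auto
 have e_eq: "e (sig c) = ?B c" "q b (sig c) = ?B c * (c \<bullet> b)" if "c : ball oc r" for b c
 proof -
  have "c : Om" using that r by blast
  then show "e (sig c) = ?B c" "q b (sig c) = ?B c * (c \<bullet> b)"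
   using that by (auto simp: e_def q_def ext_def chart_U)
 qed
 obtain DB where DB: "(?B has_derivative DB) (at (kap (gam t)))"
  using Ck_on_Suc_has_derivative[OF Ck_on_bump] by blast
 have De: "frechet_derivative (%c. e (sig c)) (at (kap (gam t))) = DB"
  by (rule frechet_derivative_at[symmetric],
    rule has_derivative_transform_within_open[OF DB open_ball a]) (simp add: e_eq)
 have Dmult: "((%c. ?B c * (c \<bullet> b)) has_derivative
   (%h. ?B (kap (gam t)) * (h \<bullet> b) + DB h * (kap (gam t) \<bullet> b))) (at (kap (gam t)))" for b
  by (intro has_derivative_mult DB has_derivative_inner_left has_derivative_ident)
 have Dq: "frechet_derivative (%c. q b (sig c)) (at (kap (gam t)))
   = (%h. ?B (kap (gam t)) * (h \<bullet> b) + DB h * (kap (gam t) \<bullet> b))" for b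
  by (rule frechet_derivative_at[symmetric],
    rule has_derivative_transform_within_open[OF Dmult open_ball a]) (simp add: e_eq)
 have val: "e (gam t) = ?B (kap (gam t))" "q b (gam t) = ?B (kap (gam t)) * (kap (gam t) \<bullet> b)" for b
  using a t by (auto simp: e_def q_def ext_def)
 have pos: "?B (kap (gam t)) > 0" using t by (intro bump_pos) auto
 have flow: "((%s. f (gam s)) has_real_derivative X f (gam t)) (at t)" if "smooth_fun A f" for f
  using gam that by (simp add: flows_on_def)
 have e': "((%s. e (gam s)) has_real_derivative DB ?\<xi>) (at t)"
  using flow[OF e] lie_algebra_eq_field[OF X e t(1)] by (simp add: De)
 have q': "((%s. q b (gam s)) has_real_derivative ?B (kap (gam t)) * (?\<xi> \<bullet> b) + DB ?\<xi> * (kap (gam t) \<bullet> b)) (at t)" for b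
  using flow[OF q[of b]] lie_algebra_eq_field[OF X q t(1), of b] by (simp add: Dq)
 have "((%s. q b (gam s) / e (gam s)) has_real_derivative ?\<xi> \<bullet> b) (at t)" for b
  using DERIV_divide[OF q'[of b] e'] pos by (simp add: val field_simps)
 moreover have "open (gam -` (sig ` ball oc (r / 2)))"
 proof -
  have sub: "ball oc (r / 2) <= Om" using r by auto
  then have "open (sig ` ball oc (r / 2))" by (rule open_chart_ball)
  then show ?thesis using gam by (intro open_vimage) (auto simp: flows_on_def)
 qed
 moreover have "t : gam -` (sig ` ball oc (r / 2))"
  using t by (auto simp: chart_U intro!: image_eqI[of _ _ "kap (gam t)"])
 moreover have "q b (gam s) / e (gam s) = kap (gam s) \<bullet> b" if s: "s : gam -` (sig ` ball oc (r / 2))" for s b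
 proof -
  obtain c where c: "gam s = sig c" "c : ball oc (r / 2)" using s by blast
  then have "c : ball oc r" "c : Om" using r by auto
  then show ?thesis
   using bump_pos[OF c(2)] by (simp add: c(1) e_eq chart_U)
 qed
 ultimately have "((%s. kap (gam s) \<bullet> b) has_real_derivative ?\<xi> \<bullet> b) (at t)" for b
  by (rule has_field_derivative_transform_within_open)
 then have "((%s. kap (gam s)) has_derivative (%h. h *\<^sub>R ?\<xi>)) (at t)"
  by (subst has_derivative_componentwise_within)
   (simp add: has_field_derivative_def mult.commute[of "?\<xi> \<bullet> _"] mult_commute_abs)
 then show ?thesis by (simp add: has_vector_derivative_def)
qed

lemma flows_on_unique:
 assumes X: "X : lie_algebra A" and gam: "flows_on X UNIV gam" and eta: "flows_on X UNIV eta"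
  and eq: "gam 0 = eta 0"
 shows "gam = eta"
proof -
 define T where "T = {t. gam t = eta t}"
 have "closed T"
  unfolding T_def using gam eta by (intro closed_Collect_eq) (simp_all add: flows_on_def)
 moreover have "open T"
  unfolding open_contains_cball
 proof
  fix t0 assume "t0 : T"
  then have t0: "gam t0 = eta t0" by (simp add: T_def)
  obtain r L where r: "r > 0" "L >= 0" "cball oc r <= Om"
   "!!x y. x : cball oc r ==> y : cball oc r ==>
    norm (field (tangent X) x - field (tangent X) y) <= L * norm (x - y)"
   using field_lipschitz[of "tangent X"] by blast
  define V where "V = sig ` ball oc (r / 2)"
  have sub: "ball oc r <= Om" "ball oc (r / 2) <= Om" using r by auto
  have V: "V = U Int kap -` ball oc (r / 2)" unfolding V_def by (rule chart_ball[OF sub(2)])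
  have shift: "flows_on X UNIV (%t. - gam t0 + gam t)" "flows_on X UNIV (%t. - gam t0 + eta t)"
   by (intro flows_on_left_transl X gam eta)+
  have "open ((%t. - gam t0 + gam t) -` V Int (%t. - gam t0 + eta t) -` V)"
   using shift open_chart_ball[OF sub(2)]
   by (intro open_Int open_vimage) (simp_all add: flows_on_def V_def)
  moreover have "t0 : (%t. - gam t0 + gam t) -` V Int (%t. - gam t0 + eta t) -` V"
   using zero_in_chart_ball[of "r / 2"] r t0 by (simp add: V_def)
  ultimately obtain d0 where d0: "d0 > 0"
   "cball t0 d0 <= (%t. - gam t0 + gam t) -` V Int (%t. - gam t0 + eta t) -` V"
   by (meson open_contains_cball)
  define d where "d = min d0 (1 / (2 * (L + 1)))"
  have "L * d <= L * (1 / (2 * (L + 1)))" using r by (intro mult_left_mono) (auto simp: d_def)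
  also have "... < 1" using r by (simp add: field_simps)
  finally have Ld: "L * d < 1" .
  have d: "d > 0" using d0 r by (simp add: d_def)
  have inV: "- gam t0 + gam t : V" "- gam t0 + eta t : V" if "t : cball t0 d" for t
   using d0(2) that by (auto simp: d_def)
  have "cball t0 d <= T"
  proof
   fix t assume t: "t : cball t0 d"
   have "kap (- gam t0 + gam t) = kap (- gam t0 + eta t)"
   proof (rule ode_unique_local[OF d Ld r(2) _ _ _ _ t, where
      u = "%t. kap (- gam t0 + gam t)" and w = "%t. kap (- gam t0 + eta t)"])
    fix t assume t: "t : cball t0 d"
    show "((%t. kap (- gam t0 + gam t)) has_vector_derivative field (tangent X) (kap (- gam t0 + gam t))) (at t)"
     using inV[OF t] by (intro flow_in_chart[OF X shift(1) r(1) sub(1)]) (simp_all add: V)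
    show "((%t. kap (- gam t0 + eta t)) has_vector_derivative field (tangent X) (kap (- gam t0 + eta t))) (at t)"
     using inV[OF t] by (intro flow_in_chart[OF X shift(2) r(1) sub(1)]) (simp_all add: V)
    show "norm (field (tangent X) (kap (- gam t0 + gam t)) - field (tangent X) (kap (- gam t0 + eta t)))
     <= L * norm (kap (- gam t0 + gam t) - kap (- gam t0 + eta t))"
     using inV[OF t] r(1) by (intro r(4)) (auto simp: V)
   qed (simp add: t0)
   then have "sig (kap (- gam t0 + gam t)) = sig (kap (- gam t0 + eta t))" by simp
   then show "t : T" using inV[OF t] by (simp add: V chart_U T_def)
  qed
  then show "EX e>0. cball t0 e <= T" using d by blast
 qed
 moreover have "0 : T" using eq by (simp add: T_def)
 ultimately have "T = UNIV" using clopen[of T] by blast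
 then show ?thesis by (auto simp: T_def fun_eq_iff)
qed

definition flow :: "'g vfield => real => 'g" where
 "flow X = (THE gam. integral_curve A X gam)"

lemma integral_curve_iff: "integral_curve A X gam \<longleftrightarrow> gam 0 = 0 & flows_on X UNIV gam"
 by (auto simp: integral_curve_def flows_on_def)

lemma integral_curve_unique:
 "X : lie_algebra A ==> integral_curve A X gam ==> integral_curve A X eta ==> gam = eta"
 unfolding integral_curve_iff using flows_on_unique by metis

lemma flow_eqI: "X : lie_algebra A ==> integral_curve A X gam ==> flow X = gam"
 unfolding flow_def by (rule the_equality) (auto intro: integral_curve_unique)

lemma flow:
 assumes "X : lie_algebra A"
 shows "flow X 0 = 0" "flows_on X UNIV (flow X)"
proof -
 obtain gam where "integral_curve A X gam" using integral_curve_exists[OF assms] by blast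
 then show "flow X 0 = 0" "flows_on X UNIV (flow X)"
  using flow_eqI[OF assms] by (simp_all add: integral_curve_iff)
qed

lemma continuous_flow: "X : lie_algebra A ==> continuous_on UNIV (flow X)"
 using flow(2) by (simp add: flows_on_def)

lemma flow_add:
 assumes X: "X : lie_algebra A"
 shows "flow X (s + t) = flow X s + flow X t"
proof -
 have fl: "flows_on X UNIV (flow X)" by (rule flow[OF X])
 have "flows_on X UNIV (%t. flow X (s + t))"
  unfolding flows_on_def
 proof (intro conjI allI ballI impI)
  show "continuous_on UNIV (%t. flow X (s + t))"
   by (rule continuous_on_compose2[OF continuous_flow[OF X]]) (auto intro!: continuous_intros)
  fix f t assume f: "smooth_fun A f"
  have "((%u. f (flow X u)) has_real_derivative X f (flow X (s + t))) (at (s + t))"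
   using fl f by (simp add: flows_on_def)
  then show "((%t. f (flow X (s + t))) has_real_derivative X f (flow X (s + t))) (at t)"
   using DERIV_shift[of "%u. f (flow X u)" _ t s] by (simp add: add.commute)
 qed
 then have "flows_on X UNIV (%t. - flow X s + flow X (s + t))" by (rule flows_on_left_transl[OF X])
 then have "(%t. - flow X s + flow X (s + t)) = flow X"
  by (rule flows_on_unique[OF X _ fl]) (simp add: flow(1)[OF X])
 from fun_cong[OF this, of t] have "flow X s + (- flow X s + flow X (s + t)) = flow X s + flow X t"
  by simp
 then show ?thesis by simp
qed

lemma vf_scale_lie_algebra:
 assumes X: "X : lie_algebra A"
 shows "vf_scale t X : lie_algebra A"
 using X smooth_fun_mult[OF smooth_fun_const[of A t]]
 unfolding lie_algebra_def vf_scale_def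
 by (auto simp: algebra_simps left_transl_def fun_eq_iff)

lemma lie_exp_eq_flow:
 assumes X: "X : lie_algebra A"
 shows "lie_exp A (vf_scale t X) = flow X t"
proof -
 have fl: "flows_on X UNIV (flow X)" by (rule flow[OF X])
 have "integral_curve A (vf_scale t X) (%s. flow X (s * t))"
  unfolding integral_curve_def
 proof (intro conjI allI impI)
  show "continuous_on UNIV (%s. flow X (s * t))"
   by (rule continuous_on_compose2[OF continuous_flow[OF X]]) (auto intro!: continuous_intros)
  fix f s assume f: "smooth_fun A f"
  have "((%u. f (flow X u)) has_real_derivative X f (flow X (s * t))) (at (s * t))"
   using fl f by (simp add: flows_on_def)
  moreover have "((%s. s * t) has_real_derivative t) (at s)"
   by (auto intro!: derivative_eq_intros)
  ultimately have "((%s. f (flow X (s * t))) has_real_derivative X f (flow X (s * t)) * t) (at s)"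
   by (rule DERIV_chain2[where f = "%u. f (flow X u)"])
  then show "((%s. f (flow X (s * t))) has_real_derivative vf_scale t X f (flow X (s * t))) (at s)"
   by (simp add: vf_scale_def mult.commute)
 qed (simp add: flow[OF X])
 from flow_eqI[OF vf_scale_lie_algebra[OF X] this] show ?thesis
  by (simp add: lie_exp_def flow_def[symmetric])
qed

lemma strict_deriv_flow:
 assumes X: "X : lie_algebra A"
 shows "strict_deriv (%t. kap (flow X t)) (%h. h *\<^sub>R tangent X) 0"
 unfolding strict_deriv_def
proof (intro conjI allI impI)
 show "bounded_linear (%h. h *\<^sub>R tangent X)" by (rule bounded_linear_scaleR_left)
 fix e :: real assume e: "e > 0"
 have o: "oc : Om" using zero_U by simp
 obtain r where r: "r > 0" "ball oc r <= Om" using chart_U(2) o open_contains_ball by blast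
 have "continuous_on Om (field (tangent X))" using Ck_field[of 0] by simp
 then have "isCont (field (tangent X)) oc"
  using chart_U(2) o continuous_on_eq_continuous_at by blast
 from this[unfolded continuous_at_eps_delta, rule_format, OF e]
 obtain d1 where d1: "d1 > 0" "!!c. dist c oc < d1 ==> dist (field (tangent X) c) (tangent X) < e"
  by (auto simp: field_at_unit)
 define rho where "rho = min (r / 2) d1"
 have rho: "rho > 0" "ball oc rho <= Om" using r d1 by (auto simp: rho_def)
 have "open (flow X -` (sig ` ball oc rho))"
  by (intro open_vimage open_chart_ball rho continuous_flow[OF X])
 moreover have "0 : flow X -` (sig ` ball oc rho)"
  using zero_in_chart_ball[OF rho(1)] by (simp add: flow[OF X])
 ultimately obtain d where d: "d > 0" "ball 0 d <= flow X -` (sig ` ball oc rho)"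
  by (meson open_contains_ball)
 show "EX d>0. ALL x:ball 0 d. ALL y:ball 0 d.
  norm (kap (flow X x) - kap (flow X y) - (x - y) *\<^sub>R tangent X) <= e * norm (x - y)"
 proof (intro exI[of _ d] conjI ballI d)
  fix x y :: real assume x: "x : ball 0 d" and y: "y : ball 0 d"
  have "norm ((kap (flow X x) - x *\<^sub>R tangent X) - (kap (flow X y) - y *\<^sub>R tangent X)) <= e * norm (x - y)"
  proof (rule differentiable_bound[where S = "ball 0 d"])
   fix z :: real assume z: "z : ball 0 d"
   have "flow X z : U Int kap -` ball oc rho" using d(2) z chart_ball[OF rho(2)] by blast
   then have zU: "flow X z : U" "kap (flow X z) : ball oc (r / 2)" "dist (kap (flow X z)) oc < d1"
    by (auto simp: rho_def dist_commute)
   have "((%s. kap (flow X s)) has_vector_derivative field (tangent X) (kap (flow X z))) (at z)"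
    by (rule flow_in_chart[OF X flow(2)[OF X] r zU(1,2)])
   then have "((%s. kap (flow X s) - s *\<^sub>R tangent X) has_derivative
     (%h. h *\<^sub>R field (tangent X) (kap (flow X z)) - h *\<^sub>R tangent X)) (at z within ball 0 d)"
    unfolding has_vector_derivative_def
    by (intro has_derivative_diff bounded_linear_imp_has_derivative[OF bounded_linear_scaleR_left])
     (erule has_derivative_at_withinI)
   then show "((%s. kap (flow X s) - s *\<^sub>R tangent X) has_derivative
     (%h. h *\<^sub>R (field (tangent X) (kap (flow X z)) - tangent X))) (at z within ball 0 d)"
    by (simp add: scaleR_diff_right)
   have "norm (field (tangent X) (kap (flow X z)) - tangent X) <= e"
    using d1(2)[OF zU(3)] by (simp add: dist_norm)
   then show "onorm (%h. h *\<^sub>R (field (tangent X) (kap (flow X z)) - tangent X)) <= e"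
    by (intro onorm_le) (simp add: mult_left_mono mult.commute[of _ "\<bar>_\<bar>"])
  qed (use x y in auto)
  then show "norm (kap (flow X x) - kap (flow X y) - (x - y) *\<^sub>R tangent X) <= e * norm (x - y)"
   by (simp add: algebra_simps)
 qed
qed

text \<open>Left invariance transports a linear relation at the unit to every point.\<close>
lemma independent_tangents:
 assumes basis: "lie_algebra_basis A n X"
  and sum: "(\<Sum>k=1..n. a k *\<^sub>R tangent (X k)) = 0" and k: "k : {1..n}"
 shows "a k = 0"
proof -
 have X: "X k : lie_algebra A" if "k : {1..n}" for k
  using basis that by (simp add: lie_algebra_basis_def)
 have at0: "(\<Sum>k=1..n. a k * X k f 0) = 0" if f: "smooth_fun A f" for f
 proof -
  let ?D = "frechet_derivative (%a. f (sig a)) (at oc)"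
  have l: "linear ?D"
   using smooth_on_has_derivative[OF smooth_fun_chart[OF f chart]] zero_U by (blast intro: has_derivative_linear)
  have "(\<Sum>k=1..n. a k * X k f 0) = (\<Sum>k=1..n. a k *\<^sub>R ?D (tangent (X k)))"
   by (intro sum.cong) (auto simp: tangent[OF X f])
  also have "... = ?D (\<Sum>k=1..n. a k *\<^sub>R tangent (X k))"
   by (simp add: linear_sum[OF l] linear_scale[OF l])
  finally show ?thesis using sum linear_0[OF l] by simp
 qed
 have "(\<Sum>k=1..n. a k * X k f x) = 0" for f x
 proof (cases "smooth_fun A f")
  case True
  have "X k f x = X k (left_transl (- x) f) 0" if "k : {1..n}" for k
   using lie_algebraD(3)[OF X[OF that] True True, of "- x"] by (simp add: left_transl_def)
  then have "(\<Sum>k=1..n. a k * X k f x) = (\<Sum>k=1..n. a k * X k (left_transl (- x) f) 0)"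
   by (intro sum.cong) auto
  then show ?thesis using at0[OF smooth_fun_left_transl[OF True]] by simp
 next
  case False
  then show ?thesis using X by (intro sum.neutral) (auto simp: lie_algebra_def)
 qed
 then show ?thesis using basis k unfolding lie_algebra_basis_def by blast
qed

end

section \<open>Lipschitz images and Lebesgue measure\<close>

lemma nn_integral_mono_emeasure:
 assumes sets: "sets M = sets N" and le: "!!E. E : sets M ==> emeasure M E <= emeasure N E"
 shows "integral\<^sup>N M f <= integral\<^sup>N N f"
proof -
 have space: "space M = space N" using sets by (rule sets_eq_imp_space_eq)
 have simple: "simple_function M g \<longleftrightarrow> simple_function N g" for g :: "'a => ennreal"
  by (simp add: simple_function_def sets space)
 have "integral\<^sup>S M g <= integral\<^sup>S N g" if g: "simple_function M g" for g :: "'a => ennreal"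
  unfolding simple_integral_def space
 proof (rule sum_mono)
  fix c assume "c : g ` space N"
  then have "g -` {c} Int space N : sets M" using g space by (auto simp: simple_function_def)
  then show "c * emeasure M (g -` {c} Int space N) <= c * emeasure N (g -` {c} Int space N)"
   by (intro mult_left_mono le) simp_all
 qed
 then show ?thesis
  unfolding nn_integral_def simple by (intro SUP_mono) (auto simp: simple)
qed

text \<open>
 A bounded set is covered, up to small measure, by cubes with disjoint interiors, and the image of
 each cube lies in a cube that is larger by a constant factor.
\<close>
lemma emeasure_lipschitz_image:
 fixes f :: "'a::euclidean_space => 'a"
 assumes S: "S : sets borel" "bounded S" and T: "T <= f ` S" and L: "L >= 0"
  and lip: "!!x y. x : S ==> y : S ==> norm (f x - f y) <= L * norm (x - y)"
 shows "emeasure lborel T <= ennreal ((2 * L * DIM('a)) ^ DIM('a)) * emeasure lborel S"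
proof -
 define c where "c = (2 * L * DIM('a)) ^ DIM('a)"
 have c0: "c >= 0" using L by (simp add: c_def)
 obtain r where r: "r > 0" "S <= cbox (- r *\<^sub>R One) (r *\<^sub>R One)"
 proof -
  obtain r where "r > 0" "!!x. x : S ==> norm x <= r" using S(2) bounded_pos by blast
  moreover from this have "S <= cbox (- r *\<^sub>R One) (r *\<^sub>R One)"
  proof (intro subsetI)
   fix x assume x: "x : S"
   have "\<bar>x \<bullet> i\<bar> <= r" if "i : Basis" for i
    using Basis_le_norm[OF that, of x] calculation(2)[OF x] by linarith
   then show "x : cbox (- r *\<^sub>R One) (r *\<^sub>R One)"
    by (simp add: mem_box abs_le_iff) (metis minus_le_iff)
  qed
  ultimately show ?thesis using that by blast
 qed
 have bound: "emeasure lborel T <= c * (emeasure lborel S + ennreal e)" if e: "e > 0" for e :: real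
 proof -
  obtain W where W: "open W" "S <= W" "emeasure lborel (W - S) < e"
   using outer_regular_lborel[OF S(1) e] by blast
  have ga: "gauge (%x. if x : S then W else UNIV)" using W by (auto simp: gauge_def)
  have ne: "box (- r *\<^sub>R One) (r *\<^sub>R One :: 'a) ~= {}" using r by (simp add: box_ne_empty)
  let ?g = "%x. if x : S then W else UNIV"
  let ?side = "%i. r *\<^sub>R One \<bullet> i - (- r *\<^sub>R One) \<bullet> i"
  have "EX \<D>. countable \<D> & (ALL K:\<D>. interior K ~= {} & (EX c d. K = cbox c d))
   & pairwise (%A B. interior A Int interior B = {}) \<D> & (ALL K:\<D>. EX x : S Int K. K <= ?g x)
   & (ALL u v. cbox u v : \<D> --> (EX n. ALL i : Basis. v \<bullet> i - u \<bullet> i = ?side i / 2^n)) & S <= \<Union>\<D>"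
  proof (rule covering_lemma[OF r(2) ne ga])
   fix \<D> assume "countable \<D>" "!!K. K : \<D> ==> interior K ~= {} & (EX c d. K = cbox c d)"
    "pairwise (%A B. interior A Int interior B = {}) \<D>"
    "!!K. K : \<D> ==> EX x : S Int K. K <= ?g x"
    "!!u v. cbox u v : \<D> ==> EX n. ALL i : Basis. v \<bullet> i - u \<bullet> i = ?side i / 2^n" "S <= \<Union>\<D>"
   then show ?thesis by (intro exI[of _ \<D>]) blast
  qed
  then obtain \<D> where D0: "countable \<D>"
   and D1: "ALL K:\<D>. interior K ~= {} & (EX c d. K = cbox c d)"
   and D2: "pairwise (%A B. interior A Int interior B = {}) \<D>"
   and D3: "ALL K:\<D>. EX x : S Int K. K <= ?g x"
   and D4: "ALL u v. cbox u v : \<D> --> (EX n. ALL i : Basis. v \<bullet> i - u \<bullet> i = ?side i / 2^n)"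
   and D5: "S <= \<Union>\<D>"
   by (elim exE conjE) (rule that)
  note \<D> = D0 bspec[OF D1] D2 bspec[OF D3] D4[rule_format] D5
  have KW: "K <= W" if "K : \<D>" for K using \<D>(4)[OF that] by auto
  have cover: "EX C. C : sets borel & f ` (S Int K) <= C & emeasure lborel C <= c * emeasure lborel (interior K)"
   if K: "K : \<D>" for K
  proof -
   obtain u v where uv: "K = cbox u v" using \<D>(2)[OF K] by blast
   obtain m where m: "!!i. i : Basis ==> v \<bullet> i - u \<bullet> i = 2 * r / 2^m"
    using \<D>(5)[of u v] K uv by auto
   define s where "s = 2 * r / 2 ^ m"
   have s: "s > 0" using r by (simp add: s_def)
   have le: "u \<bullet> i <= v \<bullet> i" if "i : Basis" for i using m[OF that] s by (simp add: s_def)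
   obtain x0 where x0: "x0 : S" "x0 : K" using \<D>(4)[OF K] by blast
   define C where "C = cbox (f x0 - (L * DIM('a) * s) *\<^sub>R One) (f x0 + (L * DIM('a) * s) *\<^sub>R One)"
   have "f ` (S Int K) <= C"
   proof clarify
    fix x assume x: "x : S" "x : K"
    have "norm (x - x0) <= (\<Sum>i\<in>Basis. \<bar>(x - x0) \<bullet> i\<bar>)" by (rule norm_le_l1)
    also have "... <= (\<Sum>i\<in>(Basis::'a set). s)"
    proof (rule sum_mono)
     fix i :: 'a assume i: "i : Basis"
     have "u \<bullet> i <= x \<bullet> i" "x \<bullet> i <= v \<bullet> i" "u \<bullet> i <= x0 \<bullet> i" "x0 \<bullet> i <= v \<bullet> i"
      using x x0 i by (auto simp: uv mem_box)
     then show "\<bar>(x - x0) \<bullet> i\<bar> <= s" using m[OF i] by (simp add: s_def inner_diff_left)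
    qed
    finally have d: "norm (x - x0) <= DIM('a) * s" by simp
    have "norm (f x - f x0) <= L * norm (x - x0)" using x x0 by (intro lip)
    also have "... <= L * (DIM('a) * s)" using d L by (rule mult_left_mono)
    finally have fd: "norm (f x - f x0) <= L * DIM('a) * s" by simp
    have "\<bar>(f x - f x0) \<bullet> i\<bar> <= L * DIM('a) * s" if "i : Basis" for i
     using Basis_le_norm[OF that, of "f x - f x0"] fd by linarith
    then show "f x : C"
     by (force simp: C_def mem_box inner_diff_left inner_add_left abs_le_iff)
   qed
   moreover have eC: "emeasure lborel C = ennreal (\<Prod>i\<in>(Basis::'a set). 2 * (L * DIM('a) * s))"
    unfolding C_def using L s
    by (subst emeasure_lborel_cbox) (auto simp: inner_diff_left inner_add_left mult_ac)
   moreover have pC: "(\<Prod>i\<in>(Basis::'a set). 2 * (L * DIM('a) * s)) = c * s ^ DIM('a)"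
    by (simp add: c_def power_mult_distrib)
   moreover have eK: "emeasure lborel (interior K) = ennreal (s ^ DIM('a))"
   proof -
    have "(\<Prod>b\<in>Basis. (v - u) \<bullet> b) = s ^ DIM('a)" by (simp add: inner_diff_left m s_def)
    then show ?thesis unfolding uv interior_cbox using emeasure_lborel_box[OF le] by simp
   qed
   ultimately have "C : sets borel & f ` (S Int K) <= C & emeasure lborel C <= c * emeasure lborel (interior K)"
    unfolding eC pC eK ennreal_mult'[OF c0] by (simp add: C_def)
   then show ?thesis by blast
  qed
  then obtain C where C: "!!K. K : \<D> ==> C K : sets borel" "!!K. K : \<D> ==> f ` (S Int K) <= C K"
   "!!K. K : \<D> ==> emeasure lborel (C K) <= c * emeasure lborel (interior K)"
   by metis
  define J where "J = to_nat_on \<D> ` \<D>"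
  define I where "I i = (if i : J then interior (from_nat_into \<D> i) else {})" for i
  define F where "F i = (if i : J then C (from_nat_into \<D> i) else {})" for i
  have fJ: "from_nat_into \<D> i : \<D>" if "i : J" for i
   using that \<D>(1) by (auto simp: J_def)
  have inj: "from_nat_into \<D> i ~= from_nat_into \<D> j" if "i : J" "j : J" "i ~= j" for i j
   using that \<D>(1) by (auto simp: J_def)
  have "T <= (\<Union>i. F i)"
  proof
   fix y assume "y : T"
   then obtain x where x: "y = f x" "x : S" using T by blast
   then obtain K where K: "K : \<D>" "x : K" using \<D>(6) by blast
   then have "y : F (to_nat_on \<D> K)" using C(2)[OF K(1)] x \<D>(1) by (auto simp: F_def J_def)
   then show "y : (\<Union>i. F i)" by blast
  qed
  then have "emeasure lborel T <= emeasure lborel (\<Union>i. F i)"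
   by (intro emeasure_mono) (auto simp: F_def C(1) fJ)
  also have "... <= (\<Sum>i. emeasure lborel (F i))"
   by (intro emeasure_subadditive_countably) (auto simp: F_def C(1) fJ)
  also have "... <= (\<Sum>i. c * emeasure lborel (I i))"
   by (intro suminf_le summableI) (auto simp: F_def I_def C(3) fJ)
  also have "... = c * (\<Sum>i. emeasure lborel (I i))" by (rule ennreal_suminf_cmult)
  also have "(\<Sum>i. emeasure lborel (I i)) = emeasure lborel (\<Union>i. I i)"
  proof (rule suminf_emeasure)
   show "disjoint_family I"
    using \<D>(3) fJ inj unfolding disjoint_family_on_def pairwise_def I_def by (auto split: if_splits)
  qed (auto simp: I_def)
  also have "... <= emeasure lborel W"
  proof (rule emeasure_mono)
   show "(\<Union>i. I i) <= W" using KW fJ interior_subset unfolding I_def by (fastforce split: if_splits)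
  qed (use W in auto)
  also have "... <= emeasure lborel S + emeasure lborel (W - S)"
   using emeasure_subadditive[of S lborel "W - S"] S W by (simp add: Un_absorb1)
  also have "... <= emeasure lborel S + ennreal e" using W(3) by (intro add_left_mono) simp
  finally show ?thesis by (simp add: mult_left_mono)
 qed
 show ?thesis
 proof (rule ennreal_le_epsilon)
  fix e :: real assume e: "e > 0"
  have "emeasure lborel T <= c * (emeasure lborel S + ennreal (e / (c + 1)))"
   using e c0 by (intro bound) simp
  also have "... = c * emeasure lborel S + ennreal (c * (e / (c + 1)))"
   using c0 e by (subst ennreal_mult) (simp_all add: distrib_left)
  also have "... <= c * emeasure lborel S + ennreal e"
  proof (intro add_left_mono ennreal_leI)
   show "c * (e / (c + 1)) <= e" using c0 e by (simp add: field_simps)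
  qed
  finally show "emeasure lborel T <= ennreal ((2 * L * DIM('a)) ^ DIM('a)) * emeasure lborel S + ennreal e"
   by (simp add: c_def)
 qed
qed

text \<open>
 A map whose strict derivative is bounded below is open with a linear modulus: the image of a
 small sphere stays away from the image of the centre, so the image of the ball, being open,
 cannot end inside the corresponding ball.
\<close>
lemma lower_lipschitz_image_ball:
 fixes f :: "'a::euclidean_space => 'a"
 assumes c: "c > 0" and d: "0 < d" "cball a d <= S" and cont: "continuous_on S f"
  and low: "!!x y. x : S ==> y : S ==> c * norm (x - y) <= norm (f x - f y)"
 shows "ball (f a) (c * d) <= f ` ball a d"
proof -
 let ?B = "ball (f a) (c * d)"
 have "inj_on f (cball a d)"
 proof (rule inj_onI)
  fix x y assume "x : cball a d" "y : cball a d" "f x = f y"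
  then have "c * norm (x - y) <= 0" using low[of x y] d(2) by (simp add: subset_iff)
  then show "x = y" using c by (simp add: mult_le_0_iff)
 qed
 then have "inj_on f (ball a d)" by (rule inj_on_subset) auto
 moreover have contc: "continuous_on (cball a d) f" using cont d(2) by (rule continuous_on_subset)
 ultimately have op: "open (f ` ball a d)"
  by (intro invariance_of_domain) (auto intro: continuous_on_subset)
 have cl: "closed (f ` cball a d)"
  by (intro compact_imp_closed compact_continuous_image contc compact_cball)
 have "?B Int f ` cball a d <= f ` ball a d"
 proof clarify
  fix x assume x: "f x : ?B" "x : cball a d"
  then have "c * norm (x - a) <= norm (f x - f a)" using d by (intro low) auto
  also have "... < c * d" using x by (simp add: dist_norm norm_minus_commute)
  finally have "x : ball a d" using c by (simp add: dist_norm norm_minus_commute)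
  then show "f x : f ` ball a d" by blast
 qed
 then have eq: "?B Int f ` cball a d = ?B Int f ` ball a d" by auto
 have "openin (top_of_set ?B) (?B Int f ` ball a d)" using op by (simp add: openin_open_Int)
 moreover have "closedin (top_of_set ?B) (?B Int f ` ball a d)"
  using cl unfolding eq[symmetric] by (simp add: closedin_closed_Int)
 moreover have "connected ?B" by simp
 ultimately have "?B Int f ` ball a d = {} \<or> ?B Int f ` ball a d = ?B"
  unfolding connected_clopen by blast
 moreover have "f a : ?B Int f ` ball a d" using c d by auto
 ultimately show ?thesis by blast
qed

section \<open>The boxes of exponentials\<close>

locale lie_basis = lie_chart A n U kap
 for A :: "('g::{topological_group_add, t2_space, second_countable_topology},
   'e::euclidean_space) chart set"
  and n :: nat and U :: "'g set" and kap :: "'g => 'e" +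
 fixes X :: "nat => 'g vfield"
 assumes basis: "lie_algebra_basis A n X"
begin

lemma n_eq: "n = DIM('e)"
 using lie chart by (auto simp: lie_group_def smooth_atlas_def split: if_splits)

definition coords :: "'e list" where
 "coords = (SOME bs. set bs = Basis & distinct bs)"

lemma coords: "set coords = Basis" "distinct coords" "length coords = n"
proof -
 have "EX bs. set bs = (Basis :: 'e set) & distinct bs"
  using finite_distinct_list[OF finite_Basis] .
 from someI_ex[OF this] show "set coords = Basis" "distinct coords"
  unfolding coords_def by blast+
 then show "length coords = n" using distinct_card n_eq by metis
qed

lemma X_in: "k : {1..n} ==> X k : lie_algebra A"
 using basis by (simp add: lie_algebra_basis_def)

text \<open>
 The coordinates of the second kind: the Euclidean space serves as the space of parameters, through
 an enumeration of its standard basis.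
\<close>
definition prefix_map :: "nat => 'e => 'g" where
 "prefix_map j s = sum_list (map (%k. flow (X k) (s \<bullet> coords ! (k - 1))) [1..<Suc j])"

abbreviation "P == prefix_map n"

lemma prefix_map_0: "prefix_map 0 s = 0"
 and prefix_map_Suc: "prefix_map (Suc j) s = prefix_map j s + flow (X (Suc j)) (s \<bullet> coords ! j)"
 by (simp_all add: prefix_map_def)

lemma prefix_map_at_0: "j <= n ==> prefix_map j 0 = 0"
 by (induction j) (auto simp: prefix_map_0 prefix_map_Suc flow[OF X_in])

lemma continuous_prefix_map: "j <= n ==> continuous_on UNIV (prefix_map j)"
proof (induction j)
 case 0
 then show ?case by (simp add: prefix_map_0[abs_def])
next
 case (Suc j)
 have "continuous_on UNIV (%s. flow (X (Suc j)) (s \<bullet> coords ! j))"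
  by (rule continuous_on_compose2[OF continuous_flow[OF X_in]])
   (use Suc.prems in \<open>auto intro!: continuous_intros\<close>)
 with Suc show ?case by (auto simp: prefix_map_Suc intro!: continuous_on_add)
qed

lemma continuous_P: "continuous_on UNIV P"
 by (rule continuous_prefix_map) simp

abbreviation "boxe eps == cbox (- eps *\<^sub>R One) (eps *\<^sub>R One :: 'e)"

lemma in_box: "s : boxe eps \<longleftrightarrow> (ALL b:Basis. \<bar>s \<bullet> b\<bar> <= eps)"
 by (auto simp: mem_box abs_le_iff)

lemma box_cball: "boxe eps <= cball 0 (real n * eps)"
proof
 fix s assume s: "s : boxe eps"
 have "norm s <= (\<Sum>b\<in>Basis. \<bar>s \<bullet> b\<bar>)" by (rule norm_le_l1)
 also have "... <= (\<Sum>b\<in>(Basis::'e set). eps)" using s unfolding in_box by (intro sum_mono) auto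
 finally show "s : cball 0 (real n * eps)" by (simp add: n_eq)
qed

lemma cball_box: "cball 0 eps <= boxe eps"
 unfolding in_box[abs_def] subset_iff using Basis_le_norm order_trans by fastforce

lemma box_mono: "eps <= dlt ==> boxe eps <= boxe dlt"
 unfolding subset_iff in_box by (meson order_trans)

lemma exp_box_eq: "exp_box A n X eps = P ` boxe eps"
proof (intro equalityI subsetI)
 fix x assume "x : P ` boxe eps"
 then obtain s where s: "x = P s" "s : boxe eps" by blast
 have "x = sum_list (map (%k. lie_exp A (vf_scale (s \<bullet> coords ! (k - 1)) (X k))) [1..<Suc n])"
  unfolding s(1) prefix_map_def
  by (intro arg_cong[where f = sum_list] map_cong) (auto simp: lie_exp_eq_flow[OF X_in])
 moreover have "- eps <= s \<bullet> coords ! (k - 1) & s \<bullet> coords ! (k - 1) <= eps" if "k : {1..n}" for k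
 proof -
  have "k - 1 < length coords" using that coords(3) by auto
  then have "coords ! (k - 1) : Basis" using nth_mem coords(1) by blast
  then have "\<bar>s \<bullet> coords ! (k - 1)\<bar> <= eps" using s(2) unfolding in_box by blast
  then show ?thesis by linarith
 qed
 ultimately show "x : exp_box A n X eps" by (auto simp: exp_box_def)
next
 fix x assume "x : exp_box A n X eps"
 then obtain t where t: "!!k. k : {1..n} ==> - eps <= t k & t k <= eps"
  "x = sum_list (map (%k. lie_exp A (vf_scale (t k) (X k))) [1..<Suc n])"
  unfolding exp_box_def by blast
 define s where "s = (\<Sum>j<n. t (Suc j) *\<^sub>R coords ! j)"
 have s: "s \<bullet> coords ! j = t (Suc j)" if j: "j < n" for j
 proof -
  have "s \<bullet> coords ! j = (\<Sum>i<n. t (Suc i) * (coords ! i \<bullet> coords ! j))"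
   by (simp add: s_def inner_sum_left)
  also have "... = (\<Sum>i<n. if i = j then t (Suc i) else 0)"
  proof (rule sum.cong)
   fix i assume "i : {..<n}"
   then have "coords ! i : Basis" "coords ! j : Basis" "coords ! i = coords ! j \<longleftrightarrow> i = j"
    using j coords(3) nth_mem[of i coords] nth_mem[of j coords] nth_eq_iff_index_eq[OF coords(2), of i j]
    unfolding coords(1) by simp_all
   then show "t (Suc i) * (coords ! i \<bullet> coords ! j) = (if i = j then t (Suc i) else 0)"
    by (simp add: inner_Basis)
  qed simp
  finally show ?thesis using j by simp
 qed
 have "s : boxe eps"
  unfolding in_box
 proof
  fix b :: 'e assume "b : Basis"
  then obtain j where "j < n" "b = coords ! j" using coords by (metis in_set_conv_nth)
  then show "\<bar>s \<bullet> b\<bar> <= eps" using s[of j] t(1)[of "Suc j"] by (simp add: abs_le_iff)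
 qed
 moreover have "x = P s"
  unfolding t(2) prefix_map_def
  by (intro arg_cong[where f = sum_list] map_cong) (auto simp: s lie_exp_eq_flow[OF X_in])
 ultimately show "x : P ` boxe eps" by blast
qed

subsection \<open>Strict derivatives of the group operations\<close>

lemma o_in: "oc : Om" using zero_U by simp

lemma strict_deriv_mult: "strict_deriv mult (%p. fst p + snd p) (oc, oc)"
proof -
 let ?D = "frechet_derivative mult (at (oc, oc))"
 have D: "(mult has_derivative ?D) (at (oc, oc))"
  by (rule smooth_on_has_derivative[OF smooth_mult in_mult_dom(1)[OF o_in]])
 have l: "linear ?D" by (rule has_derivative_linear[OF D])
 have "((%a. (a, oc)) has_derivative (%w. (w, 0))) (at oc)"
  by (auto intro!: derivative_eq_intros)
 from has_derivative_compose[OF this D]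
 have "((%a. a) has_derivative (%w. ?D (w, 0))) (at oc)"
  by (rule has_derivative_transform_within_open[OF _ chart_U(2) o_in]) (rule mult_unit(1))
 from has_derivative_unique[OF this has_derivative_ident] have 1: "?D (w, 0) = w" for w
  by (simp add: fun_eq_iff)
 have 2: "?D (0, w) = w" for w using field_at_unit[of w] by (simp add: field_def)
 have "?D p = fst p + snd p" for p
  using linear_add[OF l, of "(fst p, 0)" "(0, snd p)"] by (simp add: 1 2)
 then have "?D = (%p. fst p + snd p)" by auto
 moreover have "strict_deriv mult ?D (oc, oc)"
  using smooth_mult unfolding smooth_on_def
  by (intro C1_strict_deriv[OF open_mult_dom in_mult_dom(1)[OF o_in]]) blast
 ultimately show ?thesis by simp
qed

lemma strict_deriv_add:
 fixes f g :: "'b::real_normed_vector => 'g"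
 assumes f: "strict_deriv (%s. kap (f s)) D a" "isCont f a" "f a = 0"
  and g: "strict_deriv (%s. kap (g s)) E a" "isCont g a" "g a = 0"
 shows "strict_deriv (%s. kap (f s + g s)) (%h. D h + E h) a"
proof -
 have m: "strict_deriv (%s. mult (kap (f s), kap (g s))) (%h. D h + E h) a"
  using strict_deriv_compose[OF strict_deriv_Pair[OF f(1) g(1)], of mult "%p. fst p + snd p"]
   strict_deriv_mult f(3) g(3) by simp
 have "\<forall>\<^sub>F s in nhds a. f s : U & g s : U"
  using f(2,3) g(2,3) chart_U(1) zero_U
  by (intro eventually_conj) (auto simp: continuous_at_open eventually_nhds Ball_def)
 then obtain S where S: "open S" "a : S" "!!s. s : S ==> f s : U & g s : U"
  by (auto simp: eventually_nhds)
 show ?thesis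
  by (rule strict_deriv_cong[OF m S(1,2)]) (use S(3) in \<open>auto simp: mult_def chart_U\<close>)
qed

lemma strict_deriv_prefix_map:
 "j <= n ==> strict_deriv (%s. kap (prefix_map j s))
  (%s. \<Sum>i<j. (s \<bullet> coords ! i) *\<^sub>R tangent (X (Suc i))) 0"
proof (induction j)
 case 0
 have "bounded_linear (%_::'e. 0::'e)" by (rule bounded_linear_zero)
 then show ?case by (auto simp: prefix_map_0 strict_deriv_def intro!: exI[of _ 1])
next
 case (Suc j)
 have "bounded_linear (%s. s \<bullet> coords ! j)" by (rule bounded_linear_inner_left)
 then have lin: "strict_deriv (%s. s \<bullet> coords ! j) (%s. s \<bullet> coords ! j) 0" by (rule strict_deriv_linear)
 have "strict_deriv (%t. kap (flow (X (Suc j)) t)) (%h. h *\<^sub>R tangent (X (Suc j))) (0 \<bullet> coords ! j)"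
  using strict_deriv_flow[OF X_in, of "Suc j"] Suc.prems by simp
 from strict_deriv_compose[OF lin this]
 have fl: "strict_deriv (%s. kap (flow (X (Suc j)) (s \<bullet> coords ! j)))
   (%s. (s \<bullet> coords ! j) *\<^sub>R tangent (X (Suc j))) 0" .
 have "continuous_on UNIV (%s. flow (X (Suc j)) (s \<bullet> coords ! j))"
  by (rule continuous_on_compose2[OF continuous_flow[OF X_in]])
   (use Suc.prems in \<open>auto intro!: continuous_intros\<close>)
 then have "isCont (%s. flow (X (Suc j)) (s \<bullet> coords ! j)) 0"
  by (simp add: continuous_on_eq_continuous_at)
 moreover have "isCont (prefix_map j) 0"
  using continuous_prefix_map[of j] Suc.prems by (simp add: continuous_on_eq_continuous_at)
 ultimately have "strict_deriv (%s. kap (prefix_map j s + flow (X (Suc j)) (s \<bullet> coords ! j)))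
   (%s. (\<Sum>i<j. (s \<bullet> coords ! i) *\<^sub>R tangent (X (Suc i))) + (s \<bullet> coords ! j) *\<^sub>R tangent (X (Suc j))) 0"
  using Suc fl by (intro strict_deriv_add) (auto simp: prefix_map_at_0 flow[OF X_in])
 then show ?case by (simp add: prefix_map_Suc)
qed

text \<open>Coordinates of the second kind are bi-Lipschitz near the origin.\<close>
lemma P_bilipschitz:
 obtains c K rho where "c > 0" "K > 0" "rho > 0" "P ` cball 0 rho <= U"
  "!!s t. s : cball 0 rho ==> t : cball 0 rho ==> c * norm (s - t) <= norm (kap (P s) - kap (P t))"
  "!!s t. s : cball 0 rho ==> t : cball 0 rho ==> norm (kap (P s) - kap (P t)) <= K * norm (s - t)"
proof -
 let ?L = "%s. \<Sum>i<n. (s \<bullet> coords ! i) *\<^sub>R tangent (X (Suc i))"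
 have sd: "strict_deriv (%s. kap (P s)) ?L 0" by (rule strict_deriv_prefix_map) simp
 then have bl: "bounded_linear ?L" by (simp add: strict_deriv_def)
 have "inj ?L"
 proof (rule linear_injective_0[OF bounded_linear.linear[OF bl], THEN iffD2], intro allI impI)
  fix s assume s: "?L s = 0"
  have "(\<Sum>k=1..n. (s \<bullet> coords ! (k - 1)) *\<^sub>R tangent (X k)) = ?L s"
   by (rule sum.reindex_bij_witness[of _ Suc "%k. k - 1"]) auto
  then have z: "s \<bullet> coords ! (k - 1) = 0" if "k : {1..n}" for k
   using independent_tangents[OF basis _ that, of "%k. s \<bullet> coords ! (k - 1)"] s by simp
  show "s = 0"
  proof (rule euclidean_eqI)
   fix b :: 'e assume "b : Basis"
   then obtain j where "j < n" "b = coords ! j" using coords by (metis in_set_conv_nth)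
   then show "s \<bullet> b = 0 \<bullet> b" using z[of "Suc j"] by simp
  qed
 qed
 from linear_inj_bounded_below_pos[OF bounded_linear.linear[OF bl] this]
 obtain B where B: "B > 0" "!!x. B * norm x <= norm (?L x)" by blast
 then have "B / 2 > 0" by simp
 from strict_derivD[OF sd this] obtain d1 where d1: "d1 > 0"
  "!!s t. s : ball 0 d1 ==> t : ball 0 d1 ==>
   norm (kap (P s) - kap (P t) - ?L (s - t)) <= B / 2 * norm (s - t)" by blast
 obtain K d2 where K: "K > 0" "d2 > 0"
  "!!x y. x : ball 0 d2 ==> y : ball 0 d2 ==> norm (kap (P x) - kap (P y)) <= K * norm (x - y)"
  using strict_deriv_lipschitz[OF sd] by blast
 have "open (P -` U)" by (intro open_vimage chart_U(1) continuous_P)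
 moreover have "0 : P -` U" using zero_U by (simp add: prefix_map_at_0)
 ultimately obtain d3 where d3: "d3 > 0" "ball 0 d3 <= P -` U" by (meson open_contains_ball)
 define rho where "rho = min d1 (min d2 d3) / 2"
 have rho: "rho > 0" using d1 K d3 by (simp add: rho_def)
 then have sub: "cball 0 rho <= ball 0 d1" "cball 0 rho <= ball 0 d2" "cball (0::'e) rho <= ball 0 d3"
  unfolding rho_def by auto
 show ?thesis
 proof (rule that[of "B / 2" K rho])
  show "P ` cball 0 rho <= U" using d3 sub by blast
  fix s t assume st: "s : cball (0::'e) rho" "t : cball (0::'e) rho"
  show "norm (kap (P s) - kap (P t)) <= K * norm (s - t)" by (rule K(3)) (use st sub in blast)+
  have "norm (kap (P s) - kap (P t) - ?L (s - t)) <= B / 2 * norm (s - t)"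
   by (rule d1(2)) (use st sub in blast)+
  then show "B / 2 * norm (s - t) <= norm (kap (P s) - kap (P t))"
   using B(2)[of "s - t"] norm_triangle_ineq2[of "?L (s - t)" "kap (P s) - kap (P t)"]
   by (simp add: norm_minus_commute)
 qed (use B K rho in auto)
qed

lemma strict_deriv_inverse: "EX D. strict_deriv (%a. kap (- sig a)) D oc"
proof -
 have "smooth_on (%a. kap (- sig a)) {a : Om. - sig a : U}"
  using lie chart by (force simp: lie_group_def smooth_inversion_def)
 moreover have "continuous_on UNIV (%x::'g. - x)" by (intro continuous_intros)
 from chart_preimage_open[OF chart chart_U(1) this] have "open {a : Om. - sig a : U}" .
 moreover have "oc : {a : Om. - sig a : U}" using zero_U by (simp add: chart_U)
 ultimately have "strict_deriv (%a. kap (- sig a)) (frechet_derivative (%a. kap (- sig a)) (at oc)) oc"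
  unfolding smooth_on_def using C1_strict_deriv by blast
 then show ?thesis by blast
qed

lemma isCont_sig: "isCont sig oc"
 using chart_U(2,4) o_in continuous_on_eq_continuous_at by blast

text \<open>
 The words \<open>x - y + z\<close> in elements of a box lie in a box that is larger by a constant factor,
 because the word map is Lipschitz in the chart.
\<close>
lemma exp_box_words:
 obtains c eps0 where "c >= 1" "eps0 > 0"
  "!!eps x y z. 0 < eps ==> eps <= eps0 ==> x : P ` boxe eps ==> y : P ` boxe eps ==> z : P ` boxe eps ==>
   x - y + z : P ` boxe (c * eps)"
  "!!eps. 0 < eps ==> eps <= eps0 ==> 0 : interior (P ` boxe eps)"
proof -
 obtain b K rho where b: "b > 0" "K > 0" "rho > 0" "P ` cball 0 rho <= U"
  "!!s t. s : cball 0 rho ==> t : cball 0 rho ==> b * norm (s - t) <= norm (kap (P s) - kap (P t))"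
  "!!s t. s : cball 0 rho ==> t : cball 0 rho ==> norm (kap (P s) - kap (P t)) <= K * norm (s - t)"
  using P_bilipschitz by blast
 have P0: "P 0 = 0" by (rule prefix_map_at_0) simp
 have contP: "continuous_on (cball 0 rho) (%s. kap (P s))"
  by (rule continuous_on_compose2[OF chart_U(3) continuous_on_subset[OF continuous_P]]) (use b in auto)
 have big: "sig ` ball oc (b * dlt) <= P ` boxe dlt" if dlt: "0 < dlt" "dlt <= rho" for dlt
 proof
  fix x assume "x : sig ` ball oc (b * dlt)"
  then obtain a where a: "x = sig a" "a : ball oc (b * dlt)" by blast
  have "ball (kap (P 0)) (b * dlt) <= (%s. kap (P s)) ` ball 0 dlt"
   by (rule lower_lipschitz_image_ball[OF b(1) dlt(1) _ contP b(5)]) (use dlt in auto)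
  then obtain s where s: "a = kap (P s)" "s : ball 0 dlt" using a P0 by auto
  then have "P s : U" using b(4) dlt by (auto simp: image_subset_iff)
  then have "x = P s" using a s by (simp add: chart_U)
  moreover have "s : boxe dlt" using s(2) cball_box[of dlt] by auto
  ultimately show "x : P ` boxe dlt" by blast
 qed
 obtain rU where rU: "rU > 0" "ball oc rU <= Om" using chart_U(2) o_in open_contains_ball by blast
 define w where "w p = sig (fst p) + - sig (fst (snd p)) + sig (snd (snd p))" for p
 have w_strict: "EX D. strict_deriv (%p. kap (w p)) D (oc, oc, oc)"
 proof -
  have c1: "isCont (%p. sig (f p)) (oc, oc, oc)" if "isCont f (oc, oc, oc)" "f (oc, oc, oc) = oc"
   for f :: "'e \<times> 'e \<times> 'e => 'e"
   using isCont_o2[OF that(1), of sig] isCont_sig that(2) by simp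
  have sd: "strict_deriv (%p. kap (sig (f p))) f (oc, oc, oc)"
   if f: "bounded_linear f" "f (oc, oc, oc) = oc" for f :: "'e \<times> 'e \<times> 'e => 'e"
  proof (rule strict_deriv_cong[OF strict_deriv_linear[OF f(1)]])
   show "open (f -` Om)" using f by (intro open_vimage chart_U(2) linear_continuous_on)
   show "(oc, oc, oc) : f -` Om" using f o_in by simp
   show "f x = kap (sig (f x))" if "x : f -` Om" for x using that chart_U(7)[of "f x"] by simp
  qed
  have lin: "bounded_linear (%p::'e \<times> 'e \<times> 'e. fst p)" "bounded_linear (%p::'e \<times> 'e \<times> 'e. fst (snd p))"
   "bounded_linear (%p::'e \<times> 'e \<times> 'e. snd (snd p))"
   by (auto intro!: bounded_linear_fst bounded_linear_snd bounded_linear_fst_comp bounded_linear_snd_comp)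
  obtain D where D: "strict_deriv (%a. kap (- sig a)) D oc" using strict_deriv_inverse by blast
  have inv: "strict_deriv (%p. kap (- sig (fst (snd p)))) (%p. D (fst (snd p))) (oc, oc, oc)"
   using strict_deriv_compose[OF strict_deriv_linear[OF lin(2)], of "%a. kap (- sig a)" D "(oc, oc, oc)"] D
   by simp
  have sig0: "sig oc = 0" using zero_U by (simp add: chart_U)
  have cs: "isCont (%p. sig (fst p)) (oc, oc, oc)" "isCont (%p. sig (fst (snd p))) (oc, oc, oc)"
   "isCont (%p. sig (snd (snd p))) (oc, oc, oc)"
   by (rule c1; simp)+
  have ci: "isCont (%p. - sig (fst (snd p))) (oc, oc, oc)"
  proof -
   have "continuous_on UNIV (%x::'g. - x)" by (intro continuous_intros)
   then have "isCont (%x::'g. - x) (sig (fst (snd (oc, oc, oc))))"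
    using continuous_on_eq_continuous_at[OF open_UNIV] by blast
   from isCont_o2[OF cs(2) this] show ?thesis .
  qed
  have "strict_deriv (%p. kap (sig (fst p) + - sig (fst (snd p)))) (%p. fst p + D (fst (snd p))) (oc, oc, oc)"
   by (rule strict_deriv_add[OF sd[OF lin(1)] cs(1) _ inv ci]) (simp_all add: sig0)
  then have "strict_deriv (%p. kap (w p)) (%p. fst p + D (fst (snd p)) + snd (snd p)) (oc, oc, oc)"
   unfolding w_def
   by (rule strict_deriv_add[OF _ isCont_add[OF cs(1) ci] _ sd[OF lin(3)] cs(3)]) (simp_all add: sig0)
  then show ?thesis by blast
 qed
 then obtain M r where M: "M > 0" "r > 0"
  "!!x y. x : ball (oc, oc, oc) r ==> y : ball (oc, oc, oc) r ==> norm (kap (w x) - kap (w y)) <= M * norm (x - y)"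
  using strict_deriv_lipschitz by blast
 have "continuous_on UNIV (%p. fst p - fst (snd p) + snd (snd p) :: 'g)" by (intro continuous_intros)
 from open_vimage[OF chart_U(1) this] have "open ((%p. fst p - fst (snd p) + snd (snd p)) -` U)" .
 moreover have "(0, 0, 0) : (%p. fst p - fst (snd p) + snd (snd p)) -` U" using zero_U by simp
 ultimately obtain V1 V2' where V12: "open V1" "open V2'" "(0::'g, 0::'g, 0::'g) : V1 \<times> V2'"
  "V1 \<times> V2' <= (%p. fst p - fst (snd p) + snd (snd p)) -` U"
  by (rule open_prod_elim)
 then have V: "open V1" "open V2'" "0 : V1" "(0, 0) : V2'"
  "V1 \<times> V2' <= (%p. fst p - fst (snd p) + snd (snd p)) -` U" by auto
 obtain V2 V3 where V23: "open V2" "open V3" "(0, 0) : V2 \<times> V3" "V2 \<times> V3 <= V2'"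
  using V(2,4) by (rule open_prod_elim)
 then have V': "open V2" "open V3" "0 : V2" "0 : V3" "V2 \<times> V3 <= V2'" by auto
 have "open (P -` (V1 Int V2 Int V3))" using V V' by (intro open_vimage continuous_P open_Int)
 moreover have "0 : P -` (V1 Int V2 Int V3)" using V V' by (simp add: P0)
 ultimately obtain d where d: "d > 0" "ball 0 d <= P -` (V1 Int V2 Int V3)" by (meson open_contains_ball)
 define c where "c = max 1 (4 * M * K * n / b)"
 define Q where "Q = n + 1 + 3 * K * n"
 have "K * real n >= 0" using b(2) by simp
 then have Q: "Q > 0" "real n <= Q" "3 * K * n <= Q" unfolding Q_def by linarith+
 define eps0 where "eps0 = min (rho / c) (min rho (min d (min r (min (rU / (b + 1)) rU))) / (2 * Q))"
 have n0: "n > 0" using n_eq by simp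
 have c: "c >= 1" by (simp add: c_def)
 have eps0: "eps0 > 0" using b d M rU c Q by (simp add: eps0_def)
 show ?thesis
 proof (rule that[OF c eps0])
  fix eps assume eps: "0 < eps" "eps <= eps0"
  have "eps <= rho / c" "eps <= min rho (min d (min r (min (rU / (b + 1)) rU))) / (2 * Q)"
   using eps(2) by (simp_all add: eps0_def)
  then have e1: "c * eps <= rho" and "2 * Q * eps <= min rho (min d (min r (min (rU / (b + 1)) rU)))"
   using c Q by (simp_all add: field_simps)
  then have "2 * Q * eps <= rho" "2 * Q * eps <= d" "2 * Q * eps <= r" by simp_all
  moreover have "n * eps <= Q * eps" "3 * K * n * eps <= Q * eps" "Q * eps > 0"
   using Q eps by (auto intro: mult_right_mono)
  ultimately have e2: "n * eps <= rho" "n * eps < d" "3 * K * n * eps < r" by linarith+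
  have "eps <= c * eps" using c eps by simp
  then have erho: "eps <= rho" using e1 by linarith
  have "sig ` ball oc (b * min eps (rU / b)) <= P ` boxe (min eps (rU / b))"
   using eps b rU erho by (intro big) auto
  also have "... <= P ` boxe eps" by (intro image_mono box_mono) simp
  finally have "sig ` ball oc (b * min eps (rU / b)) <= P ` boxe eps" .
  moreover have "ball oc (b * min eps (rU / b)) <= ball oc rU"
  proof (rule subset_ball)
   have "b * min eps (rU / b) <= b * (rU / b)" using b by (intro mult_left_mono) auto
   then show "b * min eps (rU / b) <= rU" using b by simp
  qed
  then have "ball oc (b * min eps (rU / b)) <= Om" using rU by blast
  moreover have "b * min eps (rU / b) > 0" using b eps rU by simp
  ultimately show "0 : interior (P ` boxe eps)"
   by (meson interiorI open_chart_ball zero_in_chart_ball)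
  fix x y z assume "x : P ` boxe eps" "y : P ` boxe eps" "z : P ` boxe eps"
  then obtain s t q where stq: "x = P s" "y = P t" "z = P q" "s : boxe eps" "t : boxe eps" "q : boxe eps"
   by blast
  have nrm: "norm u <= n * eps" if "u : boxe eps" for u
   using subsetD[OF box_cball that] by simp
  have near: "P u : U" "P u : V1 Int V2 Int V3" "norm (kap (P u) - oc) <= K * n * eps" if u: "u : boxe eps" for u
  proof -
   have urho: "u : cball 0 rho" "u : ball 0 d" using nrm[OF u] e2 by auto
   then show "P u : U" "P u : V1 Int V2 Int V3" using b(4) d(2) by blast+
   have "norm (kap (P u) - kap (P 0)) <= K * norm (u - 0)" using urho b(3) by (intro b(6)) auto
   also have "... <= K * (n * eps)" using nrm[OF u] b by (intro mult_left_mono) auto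
   finally show "norm (kap (P u) - oc) <= K * n * eps" by (simp add: P0)
  qed
  define p where "p = (kap x, kap y, kap z)"
  have "norm (p - (oc, oc, oc)) <= norm (kap x - oc) + (norm (kap y - oc) + norm (kap z - oc))"
   unfolding p_def by (simp add: norm_Pair_le order_trans[OF norm_Pair_le])
  also have "... <= 3 * K * n * eps" using near(3)[OF stq(4)] near(3)[OF stq(5)] near(3)[OF stq(6)] stq by simp
  finally have pn: "norm (p - (oc, oc, oc)) <= 3 * K * n * eps" .
  have pr: "p : ball (oc, oc, oc) r" using pn e2(3) by (simp add: dist_norm norm_minus_commute)
  have wp: "w p = x - y + z" using near(1) stq by (simp add: w_def p_def chart_U)
  have w0: "w (oc, oc, oc) = 0" using zero_U by (simp add: w_def chart_U)
  have "norm (kap (w p) - kap (w (oc, oc, oc))) <= M * norm (p - (oc, oc, oc))"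
   using pr M by (intro M) auto
  also have "... <= M * (3 * K * n * eps)" using pn M by (intro mult_left_mono) auto
  also have "... < 4 * M * K * n / b * eps * b" using b M eps n0 by simp
  also have "... <= c * eps * b" using eps b by (intro mult_right_mono) (auto simp: c_def)
  finally have "kap (x - y + z) : ball oc (b * (c * eps))"
   by (simp add: wp w0 dist_norm norm_minus_commute mult.commute)
  moreover have "x - y + z : U"
  proof -
   have "(x, y, z) : V1 \<times> V2'" using near(2) stq V' by auto
   then show ?thesis using V(5) by auto
  qed
  then have "x - y + z = sig (kap (x - y + z))" by (simp add: chart_U)
  ultimately have "x - y + z : sig ` ball oc (b * (c * eps))" by (metis imageI)
  moreover have "sig ` ball oc (b * (c * eps)) <= P ` boxe (c * eps)"
   using e1 c eps by (intro big) auto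
  ultimately show "x - y + z : P ` boxe (c * eps)" by blast
 qed
qed

end

section \<open>Left Haar measures\<close>

locale haar_measure =
 fixes mu :: "'g::{topological_group_add, t2_space, second_countable_topology} measure"
 assumes haar: "left_haar_measure mu"
begin

lemma sets_mu [measurable_cong, simp]: "sets mu = sets borel"
 using haar by (simp add: left_haar_measure_def)

lemma space_mu [simp]: "space mu = UNIV"
 using sets_eq_imp_space_eq[OF sets_mu] by simp

lemma measurable_mu_iff: "measurable mu M = measurable borel M"
 by (rule measurable_cong_sets) simp_all

lemma continuous_measurable: "continuous_on UNIV f ==> f : Bmeas"
 by (rule borel_measurable_continuous_onI)

lemma measurable_left [measurable]: "(+) a : borel_measurable (borel :: 'g measure)"
 by (intro continuous_measurable continuous_intros)

lemma nn_integral_left: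
 assumes [measurable]: "f : Bmeas"
 shows "(\<integral>\<^sup>+x. f (a + x) \<partial>mu) = (\<integral>\<^sup>+x. f x \<partial>mu)"
proof -
 have "(\<integral>\<^sup>+x. f x \<partial>mu) = (\<integral>\<^sup>+x. f x \<partial>distr mu borel ((+) a))"
  using haar by (simp add: left_haar_measure_def)
 also have "... = (\<integral>\<^sup>+x. f (a + x) \<partial>mu)"
  by (rule nn_integral_distr) (simp_all add: measurable_mu_iff)
 finally show ?thesis by simp
qed

lemma left_image_eq: "(+) a ` E = (+) (- a) -` (E :: 'g set)"
proof (intro equalityI subsetI)
 fix x assume "x : (+) (- a) -` E"
 then show "x : (+) a ` E" by (intro image_eqI[of _ _ "- a + x"]) simp_all
qed auto

lemma left_image_sets [measurable]: "E : sets borel ==> (+) a ` E : sets (borel :: 'g measure)"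
 unfolding left_image_eq using measurable_sets[OF measurable_left, of E] by simp

lemma emeasure_left: "E : sets borel ==> emeasure mu ((+) a ` E) = emeasure mu E"
proof -
 assume E [measurable]: "E : sets borel"
 have "emeasure mu E = emeasure (distr mu borel ((+) (- a))) E"
  using haar by (simp add: left_haar_measure_def)
 also have "... = emeasure mu ((+) (- a) -` E)"
  by (subst emeasure_distr) (simp_all add: measurable_mu_iff)
 finally show ?thesis by (simp add: left_image_eq)
qed

lemma emeasure_compact_finite: "compact K ==> emeasure mu K < \<infinity>"
 using haar by (simp add: left_haar_measure_def)

lemma countable_translates:
 fixes V :: "'g set"
 assumes "open V" "V ~= {}"
 obtains D where "countable D" "(\<Union>x\<in>D. (+) x ` V) = UNIV"
proof -
 have op: "open ((+) x ` V)" for x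
  unfolding left_image_eq by (intro open_vimage assms continuous_intros)
 obtain F where F: "F <= range (%x. (+) x ` V)" "countable F" "\<Union>F = \<Union>(range (%x. (+) x ` V))"
  using Lindelof[of "range (%x. (+) x ` V)"] op by blast
 obtain D where D: "countable D" "F = (%x. (+) x ` V) ` D"
  using F(1,2) by (meson countable_subset_image)
 obtain v where v: "v : V" using assms by blast
 have "y : \<Union>(range (%x. (+) x ` V))" for y
  using v by (auto intro!: exI[of _ "y - v"] image_eqI[of _ _ v])
 then have "(\<Union>x\<in>D. (+) x ` V) = UNIV" using D F by auto
 with D(1) show ?thesis by (rule that)
qed

lemma emeasure_open_pos:
 assumes "open V" "V ~= {}"
 shows "emeasure mu V > 0"
proof (rule ccontr)
 assume "~ emeasure mu V > 0"
 then have V0: "emeasure mu V = 0" by simp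
 obtain D where D: "countable D" "(\<Union>x\<in>D. (+) x ` V) = UNIV"
  by (rule countable_translates[OF assms])
 have "(\<Union>x\<in>D. (+) x ` V) : null_sets mu"
  using assms(1) V0 D(1)
  by (intro null_sets_UN') (auto intro!: null_setsI simp: emeasure_left left_image_sets)
 then have "emeasure mu UNIV = 0" using D(2) by auto
 then show False using haar by (simp add: left_haar_measure_def)
qed

lemma sigma_finite_if:
 assumes "open V" "V ~= {}" "emeasure mu V < \<infinity>"
 shows "sigma_finite_measure mu"
proof
 obtain D where D: "countable D" "(\<Union>x\<in>D. (+) x ` V) = UNIV"
  by (rule countable_translates[OF assms(1,2)])
 show "EX A. countable A & A <= sets mu & \<Union>A = space mu & (ALL a:A. emeasure mu a ~= \<infinity>)"
 proof (intro exI[of _ "(%x. (+) x ` V) ` D"] conjI ballI)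
  show "(%x. (+) x ` V) ` D <= sets mu" using assms(1) by (auto intro: left_image_sets)
  fix a assume "a : (%x. (+) x ` V) ` D"
  then show "emeasure mu a ~= \<infinity>" using assms by (auto simp: emeasure_left)
 qed (use D in auto)
qed

lemma translate_tube:
 fixes K W :: "'g set"
 assumes "compact K" "open W" "K <= W"
 obtains V where "open V" "0 : V" "!!u. u : V ==> (+) u ` K <= W"
proof -
 have "EX A B. open A & 0 : A & open B & k : B & (ALL a:A. ALL b:B. a + b : W)" if k: "k : K" for k
 proof -
  have "continuous_on UNIV (%p::'g \<times> 'g. fst p + snd p)" by (intro continuous_intros)
  from open_vimage[OF assms(2) this] have "open ((%p. fst p + snd p) -` W)" .
  moreover have "(0, k) : (%p. fst p + snd p) -` W" using k assms by auto
  ultimately obtain A B where "open A" "open B" "(0, k) : A \<times> B" "A \<times> B <= (%p. fst p + snd p) -` W"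
   by (rule open_prod_elim)
  then show ?thesis by (intro exI[of _ A] exI[of _ B]) auto
 qed
 then obtain A B where AB: "!!k. k : K ==> open (A k) & 0 : A k & open (B k) & k : B k
   & (ALL a:A k. ALL b:B k. a + b : W)" by metis
 obtain C where C: "C <= K" "finite C" "K <= (\<Union>k\<in>C. B k)"
  by (rule compactE_image[OF assms(1), of K B]) (use AB in auto)
 show ?thesis
 proof (rule that[of "\<Inter>k\<in>C. A k"])
  show "open (\<Inter>k\<in>C. A k)" using C AB by (intro open_INT) auto
  show "0 : (\<Inter>k\<in>C. A k)" using C AB by auto
  fix u assume u: "u : (\<Inter>k\<in>C. A k)"
  show "(+) u ` K <= W"
  proof clarify
   fix x assume "x : K"
   then obtain k where "k : C" "x : B k" using C by blast
   then show "u + x : W" using u AB C by blast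
  qed
 qed
qed

end

text \<open>Iterated integrals over the parameters of successive right translations along curves.\<close>
primrec box_integral :: "real => (real => 'g) list => ('g => ennreal) => 'g::group_add => ennreal" where
 "box_integral eps [] J x = J x"
| "box_integral eps (g # gs) J x = (\<integral>\<^sup>+r. indicator {- eps..eps} r * box_integral eps gs J (x + g r) \<partial>lborel)"

lemma box_integral_PiM:
 fixes g :: "'i => real => 'g::{topological_group_add, t2_space, second_countable_topology}"
 assumes "distinct bs" and g: "!!b. b : set bs ==> continuous_on UNIV (g b)"
  and J [measurable]: "J : Bmeas"
 shows "box_integral eps (map g bs) J x = (\<integral>\<^sup>+s. (\<Prod>b\<in>set bs. indicator {- eps..eps} (s b))
   * J (x + sum_list (map (%b. g b (s b)) bs)) \<partial>PiM (set bs) (%_. lborel))"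
 using assms(1,2)
proof (induction bs arbitrary: x)
 case Nil
 show ?case by (simp add: PiM_empty nn_integral_count_space_finite)
next
 case (Cons b bs)
 interpret product_sigma_finite "%_::'i. lborel :: real measure" by standard
 have [measurable]: "g c : Bmeas" if "c : set (b # bs)" for c
  using Cons.prems(2)[OF that] by (rule borel_measurable_continuous_onI)
 have meas_sum: "(%s. sum_list (map (%b. g b (s b)) cs)) : borel_measurable (PiM (set ds) (%_. lborel))"
  if "set cs <= set ds" "set ds <= set (b # bs)" for cs ds
  using that
 proof (induction cs)
  case (Cons c cs)
  have "c : set (b # bs)" using Cons.prems by auto
  then have [measurable]: "g c : Bmeas" by simp
  have "(%s. s c) : measurable (PiM (set ds) (%_. lborel)) (lborel :: real measure)"
   using Cons.prems by (intro measurable_component_singleton) auto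
  then have [measurable]: "(%s. s c) : borel_measurable (PiM (set ds) (%_. lborel :: real measure))" by simp
  show ?case using Cons by (auto intro!: borel_measurable_add)
 qed simp
 have meas_prod: "(%s. \<Prod>b\<in>set ds. indicator {- eps..eps} (s b) :: ennreal) : borel_measurable (PiM (set ds) (%_. lborel))" for ds
 proof (rule borel_measurable_prod_ennreal)
  fix c assume "c : set ds"
  then have "(%s. s c) : measurable (PiM (set ds) (%_. lborel)) (lborel :: real measure)"
   by (intro measurable_component_singleton) auto
  then have [measurable]: "(%s. s c) : borel_measurable (PiM (set ds) (%_. lborel :: real measure))" by simp
  show "(%s. indicator {- eps..eps} (s c) :: ennreal) : borel_measurable (PiM (set ds) (%_. lborel))" by measurable
 qed
 have meas_J: "(%s. J (y + sum_list (map (%b. g b (s b)) cs))) : borel_measurable (PiM (set cs) (%_. lborel))"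
  if "set cs <= set (b # bs)" for cs y
  by (rule measurable_compose[OF _ J]) (intro borel_measurable_add measurable_const meas_sum[OF order_refl that]; simp)
 have "(\<integral>\<^sup>+s. (\<Prod>b\<in>set (b # bs). indicator {- eps..eps} (s b))
   * J (x + sum_list (map (%b. g b (s b)) (b # bs))) \<partial>PiM (set (b # bs)) (%_. lborel))
  = (\<integral>\<^sup>+y. (\<integral>\<^sup>+s. (\<Prod>c\<in>insert b (set bs). indicator {- eps..eps} ((s(b := y)) c))
   * J (x + sum_list (map (%c. g c ((s(b := y)) c)) (b # bs))) \<partial>PiM (set bs) (%_. lborel)) \<partial>lborel)"
  unfolding list.set
  using Cons.prems meas_prod[of "b # bs"] meas_J[of "b # bs"]
  by (subst product_nn_integral_insert_rev) auto
 also have "... = (\<integral>\<^sup>+y. (\<integral>\<^sup>+s. indicator {- eps..eps} y * ((\<Prod>c\<in>set bs. indicator {- eps..eps} (s c))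
   * J ((x + g b y) + sum_list (map (%c. g c (s c)) bs))) \<partial>PiM (set bs) (%_. lborel)) \<partial>lborel)"
 proof (intro nn_integral_cong)
  fix y s
  have "sum_list (map (%c. g c ((s(b := y)) c)) bs) = sum_list (map (%c. g c (s c)) bs)"
   using Cons.prems by (intro arg_cong[where f = sum_list] map_cong) auto
  moreover have "(\<Prod>c\<in>set bs. indicator {- eps..eps} ((s(b := y)) c) :: ennreal) = (\<Prod>c\<in>set bs. indicator {- eps..eps} (s c))"
   using Cons.prems by (intro prod.cong) auto
  ultimately show "(\<Prod>c\<in>insert b (set bs). indicator {- eps..eps} ((s(b := y)) c))
   * J (x + sum_list (map (%c. g c ((s(b := y)) c)) (b # bs)))
   = indicator {- eps..eps} y * ((\<Prod>c\<in>set bs. indicator {- eps..eps} (s c))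
   * J ((x + g b y) + sum_list (map (%c. g c (s c)) bs)))"
   using Cons.prems by (simp add: add.assoc mult.assoc fun_upd_same del: fun_upd_apply)
 qed
 also have "... = (\<integral>\<^sup>+y. indicator {- eps..eps} y * box_integral eps (map g bs) J (x + g b y) \<partial>lborel)"
 proof (intro nn_integral_cong)
  fix y
  have "(\<integral>\<^sup>+s. indicator {- eps..eps} y * ((\<Prod>c\<in>set bs. indicator {- eps..eps} (s c))
   * J ((x + g b y) + sum_list (map (%c. g c (s c)) bs))) \<partial>PiM (set bs) (%_. lborel))
   = indicator {- eps..eps} y * (\<integral>\<^sup>+s. (\<Prod>c\<in>set bs. indicator {- eps..eps} (s c))
   * J ((x + g b y) + sum_list (map (%c. g c (s c)) bs)) \<partial>PiM (set bs) (%_. lborel))"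
   by (intro nn_integral_cmult borel_measurable_times_ennreal meas_prod meas_J) auto
  then show "(\<integral>\<^sup>+s. indicator {- eps..eps} y * ((\<Prod>c\<in>set bs. indicator {- eps..eps} (s c))
   * J ((x + g b y) + sum_list (map (%c. g c (s c)) bs))) \<partial>PiM (set bs) (%_. lborel))
   = indicator {- eps..eps} y * box_integral eps (map g bs) J (x + g b y)"
   using Cons.IH Cons.prems by simp
 qed
 finally show ?case by simp
qed

context lie_basis
begin

lemma box_integral_eq:
 assumes J [measurable]: "J : Bmeas"
 shows "box_integral eps (map (%k. flow (X k)) [1..<Suc n]) J x
  = (\<integral>\<^sup>+s. indicator (boxe eps) s * J (x + P s) \<partial>lborel)"
proof -
 define ix where "ix b = (THE k. k : {1..n} & coords ! (k - 1) = b)" for b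
 have ix: "ix (coords ! i) = Suc i" if "i < n" for i
  unfolding ix_def
 proof (rule the_equality)
  fix k assume k: "k : {1..n} & coords ! (k - 1) = coords ! i"
  then have "k - 1 = i" using nth_eq_iff_index_eq[OF coords(2), of "k - 1" i] that coords(3) by auto
  then show "k = Suc i" using k by auto
 qed (use that in auto)
 have ixB: "ix b : {1..n}" if "b : Basis" for b
 proof -
  have "b : set coords" using that by (simp add: coords(1))
  then obtain i where "i < length coords" "coords ! i = b" unfolding in_set_conv_nth by blast
  then show ?thesis using ix[of i] coords(3) by auto
 qed
 define g where "g b = flow (X (ix b))" for b
 have maps: "map (%k. f (X k) (coords ! (k - 1))) [1..<Suc n] = map (%b. f (X (ix b)) b) coords"
  for f :: "'g vfield => 'e => 'c"
  by (rule nth_equalityI) (simp_all add: coords(3) ix del: upt_Suc)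
 have list: "map (%k. flow (X k)) [1..<Suc n] = map g coords"
  using maps[of "%Y b. flow Y"] by (simp add: g_def del: upt_Suc)
 have cont: "continuous_on UNIV (g b)" if "b : set coords" for b
  using that continuous_flow[OF X_in[OF ixB]] by (simp add: g_def coords(1))
 let ?\<iota> = "%f::'e => real. \<Sum>b\<in>Basis. f b *\<^sub>R b"
 have \<iota>: "?\<iota> f \<bullet> b = f b" if "b : Basis" for f b
  using that by (simp add: inner_sum_left inner_Basis if_distrib[of "%z. _ * z"] sum.delta cong: if_cong)
 have P_\<iota>: "P (?\<iota> f) = sum_list (map (%b. g b (f b)) coords)" for f
 proof -
  have "P (?\<iota> f) = sum_list (map (%b. flow (X (ix b)) (?\<iota> f \<bullet> b)) coords)"
   unfolding prefix_map_def using maps[of "%Y b. flow Y (?\<iota> f \<bullet> b)"] by simp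
  also have "... = sum_list (map (%b. g b (f b)) coords)"
   by (intro arg_cong[where f = sum_list] map_cong) (auto simp: coords(1) \<iota> g_def)
  finally show ?thesis .
 qed
 have ind: "indicator (boxe eps) (?\<iota> f) = (\<Prod>b\<in>Basis. indicator {- eps..eps} (f b) :: ennreal)" for f
 proof (cases "ALL b:Basis. f b : {- eps..eps}")
  case True
  then have "?\<iota> f : boxe eps" by (auto simp: mem_box \<iota>)
  then show ?thesis using True by (simp add: indicator_def)
 next
  case False
  then obtain b where b: "b : Basis" "f b ~: {- eps..eps}" by blast
  then have "?\<iota> f ~: boxe eps" by (auto simp: mem_box \<iota>)
  moreover have "(\<Prod>b\<in>Basis. indicator {- eps..eps} (f b) :: ennreal) = 0"
   using b by (intro prod_zero) (auto intro!: bexI[of _ b])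
  ultimately show ?thesis by simp
 qed
 have [measurable]: "P : Bmeas" by (intro borel_measurable_continuous_onI continuous_P)
 have "(\<integral>\<^sup>+s. indicator (boxe eps) s * J (x + P s) \<partial>lborel)
  = (\<integral>\<^sup>+s. indicator (boxe eps) s * J (x + P s) \<partial>distr (PiM Basis (%_. lborel)) borel ?\<iota>)"
  by (simp add: lborel_eq[symmetric])
 also have "... = (\<integral>\<^sup>+f. indicator (boxe eps) (?\<iota> f) * J (x + P (?\<iota> f)) \<partial>PiM Basis (%_. lborel))"
  by (intro nn_integral_distr) measurable
 also have "... = box_integral eps (map g coords) J x"
  unfolding P_\<iota> ind by (subst box_integral_PiM) (simp_all add: coords cont)
 finally show ?thesis unfolding list by (rule sym)
qed

end

section \<open>Haar measure in the chart\<close>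

locale lie_haar = lie_basis A n U kap X + haar_measure mu
 for A :: "('g::{topological_group_add, t2_space, second_countable_topology},
   'e::euclidean_space) chart set"
  and n :: nat and U :: "'g set" and kap :: "'g => 'e" and X :: "nat => 'g vfield" and mu :: "'g measure"
begin

definition sig0 :: "'e => 'g" where
 "sig0 a = (if a : Om then sig a else 0)"

lemma measurable_sig0 [measurable]: "sig0 : Bmeas"
 unfolding sig0_def[abs_def] using chart_U(2,4)
 by (intro borel_measurable_continuous_on_if) (auto intro: continuous_intros)

lemma chart_image_vimage: "kap ` (U Int E) = Om Int sig -` E"
proof (intro equalityI subsetI)
 fix a assume "a : kap ` (U Int E)"
 then obtain x where "a = kap x" "x : U" "x : E" by blast
 then show "a : Om Int sig -` E" by (simp add: chart_U(5))
next
 fix a assume "a : Om Int sig -` E"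
 then have "a = kap (sig a)" "sig a : U Int E" using chart_U(6,7)[of a] by simp_all
 then show "a : kap ` (U Int E)" by (rule image_eqI)
qed

lemma chart_image_eq: "E <= U ==> kap ` E = Om Int sig0 -` E"
 using chart_image_vimage[of E] by (auto simp: sig0_def Int_absorb1)

lemma chart_image_sets [measurable]: "E : sets borel ==> E <= U ==> kap ` E : sets borel"
proof -
 assume E: "E : sets borel" "E <= U"
 have "sig0 -` E : sets borel" by (rule measurable_sets_borel[OF measurable_sig0 E(1)])
 then show "kap ` E : sets borel"
  unfolding chart_image_eq[OF E(2)] by (rule sets.Int[OF borel_open[OF chart_U(2)]])
qed

lemma unit_neighbourhood_product:
 fixes S :: "'g set" and f :: "'g \<times> 'g => 'g"
 assumes "open S" "continuous_on UNIV f" "f (0, 0) : S"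
 obtains r where "r > 0" "ball oc r <= Om"
  "!!x y. x : sig ` ball oc r ==> y : sig ` ball oc r ==> f (x, y) : S"
proof -
 have "open (f -` S)" using assms(1,2) by (rule open_vimage)
 moreover have "(0, 0) : f -` S" using assms(3) by simp
 ultimately obtain V W where VW: "open V" "open W" "(0, 0) : V \<times> W" "V \<times> W <= f -` S"
  by (rule open_prod_elim)
 have "open (U Int (V Int W))" "0 : U Int (V Int W)" using VW chart_U(1) zero_U by auto
 then have "open (kap ` (U Int (V Int W)))"
 proof -
  have "kap ` (U Int (V Int W)) = Om Int sig -` (V Int W)"
   by (rule chart_image_vimage)
  then show ?thesis
   using continuous_open_preimage[OF chart_U(4,2) open_Int[OF VW(1,2)]] by (simp only:)
 qed
 moreover have "oc : kap ` (U Int (V Int W))" using VW zero_U by auto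
 ultimately obtain r where r: "r > 0" "ball oc r <= kap ` (U Int (V Int W))"
  by (meson open_contains_ball)
 have mem: "x : V Int W" if x: "x : sig ` ball oc r" for x
 proof -
  obtain a where "x = sig a" "a : kap ` (U Int (V Int W))" using x r by blast
  then show ?thesis unfolding chart_image_vimage by simp
 qed
 show ?thesis
 proof (rule that[OF r(1)])
  show "ball oc r <= Om" using r by blast
  fix x y assume "x : sig ` ball oc r" "y : sig ` ball oc r"
  then show "f (x, y) : S" using mem VW(4) by blast
 qed
qed

text \<open>Right translations by small elements are uniformly Lipschitz in the chart.\<close>
lemma right_translation_lipschitz:
 obtains r S where "r > 0" "ball oc r <= Om" "open S" "0 : S"
  "!!a x. a : ball oc r ==> x : S ==> sig a + x : U"
  "!!a b x. a : ball oc r ==> b : ball oc r ==> x : S ==>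
   norm (kap (sig a + x) - kap (sig b + x)) <= 2 * norm (a - b)"
proof -
 from strict_derivD[OF strict_deriv_mult zero_less_one]
 obtain d where d: "d > 0"
  "!!p q. p : ball (oc, oc) d ==> q : ball (oc, oc) d ==>
   norm (mult p - mult q - (fst (p - q) + snd (p - q))) <= 1 * norm (p - q)" by blast
 have "continuous_on UNIV (%p::'g \<times> 'g. fst p + snd p)" by (intro continuous_intros)
 then obtain r1 where r1: "r1 > 0" "ball oc r1 <= Om"
  "!!x y. x : sig ` ball oc r1 ==> y : sig ` ball oc r1 ==> fst (x, y) + snd (x, y) : U"
  using unit_neighbourhood_product[OF chart_U(1), of "%p. fst p + snd p"] zero_U by auto
 define r where "r = min r1 (d / 2)"
 have r: "r > 0" "ball oc r <= Om" "ball oc r <= ball oc r1" using r1 d by (auto simp: r_def)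
 show ?thesis
 proof (rule that[OF r(1,2), of "sig ` ball oc r"])
  show "open (sig ` ball oc r)" by (rule open_chart_ball[OF r(2)])
  show "0 : sig ` ball oc r" by (rule zero_in_chart_ball[OF r(1)])
  show U: "sig a + x : U" if "a : ball oc r" "x : sig ` ball oc r" for a x
  proof -
   have "sig a : sig ` ball oc r1" "x : sig ` ball oc r1" using that r(3) by blast+
   then show ?thesis using r1(3)[of "sig a" x] by simp
  qed
  fix a b x assume a: "a : ball oc r" and b: "b : ball oc r" and x: "x : sig ` ball oc r"
  obtain e where e: "x = sig e" "e : ball oc r" using x by blast
  then have "kap x = e" using r(2) chart_U(7) by blast
  then have kapx: "norm (kap x - oc) < d / 2" "x : U"
   using e r(2) chart_U(6)[of e] by (auto simp: r_def dist_norm norm_minus_commute)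
  have near: "(c, kap x) : ball (oc, oc) d" if "c : ball oc r" for c
  proof -
   have "norm ((oc, oc) - (c, kap x)) <= norm (oc - c) + norm (oc - kap x)"
    by (simp add: norm_Pair_le)
   also have "... < d" using that kapx by (simp add: r_def dist_norm norm_minus_commute)
   finally show ?thesis by (simp add: dist_norm)
  qed
  have "norm (mult (a, kap x) - mult (b, kap x) - (a - b)) <= norm (a - b)"
   using d(2)[OF near[OF a] near[OF b]] by (simp add: norm_Pair)
  then have "norm (mult (a, kap x) - mult (b, kap x)) <= 2 * norm (a - b)"
   using norm_triangle_sub[of "mult (a, kap x) - mult (b, kap x)" "a - b"] by simp
  then show "norm (kap (sig a + x) - kap (sig b + x)) <= 2 * norm (a - b)"
   using kapx by (simp add: mult_def chart_U)
 qed
qed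

lemma locally_finite_measure: "EX r>0. ball oc r <= Om & emeasure mu (sig ` ball oc r) < \<infinity>"
proof -
 obtain r where r: "r > 0" "cball oc r <= Om" using chart_U(2) o_in open_contains_cball by blast
 have "compact (sig ` cball oc r)"
  using r by (intro compact_continuous_image continuous_on_subset[OF chart_U(4)]) auto
 then have "emeasure mu (sig ` cball oc r) < \<infinity>" and "closed (sig ` cball oc r)"
  by (rule emeasure_compact_finite, rule compact_imp_closed)
 moreover have "emeasure mu (sig ` ball oc r) <= emeasure mu (sig ` cball oc r)"
  using calculation(2) by (intro emeasure_mono) auto
 moreover have "ball oc r <= Om" using r by auto
 ultimately show ?thesis using r by (intro exI[of _ r]) (auto intro: order.strict_trans1)
qed

lemma sigma_finite_mu: "sigma_finite_measure mu"
proof -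
 obtain r where r: "r > 0" "ball oc r <= Om" "emeasure mu (sig ` ball oc r) < \<infinity>"
  using locally_finite_measure by blast
 show ?thesis
  by (rule sigma_finite_if[OF open_chart_ball[OF r(2)] _ r(3)]) (use zero_in_chart_ball[OF r(1)] in blast)
qed

text \<open>
 Evaluate the measure of \<open>{(b, x). sig b + x : E}\<close>, with \<open>b\<close> in a ball, in both orders. For
 fixed \<open>b\<close> the section has the Haar measure of \<open>E\<close>; for fixed small \<open>x\<close> it is a right translate
 of \<open>E\<close>, whose Lebesgue measure is comparable to that of \<open>E\<close>.
\<close>
lemma haar_lebesgue_comparable:
 obtains R C where "R > 0" "C > 0" "ball oc R <= Om"
  "!!E. E : sets borel ==> E <= sig ` ball oc R ==> emeasure mu E <= ennreal C * emeasure lborel (kap ` E)"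
  "!!E. E : sets borel ==> E <= sig ` ball oc R ==> emeasure lborel (kap ` E) <= ennreal C * emeasure mu E"
proof -
 obtain r0 S where S: "r0 > 0" "ball oc r0 <= Om" "open S" "0 : S"
  "!!a x. a : ball oc r0 ==> x : S ==> sig a + x : U"
  "!!a b x. a : ball oc r0 ==> b : ball oc r0 ==> x : S ==>
   norm (kap (sig a + x) - kap (sig b + x)) <= 2 * norm (a - b)"
  using right_translation_lipschitz by blast
 obtain rf where rf: "rf > 0" "ball oc rf <= Om" "emeasure mu (sig ` ball oc rf) < \<infinity>"
  using locally_finite_measure by blast
 define O1 where "O1 = S Int sig ` ball oc rf"
 have O1: "open O1" "0 : O1" "O1 <= S"
  using S open_chart_ball[OF rf(2)] zero_in_chart_ball[OF rf(1)] by (auto simp: O1_def)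
 have O1fin: "emeasure mu O1 < \<infinity>"
 proof -
  have "emeasure mu O1 <= emeasure mu (sig ` ball oc rf)"
   using open_chart_ball[OF rf(2)] by (intro emeasure_mono) (auto simp: O1_def)
  then show ?thesis using rf(3) by (rule order.strict_trans1)
 qed
 have "continuous_on UNIV (%p::'g \<times> 'g. - fst p + snd p)" by (intro continuous_intros)
 then obtain r1 where r1: "r1 > 0" "ball oc r1 <= Om"
  "!!x y. x : sig ` ball oc r1 ==> y : sig ` ball oc r1 ==> - fst (x, y) + snd (x, y) : O1"
  using unit_neighbourhood_product[OF O1(1), of "%p. - fst p + snd p"] O1(2) by auto
 define R1 where "R1 = min r0 r1"
 let ?V = "%r. sig ` ball oc r"
 have R1: "R1 > 0" "ball oc R1 <= Om" "ball oc R1 <= ball oc r0" "ball oc R1 <= ball oc r1"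
  using S r1 by (auto simp: R1_def)
 have diff: "- x + y : O1" if "x : ?V R1" "y : ?V R1" for x y
 proof -
  have "x : ?V r1" "y : ?V r1" using that R1(4) by blast+
  then show ?thesis using r1(3)[of x y] by simp
 qed
 have "continuous_on UNIV (%p::'g \<times> 'g. fst p - snd p)" by (intro continuous_intros)
 then obtain r2 where r2: "r2 > 0" "ball oc r2 <= Om"
  "!!x y. x : ?V r2 ==> y : ?V r2 ==> fst (x, y) - snd (x, y) : ?V R1"
  using unit_neighbourhood_product[OF open_chart_ball[OF R1(2)], of "%p. fst p - snd p"]
   zero_in_chart_ball[OF R1(1)] by auto
 define R where "R = min R1 r2"
 have R: "R > 0" "ball oc R <= ball oc R1" "ball oc R <= ball oc r2" "ball oc R <= Om"
  using R1 r2 by (auto simp: R_def)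
 define V where "V = ?V R Int O1"
 have V: "open V" "0 : V" "V <= O1"
  using open_chart_ball[OF R(4)] zero_in_chart_ball[OF R(1)] O1 by (auto simp: V_def)
 have Vpos: "emeasure mu V > 0" using V by (intro emeasure_open_pos) auto
 have Vfin: "emeasure mu V < \<infinity>"
  using emeasure_mono[OF V(3), of mu] O1 O1fin by (auto intro: order.strict_trans1)
 define L where "L = emeasure lborel (ball oc R1)"
 have L: "L > 0" "L < \<infinity>"
  using R1(1) unfolding L_def by (simp_all add: emeasure_ball less_imp_le unit_ball_vol_pos)
 define c where "c = (2 * 2 * real DIM('e)) ^ DIM('e)"
 have c: "c > 0" by (simp add: c_def)
 define M where "M E x = {b : ball oc R1. sig0 b + x : E}" for E x
 have sig0: "sig0 b = sig b" if "b : ball oc R1" for b using that R1(2) by (auto simp: sig0_def)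
 define G where "G E b x = (indicator (ball oc R1) b * indicator E (sig0 b + x) :: ennreal)" for E b x
 have Gmeas: "(%p. G E (fst p) (snd p)) : borel_measurable (borel \<Otimes>\<^sub>M borel)"
  if [measurable]: "E : sets borel" for E
 proof -
  have [measurable]: "ball oc R1 : sets borel" by simp
  show ?thesis unfolding G_def by measurable
 qed
 have M_sets: "M E x : sets borel" if E [measurable]: "E : sets borel" for E x
 proof -
  have "ball oc R1 Int (%b. sig0 b + x) -` E : sets borel"
   by (intro sets.Int measurable_sets_borel[OF _ E]) simp_all
  moreover have "M E x = ball oc R1 Int (%b. sig0 b + x) -` E" by (auto simp: M_def)
  ultimately show ?thesis by simp
 qed
 have inner: "(\<integral>\<^sup>+b. G E b x \<partial>lborel) = emeasure lborel (M E x)" if [measurable]: "E : sets borel" for E x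
 proof -
  have "M E x : sets borel" by (rule M_sets[OF that])
  moreover have "G E b x = indicator (M E x) b" for b by (auto simp: G_def M_def indicator_def)
  ultimately show ?thesis by simp
 qed
 have two_orders: "L * emeasure mu E = (\<integral>\<^sup>+x. emeasure lborel (M E x) \<partial>mu)"
  and M_meas: "(%x. emeasure lborel (M E x)) : borel_measurable mu" if E: "E : sets borel" for E
 proof -
  interpret M: sigma_finite_measure mu by (rule sigma_finite_mu)
  interpret pair_sigma_finite "lborel :: 'e measure" mu by standard
  have "sets ((lborel :: 'e measure) \<Otimes>\<^sub>M mu) = sets (borel \<Otimes>\<^sub>M borel)" by (intro sets_pair_measure_cong) simp_all
  from measurable_cong_sets[OF this refl[of "sets (borel :: ennreal measure)"]] have G: "(%(b, x). G E b x) : borel_measurable (lborel \<Otimes>\<^sub>M mu)"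
   using Gmeas[OF E] by (simp only: case_prod_beta')
  have "(%x. \<integral>\<^sup>+b. G E b x \<partial>lborel) : borel_measurable mu"
   using lborel.borel_measurable_nn_integral[OF measurable_pair_swap[OF G]] by simp
  then show "(%x. emeasure lborel (M E x)) : borel_measurable mu" by (simp add: inner[OF E])
  have "(\<integral>\<^sup>+b. (\<integral>\<^sup>+x. G E b x \<partial>mu) \<partial>lborel) = (\<integral>\<^sup>+x. (\<integral>\<^sup>+b. G E b x \<partial>lborel) \<partial>mu)"
   using Fubini'[OF G] by simp
  moreover have "(\<integral>\<^sup>+x. G E b x \<partial>mu) = indicator (ball oc R1) b * emeasure mu E" for b
  proof -
   have [measurable]: "E : sets borel" by (rule E)
   have "(\<integral>\<^sup>+x. G E b x \<partial>mu) = (\<integral>\<^sup>+x. indicator (ball oc R1) b * indicator E x \<partial>mu)"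
    unfolding G_def by (rule nn_integral_left[of "%x. indicator (ball oc R1) b * indicator E x"]) measurable
   also have "... = indicator (ball oc R1) b * emeasure mu E"
    by (rule nn_integral_cmult_indicator) simp
   finally show ?thesis .
  qed
  ultimately have iter: "(\<integral>\<^sup>+b. indicator (ball oc R1) b * emeasure mu E \<partial>lborel)
    = (\<integral>\<^sup>+x. emeasure lborel (M E x) \<partial>mu)"
   by (simp add: inner[OF E])
  show "L * emeasure mu E = (\<integral>\<^sup>+x. emeasure lborel (M E x) \<partial>mu)"
  proof -
   have "(\<integral>\<^sup>+b. indicator (ball oc R1) b * emeasure mu E \<partial>lborel)
     = (\<integral>\<^sup>+b. emeasure mu E * indicator (ball oc R1) b \<partial>(lborel :: 'e measure))"
    by (simp only: mult.commute)
   also have "... = emeasure mu E * L" unfolding L_def by (rule nn_integral_cmult_indicator) simp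
   finally show ?thesis using iter by (simp add: mult.commute)
  qed
 qed
 have lower: "emeasure lborel (kap ` E) <= c * emeasure lborel (M E x)"
  if E: "E : sets borel" "E <= ?V R" and x: "x : V" for E x
  unfolding c_def
 proof (rule emeasure_lipschitz_image[where f = "%b. kap (sig b + x)"])
  show "M E x : sets borel" by (rule M_sets[OF E(1)])
  show "bounded (M E x)" by (rule bounded_subset[OF bounded_ball]) (auto simp: M_def)
  show "kap ` E <= (%b. kap (sig b + x)) ` M E x"
  proof clarify
   fix y assume y: "y : E"
   have "y - x : ?V R1"
   proof -
    have "y : ?V r2" "x : ?V r2" using y x E(2) R(3) unfolding V_def by blast+
    then show ?thesis using r2(3)[of y x] by simp
   qed
   then obtain b where b: "y - x = sig b" "b : ball oc R1" by blast
   have yb: "y = sig b + x" using b(1) by (metis diff_add_cancel)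
   then have "b : M E x" using b y sig0[OF b(2)] by (simp add: M_def)
   then show "kap y : (%b. kap (sig b + x)) ` M E x" using yb by blast
  qed
  fix a b assume "a : M E x" "b : M E x"
  then have "a : ball oc r0" "b : ball oc r0" using R1(3) unfolding M_def by blast+
  moreover have "x : S" using V(3) O1(3) x by blast
  ultimately show "norm (kap (sig a + x) - kap (sig b + x)) <= 2 * norm (a - b)" by (rule S(6))
 qed simp
 have upper: "emeasure lborel (M E x) <= c * emeasure lborel (kap ` E) * indicator O1 x"
  if E: "E : sets borel" "E <= ?V R" for E x
 proof (cases "M E x = {}")
  case False
  have sub: "E <= ?V R1" using E(2) R(2) by blast
  have subU: "E <= U" using E(2) chart_ball[OF R(4)] by blast
  obtain b where b: "b : ball oc R1" "sig b + x : E" using False sig0 unfolding M_def by auto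
  then have "sig b : ?V R1" "sig b + x : ?V R1" using sub by blast+
  from diff[OF this] diff[OF this(2,1)] have x: "x : O1" "- x : O1"
   by (simp_all add: minus_add)
  have "emeasure lborel (M E x) <= c * emeasure lborel (kap ` E)"
   unfolding c_def
  proof (rule emeasure_lipschitz_image[where f = "%a. kap (sig a + - x)"])
   show "kap ` E : sets borel" by (rule chart_image_sets[OF E(1) subU])
   have kE: "kap ` E <= ball oc R"
   proof clarify
    fix y assume "y : E"
    then obtain b where "y = sig b" "b : ball oc R" using E(2) by blast
    then show "kap y : ball oc R" using chart_U(7)[of b] R(4) by auto
   qed
   show "bounded (kap ` E)" by (rule bounded_subset[OF bounded_ball kE])
   show "M E x <= (%a. kap (sig a + - x)) ` kap ` E"
   proof
    fix a assume "a : M E x"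
    then have a: "a : ball oc R1" "sig a + x : E" using sig0 by (auto simp: M_def)
    have "sig (kap (sig a + x)) + - x = sig a" using a(2) subU by (simp add: chart_U(5) subset_iff add.assoc)
    moreover have "kap (sig a) = a" using a(1) R1(2) by (intro chart_U(7)) auto
    ultimately show "a : (%a. kap (sig a + - x)) ` kap ` E"
     using a(2) by (intro image_eqI[of _ _ "kap (sig a + x)"]) auto
   qed
   fix a b assume "a : kap ` E" "b : kap ` E"
   then have "a : ball oc r0" "b : ball oc r0" using kE R(2) R1(3) by blast+
   moreover have "- x : S" using O1(3) x(2) by blast
   ultimately show "norm (kap (sig a + - x) - kap (sig b + - x)) <= 2 * norm (a - b)" by (rule S(6))
  qed simp
  then show ?thesis using x by simp
 qed simp
 have main1: "L * emeasure mu E <= c * emeasure lborel (kap ` E) * emeasure mu O1"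
  if E: "E : sets borel" "E <= ?V R" for E
 proof -
  have "L * emeasure mu E <= (\<integral>\<^sup>+x. c * emeasure lborel (kap ` E) * indicator O1 x \<partial>mu)"
   unfolding two_orders[OF E(1)] by (intro nn_integral_mono upper E)
  also have "... = c * emeasure lborel (kap ` E) * emeasure mu O1"
   using O1(1) by (intro nn_integral_cmult_indicator) simp
  finally show ?thesis .
 qed
 have main2: "emeasure lborel (kap ` E) * emeasure mu V <= c * (L * emeasure mu E)"
  if E: "E : sets borel" "E <= ?V R" for E
 proof -
  have "emeasure lborel (kap ` E) * emeasure mu V = (\<integral>\<^sup>+x. emeasure lborel (kap ` E) * indicator V x \<partial>mu)"
   using V(1) by (intro nn_integral_cmult_indicator[symmetric]) simp
  also have "... <= (\<integral>\<^sup>+x. c * emeasure lborel (M E x) \<partial>mu)"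
   by (intro nn_integral_mono) (auto simp: indicator_def lower[OF E])
  also have "... = c * (\<integral>\<^sup>+x. emeasure lborel (M E x) \<partial>mu)"
   by (rule nn_integral_cmult[OF M_meas[OF E(1)]])
  also have "... = c * (L * emeasure mu E)" by (simp add: two_orders[OF E(1)])
  finally show ?thesis .
 qed
 define l m v where "l = enn2real L" "m = enn2real (emeasure mu O1)" "v = enn2real (emeasure mu V)"
 have eqs: "L = ennreal l" "emeasure mu O1 = ennreal m" "emeasure mu V = ennreal v"
  using L O1fin Vfin by (simp_all add: l_m_v_def)
 have pos: "l > 0" "v > 0" "m >= 0"
  using L Vpos Vfin by (simp_all add: l_m_v_def enn2real_positive_iff)
 define C where "C = max (c * m / l) (c * l / v) + 1"
 have "c * m / l >= 0" using c pos by simp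
 then have C: "C > 0" "c * m / l <= C" "c * l / v <= C" unfolding C_def by linarith+
 show ?thesis
 proof (rule that[OF R(1) C(1) R(4)])
  fix E assume E: "E : sets borel" "E <= ?V R"
  have "emeasure mu E = ennreal (1 / l) * (L * emeasure mu E)"
  proof -
   have "ennreal (1 / l) * ennreal l = 1" using pos by (simp add: ennreal_mult[symmetric])
   then show ?thesis by (simp add: eqs mult.assoc[symmetric])
  qed
  also have "... <= ennreal (1 / l) * (c * emeasure lborel (kap ` E) * emeasure mu O1)"
   by (intro mult_left_mono main1 E) simp
  also have "... = ennreal (c * m / l) * emeasure lborel (kap ` E)"
  proof -
   have "ennreal (c * m / l) = ennreal (1 / l) * (ennreal c * ennreal m)"
    using pos c by (simp add: ennreal_mult[symmetric])
   then show ?thesis by (simp add: eqs mult_ac)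
  qed
  also have "... <= ennreal C * emeasure lborel (kap ` E)" using C by (intro mult_right_mono ennreal_leI) auto
  finally show "emeasure mu E <= ennreal C * emeasure lborel (kap ` E)" .
  have "emeasure lborel (kap ` E) = ennreal (1 / v) * (emeasure lborel (kap ` E) * emeasure mu V)"
  proof -
   have "ennreal (1 / v) * ennreal v = 1" using pos by (simp add: ennreal_mult[symmetric])
   then show ?thesis unfolding eqs by (simp only: mult.left_commute[of "ennreal (1 / v)"] mult_1_right)
  qed
  also have "... <= ennreal (1 / v) * (c * (L * emeasure mu E))"
   by (intro mult_left_mono main2 E) simp
  also have "... = ennreal (c * l / v) * emeasure mu E"
  proof -
   have "ennreal (c * l / v) = ennreal (1 / v) * (ennreal c * ennreal l)"
    using pos c by (simp add: ennreal_mult[symmetric])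
   then show ?thesis by (simp add: eqs mult_ac)
  qed
  also have "... <= ennreal C * emeasure mu E" using C by (intro mult_right_mono ennreal_leI) auto
  finally show "emeasure lborel (kap ` E) <= ennreal C * emeasure mu E" .
 qed
qed

end

section \<open>A Sobolev inequality along one-parameter subgroups\<close>

text \<open>
 The fundamental theorem of calculus for an everywhere differentiable function, with the length of
 its derivative integrated in the extended sense. If that integral is finite, the derivative is
 absolutely integrable; otherwise there is nothing to prove.
\<close>
lemma norm_diff_le_nn_integral_deriv:
 fixes h :: "real => complex"
 assumes deriv: "!!t. t : {a..b} ==> (h has_vector_derivative h' t) (at t within {a..b})"
  and meas [measurable]: "h' : Bmeas" and ab: "a <= b"
 shows "enorm (h b - h a) <= (\<integral>\<^sup>+t. indicator {a..b} t * enorm (h' t) \<partial>lborel)"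
proof (cases "(\<integral>\<^sup>+t. indicator {a..b} t * enorm (h' t) \<partial>lborel) < \<infinity>")
 case True
 have ftc: "(h' has_integral h b - h a) {a..b}"
  by (rule fundamental_theorem_of_calculus[OF ab deriv])
 have ind: "indicator {a..b} t * enorm (h' t) = enorm (indicator {a..b} t *\<^sub>R h' t)" for t
  by (simp add: indicator_def)
 have int: "integrable lborel (%t. indicator {a..b} t *\<^sub>R h' t)"
  by (rule integrableI_bounded) (measurable, use True in \<open>simp only: ind\<close>)
 then have "set_integrable lborel {a..b} h'" by (simp add: set_integrable_def)
 from set_borel_integral_eq_integral(2)[OF this] ftc
 have "h b - h a = integral\<^sup>L lborel (%t. indicator {a..b} t *\<^sub>R h' t)"
  by (simp add: set_lebesgue_integral_def integral_unique)
 then have "enorm (h b - h a) <= (\<integral>\<^sup>+t. enorm (indicator {a..b} t *\<^sub>R h' t) \<partial>lborel)"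
  using integral_norm_bound_ennreal[OF int] by simp
 then show ?thesis by (simp only: ind)
next
 case False
 then have "(\<integral>\<^sup>+t. indicator {a..b} t * enorm (h' t) \<partial>lborel) = top"
  by (metis infinity_ennreal_def less_top)
 then show ?thesis by (simp only: top_greatest)
qed

definition right_curve_deriv ::
  "(real => 'g::group_add) => ('g => complex) => ('g => complex) => bool" where
 "right_curve_deriv g f f' \<longleftrightarrow> (ALL x. ((%t. f (x + g t)) has_vector_derivative f' x) (at 0))"

text \<open>
 A tower of derivatives of order at most \<open>m\<close>. The latest derivative is the head of the list, so
 that prolonging a tower is \<open>Cons\<close>.
\<close>
definition right_tower ::
  "(nat => real => 'g::{group_add, topological_space}) => nat => nat
   => (nat list => 'g => complex) => bool" where
 "right_tower gam n m D \<longleftrightarrow>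
  (ALL alp. set alp <= {1..n} --> length alp <= m --> D alp : Bmeas) &
  (ALL alp k. set alp <= {1..n} --> length alp < m --> k : {1..n} --> right_curve_deriv (gam k) (D alp) (D (k # alp)))"

locale curves =
 fixes gam :: "nat => real => 'g::{topological_group_add, t2_space, second_countable_topology}"
  and n :: nat
 assumes curve_add: "k : {1..n} ==> gam k (s + t) = gam k s + gam k t"
  and curve_cont: "k : {1..n} ==> continuous_on UNIV (gam k)"
begin

lemma curve_0: "k : {1..n} ==> gam k 0 = 0"
 using curve_add[of k 0 0] by (metis add.right_neutral add_left_cancel)

lemma curve_minus: "k : {1..n} ==> gam k (- t) = - gam k t"
 using curve_add[of k t "- t"] curve_0[of k] by (simp add: minus_unique)

lemma measurable_curve: "k : {1..n} ==> (%t. x + gam k t) : Bmeas"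
 by (intro borel_measurable_continuous_onI continuous_on_add continuous_on_const curve_cont)

lemma right_curve_deriv_along:
 assumes "k : {1..n}" "right_curve_deriv (gam k) f f'"
 shows "((%t. f (x + gam k t)) has_vector_derivative f' (x + gam k t)) (at t)"
proof -
 have "((%s. f ((x + gam k t) + gam k s)) has_vector_derivative f' (x + gam k t)) (at 0)"
  using assms(2) by (simp add: right_curve_deriv_def)
 then have 1: "((%s. f (x + gam k (t + s))) has_vector_derivative f' (x + gam k t)) (at (t - t))"
  by (simp add: curve_add[OF assms(1)] add.assoc)
 have "((%u. u - t) has_vector_derivative 1) (at t)"
  by (auto intro!: derivative_eq_intros)
 from vector_diff_chain_at[OF this 1] show ?thesis by (simp add: o_def)
qed

lemma increment_le:
 assumes k: "k : {1..n}" and d: "right_curve_deriv (gam k) f f'" and m: "f' : Bmeas"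
  and s: "s : {- eps..eps}" and t: "t : {- eps..eps}"
 shows "enorm (f (x + gam k t) - f (x + gam k s))
  <= (\<integral>\<^sup>+r. indicator {- eps..eps} r * enorm (f' (x + gam k r)) \<partial>lborel)"
proof -
 have meas: "(%r. f' (x + gam k r)) : Bmeas"
  using measurable_compose[OF measurable_curve[OF k] m] .
 have le: "enorm (f (x + gam k b) - f (x + gam k a))
  <= (\<integral>\<^sup>+r. indicator {- eps..eps} r * enorm (f' (x + gam k r)) \<partial>lborel)"
  if ab: "a <= b" "a : {- eps..eps}" "b : {- eps..eps}" for a b
 proof -
  have "enorm (f (x + gam k b) - f (x + gam k a))
   <= (\<integral>\<^sup>+r. indicator {a..b} r * enorm (f' (x + gam k r)) \<partial>lborel)"
   by (rule norm_diff_le_nn_integral_deriv[OF has_vector_derivative_at_within[OF right_curve_deriv_along[OF k d]] meas ab(1)])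
  also have "... <= (\<integral>\<^sup>+r. indicator {- eps..eps} r * enorm (f' (x + gam k r)) \<partial>lborel)"
   using ab by (intro nn_integral_mono) (auto simp: indicator_def)
  finally show ?thesis .
 qed
 show ?thesis
 proof (cases "s <= t")
  case True
  then show ?thesis using le s t by blast
 next
  case False
  then show ?thesis using le[of t s] s t by (simp add: norm_minus_commute)
 qed
qed

abbreviation "tail j == map gam [Suc j..<Suc n]"

lemma tail_step: "j < n ==> tail j = gam (Suc j) # tail (Suc j)"
 by (simp add: upt_conv_Cons del: upt_Suc)

lemma box_integral_measurable:
 assumes "set ks <= {1..n}" and J: "J : Bmeas"
 shows "box_integral eps (map gam ks) J : Bmeas"
 using assms(1)
proof (induction ks)
 case Nil
 then show ?case using J by (simp cong: measurable_cong)
next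
 case (Cons k ks)
 have [measurable]: "gam k : Bmeas"
  using Cons.prems by (intro borel_measurable_continuous_onI curve_cont) auto
 have [measurable]: "box_integral eps (map gam ks) J : Bmeas" using Cons by auto
 have "(%(x, r). indicator {- eps..eps} r * box_integral eps (map gam ks) J (x + gam k r))
   : borel_measurable (borel \<Otimes>\<^sub>M lborel)"
  by measurable
 from lborel.borel_measurable_nn_integral[OF this] show ?case by simp
qed

lemma box_integral_mono:
 "(!!x. J x <= J' x) ==> box_integral eps gs J x <= box_integral eps gs J' x"
 by (induction gs arbitrary: x) (auto intro!: nn_integral_mono mult_left_mono)

lemma tail_measurable: "J : Bmeas ==> box_integral eps (tail j) J : Bmeas"
 by (rule box_integral_measurable) auto

lemma box_integral_add:
 assumes "set ks <= {1..n}" "J : Bmeas" "K : Bmeas"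
 shows "box_integral eps (map gam ks) (%x. J x + K x) x
  = box_integral eps (map gam ks) J x + box_integral eps (map gam ks) K x"
 using assms(1)
proof (induction ks arbitrary: x)
 case (Cons k ks)
 have k: "k : {1..n}" using Cons.prems by simp
 have m: "(%r. indicator {- eps..eps} r * box_integral eps (map gam ks) L (x + gam k r)) : borel_measurable lborel"
  if "L : Bmeas" for L
  using measurable_compose[OF measurable_curve[OF k] box_integral_measurable[of ks L eps]] that Cons.prems
  by (auto intro!: borel_measurable_times_ennreal)
 show ?case
  using Cons by (simp add: distrib_left nn_integral_add[OF m[OF assms(2)] m[OF assms(3)]])
qed simp

lemma box_integral_const:
 assumes "eps >= 0"
 shows "box_integral eps gs (%_. c) x = ennreal ((2 * eps) ^ length gs) * c"
proof (induction gs arbitrary: x)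
 case (Cons g gs)
 have "box_integral eps (g # gs) (%_. c) x
  = (\<integral>\<^sup>+r. (ennreal ((2 * eps) ^ length gs) * c) * indicator {- eps..eps} r \<partial>lborel)"
  by (simp add: Cons mult.commute)
 also have "... = ennreal ((2 * eps) ^ length gs) * c * ennreal (2 * eps)"
  using assms by (subst nn_integral_cmult_indicator) auto
 finally show ?case using assms by (simp add: ennreal_mult mult_ac)
qed simp

text \<open>
 Integrating out one coordinate at a time, from the last to the first, costs one derivative per
 coordinate. Each new derivative acts at the far right of the word, so no derivative has to be
 moved past a group element and no adjoint action appears.
\<close>
lemma sobolev:
 assumes D: "right_tower gam n n D" and J: "J : Bmeas"
  and DJ: "!!alp x. set alp <= {1..n} ==> length alp <= n ==> enorm (D alp x) <= J x"
  and eps: "0 < eps" "eps <= 1 / 2" and j: "j <= n"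
  and alp: "set alp <= {1..n}" "length alp <= j"
 shows "enorm (D alp x) <= ennreal ((1 / eps) ^ (n - j)) * box_integral eps (tail j) J x"
 using j alp
proof (induction "n - j" arbitrary: j alp x)
 case 0
 then show ?case using DJ[of alp x] by simp
next
 case (Suc m)
 then have jn: "j < n" by simp
 have k: "Suc j : {1..n}" using jn by simp
 let ?g = "gam (Suc j)" and ?I = "%r. indicator {- eps..eps} r :: ennreal"
 define N where "N = ennreal ((1 / eps) ^ (n - Suc j))"
 define B where "B y = N * box_integral eps (tail (Suc j)) J y" for y
 have IH: "enorm (D \<beta> y) <= B y" if "set \<beta> <= {1..n}" "length \<beta> <= Suc j" for \<beta> y
  unfolding B_def N_def using Suc.hyps(2) jn that by (intro Suc.hyps(1)) auto
 have alpn: "length alp < n" using Suc.prems jn by simp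
 have d: "right_curve_deriv ?g (D alp) (D (Suc j # alp))" and m: "D (Suc j # alp) : Bmeas"
  and m0: "D alp : Bmeas"
  using D Suc.prems alpn k by (auto simp: right_tower_def)
 have mB: "(%r. B (x + ?g r)) : Bmeas"
  using measurable_compose[OF measurable_curve[OF k] tail_measurable[OF J]]
  unfolding B_def by (intro borel_measurable_times_ennreal) auto
 define Q where "Q = (\<integral>\<^sup>+r. ?I r * B (x + ?g r) \<partial>lborel)"
 have "enorm (D alp x) <= B (x + ?g t) + Q" if t: "t : {- eps..eps}" for t
 proof -
  have "norm (D alp x) <= norm (D alp (x + ?g t)) + norm (D alp (x + ?g t) - D alp (x + ?g 0))"
   using norm_triangle_ineq2[of "D alp x" "D alp (x + ?g t)"]
   by (simp add: curve_0[OF k] norm_minus_commute)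
  then have "enorm (D alp x)
    <= enorm (D alp (x + ?g t)) + enorm (D alp (x + ?g t) - D alp (x + ?g 0))"
   by (simp add: ennreal_plus[symmetric] del: ennreal_plus)
  also have "enorm (D alp (x + ?g t)) <= B (x + ?g t)"
   using Suc.prems by (intro IH) auto
  also have "enorm (D alp (x + ?g t) - D alp (x + ?g 0))
    <= (\<integral>\<^sup>+r. ?I r * enorm (D (Suc j # alp) (x + ?g r)) \<partial>lborel)"
   using eps t by (intro increment_le[OF k d m]) auto
  also have "... <= Q"
   unfolding Q_def using Suc.prems k by (intro nn_integral_mono mult_left_mono IH) auto
  finally show ?thesis by (simp add: add_mono)
 qed
 then have "(\<integral>\<^sup>+t. ?I t * enorm (D alp x) \<partial>lborel) <= (\<integral>\<^sup>+t. ?I t * B (x + ?g t) + ?I t * Q \<partial>lborel)"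
  by (intro nn_integral_mono) (auto simp: indicator_def)
 also have "... = Q + (\<integral>\<^sup>+t. ?I t * Q \<partial>lborel)"
  unfolding Q_def using mB by (subst nn_integral_add) auto
 also have "(\<integral>\<^sup>+t. ?I t * Q \<partial>lborel) = ennreal (2 * eps) * Q"
  using eps by (subst nn_integral_multc) auto
 finally have "ennreal (2 * eps) * enorm (D alp x) <= (1 + ennreal (2 * eps)) * Q"
  using eps by (subst (asm) nn_integral_multc) (auto simp: distrib_right)
 also have "1 + ennreal (2 * eps) <= 2"
  using eps by (simp add: ennreal_plus[symmetric] ennreal_1[symmetric] ennreal_leI del: ennreal_plus ennreal_1 flip: ennreal_numeral)
 finally have *: "ennreal (2 * eps) * enorm (D alp x) <= 2 * Q" by (simp add: mult_right_mono)
 have "enorm (D alp x) = ennreal (1 / (2 * eps)) * (ennreal (2 * eps) * enorm (D alp x))"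
  using eps by (simp add: mult.assoc[symmetric] ennreal_mult[symmetric])
 also have "... <= ennreal (1 / (2 * eps)) * (2 * Q)" using * by (rule mult_left_mono) simp
 also have "... = ennreal (1 / eps) * Q"
 proof -
  have "ennreal (1 / (2 * eps)) * 2 = ennreal (1 / (2 * eps) * 2)"
   using eps by (subst ennreal_mult) auto
  then show ?thesis using eps by (simp add: mult.assoc[symmetric])
 qed
 also have "Q = N * box_integral eps (tail j) J x"
 proof -
  have "Q = (\<integral>\<^sup>+r. N * (?I r * box_integral eps (tail (Suc j)) J (x + ?g r)) \<partial>lborel)"
   by (simp add: Q_def B_def mult_ac)
  also have "... = N * (\<integral>\<^sup>+r. ?I r * box_integral eps (tail (Suc j)) J (x + ?g r) \<partial>lborel)"
   using measurable_compose[OF measurable_curve[OF k] tail_measurable[OF J]]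
   by (intro nn_integral_cmult) auto
  finally show ?thesis by (simp only: tail_step[OF jn] box_integral.simps)
 qed
 also have "ennreal (1 / eps) * (N * box_integral eps (tail j) J x)
   = ennreal ((1 / eps) ^ (n - j)) * box_integral eps (tail j) J x"
 proof -
  have "n - j = Suc (n - Suc j)" using jn by simp
  then have "ennreal ((1 / eps) ^ (n - j)) = ennreal (1 / eps) * N"
   using eps by (simp add: N_def ennreal_mult[symmetric] del: ennreal_mult'')
  then show ?thesis by (simp add: mult.assoc)
 qed
 finally show ?case .
qed

lemma poincare_aux:
 assumes D: "right_tower gam n n D" and J: "J : Bmeas"
  and DJ: "!!alp x. set alp <= {1..n} ==> length alp <= n ==> enorm (D alp x) <= J x"
  and eps: "0 < eps" "eps <= 1 / 2" and j: "j <= n"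
 shows "box_integral eps (tail j) (%y. enorm (D [] y - D [] x)) x
  <= ennreal (real (n - j) * 2 ^ n * eps) * box_integral eps (tail j) J x"
 using j
proof (induction "n - j" arbitrary: j x)
 case 0
 then show ?case by simp
next
 case (Suc m)
 then have jn: "j < n" by simp
 have k: "Suc j : {1..n}" using jn by simp
 let ?g = "gam (Suc j)" and ?I = "%r. indicator {- eps..eps} r :: ennreal"
 let ?T = "tail (Suc j)"
 have m0: "D [] : Bmeas" using D by (simp add: right_tower_def)
 have m1: "D [Suc j] : Bmeas" and d: "right_curve_deriv ?g (D []) (D [Suc j])"
  using D jn by (auto simp: right_tower_def)
 have mdiff: "(%y. enorm (D [] y - c)) : Bmeas" for c
  using m0 by measurable
 define Q where "Q = box_integral eps (tail j) J x"
 have Q: "Q = (\<integral>\<^sup>+r. ?I r * box_integral eps ?T J (x + ?g r) \<partial>lborel)"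
  unfolding Q_def by (simp only: tail_step[OF jn] box_integral.simps)
 have mT: "(%r. box_integral eps ?T J (x + ?g r)) : Bmeas"
  using measurable_compose[OF measurable_curve[OF k] tail_measurable[OF J]] .
 have inc: "enorm (D [] (x + ?g r) - D [] x) <= ennreal ((1 / eps) ^ (n - Suc j)) * Q"
  if r: "r : {- eps..eps}" for r
 proof -
  have "enorm (D [] (x + ?g r) - D [] (x + ?g 0))
   <= (\<integral>\<^sup>+r. ?I r * enorm (D [Suc j] (x + ?g r)) \<partial>lborel)"
   using eps r by (intro increment_le[OF k d m1]) auto
  also have "... <= (\<integral>\<^sup>+r. ?I r * (ennreal ((1 / eps) ^ (n - Suc j)) * box_integral eps ?T J (x + ?g r)) \<partial>lborel)"
   using jn by (intro nn_integral_mono mult_left_mono sobolev[OF D J DJ eps]) auto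
  also have "... = (\<integral>\<^sup>+r. ennreal ((1 / eps) ^ (n - Suc j)) * (?I r * box_integral eps ?T J (x + ?g r)) \<partial>lborel)"
   by (simp add: mult_ac)
  also have "... = ennreal ((1 / eps) ^ (n - Suc j)) * Q"
   unfolding Q using mT by (intro nn_integral_cmult) auto
  finally show ?thesis by (simp add: curve_0[OF k])
 qed
 have len: "length ?T = n - Suc j" by (simp del: upt_Suc)
 define c where "c = ennreal (real (n - Suc j) * 2 ^ n * eps)"
 define e where "e = ennreal ((2 * eps) ^ (n - Suc j)) * (ennreal ((1 / eps) ^ (n - Suc j)) * Q)"
 have step: "box_integral eps ?T (%y. enorm (D [] y - D [] x)) (x + ?g r)
   <= c * box_integral eps ?T J (x + ?g r) + e" if r: "r : {- eps..eps}" for r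
 proof -
  let ?c = "enorm (D [] (x + ?g r) - D [] x)"
  have "box_integral eps ?T (%y. enorm (D [] y - D [] x)) (x + ?g r)
   <= box_integral eps ?T (%y. enorm (D [] y - D [] (x + ?g r)) + ?c) (x + ?g r)"
  proof (rule box_integral_mono)
   fix y
   have "norm (D [] y - D [] x) <= norm (D [] y - D [] (x + ?g r)) + norm (D [] (x + ?g r) - D [] x)"
    using norm_triangle_ineq[of "D [] y - D [] (x + ?g r)" "D [] (x + ?g r) - D [] x"] by simp
   then show "enorm (D [] y - D [] x) <= enorm (D [] y - D [] (x + ?g r)) + ?c"
    by (simp add: ennreal_plus[symmetric] del: ennreal_plus)
  qed
  also have "... = box_integral eps ?T (%y. enorm (D [] y - D [] (x + ?g r))) (x + ?g r)
    + ennreal ((2 * eps) ^ (n - Suc j)) * ?c"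
   using eps by (subst box_integral_add[OF _ mdiff]) (auto simp: box_integral_const len simp del: upt_Suc)
  also have "... <= c * box_integral eps ?T J (x + ?g r) + e"
   unfolding c_def e_def using Suc.hyps(2) jn inc[OF r]
   by (intro add_mono Suc.hyps(1) mult_left_mono) auto
  finally show ?thesis .
 qed
 have "box_integral eps (tail j) (%y. enorm (D [] y - D [] x)) x
   <= (\<integral>\<^sup>+r. c * (?I r * box_integral eps ?T J (x + ?g r)) + ?I r * e \<partial>lborel)"
  unfolding tail_step[OF jn] box_integral.simps
 proof (rule nn_integral_mono)
  fix r
  show "?I r * box_integral eps ?T (%y. enorm (D [] y - D [] x)) (x + ?g r)
   <= c * (?I r * box_integral eps ?T J (x + ?g r)) + ?I r * e"
   using step[of r] by (cases "r : {- eps..eps}") auto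
 qed
 also have "... = c * Q + ennreal (2 * eps) * e"
  unfolding Q using mT eps by (subst nn_integral_add) (auto simp: nn_integral_cmult nn_integral_multc)
 also have "ennreal (2 * eps) * e <= ennreal (2 ^ n * eps) * Q"
 proof -
  have "2 * eps * ((2 * eps) ^ (n - Suc j) * (1 / eps) ^ (n - Suc j)) = 2 ^ Suc (n - Suc j) * eps"
   using eps by (simp add: power_mult_distrib power_one_over field_simps)
  moreover have "ennreal (2 * eps) * e = ennreal (2 * eps * ((2 * eps) ^ (n - Suc j) * (1 / eps) ^ (n - Suc j))) * Q"
   using eps by (simp add: e_def ennreal_mult mult.assoc)
  moreover have "(2::real) ^ Suc (n - Suc j) <= 2 ^ n" using jn by (intro power_increasing) auto
  ultimately show ?thesis using eps by (auto intro!: mult_right_mono ennreal_leI)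
 qed
 also have "c * Q + ennreal (2 ^ n * eps) * Q = ennreal (real (n - j) * 2 ^ n * eps) * Q"
 proof -
  have "real (n - j) = real (n - Suc j) + 1" using jn by simp
  then have "real (n - j) * 2 ^ n * eps = real (n - Suc j) * 2 ^ n * eps + 2 ^ n * eps" by (simp add: algebra_simps)
  then show ?thesis using eps by (simp add: c_def ennreal_plus distrib_right)
 qed
 finally show ?case by (simp add: Q_def add_left_mono)
qed

end

section \<open>The geometric properties of the boxes\<close>

definition exp_words :: "(nat => real => 'g::monoid_add) => nat => real => 'g set" where
 "exp_words gam n eps = {sum_list (map (%k. gam k (t k)) [1..<Suc n]) | t. ALL k:{1..n}. - eps <= t k & t k <= eps}"

text \<open>
 All that is used of the Lie group from here on. The constants in the two-sided comparison of Haar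
 measure with the parameter integrals do not depend on \<open>eps\<close>, nor does the factor by which words
 in a box leave it.
\<close>
locale sampling_group = curves gam n + haar_measure mu
 for gam :: "nat => real => 'g::{topological_group_add, t2_space, second_countable_topology}"
  and n :: nat and mu :: "'g measure" +
 assumes box_compact: "compact (exp_words gam n eps)"
  and box_small: "open V ==> 0 : V ==> EX dlt>0. ALL eps. 0 < eps --> eps <= dlt --> exp_words gam n eps <= V"
  and box_words: "EX c>=1. EX dlt>0. ALL eps. 0 < eps --> eps <= dlt --> 0 : interior (exp_words gam n eps) &
   (ALL x:exp_words gam n eps. ALL y:exp_words gam n eps. ALL z:exp_words gam n eps. x - y + z : exp_words gam n (c * eps))"
  and box_measure: "EX C>0. EX dlt>0. ALL eps. 0 < eps --> eps <= dlt --> (ALL J:Bmeas.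
   box_integral eps (map gam [1..<Suc n]) J 0 <= ennreal C * (\<integral>\<^sup>+x. indicator (exp_words gam n eps) x * J x \<partial>mu) &
   (\<integral>\<^sup>+x. indicator (exp_words gam n eps) x * J x \<partial>mu) <= ennreal C * box_integral eps (map gam [1..<Suc n]) J 0)"
  and overlap: "E : sets borel ==> emeasure mu E > 0 ==> EX K d V. K <= E & K : sets borel &
   (d::real) > 0 & open V & 0 : V & (ALL u:V. ennreal d <= emeasure mu (K Int (+) u ` K))"
  and sigma_finite: "sigma_finite_measure mu"

context lie_haar
begin

lemma box_emeasure_comparable:
 obtains C dlt where "C > 0" "dlt > 0"
  "!!eps E. 0 < eps ==> eps <= dlt ==> E : sets borel ==>
   emeasure lborel (boxe eps Int P -` E) <= ennreal C * emeasure mu (P ` boxe eps Int E)"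
  "!!eps E. 0 < eps ==> eps <= dlt ==> E : sets borel ==>
   emeasure mu (P ` boxe eps Int E) <= ennreal C * emeasure lborel (boxe eps Int P -` E)"
proof -
 obtain b K rho where b: "b > 0" "K > 0" "rho > 0" "P ` cball 0 rho <= U"
  "!!s t. s : cball 0 rho ==> t : cball 0 rho ==> b * norm (s - t) <= norm (kap (P s) - kap (P t))"
  "!!s t. s : cball 0 rho ==> t : cball 0 rho ==> norm (kap (P s) - kap (P t)) <= K * norm (s - t)"
  using P_bilipschitz by blast
 obtain R C where R: "R > 0" "C > 0" "ball oc R <= Om"
  "!!E. E : sets borel ==> E <= sig ` ball oc R ==> emeasure mu E <= ennreal C * emeasure lborel (kap ` E)"
  "!!E. E : sets borel ==> E <= sig ` ball oc R ==> emeasure lborel (kap ` E) <= ennreal C * emeasure mu E"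
  using haar_lebesgue_comparable by blast
 have "open (P -` (sig ` ball oc R))" by (intro open_vimage open_chart_ball R continuous_P)
 moreover have "0 : P -` (sig ` ball oc R)" using zero_in_chart_ball[OF R(1)] by (simp add: prefix_map_at_0)
 ultimately obtain d where d: "d > 0" "ball 0 d <= P -` (sig ` ball oc R)" by (meson open_contains_ball)
 define dlt where "dlt = min rho (d / 2) / (n + 1)"
 have dlt: "dlt > 0" using b d by (simp add: dlt_def)
 define c1 where "c1 = (2 * K * real DIM('e)) ^ DIM('e)"
 define c2 where "c2 = (2 * (1 / b) * real DIM('e)) ^ DIM('e)"
 have c: "c1 > 0" "c2 > 0" using b by (simp_all add: c1_def c2_def)
 define M where "M = C * c1 + C * c2"
 have M: "M > 0" "C * c1 <= M" "C * c2 <= M" using c R by (simp_all add: M_def add_pos_pos)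
 have key: "emeasure lborel (boxe eps Int P -` E) <= ennreal M * emeasure mu (P ` boxe eps Int E)
  & emeasure mu (P ` boxe eps Int E) <= ennreal M * emeasure lborel (boxe eps Int P -` E)"
  if eps: "0 < eps" "eps <= dlt" and E: "E : sets borel" for eps E
 proof -
  have "(n + 1) * eps <= min rho (d / 2)" using eps by (simp add: dlt_def field_simps)
  then have "real n * eps <= rho" "real n * eps < d" using eps d by (auto simp: algebra_simps)
  then have sub: "boxe eps <= cball 0 rho" "boxe eps <= ball 0 d"
   using box_cball[of eps] by (auto simp: subset_iff simp del: mem_box)
  define S where "S = boxe eps Int P -` E"
  have S: "S <= cball 0 rho" "S <= ball 0 d" using sub by (auto simp: S_def)
  have PS: "P ` boxe eps Int E = P ` S" by (auto simp: S_def)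
  have "P -` E : sets borel"
   using measurable_sets_borel[OF borel_measurable_continuous_onI[OF continuous_P] E] .
  then have Sb: "S : sets borel" unfolding S_def by (intro sets.Int) simp_all
  have "compact (P ` boxe eps)"
   by (intro compact_continuous_image continuous_on_subset[OF continuous_P] compact_cbox) simp
  then have Eb: "P ` S : sets borel"
   unfolding PS[symmetric] by (rule sets.Int[OF borel_closed[OF compact_imp_closed] E])
  have PSV: "P ` S <= sig ` ball oc R" using S(2) d(2) by blast
  have PSU: "P ` S <= U" using S(1) b(4) by blast
  have bS: "bounded S" by (rule bounded_subset[OF bounded_cball S(1)])
  have 1: "emeasure lborel (kap ` P ` S) <= ennreal c1 * emeasure lborel S"
   unfolding c1_def
  proof (rule emeasure_lipschitz_image[OF Sb bS, where f = "%s. kap (P s)"])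
   show "kap ` P ` S <= (%s. kap (P s)) ` S" by auto
   show "norm (kap (P s) - kap (P t)) <= K * norm (s - t)" if "s : S" "t : S" for s t
    using that S(1) by (intro b(6)) blast+
  qed (use b in simp)
  have inj: "inj_on (%s. kap (P s)) S"
  proof (rule inj_onI)
   fix s t assume st: "s : S" "t : S" "kap (P s) = kap (P t)"
   have "s : cball 0 rho" "t : cball 0 rho" using st(1,2) S(1) by blast+
   then have "b * norm (s - t) <= 0" using b(5)[of s t] st(3) by simp
   then show "s = t" using b by (simp add: mult_le_0_iff)
  qed
  have 2: "emeasure lborel S <= ennreal c2 * emeasure lborel (kap ` P ` S)"
   unfolding c2_def
  proof (rule emeasure_lipschitz_image[where f = "inv_into S (%s. kap (P s))"])
   show "kap ` P ` S : sets borel" by (rule chart_image_sets[OF Eb PSU])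
   have "kap ` P ` S <= ball oc R"
   proof clarify
    fix s assume "s : S"
    then obtain a where "P s = sig a" "a : ball oc R" using PSV by blast
    then show "kap (P s) : ball oc R" using chart_U(7)[of a] R(3) by auto
   qed
   then show "bounded (kap ` P ` S)" by (rule bounded_subset[OF bounded_ball])
   show "S <= inv_into S (%s. kap (P s)) ` kap ` P ` S"
   proof
    fix s assume "s : S"
    then show "s : inv_into S (%s. kap (P s)) ` kap ` P ` S"
     using inv_into_f_f[OF inj, of s] by (auto simp: image_image intro!: image_eqI[of _ _ s])
   qed
   fix x y assume "x : kap ` P ` S" "y : kap ` P ` S"
   then obtain s t where st: "s : S" "t : S" "x = kap (P s)" "y = kap (P t)" by blast
   have "b * norm (s - t) <= norm (x - y)" unfolding st using st(1,2) S(1) by (intro b(5)) blast+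
   then show "norm (inv_into S (%s. kap (P s)) x - inv_into S (%s. kap (P s)) y) <= 1 / b * norm (x - y)"
    using inv_into_f_f[OF inj st(1)] inv_into_f_f[OF inj st(2)] b by (simp add: st field_simps)
  qed (use b in simp)
  have "emeasure lborel S <= ennreal c2 * (ennreal C * emeasure mu (P ` S))"
   using 2 R(5)[OF Eb PSV] by (meson mult_left_mono order_trans zero_le)
  also have "... = ennreal (C * c2) * emeasure mu (P ` S)"
   using c R by (subst mult.commute[of C c2]) (simp add: ennreal_mult mult.assoc)
  also have "... <= ennreal M * emeasure mu (P ` S)" using M by (intro mult_right_mono ennreal_leI) auto
  finally have A: "emeasure lborel S <= ennreal M * emeasure mu (P ` S)" .
  have "emeasure mu (P ` S) <= ennreal C * (ennreal c1 * emeasure lborel S)"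
   using 1 R(4)[OF Eb PSV] by (meson mult_left_mono order_trans zero_le)
  also have "... = ennreal (C * c1) * emeasure lborel S"
   using c R by (simp add: ennreal_mult mult.assoc)
  also have "... <= ennreal M * emeasure lborel S" using M by (intro mult_right_mono ennreal_leI) auto
  finally show ?thesis using A unfolding PS S_def by blast
 qed
 show ?thesis by (rule that[OF M(1) dlt]) (use key in blast)+
qed

lemma box_nn_integral_comparable:
 obtains C dlt where "C > 0" "dlt > 0"
  "!!eps J. 0 < eps ==> eps <= dlt ==> J : Bmeas ==>
   (\<integral>\<^sup>+s. indicator (boxe eps) s * J (P s) \<partial>lborel) <= ennreal C * (\<integral>\<^sup>+x. indicator (P ` boxe eps) x * J x \<partial>mu) &
   (\<integral>\<^sup>+x. indicator (P ` boxe eps) x * J x \<partial>mu) <= ennreal C * (\<integral>\<^sup>+s. indicator (boxe eps) s * J (P s) \<partial>lborel)"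
proof -
 obtain C dlt where C: "C > 0" "dlt > 0"
  "!!eps E. 0 < eps ==> eps <= dlt ==> E : sets borel ==>
   emeasure lborel (boxe eps Int P -` E) <= ennreal C * emeasure mu (P ` boxe eps Int E)"
  "!!eps E. 0 < eps ==> eps <= dlt ==> E : sets borel ==>
   emeasure mu (P ` boxe eps Int E) <= ennreal C * emeasure lborel (boxe eps Int P -` E)"
  using box_emeasure_comparable by blast
 have [measurable]: "P : Bmeas" by (intro borel_measurable_continuous_onI continuous_P)
 show ?thesis
 proof (rule that[OF C(1,2)])
  fix eps and J :: "'g => ennreal" assume eps: "0 < eps" "eps <= dlt" and J [measurable]: "J : Bmeas"
  have "compact (P ` boxe eps)"
   by (intro compact_continuous_image continuous_on_subset[OF continuous_P] compact_cbox) simp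
  then have Qb: "P ` boxe eps : sets borel" by (intro borel_closed compact_imp_closed)
  define Bx Q where "Bx = boxe eps" and "Q = P ` Bx"
  have [measurable]: "Q : sets borel" "Bx : sets borel"
   using Qb by (simp_all add: Q_def Bx_def)
  define M1 where "M1 = distr (density lborel (indicator Bx)) borel P"
  define N1 where "N1 = density mu (indicator Q)"
  have sets: "sets M1 = sets borel" "sets N1 = sets borel" by (simp_all add: M1_def N1_def)
  have i1: "(\<integral>\<^sup>+x. J x \<partial>M1) = (\<integral>\<^sup>+s. indicator Bx s * J (P s) \<partial>lborel)"
   unfolding M1_def by (subst nn_integral_distr) (simp_all add: nn_integral_density)
  have i2: "(\<integral>\<^sup>+x. J x \<partial>N1) = (\<integral>\<^sup>+x. indicator Q x * J x \<partial>mu)"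
   unfolding N1_def by (subst nn_integral_density) (simp_all add: measurable_mu_iff)
  have e1: "emeasure M1 E = emeasure lborel (Bx Int P -` E)" if [measurable]: "E : sets borel" for E
  proof -
   have "emeasure M1 E = (\<integral>\<^sup>+x. indicator E x \<partial>M1)" using that by (simp add: sets)
   also have "... = (\<integral>\<^sup>+s. indicator Bx s * indicator E (P s) \<partial>lborel)"
    unfolding M1_def by (subst nn_integral_distr) (simp_all add: nn_integral_density)
   also have "... = (\<integral>\<^sup>+s. indicator (Bx Int P -` E) s \<partial>lborel)"
    by (intro nn_integral_cong) (auto simp: indicator_def)
   also have "... = emeasure lborel (Bx Int P -` E)"
    using measurable_sets_borel[of P borel E] by (intro nn_integral_indicator) simp
   finally show ?thesis .
  qed
  have e2: "emeasure N1 E = emeasure mu (Q Int E)" if [measurable]: "E : sets borel" for E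
  proof -
   have "emeasure N1 E = (\<integral>\<^sup>+x. indicator Q x * indicator E x \<partial>mu)"
    unfolding N1_def by (subst emeasure_density) (simp_all add: measurable_mu_iff)
   also have "... = (\<integral>\<^sup>+x. indicator (Q Int E) x \<partial>mu)"
    by (intro nn_integral_cong) (auto simp: indicator_def)
   finally show ?thesis by simp
  qed
  have "(\<integral>\<^sup>+x. J x \<partial>M1) <= (\<integral>\<^sup>+x. J x \<partial>density N1 (%_. ennreal C))"
   by (rule nn_integral_mono_emeasure)
    (simp_all add: sets e1 e2 C(3)[OF eps, folded Bx_def, folded Q_def] emeasure_density_const)
  also have "... = ennreal C * (\<integral>\<^sup>+x. J x \<partial>N1)"
   by (simp add: nn_integral_density nn_integral_cmult sets cong: measurable_cong_sets)
  finally have A: "(\<integral>\<^sup>+x. J x \<partial>M1) <= ennreal C * (\<integral>\<^sup>+x. J x \<partial>N1)" .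
  have "(\<integral>\<^sup>+x. J x \<partial>N1) <= (\<integral>\<^sup>+x. J x \<partial>density M1 (%_. ennreal C))"
   by (rule nn_integral_mono_emeasure)
    (simp_all add: sets e1 e2 C(4)[OF eps, folded Bx_def, folded Q_def] emeasure_density_const)
  also have "... = ennreal C * (\<integral>\<^sup>+x. J x \<partial>M1)"
   by (simp add: nn_integral_density nn_integral_cmult sets cong: measurable_cong_sets)
  finally show "(\<integral>\<^sup>+s. indicator (boxe eps) s * J (P s) \<partial>lborel) <= ennreal C * (\<integral>\<^sup>+x. indicator (P ` boxe eps) x * J x \<partial>mu) &
   (\<integral>\<^sup>+x. indicator (P ` boxe eps) x * J x \<partial>mu) <= ennreal C * (\<integral>\<^sup>+s. indicator (boxe eps) s * J (P s) \<partial>lborel)"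
   using A by (simp only: i1 i2 Bx_def Q_def)
 qed
qed

text \<open>
 Steinhaus: a compact subset \<open>K\<close> of positive measure has a neighbourhood of only slightly larger
 measure, which contains \<open>K\<close> translated by every small element; two subsets of nearly full
 measure must overlap.
\<close>
lemma haar_overlap_in_chart:
 assumes E: "E : sets borel" "emeasure mu E > 0" "E <= sig ` ball oc R" and R: "ball oc R <= Om" "C > 0"
  and cmp: "!!E. E : sets borel ==> E <= sig ` ball oc R ==> emeasure mu E <= ennreal C * emeasure lborel (kap ` E)"
   "!!E. E : sets borel ==> E <= sig ` ball oc R ==> emeasure lborel (kap ` E) <= ennreal C * emeasure mu E"
 obtains K d V where "K <= E" "K : sets borel" "(d::real) > 0" "open V" "0 : V"
  "!!u. u : V ==> ennreal d <= emeasure mu (K Int (+) u ` K)"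
proof -
 have EU: "E <= U" using E(3) chart_ball[OF R(1)] by blast
 have there: "sig ` kap ` F = F" if "F <= U" for F using that by (force simp: chart_U image_image subset_iff)
 have forth: "kap ` sig ` F = F" if "F <= ball oc R" for F
  using that R(1) chart_U(7) by (force simp: image_image subset_iff)
 have kb: "kap ` E : sets borel" by (rule chart_image_sets[OF E(1) EU])
 have kE: "kap ` E <= ball oc R"
  using E(3) forth[of "ball oc R"] by blast
 have pos: "emeasure lborel (kap ` E) > 0"
  using cmp(1)[OF E(1,3)] E(2) by (cases "emeasure lborel (kap ` E) = 0") (auto simp: zero_less_iff_neq_zero)
 have fin: "emeasure lborel F < \<infinity>" if "F <= ball oc R" for F
  using emeasure_mono[OF that, of lborel] emeasure_lborel_ball_finite[of "oc" R] by (auto intro: order.strict_trans1)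
 define L where "L = enn2real (emeasure lborel (kap ` E))"
 have L: "emeasure lborel (kap ` E) = ennreal L" "L > 0"
  using pos fin[OF kE] by (simp_all add: L_def enn2real_positive_iff)
 have "kap ` E : sets lebesgue" using kb by auto
 from sets_lebesgue_inner_closed[OF this, of "L / 2"] L(2)
 obtain T where T: "closed T" "T <= kap ` E" "kap ` E - T : lmeasurable" "emeasure lebesgue (kap ` E - T) < ennreal (L / 2)"
  by auto
 have cT: "compact T"
  using T(1) bounded_subset[OF bounded_ball order_trans[OF T(2) kE]] by (simp add: compact_eq_bounded_closed)
 have "emeasure lborel (kap ` E - T) < ennreal (L / 2)" using T(4) kb T(1) by simp
 then have lt: "emeasure lborel (kap ` E - T) < ennreal (L / 2)" .
 have split: "emeasure lborel (kap ` E) = emeasure lborel T + emeasure lborel (kap ` E - T)"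
  using T(1,2) kb by (subst plus_emeasure) (auto simp: Un_absorb1)
 have "emeasure lborel T ~= 0"
 proof
  assume "emeasure lborel T = 0"
  then have "ennreal L = emeasure lborel (kap ` E - T)" using split L(1) by simp
  then have "ennreal L < ennreal (L / 2)" using lt by (simp only:)
  then show False using L(2) by (simp add: ennreal_less_iff)
 qed
 then have Tpos: "emeasure lborel T > 0" by (simp add: zero_less_iff_neq_zero)
 define K where "K = sig ` T"
 have TR: "T <= ball oc R" using T(2) kE by blast
 have KE: "K <= E" unfolding K_def using T(2) there[OF EU] by blast
 have cK: "compact K" unfolding K_def
  using TR R(1) by (intro compact_continuous_image continuous_on_subset[OF chart_U(4)] cT) blast
 have Kb: "K : sets borel" using cK by (intro borel_closed compact_imp_closed)
 have kK: "kap ` K = T" unfolding K_def by (rule forth[OF TR])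
 have KR: "K <= sig ` ball oc R" unfolding K_def using TR by blast
 have Kpos: "emeasure mu K > 0"
  using cmp(2)[OF Kb KR] Tpos unfolding kK by (cases "emeasure mu K = 0") (auto simp: zero_less_iff_neq_zero)
 define m where "m = enn2real (emeasure mu K)"
 have m: "emeasure mu K = ennreal m" "m > 0"
  using Kpos emeasure_compact_finite[OF cK] by (simp_all add: m_def enn2real_positive_iff)
 have Tb: "T : sets borel" using T(1) by simp
 have "m / (4 * C) > 0" using m R by simp
 from outer_regular_lborel[OF Tb this] obtain W' where W': "open W'" "T <= W'" "emeasure lborel (W' - T) < ennreal (m / (4 * C))"
  by blast
 define W where "W = sig ` (W' Int ball oc R)"
 have kW: "kap ` W = W' Int ball oc R" unfolding W_def by (rule forth) simp
 have WU: "W = U Int kap -` (W' Int ball oc R)"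
 proof (intro equalityI subsetI)
  fix x assume x: "x : W"
  then have "kap x : W' Int ball oc R" using kW by blast
  moreover have "x : U" using x R(1) chart_U(6) unfolding W_def by blast
  ultimately show "x : U Int kap -` (W' Int ball oc R)" by blast
 next
  fix x assume "x : U Int kap -` (W' Int ball oc R)"
  then have "x = sig (kap x)" "kap x : W' Int ball oc R" by (simp_all add: chart_U(5))
  then show "x : W" unfolding W_def by (rule image_eqI)
 qed
 have oW: "open W"
  unfolding WU by (intro continuous_open_preimage chart_U open_Int W'(1) open_ball)
 have KW: "K <= W" unfolding K_def W_def using W'(2) TR by blast
 have small: "emeasure mu (W - K) <= ennreal (m / 4)"
 proof -
  have "kap ` (W - K) <= W' - T"
  proof clarify
   fix x assume x: "x : W" "x ~: K"
   have "kap x : W'" using x kW by blast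
   moreover have "kap x ~: T"
   proof
    assume "kap x : T"
    then have "sig (kap x) : K" unfolding K_def by blast
    then show False using x WU by (auto simp: chart_U(5))
   qed
   ultimately show "kap x : W' - T" by blast
  qed
  then have le: "emeasure lborel (kap ` (W - K)) <= emeasure lborel (W' - T)"
   using W'(1) Tb by (intro emeasure_mono) auto
  have "emeasure mu (W - K) <= ennreal C * emeasure lborel (kap ` (W - K))"
   using oW Kb unfolding W_def by (intro cmp(1)) auto
  also have "... <= ennreal C * ennreal (m / (4 * C))"
   using le W'(3) by (intro mult_left_mono) auto
  also have "... = ennreal (m / 4)" using R m by (simp add: ennreal_mult[symmetric])
  finally show ?thesis .
 qed
 obtain V where V: "open V" "0 : V" "!!u. u : V ==> (+) u ` K <= W"
  using translate_tube[OF cK oW KW] by blast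
 show ?thesis
 proof (rule that[OF KE Kb _ V(1,2)])
  show "m / 4 > 0" using m by simp
  fix u assume u: "u : V"
  have uK: "(+) u ` K : sets borel" by (rule left_image_sets[OF Kb])
  have "ennreal m = emeasure mu ((+) u ` K)" using m emeasure_left[OF Kb] by simp
  also have "... <= emeasure mu ((K Int (+) u ` K) Un (W - K))"
   using V(3)[OF u] uK Kb oW by (intro emeasure_mono) auto
  also have "... <= emeasure mu (K Int (+) u ` K) + emeasure mu (W - K)"
   using uK Kb oW by (intro emeasure_subadditive) auto
  also have "... <= emeasure mu (K Int (+) u ` K) + ennreal (m / 4)"
   by (intro add_left_mono small)
  finally have le: "ennreal m <= emeasure mu (K Int (+) u ` K) + ennreal (m / 4)" .
  show "ennreal (m / 4) <= emeasure mu (K Int (+) u ` K)"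
  proof (rule ccontr)
   assume "~ ennreal (m / 4) <= emeasure mu (K Int (+) u ` K)"
   then have "emeasure mu (K Int (+) u ` K) + ennreal (m / 4) <= ennreal (m / 4) + ennreal (m / 4)"
    by (intro add_right_mono) simp
   with le have "ennreal m <= ennreal (m / 4) + ennreal (m / 4)" by (rule order_trans)
   also have "... = ennreal (m / 4 + m / 4)" using m(2) by (intro ennreal_plus[symmetric]) auto
   finally show False using m(2) by (subst (asm) ennreal_le_iff) auto
  qed
 qed
qed

lemma haar_overlap:
 assumes E: "E : sets borel" "emeasure mu E > 0"
 shows "EX K d V. K <= E & K : sets borel &
   (d::real) > 0 & open V & 0 : V & (ALL u:V. ennreal d <= emeasure mu (K Int (+) u ` K))"
proof -
 obtain R C where R: "R > 0" "C > 0" "ball oc R <= Om"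
  "!!E. E : sets borel ==> E <= sig ` ball oc R ==> emeasure mu E <= ennreal C * emeasure lborel (kap ` E)"
  "!!E. E : sets borel ==> E <= sig ` ball oc R ==> emeasure lborel (kap ` E) <= ennreal C * emeasure mu E"
  using haar_lebesgue_comparable by blast
 let ?B = "sig ` ball oc R"
 have B: "open ?B" "?B ~= {}" using open_chart_ball[OF R(3)] R(1) by auto
 obtain D where D: "countable D" "(\<Union>x\<in>D. (+) x ` ?B) = UNIV"
  using countable_translates[OF B] by blast
 have "EX x:D. emeasure mu (E Int (+) x ` ?B) > 0"
 proof (rule ccontr)
  assume "~ ?thesis"
  then have zero: "emeasure mu (E Int (+) x ` ?B) = 0" if "x : D" for x
   using that by (simp add: zero_less_iff_neq_zero)
  have "E Int (+) x ` ?B : sets mu" for x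
   using sets.Int[OF E(1) left_image_sets[OF borel_open[OF B(1)]]] by simp
  then have null: "E Int (+) x ` ?B : null_sets mu" if "x : D" for x
   using null_setsI[OF zero[OF that]] by blast
  have "(\<Union>x\<in>D. E Int (+) x ` ?B) : null_sets mu" by (rule null_sets_UN'[OF D(1) null])
  moreover have "(\<Union>x\<in>D. E Int (+) x ` ?B) = E" unfolding Int_UN_distrib[symmetric] D(2) by (rule Int_UNIV_right)
  ultimately have "E : null_sets mu" by (simp only:)
  then show False using null_setsD1[of E mu] E(2) by (simp only: less_irrefl)
 qed
 then obtain x where x: "emeasure mu (E Int (+) x ` ?B) > 0" by blast
 define F where "F = (+) (- x) ` (E Int (+) x ` ?B)"
 have "E Int (+) x ` ?B : sets borel"
  by (rule sets.Int[OF E(1) left_image_sets[OF borel_open[OF B(1)]]])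
 then have F: "F : sets borel" "emeasure mu F > 0"
  unfolding F_def using x by (simp_all only: left_image_sets emeasure_left)
 have "F <= ?B"
 proof
  fix z assume "z : F"
  then obtain b where "b : ?B" "z = - x + (x + b)" unfolding F_def by blast
  then show "z : ?B" by (simp add: add.assoc[symmetric])
 qed
 note F = F this
 obtain K d V where K: "K <= F" "K : sets borel" "(d::real) > 0" "open V" "0 : V"
  "!!u. u : V ==> ennreal d <= emeasure mu (K Int (+) u ` K)"
  using haar_overlap_in_chart[OF F R(3,2,4,5)] by blast
 have "continuous_on UNIV (%u. - x + u + x)" by (intro continuous_intros)
 then have oV: "open ((%u. - x + u + x) -` V)" by (rule open_vimage[OF K(4)])
 show ?thesis
 proof (intro exI conjI ballI)
  show "(+) x ` K <= E" using K(1) by (auto simp: F_def)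
  show "(+) x ` K : sets borel" by (rule left_image_sets[OF K(2)])
  show "d > 0" "open ((%u. - x + u + x) -` V)" "0 : (%u. - x + u + x) -` V"
   using K oV by simp_all
  fix u assume "u : (%u. - x + u + x) -` V"
  then have "ennreal d <= emeasure mu (K Int (+) (- x + u + x) ` K)" by (intro K(6)) simp
  also have "... = emeasure mu ((+) x ` (K Int (+) (- x + u + x) ` K))"
   using K(2) by (intro emeasure_left[symmetric] sets.Int left_image_sets)
  also have "(+) x ` (K Int (+) (- x + u + x) ` K) = (+) x ` K Int (+) u ` (+) x ` K"
  proof -
   have "(+) x ` (K Int (+) (- x + u + x) ` K) = (+) x ` K Int (+) x ` (+) (- x + u + x) ` K"
    by (rule image_Int) simp
   also have "(+) x ` (+) (- x + u + x) ` K = (+) u ` (+) x ` K"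
    by (simp add: image_image add.assoc[symmetric])
   finally show ?thesis .
  qed
  finally show "ennreal d <= emeasure mu ((+) x ` K Int (+) u ` (+) x ` K)" .
 qed
qed

lemma sampling_group: "sampling_group (%k. flow (X k)) n mu"
proof -
 have words: "exp_words (%k. flow (X k)) n eps = P ` boxe eps" for eps
 proof -
  have "map (%k. lie_exp A (vf_scale (t k) (X k))) [1..<Suc n] = map (%k. flow (X k) (t k)) [1..<Suc n]" for t
   by (rule map_cong) (auto simp: lie_exp_eq_flow[OF X_in])
  then have "exp_words (%k. flow (X k)) n eps = exp_box A n X eps"
   unfolding exp_words_def exp_box_def by (simp only:)
  then show ?thesis by (simp only: exp_box_eq)
 qed
 show ?thesis
 proof
  show "flow (X k) (s + t) = flow (X k) s + flow (X k) t" if "k : {1..n}" for k s t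
   by (rule flow_add[OF X_in[OF that]])
  show "continuous_on UNIV (flow (X k))" if "k : {1..n}" for k
   by (rule continuous_flow[OF X_in[OF that]])
  show "compact (exp_words (%k. flow (X k)) n eps)" for eps
   unfolding words by (intro compact_continuous_image continuous_on_subset[OF continuous_P] compact_cbox) simp
  show "EX dlt>0. ALL eps. 0 < eps --> eps <= dlt --> exp_words (%k. flow (X k)) n eps <= V" if V: "open V" "0 : V" for V
  proof -
   have "open (P -` V)" by (intro open_vimage V continuous_P)
   moreover have "0 : P -` V" using V by (simp add: prefix_map_at_0)
   ultimately obtain d where d: "d > 0" "ball 0 d <= P -` V" by (meson open_contains_ball)
   show ?thesis
   proof (intro exI[of _ "d / (2 * (n + 1))"] conjI allI impI)
    fix eps assume eps: "0 < eps" "eps <= d / (2 * (n + 1))"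
    then have "(n + 1) * eps <= d / 2" by (simp add: field_simps)
    then have "real n * eps < d" using eps d by (simp add: algebra_simps)
    then have "cball 0 (real n * eps) <= ball (0::'e) d" by auto
    then have "boxe eps <= P -` V" using box_cball[of eps] d(2) by blast
    then show "exp_words (%k. flow (X k)) n eps <= V" unfolding words by blast
   qed (use d in simp)
  qed
  obtain c dlt where c: "c >= 1" "dlt > 0"
   "!!eps x y z. 0 < eps ==> eps <= dlt ==> x : P ` boxe eps ==> y : P ` boxe eps ==> z : P ` boxe eps ==>
    x - y + z : P ` boxe (c * eps)"
   "!!eps. 0 < eps ==> eps <= dlt ==> 0 : interior (P ` boxe eps)"
   using exp_box_words by blast
  then show "EX c>=1. EX dlt>0. ALL eps. 0 < eps --> eps <= dlt --> 0 : interior (exp_words (%k. flow (X k)) n eps) &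
   (ALL x:exp_words (%k. flow (X k)) n eps. ALL y:exp_words (%k. flow (X k)) n eps.
    ALL z:exp_words (%k. flow (X k)) n eps. x - y + z : exp_words (%k. flow (X k)) n (c * eps))"
   unfolding words by blast
  obtain C dlt' where C: "C > 0" "dlt' > 0"
   "!!eps J. 0 < eps ==> eps <= dlt' ==> J : Bmeas ==>
   (\<integral>\<^sup>+s. indicator (boxe eps) s * J (P s) \<partial>lborel) <= ennreal C * (\<integral>\<^sup>+x. indicator (P ` boxe eps) x * J x \<partial>mu) &
   (\<integral>\<^sup>+x. indicator (P ` boxe eps) x * J x \<partial>mu) <= ennreal C * (\<integral>\<^sup>+s. indicator (boxe eps) s * J (P s) \<partial>lborel)"
   using box_nn_integral_comparable by blast
  show "EX C>0. EX dlt>0. ALL eps. 0 < eps --> eps <= dlt --> (ALL J:Bmeas.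
   box_integral eps (map (%k. flow (X k)) [1..<Suc n]) J 0
    <= ennreal C * (\<integral>\<^sup>+x. indicator (exp_words (%k. flow (X k)) n eps) x * J x \<partial>mu) &
   (\<integral>\<^sup>+x. indicator (exp_words (%k. flow (X k)) n eps) x * J x \<partial>mu)
    <= ennreal C * box_integral eps (map (%k. flow (X k)) [1..<Suc n]) J 0)"
  proof (rule exI[of _ C], rule conjI[OF C(1)], rule exI[of _ dlt'], rule conjI[OF C(2)], intro allI impI ballI conjI)
   fix eps and J :: "'g => ennreal" assume eps: "0 < eps" "eps <= dlt'" and J: "J : Bmeas"
   have eq: "box_integral eps (map (%k. flow (X k)) [1..<Suc n]) J 0 = (\<integral>\<^sup>+s. indicator (boxe eps) s * J (P s) \<partial>lborel)"
    using box_integral_eq[OF J, of eps 0] by (simp only: add_0_left)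
   show "box_integral eps (map (%k. flow (X k)) [1..<Suc n]) J 0
    <= ennreal C * (\<integral>\<^sup>+x. indicator (exp_words (%k. flow (X k)) n eps) x * J x \<partial>mu)"
    "(\<integral>\<^sup>+x. indicator (exp_words (%k. flow (X k)) n eps) x * J x \<partial>mu)
    <= ennreal C * box_integral eps (map (%k. flow (X k)) [1..<Suc n]) J 0"
    unfolding eq words using C(3)[OF eps J] by blast+
  qed
  show "EX K d V. K <= E & K : sets borel & (d::real) > 0 & open V & 0 : V &
    (ALL u:V. ennreal d <= emeasure mu (K Int (+) u ` K))"
   if "E : sets borel" "emeasure mu E > 0" for E
   using that by (rule haar_overlap)
 qed (rule sigma_finite_measure.sigma_finite_countable[OF sigma_finite_mu])
qed

end

text \<open>A zero-dimensional Lie group is a countable discrete group; the boxes are the unit.\<close>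
lemma sampling_group_discrete:
 fixes mu :: "'g::{topological_group_add, t2_space, second_countable_topology} measure"
 assumes haar: "left_haar_measure mu" and discrete: "!!x::'g. open {x}"
 shows "sampling_group (%_ _. 0) 0 mu"
proof -
 interpret haar_measure mu by standard (rule haar)
 have words: "exp_words (%_ _. 0 :: 'g) 0 eps = {0}" for eps by (auto simp: exp_words_def)
 have pos: "emeasure mu {x} > 0" for x by (rule emeasure_open_pos[OF discrete]) simp
 have fin: "emeasure mu {x} < \<infinity>" for x by (rule emeasure_compact_finite) simp
 define m where "m = enn2real (emeasure mu {0})"
 have m: "emeasure mu {0} = ennreal m" "m > 0"
  using pos[of 0] fin[of 0] by (simp_all add: m_def enn2real_positive_iff)
 have sf: "sigma_finite_measure mu" by (rule sigma_finite_if[OF discrete[of 0] _ fin[of 0]]) simp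
 have mm: "max m (1 / m) > 0" using m by simp
 show ?thesis
 proof
  show "EX c>=1. EX dlt>0. ALL eps. 0 < eps --> eps <= dlt --> 0 : interior (exp_words (%_ _. 0 :: 'g) 0 eps) &
   (ALL x:exp_words (%_ _. 0) 0 eps. ALL y:exp_words (%_ _. 0) 0 eps. ALL z:exp_words (%_ _. 0) 0 eps.
    x - y + z : exp_words (%_ _. 0 :: 'g) 0 (c * eps))"
   unfolding words using interior_open[OF discrete[of 0]]
   by (intro exI[of _ 1] conjI) (auto intro!: exI[of _ 1])
  show "EX C>0. EX dlt>0. ALL eps. 0 < eps --> eps <= dlt --> (ALL J:Bmeas.
   box_integral eps (map (%_ _. 0) [1..<Suc 0]) J 0 <= ennreal C * (\<integral>\<^sup>+x. indicator (exp_words (%_ _. 0) 0 eps) x * J x \<partial>mu) &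
   (\<integral>\<^sup>+x. indicator (exp_words (%_ _. 0) 0 eps) x * J x \<partial>mu) <= ennreal C * box_integral eps (map (%_ _. 0) [1..<Suc 0]) J 0)"
  proof (rule exI[of _ "max m (1 / m)"], rule conjI[OF mm], rule exI[of _ "1::real"], rule conjI[OF zero_less_one],
    intro allI impI ballI conjI)
   fix eps :: real and J :: "'g => ennreal"
   have int: "(\<integral>\<^sup>+x. indicator (exp_words (%_ _. 0) 0 eps) x * J x \<partial>mu) = J 0 * ennreal m"
   proof -
    have "(\<integral>\<^sup>+x. indicator {0} x * J x \<partial>mu) = (\<integral>\<^sup>+x. J 0 * indicator {0} x \<partial>mu)"
     by (intro nn_integral_cong) (auto simp: indicator_def)
    also have "... = J 0 * emeasure mu {0}" by (rule nn_integral_cmult_indicator) simp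
    finally show ?thesis by (simp add: words m)
   qed
   have "J 0 = ennreal (1 / m) * (J 0 * ennreal m)"
    using m(2) by (simp add: mult.left_commute ennreal_mult[symmetric])
   also have "... <= ennreal (max m (1 / m)) * (J 0 * ennreal m)"
    by (intro mult_right_mono ennreal_leI) auto
   finally show "box_integral eps (map (%_ _. 0) [1..<Suc 0]) J 0
     <= ennreal (max m (1 / m)) * (\<integral>\<^sup>+x. indicator (exp_words (%_ _. 0) 0 eps) x * J x \<partial>mu)"
    by (simp add: int)
   have "J 0 * ennreal m <= J 0 * ennreal (max m (1 / m))" by (intro mult_left_mono ennreal_leI) auto
   then show "(\<integral>\<^sup>+x. indicator (exp_words (%_ _. 0) 0 eps) x * J x \<partial>mu)
     <= ennreal (max m (1 / m)) * box_integral eps (map (%_ _. 0) [1..<Suc 0]) J 0"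
    unfolding int by (simp add: mult.commute)
  qed
  show "EX K d V. K <= E & K : sets borel & (d::real) > 0 & open V & 0 : V &
    (ALL u:V. ennreal d <= emeasure mu (K Int (+) u ` K))"
   if E: "E : sets borel" "emeasure mu E > 0" for E
  proof -
   obtain x where x: "x : E" using E(2) by fastforce
   define d where "d = enn2real (emeasure mu {x})"
   have d: "emeasure mu {x} = ennreal d" "d > 0"
    using pos[of x] fin[of x] by (simp_all add: d_def enn2real_positive_iff)
   show ?thesis
    by (intro exI[of _ "{x}"] exI[of _ d] exI[of _ "{0}"]) (use x d discrete in auto)
  qed
  show "EX dlt>0. ALL eps. 0 < eps --> eps <= dlt --> exp_words (%_ _. 0 :: 'g) 0 eps <= V" if "open V" "0 : V" for V
   unfolding words using that by (intro exI[of _ 1]) auto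
 qed (use sf[THEN sigma_finite_measure.sigma_finite_countable] in \<open>simp_all add: words\<close>)
qed

lemma lie_group_sampling_group:
 fixes A :: "('g::{topological_group_add, t2_space, second_countable_topology}, 'e::euclidean_space) chart set"
 assumes lie: "lie_group A n" and basis: "lie_algebra_basis A n X" and haar: "left_haar_measure mu"
 shows "EX gam. sampling_group gam n mu & (ALL k:{1..n}. ALL t. lie_exp A (vf_scale t (X k)) = gam k t)"
proof (cases "n = 0")
 case True
 then have "open {x}" for x :: 'g using lie by (simp add: lie_group_def smooth_atlas_def)
 then show ?thesis using sampling_group_discrete[OF haar] True by (intro exI[of _ "%_ _. 0"]) simp
next
 case False
 then have "(\<Union>c\<in>A. fst c) = UNIV" using lie by (simp add: lie_group_def smooth_atlas_def)
 then obtain c where "c : A" "0 : fst c" by blast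
 then interpret lie_haar A n "fst c" "snd c" X mu
  by unfold_locales (simp_all add: lie basis haar)
 show ?thesis
  by (intro exI[of _ "%k. flow (X k)"] conjI sampling_group ballI allI lie_exp_eq_flow X_in)
qed

section \<open>Solid spaces have a monotone norm up to a constant\<close>

text \<open>
 Zabreiko's lemma: a finite countably subadditive seminorm on a complete seminormed space is
 bounded. By Baire's argument the sublevel sets of the seminorm cannot all be nowhere dense; one of
 them is dense in a ball, and every vector is then a fast converging series of vectors from
 multiples of that set.
\<close>
locale complete_function_space =
 fixes V :: "('a => complex) set" and N :: "('a => complex) => real"
 assumes add: "f : V ==> g : V ==> (%x. f x + g x) : V"
  and scale: "f : V ==> (%x. a * f x) : V"
  and zero: "(%_. 0) : V"
  and nonneg: "f : V ==> 0 <= N f"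
  and triangle: "f : V ==> g : V ==> N (%x. f x + g x) <= N f + N g"
  and homogeneous: "f : V ==> N (%x. a * f x) = norm a * N f"
  and complete: "(!!m. F m : V) ==> (!!e. 0 < e ==> EX M. ALL m>=M. ALL k>=M. N (%x. F m x - F k x) < e) ==>
   EX f:V. (%m. N (%x. F m x - f x)) \<longlonglongrightarrow> 0"
begin

lemma uminus: "f : V ==> (%x. - f x) : V"
 using scale[of f "-1"] by simp

lemma diff: "f : V ==> g : V ==> (%x. f x - g x) : V"
 using add[OF _ uminus, of f g] by simp

lemma N_uminus: "f : V ==> N (%x. - f x) = N f"
 using homogeneous[of f "-1"] by simp

lemma N_commute: "f : V ==> g : V ==> N (%x. f x - g x) = N (%x. g x - f x)"
 using N_uminus[OF diff, of g f] by simp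

lemma triangle3: "f : V ==> g : V ==> h : V ==> N (%x. f x - h x) <= N (%x. f x - g x) + N (%x. g x - h x)"
 using triangle[OF diff diff, of f g g h] by simp

lemma sum_mem: "(!!i. i : I ==> F i : V) ==> (%x. \<Sum>i\<in>I. F i x) : V"
 by (induction I rule: infinite_finite_induct) (auto intro: zero add)

lemma N_zero: "N (%_. 0) = 0"
 using homogeneous[OF zero, of 0] by simp

lemma N_sum: "(!!i. i : I ==> F i : V) ==> N (%x. \<Sum>i\<in>I. F i x) <= (\<Sum>i\<in>I. N (F i))"
proof (induction I rule: infinite_finite_induct)
 case (insert i I)
 have "N (%x. F i x + (\<Sum>i\<in>I. F i x)) <= N (F i) + N (%x. \<Sum>i\<in>I. F i x)"
  using insert.prems by (intro triangle sum_mem) auto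
 also have "... <= N (F i) + (\<Sum>i\<in>I. N (F i))" using insert by auto
 finally show ?case using insert by simp
qed (simp_all add: N_zero)

lemma geometric_cauchy:
 assumes F: "!!m. F m : V" and le: "!!m. N (%x. F (Suc m) x - F m x) <= C * (1 / 2) ^ m" and C: "C >= 0"
 shows "EX f:V. (%m. N (%x. F m x - f x)) \<longlonglongrightarrow> 0"
proof (rule complete[OF F])
 have far: "N (%x. F (m + k) x - F m x) <= 2 * C * (1 / 2) ^ m - 2 * C * (1 / 2) ^ (m + k)" for m k
 proof (induction k)
  case 0
  then show ?case by (simp add: N_zero)
 next
  case (Suc k)
  have "N (%x. F (m + Suc k) x - F m x) <= N (%x. F (Suc (m + k)) x - F (m + k) x) + N (%x. F (m + k) x - F m x)"
   using triangle3[OF F F F] by simp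
  also have "... <= C * (1 / 2) ^ (m + k) + (2 * C * (1 / 2) ^ m - 2 * C * (1 / 2) ^ (m + k))"
   by (intro add_mono le Suc)
  finally show ?case by simp
 qed
 have far': "N (%x. F k x - F m x) <= 2 * C * (1 / 2) ^ m" if "m <= k" for m k
  using far[of m "k - m"] that C by (simp add: order.trans)
 fix e :: real assume e: "0 < e"
 have "(%m. 4 * C * (1 / 2) ^ m) \<longlonglongrightarrow> 4 * C * 0"
  by (intro tendsto_intros) auto
 then obtain M where M: "4 * C * (1 / 2) ^ M < e"
  using e by (force dest!: order_tendstoD(2) simp: eventually_sequentially)
 have "N (%x. F m x - F k x) < e" if "m >= M" "k >= M" for m k
 proof -
  have "N (%x. F m x - F k x) <= N (%x. F m x - F M x) + N (%x. F M x - F k x)"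
   by (rule triangle3) (rule F)+
  also have "N (%x. F M x - F k x) = N (%x. F k x - F M x)" by (rule N_commute) (rule F)+
  finally show ?thesis using far'[OF that(1)] far'[OF that(2)] M by simp
 qed
 then show "EX M. ALL m>=M. ALL k>=M. N (%x. F m x - F k x) < e" by blast
qed

lemma zabreiko:
 fixes p :: "('a => complex) => real"
 assumes p_nonneg: "!!f. f : V ==> 0 <= p f"
  and p_triangle: "!!f g. f : V ==> g : V ==> p (%x. f x + g x) <= p f + p g"
  and p_homogeneous: "!!f a. f : V ==> p (%x. a * f x) = norm a * p f"
  and p_countable: "!!F f C. (!!m. F m : V) ==> f : V ==> 0 <= C ==>
   (!!m. p (F m) <= C * (1 / 2) ^ m) ==>
   (%m. N (%x. (\<Sum>i<m. F i x) - f x)) \<longlonglongrightarrow> 0 ==> p f <= 2 * C"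
 shows "EX C>=0. ALL f:V. p f <= C * N f"
proof -
 define dense where "dense j c r \<longleftrightarrow> (ALL g:V. N (%x. g x - c x) < r -->
  (ALL e>0. EX h:V. p h <= real j & N (%x. g x - h x) < e))" for j :: nat and c r
 have "EX j c r. c : V & r > 0 & dense j c r"
 proof (rule ccontr)
  assume no: "~ (EX j c r. c : V & r > 0 & dense j c r)"
  define Q where "Q j c r c' r' \<longleftrightarrow> c' : V & 0 < r' & r' <= r / 4 & N (%x. c' x - c x) <= r / 4
    & (ALL h:V. p h <= real j --> N (%x. c' x - h x) >= 4 * r')" for j :: nat and c r c' r'
  have step: "EX c' r'. Q j c r c' r'" if "c : V" "r > 0" for j c r
  proof -
   have "~ dense j c (r / 4)" using no that by auto
   then obtain g e where g: "g : V" "N (%x. g x - c x) < r / 4" "e > 0"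
    "!!h. h : V ==> p h <= real j ==> N (%x. g x - h x) >= e"
    unfolding dense_def by (auto simp: not_less)
   have "4 * min (r / 4) (e / 4) <= e" by linarith
   then have "Q j c r g (min (r / 4) (e / 4))"
    unfolding Q_def using g that by (auto intro: order_trans[OF _ g(4)])
   then show ?thesis by blast
  qed
  have "ALL z. EX q. fst (snd z) : V --> snd (snd z) > 0 --> Q (fst z) (fst (snd z)) (snd (snd z)) (fst q) (snd q)"
   using step by (simp only: split_paired_Ex fst_conv snd_conv) blast
  from choice[OF this] obtain nq where nq: "!!z. fst (snd z) : V ==> snd (snd z) > 0 ==>
    Q (fst z) (fst (snd z)) (snd (snd z)) (fst (nq z)) (snd (nq z))" by blast
  define nc nr where "nc j c r = fst (nq (j, c, r))" and "nr j c r = snd (nq (j, c, r))" for j c r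
  have n: "nc j c r : V & 0 < nr j c r & nr j c r <= r / 4
    & N (%x. nc j c r x - c x) <= r / 4 & (ALL h:V. p h <= real j --> N (%x. nc j c r x - h x) >= 4 * nr j c r)"
   if "c : V" "r > 0" for j c r
   using nq[of "(j, c, r)"] that unfolding Q_def nc_def nr_def by simp
  define s where "s = rec_nat ((%_. 0), 1) (%j (c, r). (nc j c r, nr j c r))"
  define c r where "c j = fst (s j)" and "r j = snd (s j)" for j
  have s_Suc: "c (Suc j) = nc j (c j) (r j)" "r (Suc j) = nr j (c j) (r j)" for j
   by (simp_all add: c_def r_def s_def case_prod_beta)
  have cr: "c j : V & r j > 0" for j
  proof (induction j)
   case 0
   then show ?case by (simp add: c_def r_def s_def zero)
  next
   case (Suc j)
   then show ?case using n[of "c j" "r j" j] by (simp add: s_Suc)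
  qed
  have st: "r (Suc j) <= r j / 4" "N (%x. c (Suc j) x - c j x) <= r j / 4"
   "!!h. h : V ==> p h <= real j ==> N (%x. c (Suc j) x - h x) >= 4 * r (Suc j)" for j
   using n[of "c j" "r j" j] cr[of j] by (auto simp: s_Suc)
  have r_small: "r (j + i) <= r j * (1 / 4) ^ i" for i j
  proof (induction i)
   case (Suc i)
   then show ?case using st(1)[of "j + i"] by simp
  qed simp
  have r_half: "r j <= (1 / 2) ^ j" for j
  proof -
   have "r j <= (1 / 4) ^ j" using r_small[of 0 j] by (simp add: r_def s_def)
   also have "... <= (1 / 2) ^ j" by (intro power_mono) auto
   finally show ?thesis .
  qed
  have "N (%x. c (Suc j) x - c j x) <= 1 * (1 / 2) ^ j" for j
   using r_half[of j] st(2)[of j] cr[of j] by linarith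
  then obtain f where f: "f : V" "(%m. N (%x. c m x - f x)) \<longlonglongrightarrow> 0"
   using geometric_cauchy[of c 1] cr by auto
  have stay: "N (%x. c (j + i) x - c j x) <= r j" for i j
  proof -
   have "N (%x. c (j + i) x - c j x) <= r j - r j * (1 / 4) ^ i"
   proof (induction i)
    case 0
    then show ?case by (simp add: N_zero)
   next
    case (Suc i)
    have "N (%x. c (j + Suc i) x - c j x)
     <= N (%x. c (Suc (j + i)) x - c (j + i) x) + N (%x. c (j + i) x - c j x)"
     using triangle3[of "c (Suc (j + i))" "c (j + i)" "c j"] cr by simp
    also have "... <= r (j + i) / 4 + (r j - r j * (1 / 4) ^ i)" by (intro add_mono st Suc)
    also have "... <= r j * (1 / 4) ^ i / 4 + (r j - r j * (1 / 4) ^ i)" using r_small[of j i] by simp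
    also have "... <= r j - r j * (1 / 4) ^ Suc i"
    proof -
     have "r j * (1 / 4) ^ i >= 0" using cr[of j] by simp
     then show ?thesis by simp
    qed
    finally show ?case .
   qed
   also have "... <= r j" using cr[of j] by simp
   finally show ?thesis .
  qed
  have lim: "N (%x. f x - c j x) <= r j" for j
  proof (rule field_le_epsilon)
   fix e :: real assume "e > 0"
   then have "\<forall>\<^sub>F m in sequentially. N (%x. c m x - f x) < e" by (rule order_tendstoD(2)[OF f(2)])
   then obtain M where M: "!!m. m >= M ==> N (%x. c m x - f x) < e" by (auto simp: eventually_sequentially)
   have "N (%x. f x - c j x) <= N (%x. f x - c (j + M) x) + N (%x. c (j + M) x - c j x)"
    using triangle3[of f "c (j + M)" "c j"] f cr by simp
   also have "N (%x. f x - c (j + M) x) = N (%x. c (j + M) x - f x)"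
    using N_commute[of f "c (j + M)"] f cr by simp
   finally show "N (%x. f x - c j x) <= r j + e" using M[of "j + M"] stay[of j M] by simp
  qed
  obtain j :: nat where j: "p f <= real j" using real_arch_simple by blast
  have "4 * r (Suc j) <= N (%x. c (Suc j) x - f x)" by (rule st(3)[OF f(1) j])
  also have "... = N (%x. f x - c (Suc j) x)" using N_commute[of f "c (Suc j)"] f cr by simp
  also have "... <= r (Suc j)" by (rule lim)
  finally show False using cr[of "Suc j"] by simp
 qed
 then obtain j c r where d: "c : V" "r > 0" "dense j c r" by blast
 \<comment> \<open>Translating by the centre and rescaling: approximation of every vector from its own scale.\<close>
 define K where "K = 2 * (2 * real j + 1) / r"
 have K: "K > 0" using d by (simp add: K_def)
 have approx: "EX h:V. p h <= K * t & N (%x. g x - h x) <= t / 2" if g: "g : V" "N g <= t" "t > 0" for g t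
 proof -
  define s where "s = r / (2 * t)"
  have s: "s > 0" using d g by (simp add: s_def)
  let ?g = "%x. c x + of_real s * g x"
  have gV: "?g : V" by (intro add scale d g)
  have "N (%x. ?g x - c x) = s * N g" using homogeneous[OF g(1), of "of_real s"] s by simp
  also have "... <= s * t" using g s by (intro mult_left_mono) auto
  also have "... < r" using d g by (simp add: s_def)
  finally obtain h where h: "h : V" "p h <= real j" "N (%x. ?g x - h x) < r / 4 / 2"
   using d(3)[unfolded dense_def, rule_format, OF gV, of "r / 4 / 2"] d(2) by auto
  obtain h1 where h1: "h1 : V" "p h1 <= real j" "N (%x. c x - h1 x) < r / 4 / 2"
   using d(3)[unfolded dense_def, rule_format, OF d(1), of "r / 4 / 2"] d(2) N_zero by auto
  let ?h = "%x. of_real (1 / s) * (h x + - 1 * h1 x)"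
  have hV: "(%x. h x + - 1 * h1 x) : V" by (rule add[OF h(1) scale[OF h1(1)]])
  have "p ?h = 1 / s * p (%x. h x + - 1 * h1 x)" using p_homogeneous[OF hV, of "of_real (1 / s)"] s by (simp add: norm_divide)
  also have "p (%x. h x + - 1 * h1 x) <= p h + p (%x. - 1 * h1 x)" by (rule p_triangle[OF h(1) scale[OF h1(1)]])
  also have "p (%x. - 1 * h1 x) = p h1" using p_homogeneous[OF h1(1), of "-1"] by simp
  finally have "p ?h <= 1 / s * (p h + p h1)" using s by (simp add: divide_right_mono)
  also have "... <= 1 / s * (real j + real j)" using s h h1 by (intro mult_left_mono add_mono) auto
  also have "... <= K * t" using d g by (simp add: s_def K_def field_simps)
  finally have ph: "p ?h <= K * t" .
  have "(%x. g x - ?h x) = (%x. of_real (1 / s) * ((?g x - h x) - (c x - h1 x)))"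
   using s by (simp add: fun_eq_iff field_simps)
  then have "N (%x. g x - ?h x) = 1 / s * N (%x. (?g x - h x) - (c x - h1 x))"
   using homogeneous[OF diff[OF diff[OF gV h(1)] diff[OF d(1) h1(1)]], of "of_real (1 / s)"] s
   by (simp add: norm_divide)
  also have "N (%x. (?g x - h x) - (c x - h1 x)) <= N (%x. ?g x - h x) + N (%x. c x - h1 x)"
   using triangle[OF diff[OF gV h(1)] uminus[OF diff[OF d(1) h1(1)]]] N_uminus[OF diff[OF d(1) h1(1)]] by simp
  finally have "N (%x. g x - ?h x) <= 1 / s * (N (%x. ?g x - h x) + N (%x. c x - h1 x))"
   using s by (simp add: divide_right_mono)
  also have "... <= 1 / s * (r / 4)" using s h h1 by (intro mult_left_mono) auto
  also have "... = t / 2" using d g by (simp add: s_def field_simps)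
  finally show ?thesis using ph scale[OF hV] by blast
 qed
 have bound: "p f <= 2 * (K * t)" if f: "f : V" "N f <= t" "t > 0" for f t
 proof -
  have "EX h. ALL g k. g : V --> N g <= t * (1 / 2) ^ k -->
   h g k : V & p (h g k) <= K * (t * (1 / 2) ^ k) & N (%x. g x - h g k x) <= t * (1 / 2) ^ k / 2"
  proof (rule choice, rule allI)
   fix g
   show "EX h. ALL k. g : V --> N g <= t * (1 / 2) ^ k -->
   h k : V & p (h k) <= K * (t * (1 / 2) ^ k) & N (%x. g x - h k x) <= t * (1 / 2) ^ k / 2"
   proof (rule choice, rule allI)
    fix k
    show "EX h. g : V --> N g <= t * (1 / 2) ^ k -->
     h : V & p h <= K * (t * (1 / 2) ^ k) & N (%x. g x - h x) <= t * (1 / 2) ^ k / 2"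
     using approx[of g "t * (1 / 2) ^ k"] f(3) by auto
   qed
  qed
  then obtain h where h: "!!g k. g : V ==> N g <= t * (1 / 2) ^ k ==>
   h g k : V & p (h g k) <= K * (t * (1 / 2) ^ k) & N (%x. g x - h g k x) <= t * (1 / 2) ^ k / 2" by blast
  define R where "R = rec_nat f (%k g x. g x - h g k x)"
  have R: "R 0 = f" "R (Suc k) = (%x. R k x - h (R k) k x)" for k by (simp_all add: R_def)
  have RV: "R k : V & N (R k) <= t * (1 / 2) ^ k" for k
  proof (induction k)
   case 0
   then show ?case using f by (simp add: R)
  next
   case (Suc k)
   then show ?case using h[of "R k" k] by (auto simp: R intro: diff)
  qed
  define F where "F k = h (R k) k" for k
  have F: "F k : V" "p (F k) <= (K * t) * (1 / 2) ^ k" for k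
   using h[of "R k" k] RV[of k] by (auto simp: F_def mult.assoc)
  have part: "(\<Sum>i<m. F i x) = f x - R m x" for m x
   by (induction m) (auto simp: R F_def)
  have "(%m. N (%x. (\<Sum>i<m. F i x) - f x)) \<longlonglongrightarrow> 0"
  proof (rule tendsto_sandwich[OF _ _ tendsto_const])
   have eq: "N (%x. (\<Sum>i<m. F i x) - f x) = N (R m)" for m
    using N_uminus[of "R m"] RV[of m] by (simp add: part)
   show "\<forall>\<^sub>F m in sequentially. 0 <= N (%x. (\<Sum>i<m. F i x) - f x)"
    using RV nonneg by (simp add: eq)
   show "\<forall>\<^sub>F m in sequentially. N (%x. (\<Sum>i<m. F i x) - f x) <= t * (1 / 2) ^ m"
    using RV by (simp add: eq)
   have "(%m. t * (1 / 2) ^ m) \<longlonglongrightarrow> t * 0" by (intro tendsto_intros) auto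
   then show "(%m. t * (1 / 2) ^ m) \<longlonglongrightarrow> 0" by simp
  qed
  then show ?thesis using K f by (intro p_countable[OF F(1) f(1) _ F(2)]) auto
 qed
 show ?thesis
 proof (intro exI[of _ "2 * K"] conjI ballI)
  fix f assume f: "f : V"
  show "p f <= 2 * K * N f"
  proof (rule field_le_epsilon)
   fix e :: real assume e: "e > 0"
   have "p f <= 2 * (K * (N f + e / (2 * K)))"
    using f e K nonneg[OF f] by (intro bound) (auto intro: add_nonneg_pos)
   also have "... = 2 * K * N f + e" using K by (simp add: field_simps)
   finally show "p f <= 2 * K * N f + e" .
  qed
 qed (use K in simp)
qed

end

section \<open>Local estimates and sampling points\<close>

context sampling_group
begin

abbreviation "U eps == exp_words gam n eps"

lemma exp_words_mono: "eps <= dlt ==> U eps <= U dlt"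
proof
 fix z assume le: "eps <= dlt" and "z : U eps"
 then obtain t where "z = sum_list (map (%k. gam k (t k)) [1..<Suc n])" "ALL k:{1..n}. - eps <= t k & t k <= eps"
  unfolding exp_words_def by blast
 then show "z : U dlt"
  unfolding exp_words_def using le by (intro CollectI exI[of _ t]) force
qed

lemma box_sets [measurable]: "U eps : sets borel"
 by (intro borel_closed compact_imp_closed box_compact)

lemma translated_box_sets [measurable]: "(+) x ` U eps : sets borel"
 by (rule left_image_sets[OF box_sets])

lemma mem_translate: "y : (+) x ` S \<longleftrightarrow> - x + y : (S :: 'g set)"
 by (force simp: add.assoc[symmetric] intro: image_eqI[of _ _ "- x + y"])

lemma box_integral_translate: "box_integral eps gs (%u. J (x + u)) y = box_integral eps gs J (x + (y :: 'g))"
 by (induction gs arbitrary: y) (simp_all add: add.assoc)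

lemma translated_box_measure:
 obtains C dlt where "C > 0" "dlt > 0" "dlt <= 1 / 2"
  "!!eps J x. 0 < eps ==> eps <= dlt ==> J : Bmeas ==>
   box_integral eps (tail 0) J x <= ennreal C * (\<integral>\<^sup>+y. indicator ((+) x ` U eps) y * J y \<partial>mu)"
  "!!eps J x. 0 < eps ==> eps <= dlt ==> J : Bmeas ==>
   (\<integral>\<^sup>+y. indicator ((+) x ` U eps) y * J y \<partial>mu) <= ennreal C * box_integral eps (tail 0) J x"
proof -
 obtain C dlt where C: "C > 0" "dlt > 0" and le: "ALL eps. 0 < eps --> eps <= dlt --> (ALL J:Bmeas.
   box_integral eps (tail 0) J 0 <= ennreal C * (\<integral>\<^sup>+x. indicator (U eps) x * J x \<partial>mu) &
   (\<integral>\<^sup>+x. indicator (U eps) x * J x \<partial>mu) <= ennreal C * box_integral eps (tail 0) J 0)"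
  using box_measure unfolding One_nat_def by blast
 have key: "box_integral eps (tail 0) J x <= ennreal C * (\<integral>\<^sup>+y. indicator ((+) x ` U eps) y * J y \<partial>mu) &
  (\<integral>\<^sup>+y. indicator ((+) x ` U eps) y * J y \<partial>mu) <= ennreal C * box_integral eps (tail 0) J x"
  if eps: "0 < eps" "eps <= min dlt (1 / 2)" and J [measurable]: "J : Bmeas" for eps x and J :: "'g => ennreal"
 proof -
  have "(%u. J (x + u)) : Bmeas"
   using measurable_compose[OF measurable_left J] .
  moreover have "(\<integral>\<^sup>+u. indicator (U eps) u * J (x + u) \<partial>mu) = (\<integral>\<^sup>+y. indicator ((+) x ` U eps) y * J y \<partial>mu)"
  proof -
   have "(%y. indicator ((+) x ` U eps) y * J y) : Bmeas" by measurable
   from nn_integral_left[OF this, of x]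
   have "(\<integral>\<^sup>+y. indicator ((+) x ` U eps) y * J y \<partial>mu) = (\<integral>\<^sup>+u. indicator ((+) x ` U eps) (x + u) * J (x + u) \<partial>mu)"
    by simp
   also have "... = (\<integral>\<^sup>+u. indicator (U eps) u * J (x + u) \<partial>mu)"
    by (intro nn_integral_cong) (simp add: indicator_def mem_translate add.assoc[symmetric])
   finally show ?thesis ..
  qed
  ultimately show ?thesis
   using le[rule_format, of eps "%u. J (x + u)"] eps by (simp add: box_integral_translate del: upt_Suc)
 qed
 show ?thesis by (rule that[of C "min dlt (1 / 2)"]) (use C key in auto)
qed

text \<open>
 The two consequences of differentiability that are used: a function is bounded by the local
 average of its derivatives, and its mean oscillation on a box is of the order of the size of the
 box.
\<close>
lemma local_estimates:
 obtains C dlt where "C > 0" "dlt > 0"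
  "!!eps D J x. 0 < eps ==> eps <= dlt ==> right_tower gam n n D ==> J : Bmeas ==>
   (!!alp x. set alp <= {1..n} ==> length alp <= n ==> enorm (D alp x) <= J x) ==>
   enorm (D [] x) <= ennreal (C * (1 / eps) ^ n) * (\<integral>\<^sup>+y. indicator ((+) x ` U eps) y * J y \<partial>mu)"
  "!!eps D J x. 0 < eps ==> eps <= dlt ==> right_tower gam n n D ==> J : Bmeas ==>
   (!!alp x. set alp <= {1..n} ==> length alp <= n ==> enorm (D alp x) <= J x) ==>
   (\<integral>\<^sup>+y. indicator ((+) x ` U eps) y * enorm (D [] y - D [] x) \<partial>mu)
    <= ennreal (C * eps) * (\<integral>\<^sup>+y. indicator ((+) x ` U eps) y * J y \<partial>mu)"
proof -
 obtain C dlt where C: "C > 0" "dlt > 0" "dlt <= 1 / 2"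
  "!!eps J x. 0 < eps ==> eps <= dlt ==> J : Bmeas ==>
   box_integral eps (tail 0) J x <= ennreal C * (\<integral>\<^sup>+y. indicator ((+) x ` U eps) y * J y \<partial>mu)"
  "!!eps J x. 0 < eps ==> eps <= dlt ==> J : Bmeas ==>
   (\<integral>\<^sup>+y. indicator ((+) x ` U eps) y * J y \<partial>mu) <= ennreal C * box_integral eps (tail 0) J x"
  using translated_box_measure by blast
 define C' where "C' = C * (real n * 2 ^ n) * C + C"
 have C': "C' > 0" "C * (real n * 2 ^ n) * C <= C'" "C <= C'" using C by (auto simp: C'_def intro!: add_nonneg_pos)
 show ?thesis
 proof (rule that[OF C'(1) C(2)])
  fix eps D x and J :: "'g => ennreal"
  assume eps: "0 < eps" "eps <= dlt" and D: "right_tower gam n n D" and J: "J : Bmeas"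
   and DJ: "!!alp x. set alp <= {1..n} ==> length alp <= n ==> enorm (D alp x) <= J x"
  have eps2: "eps <= 1 / 2" using eps C by simp
  let ?A = "\<integral>\<^sup>+y. indicator ((+) x ` U eps) y * J y \<partial>mu"
  have "enorm (D [] x) <= ennreal ((1 / eps) ^ n) * box_integral eps (tail 0) J x"
   using sobolev[OF D J DJ eps(1) eps2, of 0 "[]" x] by simp
  also have "... <= ennreal ((1 / eps) ^ n) * (ennreal C * ?A)"
   by (rule mult_left_mono[OF C(4)[OF eps J]]) simp
  also have "... = ennreal ((1 / eps) ^ n * C) * ?A"
   using C eps by (simp add: ennreal_mult mult.assoc)
  also have "... <= ennreal (C' * (1 / eps) ^ n) * ?A"
   using C'(3) eps by (intro mult_right_mono ennreal_leI) (auto simp: mult.commute intro!: mult_right_mono divide_right_mono)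
  finally show "enorm (D [] x) <= ennreal (C' * (1 / eps) ^ n) * ?A" .
  have [measurable]: "D [] : Bmeas" using D by (simp add: right_tower_def)
  have "(\<integral>\<^sup>+y. indicator ((+) x ` U eps) y * enorm (D [] y - D [] x) \<partial>mu)
    <= ennreal C * box_integral eps (tail 0) (%y. enorm (D [] y - D [] x)) x"
   by (rule C(5)[OF eps]) measurable
  also have "... <= ennreal C * (ennreal (real n * 2 ^ n * eps) * (ennreal C * ?A))"
   using poincare_aux[OF D J DJ eps(1) eps2, of 0 x] C(4)[OF eps J]
   by (intro mult_left_mono order_trans[OF _ mult_left_mono[OF C(4)[OF eps J]]]) auto
  also have "... = ennreal (C * (real n * 2 ^ n * eps * C)) * ?A"
   using C eps by (simp add: ennreal_mult mult.assoc)
  also have "... <= ennreal (C' * eps) * ?A"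
  proof (intro mult_right_mono ennreal_leI)
   have "C * (real n * 2 ^ n * eps * C) = C * (real n * 2 ^ n) * C * eps" by simp
   also have "... <= C' * eps" by (rule mult_right_mono[OF C'(2)]) (use eps in simp)
   finally show "C * (real n * 2 ^ n * eps * C) <= C' * eps" .
  qed simp
  finally show "(\<integral>\<^sup>+y. indicator ((+) x ` U eps) y * enorm (D [] y - D [] x) \<partial>mu)
    <= ennreal (C' * eps) * ?A" .
 qed
qed

lemma box_volume:
 obtains C dlt where "C > 0" "dlt > 0"
  "!!eps. 0 < eps ==> eps <= dlt ==> emeasure mu (U eps) <= ennreal (C * (2 * eps) ^ n)"
  "!!eps. 0 < eps ==> eps <= dlt ==> ennreal ((2 * eps) ^ n) <= ennreal C * emeasure mu (U eps)"
proof -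
 obtain C dlt where C: "C > 0" "dlt > 0" "dlt <= 1 / 2"
  "!!eps J x. 0 < eps ==> eps <= dlt ==> J : Bmeas ==>
   box_integral eps (tail 0) J x <= ennreal C * (\<integral>\<^sup>+y. indicator ((+) x ` U eps) y * J y \<partial>mu)"
  "!!eps J x. 0 < eps ==> eps <= dlt ==> J : Bmeas ==>
   (\<integral>\<^sup>+y. indicator ((+) x ` U eps) y * J y \<partial>mu) <= ennreal C * box_integral eps (tail 0) J x"
  using translated_box_measure by blast
 have box: "box_integral eps (tail 0) (%_. 1) 0 = ennreal ((2 * eps) ^ n)" if "0 < eps" for eps
  using that by (simp add: box_integral_const del: upt_Suc)
 have int: "(\<integral>\<^sup>+y. indicator ((+) 0 ` U eps) y * 1 \<partial>mu) = emeasure mu (U eps)" for eps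
  by simp
 show ?thesis
 proof (rule that[OF C(1,2)])
  fix eps :: real assume eps: "0 < eps" "eps <= dlt"
  show "emeasure mu (U eps) <= ennreal (C * (2 * eps) ^ n)"
   using C(5)[OF eps, of "%_. 1" 0] C(1) eps unfolding int box[OF eps(1)] by (simp add: ennreal_mult)
  show "ennreal ((2 * eps) ^ n) <= ennreal C * emeasure mu (U eps)"
   using C(4)[OF eps, of "%_. 1" 0] unfolding int box[OF eps(1)] by simp
 qed
qed

text \<open>
 Take a maximal family of disjoint translates of a smaller box \<open>W\<close>. By maximality the translates of
 the box cover, and comparing volumes bounds the overlaps; since the volume of a box of size \<open>eps\<close> is
 of order \<open>eps\<close> to the \<open>n\<close>, the bound does not depend on \<open>eps\<close>.
\<close>
lemma sampling_points:
 obtains M :: nat and dlt where "dlt > 0"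
  "!!eps. 0 < eps ==> eps <= dlt ==> EX (I::nat set) x. relatively_separated (U eps) I x &
   (ALL y. finite {i:I. y : (+) (x i) ` U eps} & card {i:I. y : (+) (x i) ` U eps} <= M) &
   (ALL K. compact K --> finite {i:I. (+) (x i) ` U eps Int K ~= {}})"
proof -
 obtain c dlt1 where c: "c >= 1" "dlt1 > 0" and words: "ALL eps. 0 < eps --> eps <= dlt1 --> 0 : interior (U eps) &
   (ALL x:U eps. ALL y:U eps. ALL z:U eps. x - y + z : U (c * eps))"
  using box_words by blast
 obtain C dlt2 where C: "C > 0" "dlt2 > 0"
  "!!eps. 0 < eps ==> eps <= dlt2 ==> emeasure mu (U eps) <= ennreal (C * (2 * eps) ^ n)"
  "!!eps. 0 < eps ==> eps <= dlt2 ==> ennreal ((2 * eps) ^ n) <= ennreal C * emeasure mu (U eps)"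
  using box_volume by blast
 \<comment> \<open>The volume ratio of the boxes of sizes \<open>c * eps\<close> and \<open>eps / c\<close>.\<close>
 define b where "b = C * (c * c) ^ n * C"
 have b0: "b >= 0" using C c by (simp add: b_def)
 show ?thesis
 proof (rule that[of "min dlt1 dlt2 / c" "nat \<lfloor>b\<rfloor>"])
  show "min dlt1 dlt2 / c > 0" using c C by simp
  fix eps :: real assume eps: "0 < eps" "eps <= min dlt1 dlt2 / c"
  have ceps: "c * eps <= min dlt1 dlt2" using eps c by (simp add: field_simps)
  have "1 * eps <= c * eps" using c eps by (intro mult_right_mono) auto
  then have epsc: "eps <= c * eps" by simp
  have epsd: "eps / c <= eps" "0 < eps / c" using c eps by (simp_all add: divide_le_eq)
  have small: "eps <= dlt1" "eps / c <= dlt1" "eps / c <= dlt2" using epsc epsd ceps by linarith+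
  define W where "W = U (eps / c)"
  have W: "0 : interior W" "compact W" "W <= U eps" "W : sets borel"
   unfolding W_def using words[rule_format, of "eps / c"] epsd small box_compact
   by (auto intro: exp_words_mono[THEN subsetD])
  have W0: "0 : W" using W(1) interior_subset by blast
  have diffW: "x - y : U eps" if "x : W" "y : W" for x y
  proof -
   have "ALL x:W. ALL y:W. ALL z:W. x - y + z : U (c * (eps / c))"
    using words epsd small unfolding W_def by blast
   then have "x - y + 0 : U (c * (eps / c))" using that W0 by blast
   then show ?thesis using c by simp
  qed
  have diffU: "x - y + z : U (c * eps)" if "x : U eps" "y : U eps" "z : W" for x y z
   using words eps(1) small(1) that W(3) by blast
  have posW: "emeasure mu W > 0"
  proof -
   have "emeasure mu (interior W) > 0" using W(1) by (intro emeasure_open_pos) auto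
   also have "emeasure mu (interior W) <= emeasure mu W" using W(4) interior_subset by (intro emeasure_mono) auto
   finally show ?thesis .
  qed
  have finW: "emeasure mu W < \<infinity>" by (rule emeasure_compact_finite[OF W(2)])
  have volU: "emeasure mu (U (c * eps)) <= ennreal b * emeasure mu W"
  proof -
   have "emeasure mu (U (c * eps)) <= ennreal (C * (2 * (c * eps)) ^ n)"
    using c eps ceps by (intro C(3)) auto
   also have "C * (2 * (c * eps)) ^ n = C * (c * c) ^ n * (2 * (eps / c)) ^ n"
   proof -
    have "2 * (c * eps) = (c * c) * (2 * (eps / c))" using c by simp
    then show ?thesis by (simp only: power_mult_distrib mult.assoc)
   qed
   also have "ennreal ... = ennreal (C * (c * c) ^ n) * ennreal ((2 * (eps / c)) ^ n)"
    using C c eps by (intro ennreal_mult) auto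
   also have "... <= ennreal (C * (c * c) ^ n) * (ennreal C * emeasure mu W)"
    unfolding W_def using epsd small by (intro mult_left_mono C(4)) auto
   also have "... = ennreal b * emeasure mu W"
    using C c by (simp add: b_def ennreal_mult mult.assoc)
   finally show ?thesis .
  qed
  define \<S> where "\<S> = {S. ALL x:S. ALL y:S. x ~= y --> (+) x ` W Int (+) y ` W = {}}"
  have "EX S:\<S>. ALL X:\<S>. S <= X --> X = S"
  proof (rule subset_Zorn')
   fix \<C> assume ch: "subset.chain \<S> \<C>"
   show "\<Union>\<C> : \<S>"
    unfolding \<S>_def
   proof (intro CollectI ballI impI)
    fix x y assume "x : \<Union>\<C>" "y : \<Union>\<C>" and ne: "x ~= y"
    then obtain X Y where XY: "X : \<C>" "Y : \<C>" "x : X" "y : Y" by blast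
    then have "X <= Y \<or> Y <= X" "X : \<S>" "Y : \<S>"
     using ch by (auto simp: subset_chain_def)
    then show "(+) x ` W Int (+) y ` W = {}" using XY ne unfolding \<S>_def by blast
   qed
  qed
  then obtain S where S: "S : \<S>" and max: "!!X. X : \<S> ==> S <= X ==> X = S" by blast
  have disj: "(+) x ` W Int (+) y ` W = {}" if "x : S" "y : S" "x ~= y" for x y
   using S that unfolding \<S>_def by blast
  have cover: "EX x:S. y : (+) x ` U eps" for y
  proof (cases "y : S")
   case True
   have "y : (+) y ` U eps" using W0 W(3) by (intro image_eqI[of _ _ 0]) auto
   then show ?thesis using True by blast
  next
   case False
   then have "insert y S ~: \<S>" using max[of "insert y S"] by blast
   then obtain x where x: "x : S" "(+) x ` W Int (+) y ` W ~= {}"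
    using disj unfolding \<S>_def by blast
   then obtain w w' where w: "w : W" "w' : W" "x + w = y + w'" by blast
   then have "y = x + (w - w')" by (metis add_diff_cancel add_diff_eq)
   then show ?thesis using x(1) diffW[OF w(1,2)] by blast
  qed
  have count: "finite A & card A <= nat \<lfloor>a\<rfloor>"
   if A: "A <= S" "!!x. x : A ==> (+) x ` W <= T" "T : sets borel" "emeasure mu T <= ennreal a * emeasure mu W" "a >= 0" for A T a
  proof (rule finite_if_finite_subsets_card_bdd)
   fix G assume G: "G <= A" "finite G"
   have sets: "(+) x ` W : sets mu" for x using left_image_sets[OF W(4)] by simp
   have "of_nat (card G) * emeasure mu W = (\<Sum>x\<in>G. emeasure mu ((+) x ` W))"
    by (simp add: emeasure_left[OF W(4)])
   also have "... = emeasure mu (\<Union>x\<in>G. (+) x ` W)"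
   proof (rule sum_emeasure)
    show "disjoint_family_on (%x. (+) x ` W) G"
     unfolding disjoint_family_on_def using disj G A(1) by blast
   qed (use sets G in auto)
   also have "... <= emeasure mu T" using A(2,3) G by (intro emeasure_mono) auto
   also have "... <= ennreal a * emeasure mu W" by (rule A(4))
   finally have le: "of_nat (card G) * emeasure mu W <= ennreal a * emeasure mu W" .
   define w where "w = enn2real (emeasure mu W)"
   have w: "emeasure mu W = ennreal w" "w > 0"
    using posW finW by (simp_all add: w_def enn2real_positive_iff)
   have "ennreal (real (card G) * w) <= ennreal (a * w)"
    using le w A(5) by (simp add: ennreal_of_nat_eq_real_of_nat ennreal_mult)
   then have "real (card G) * w <= a * w" using w A(5) by (subst (asm) ennreal_le_iff) auto
   then have "real (card G) <= a" using w by simp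
   then show "card G <= nat \<lfloor>a\<rfloor>" by (simp add: le_nat_floor)
  qed
  have meets: "finite {x:S. (+) y ` U eps Int (+) x ` U eps ~= {}} & card {x:S. (+) y ` U eps Int (+) x ` U eps ~= {}} <= nat \<lfloor>b\<rfloor>" for y
  proof (rule count)
   fix x assume "x : {x:S. (+) y ` U eps Int (+) x ` U eps ~= {}}"
   then obtain u u' where u: "u : U eps" "u' : U eps" "y + u = x + u'" by blast
   then have x: "x = y + u - u'" by (metis add_diff_cancel)
   show "(+) x ` W <= (+) y ` U (c * eps)"
   proof
    fix z assume "z : (+) x ` W"
    then obtain w where w: "w : W" "z = x + w" by blast
    then have "z = y + (u - u' + w)" unfolding x by (simp add: add.assoc diff_conv_add_uminus del: add_uminus_conv_diff)
    then show "z : (+) y ` U (c * eps)" using diffU[OF u(1,2) w(1)] by blast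
   qed
  qed (use volU b0 in \<open>auto simp: emeasure_left\<close>)
  have hits: "finite {x:S. (+) x ` U eps Int K ~= {}}" if K: "compact K" for K
  proof -
   define T where "T = (%(k, u, w). k - u + w) ` (K \<times> U eps \<times> W)"
   have "compact T" unfolding T_def case_prod_beta
    by (intro compact_continuous_image compact_Times K W box_compact continuous_intros)
   then have T: "T : sets borel" "emeasure mu T < \<infinity>"
    by (rule borel_closed[OF compact_imp_closed], rule emeasure_compact_finite)
   define w t where "w = enn2real (emeasure mu W)" and "t = enn2real (emeasure mu T)"
   define a where "a = t / w"
   have w: "emeasure mu W = ennreal w" "w > 0"
    using posW finW by (simp_all add: w_def enn2real_positive_iff)
   have t: "emeasure mu T = ennreal t" "t >= 0" using T(2) by (simp_all add: t_def)
   have "emeasure mu T <= ennreal a * emeasure mu W"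
    unfolding w t using w t by (simp add: a_def ennreal_mult[symmetric])
   moreover have "(+) x ` W <= T" if hit: "x : {x:S. (+) x ` U eps Int K ~= {}}" for x
   proof
    fix z assume "z : (+) x ` W"
    then obtain w where w: "w : W" "z = x + w" by blast
    obtain u where u: "u : U eps" "x + u : K" using hit by blast
    have "z = (x + u) - u + w" using w(2) by simp
    then show "z : T" unfolding T_def using u w(1) by (intro image_eqI[of _ _ "(x + u, u, w)"]) auto
   qed
   ultimately show ?thesis using count[of "{x:S. (+) x ` U eps Int K ~= {}}" T a] T(1) w t by (auto simp: a_def)
  qed
  have "countable S"
  proof -
   let ?F = "%x. (+) x ` interior W"
   have d: "?F x Int ?F y = {}" if "x : S" "y : S" "x ~= y" for x y
    using disj[OF that] interior_subset[of W] by blast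
   have ne: "x : ?F x" for x using W(1) by (intro image_eqI[of _ _ 0]) auto
   have inj: "inj_on ?F S"
   proof (rule inj_onI, rule ccontr)
    fix x y assume "x : S" "y : S" "?F x = ?F y" "x ~= y"
    then show False using d[of x y] ne[of x] by blast
   qed
   have "countable (?F ` S)"
   proof (rule countable_disjoint_open_subsets)
    show "open T" if "T : ?F ` S" for T
    proof -
     obtain x where "T = ?F x" using \<open>T : ?F ` S\<close> by blast
     then show ?thesis unfolding left_image_eq by (simp add: open_vimage continuous_intros)
    qed
    show "disjoint (?F ` S)" unfolding disjoint_def using d by blast
   qed
   then show ?thesis by (rule countable_image_inj_on[OF _ inj])
  qed
  define I where "I = to_nat_on S ` S"
  define x where "x = from_nat_into S"
  have x: "x (to_nat_on S s) = s" if "s : S" for s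
   unfolding x_def by (rule from_nat_into_to_nat_on[OF \<open>countable S\<close> that])
  have xS: "x i : S" if "i : I" for i using that x unfolding I_def by auto
  have image: "{i:I. Q (x i)} = to_nat_on S ` {s:S. Q s}" for Q
   unfolding I_def using x by force
  have bound: "finite {i:I. Q (x i)} & card {i:I. Q (x i)} <= m" if "finite {s:S. Q s} & card {s:S. Q s} <= m" for Q m
   unfolding image using that card_image_le[of "{s:S. Q s}" "to_nat_on S"] by auto
  have many: "finite {j:I. (+) y ` U eps Int (+) (x j) ` U eps ~= {}} & card {j:I. (+) y ` U eps Int (+) (x j) ` U eps ~= {}} <= nat \<lfloor>b\<rfloor>" for y
   by (rule bound[OF meets])
  have "relatively_separated (U eps) I x"
   unfolding relatively_separated_def
  proof (intro conjI exI[of _ "nat \<lfloor>b\<rfloor>"] ballI)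
   show "0 : interior (U eps)" using W(1,3) interior_mono by blast
   show "(\<Union>i\<in>I. (+) (x i) ` U eps) = UNIV"
   proof -
    have "y : (\<Union>i\<in>I. (+) (x i) ` U eps)" for y
    proof -
     obtain s where s: "s : S" "y : (+) s ` U eps" using cover by blast
     then show ?thesis by (intro UN_I[of "to_nat_on S s"]) (auto simp: I_def x)
    qed
    then show ?thesis by blast
   qed
  qed (use many box_compact in auto)
  moreover have "finite {i:I. y : (+) (x i) ` U eps} & card {i:I. y : (+) (x i) ` U eps} <= nat \<lfloor>b\<rfloor>" for y
  proof -
   have "{i:I. y : (+) (x i) ` U eps} <= {j:I. (+) y ` U eps Int (+) (x j) ` U eps ~= {}}"
   proof -
    have "y : (+) y ` U eps" using W0 W(3) by (intro image_eqI[of _ _ 0]) auto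
    then show ?thesis by blast
   qed
   then show ?thesis using many[of y] by (meson card_mono finite_subset le_trans)
  qed
  moreover have "finite {i:I. (+) (x i) ` U eps Int K ~= {}}" if "compact K" for K
   unfolding image[of "%s. (+) s ` U eps Int K ~= {}"] using hits[OF that] by simp
  ultimately show "EX (I::nat set) x. relatively_separated (U eps) I x &
   (ALL y. finite {i:I. y : (+) (x i) ` U eps} & card {i:I. y : (+) (x i) ` U eps} <= nat \<lfloor>b\<rfloor>) &
   (ALL K. compact K --> finite {i:I. (+) (x i) ` U eps Int K ~= {}})"
   by blast
 qed
qed

end

locale sampling_space = sampling_group gam n mu + solid_translation_invariant_space mu B N
 for gam :: "nat => real => 'g::{topological_group_add, t2_space, second_countable_topology}"
  and n :: nat and mu :: "'g measure" and B :: "('g => complex) set" and N :: "('g => complex) => real"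
begin

sublocale B: complete_function_space B N
 by standard (rule add_mem scale_mem zero_mem norm_nonneg norm_triangle norm_scale complete; assumption)+

lemma AE_if_AE_compact:
 assumes "!!K. compact K ==> AE x in mu. x : K --> Q x"
 shows "AE x in mu. Q x"
proof -
 obtain eps where "0 : interior (exp_words gam n eps)" using box_words by blast
 then have ne: "interior (exp_words gam n eps) ~= {}" by blast
 obtain D where D: "countable D" "(\<Union>x\<in>D. (+) x ` interior (exp_words gam n eps)) = UNIV"
  using countable_translates[OF open_interior ne] by blast
 have "AE y in mu. y : (+) x ` exp_words gam n eps --> Q y" for x
  by (intro assms compact_continuous_image continuous_intros box_compact)
 then have "AE y in mu. ALL x:D. y : (+) x ` exp_words gam n eps --> Q y"
  by (intro AE_ball_countable[THEN iffD2] D(1) ballI)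
 then show ?thesis
 proof eventually_elim
  case (elim y)
  have "y : (\<Union>x\<in>D. (+) x ` interior (exp_words gam n eps))" using D(2) by simp
  then show "Q y" using elim interior_subset[of "exp_words gam n eps"] by blast
 qed
qed

definition tends_locally :: "(nat => 'g => complex) => ('g => complex) => bool" where
 "tends_locally F f \<longleftrightarrow> (ALL K dlt. compact K --> 0 < dlt -->
  (%m. measure mu {x : K. dlt <= norm (F m x - f x)}) \<longlonglongrightarrow> 0)"

lemma compact_fmeasurable: "compact K ==> K : fmeasurable mu"
 by (rule fmeasurableI) (simp_all only: sets_mu borel_closed compact_imp_closed emeasure_compact_finite)

lemma deviation_fmeasurable:
 assumes "compact K" and [measurable]: "f : Bmeas" "g : Bmeas"
 shows "{x : K. dlt <= norm (f x - g x :: complex)} : fmeasurable mu"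
proof (rule fmeasurableI2[OF compact_fmeasurable[OF assms(1)]])
 have "{x. dlt <= norm (f x - g x)} : sets borel" by measurable
 then have "K Int {x. dlt <= norm (f x - g x)} : sets borel"
  by (rule sets.Int[OF borel_closed[OF compact_imp_closed[OF assms(1)]]])
 then show "{x : K. dlt <= norm (f x - g x)} : sets mu" by (simp add: Int_def)
qed auto

lemma tends_locally_unique:
 assumes m: "!!m. F m : Bmeas" "f : Bmeas" "g : Bmeas"
  and F: "tends_locally F f" "tends_locally F g"
 shows "AE x in mu. f x = g x"
proof (rule AE_if_AE_compact)
 fix K :: "'g set" assume K: "compact K"
 define E where "E j = {x : K. 1 / real (Suc j) <= norm (f x - g x)}" for j
 have "AE x in mu. x ~: E j" for j
 proof -
  let ?d = "1 / real (Suc j) / 2"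
  have le: "measure mu (E j) <= measure mu {x : K. ?d <= norm (F m x - f x)} + measure mu {x : K. ?d <= norm (F m x - g x)}" for m
  proof -
   have fm: "{x : K. ?d <= norm (F m x - f x)} : fmeasurable mu" "{x : K. ?d <= norm (F m x - g x)} : fmeasurable mu"
    by (intro deviation_fmeasurable K assms)+
   have "measure mu (E j) <= measure mu ({x : K. ?d <= norm (F m x - f x)} Un {x : K. ?d <= norm (F m x - g x)})"
   proof (rule measure_mono_fmeasurable)
    show "E j <= {x : K. ?d <= norm (F m x - f x)} Un {x : K. ?d <= norm (F m x - g x)}"
    proof
     fix x assume x: "x : E j"
     have "norm (f x - g x) <= norm (F m x - g x) + norm (F m x - f x)"
      using norm_triangle_ineq4[of "F m x - g x" "F m x - f x"] by simp
     then show "x : {x : K. ?d <= norm (F m x - f x)} Un {x : K. ?d <= norm (F m x - g x)}"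
      using x field_sum_of_halves[of "1 / real (Suc j)"] unfolding E_def mem_Collect_eq Un_iff
      by (cases "?d <= norm (F m x - f x)") auto
    qed
    show "E j : sets mu" unfolding E_def using deviation_fmeasurable[OF K m(2,3)] by (rule fmeasurableD)
   qed (intro fmeasurable.Un fm)
   also have "... <= measure mu {x : K. ?d <= norm (F m x - f x)} + measure mu {x : K. ?d <= norm (F m x - g x)}"
    by (intro measure_Un_le fmeasurableD fm)
   finally show ?thesis .
  qed
  have "?d > 0" by simp
  then have "(%m. measure mu {x : K. ?d <= norm (F m x - f x)} + measure mu {x : K. ?d <= norm (F m x - g x)}) \<longlonglongrightarrow> 0 + 0"
   using F K unfolding tends_locally_def by (intro tendsto_add) blast+
  then have "measure mu (E j) <= 0 + 0" by (rule LIMSEQ_le_const) (use le in blast)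
  then have "emeasure mu (E j) = 0"
   using deviation_fmeasurable[OF K m(2,3)] by (simp add: E_def emeasure_eq_measure2 measure_le_0_iff)
  then show ?thesis
   using deviation_fmeasurable[OF K m(2,3)] unfolding E_def by (intro AE_not_in null_setsI fmeasurableD)
 qed
 then have "AE x in mu. ALL j. x ~: E j" by (simp add: AE_all_countable)
 then show "AE x in mu. x : K --> f x = g x"
 proof eventually_elim
  case (elim x)
  show ?case
  proof (rule impI, rule ccontr)
   assume x: "x : K" "f x ~= g x"
   then obtain j where "inverse (real (Suc j)) < norm (f x - g x)"
    using reals_Archimedean[of "norm (f x - g x)"] by auto
   then have "x : E j" using x(1) unfolding E_def by (simp add: inverse_eq_divide del: of_nat_Suc)
   then show False using elim by blast
  qed
 qed
qed

lemma tends_locally_pointwise: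
 assumes m: "!!m. F m : Bmeas" "f : Bmeas"
  and lim: "!!x. (%m. F m x) \<longlonglongrightarrow> f x"
 shows "tends_locally F f"
 unfolding tends_locally_def
proof (intro allI impI)
 fix K :: "'g set" and dlt :: real assume K: "compact K" and dlt: "0 < dlt"
 define E where "E m = {x : K. dlt <= norm (F m x - f x)}" for m
 have E: "E m : sets mu" for m
  unfolding E_def by (intro fmeasurableD deviation_fmeasurable K m)
 have "(%m. \<integral>x. indicator (E m) x \<partial>mu) \<longlonglongrightarrow> (\<integral>x. (0 :: real) \<partial>mu)"
 proof (rule integral_dominated_convergence[where w = "indicator K"])
  show "integrable mu (indicator K :: 'g => real)"
   using compact_fmeasurable[OF K] by (intro integrable_real_indicator) (auto simp: fmeasurable_def)
  show "AE x in mu. (%m. indicator (E m) x :: real) \<longlonglongrightarrow> 0"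
  proof (rule AE_I2, rule tendsto_eventually)
   fix x
   have "\<forall>\<^sub>F m in sequentially. dist (F m x) (f x) < dlt" by (rule tendstoD[OF lim dlt])
   then show "\<forall>\<^sub>F m in sequentially. (indicator (E m) x :: real) = 0"
    by eventually_elim (auto simp: E_def dist_norm)
  qed
  show "indicator (E m) : borel_measurable mu" for m using E by (rule borel_measurable_indicator)
  show "AE x in mu. norm (indicator (E m) x :: real) <= indicator K x" for m
   by (auto simp: E_def indicator_def)
 qed simp
 then show "(%m. measure mu (E m)) \<longlonglongrightarrow> 0" using E by simp
qed

lemma norm_cong_AE:
 assumes "f : B" "g : B" "AE x in mu. f x = g x"
 shows "N f = N g"
proof -
 have z: "N (%x. f x - g x) = 0"
  using assms by (subst norm_eq_zero) (auto intro: B.diff)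
 have "N f <= N (%x. f x - g x) + N g" using norm_triangle[OF B.diff[OF assms(1,2)] assms(2)] by simp
 moreover have "N g <= N (%x. g x - f x) + N f" using norm_triangle[OF B.diff[OF assms(2,1)] assms(1)] by simp
 ultimately show ?thesis using z B.N_commute[OF assms(1,2)] by simp
qed

lemma mem_cong_AE: "g : B ==> f : Bmeas ==> AE x in mu. f x = g x ==> f : B"
 by (erule solid) (auto elim: eventually_mono)

lemma series_bound:
 assumes F: "!!i. F i : B" "!!i. N (F i) <= C * (1 / 2) ^ i" and C: "0 <= C"
  and f: "f : Bmeas" and lim: "tends_locally (%m x. \<Sum>i<m. F i x) f"
 shows "f : B & N f <= 2 * C"
proof -
 define S where "S m x = (\<Sum>i<m. F i x)" for m x
 have S: "S m : B" for m unfolding S_def[abs_def] using B.sum_mem[of "{..<m}" F] F(1) by blast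
 have "N (%x. S (Suc m) x - S m x) <= C * (1 / 2) ^ m" for m
  using F(2)[of m] by (simp add: S_def)
 then obtain g where g: "g : B" "(%m. N (%x. S m x - g x)) \<longlonglongrightarrow> 0"
  using B.geometric_cauchy[of S C] S C by blast
 have "tends_locally S g" unfolding tends_locally_def
  using converges_locally_in_measure[of S g, OF S g] by blast
 moreover have "tends_locally S f" using lim unfolding S_def[abs_def] .
 ultimately have eq: "AE x in mu. f x = g x"
  using measurable[OF S] measurable[OF g(1)] f by (intro tends_locally_unique[of S])
 have fB: "f : B" by (rule mem_cong_AE[OF g(1) f eq])
 have NS: "N (S m) <= 2 * C" for m
 proof -
  have "N (S m) <= (\<Sum>i<m. N (F i))" unfolding S_def[abs_def] by (rule B.N_sum) (use F(1) in auto)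
  also have "... <= (\<Sum>i<m. C * (1 / 2) ^ i)" by (intro sum_mono F(2))
  also have "... = 2 * C - 2 * C * (1 / 2) ^ m" by (induction m) (auto simp: algebra_simps)
  also have "... <= 2 * C" using C by simp
  finally show ?thesis .
 qed
 have "N g <= 2 * C + N (%x. S m x - g x)" for m
 proof -
  have "N g <= N (%x. g x - S m x) + N (S m)" using norm_triangle[OF B.diff[OF g(1) S] S, of m m] by simp
  then show ?thesis using NS[of m] B.N_commute[OF g(1) S, of m] by simp
 qed
 moreover have "(%m. 2 * C + N (%x. S m x - g x)) \<longlonglongrightarrow> 2 * C + 0"
  by (intro tendsto_intros g(2))
 ultimately have "N g <= 2 * C + 0" by (intro LIMSEQ_le_const) auto
 then show ?thesis using fB norm_cong_AE[OF fB g(1) eq] by simp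
qed

text \<open>
 Multiplication of a fixed element of \<open>B\<close> with a bounded function is continuous in the bounded
 function: the seminorm in question is countably subadditive because of \<open>series_bound\<close>.
\<close>
lemma multiplier_bound:
 assumes g: "g : B"
 shows "EX C>=0. ALL m:Bmeas. (ALL x. norm (m x) <= 1) --> N (%x. m x * g x) <= C"
proof -
 define L :: "('g => complex) set" where "L = {m : Bmeas. EX c. ALL x. norm (m x) <= c}"
 define NL :: "('g => complex) => real" where "NL m = (SUP x. norm (m x))" for m
 have up: "norm (m x) <= NL m" if "m : L" for m x
 proof -
  obtain c where "ALL x. norm (m x) <= c" using \<open>m : L\<close> by (auto simp: L_def)
  then show ?thesis unfolding NL_def by (intro cSUP_upper bdd_aboveI[of _ c]) auto
 qed
 have least: "NL m <= c" if "!!x. norm (m x) <= c" for m c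
  unfolding NL_def using that by (intro cSUP_least) auto
 have L_meas: "m : Bmeas" if "m : L" for m using that by (simp add: L_def)
 have LI: "m : L" if "m : Bmeas" "!!x. norm (m x) <= c" for m c
  using that by (auto simp: L_def)
 have addL: "(%x. a x + b x) : L" if a: "a : L" and b: "b : L" for a b
  using L_meas[OF a] L_meas[OF b] up[OF a] up[OF b]
  by (intro LI[of _ "NL a + NL b"]) (auto intro: order_trans[OF norm_triangle_ineq] add_mono)
 have scaleL: "(%x. z * a x) : L" if a: "a : L" for a z
  using L_meas[OF a] up[OF a] by (intro LI[of _ "norm z * NL a"]) (auto simp: norm_mult intro: mult_left_mono)
 have nonnegL: "0 <= NL a" if "a : L" for a using up[OF that, of 0] norm_ge_zero order_trans by blast
 have hom: "NL (%x. z * a x) <= norm z * NL a" if "a : L" for a z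
  using up[OF that] by (intro least) (auto simp: norm_mult intro: mult_left_mono)
 interpret L: complete_function_space L NL
 proof
  show "(%_. 0) : L" by (rule LI[of _ 0]) auto
  show "NL (%x. a x + b x) <= NL a + NL b" if "a : L" "b : L" for a b
   using up[OF that(1)] up[OF that(2)] by (intro least) (auto intro: order_trans[OF norm_triangle_ineq] add_mono)
  show "NL (%x. z * a x) = norm z * NL a" if a: "a : L" for a z
  proof (cases "z = 0")
   case True
   then show ?thesis using hom[OF a, of z] nonnegL[OF scaleL[OF a, of z]] by simp
  next
   case False
   have "NL a = NL (%x. 1 / z * (z * a x))" using False by simp
   also have "... <= norm (1 / z) * NL (%x. z * a x)" by (rule hom[OF scaleL[OF a]])
   finally have "norm z * NL a <= NL (%x. z * a x)" using False by (simp add: norm_divide field_simps)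
   then show ?thesis using hom[OF a, of z] by simp
  qed
  fix F :: "nat => 'g => complex" assume F: "!!m. F m : L" and C: "!!e. 0 < e ==> EX M. ALL m>=M. ALL k>=M. NL (%x. F m x - F k x) < e"
  have dL: "(%x. a x - b x) : L" if "a : L" "b : L" for a b
   using addL[OF that(1) scaleL[OF that(2), of "-1"]] by simp
  have Cx: "EX M. ALL m>=M. ALL k>=M. ALL x. norm (F m x - F k x) < e" if "e > 0" for e
   using C[OF that] up[OF dL[OF F F]] by (meson le_less_trans)
  have "Cauchy (%m. F m x)" for x
   unfolding Cauchy_def dist_norm using Cx by meson
  then have lim: "(%m. F m x) \<longlonglongrightarrow> lim (%m. F m x)" for x
   by (simp add: Cauchy_convergent convergent_LIMSEQ_iff[symmetric])
  define f where "f x = lim (%m. F m x)" for x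
  have fm: "f : Bmeas"
   by (rule borel_measurable_LIMSEQ_metric[of F]) (use L_meas[OF F] lim in \<open>auto simp: f_def\<close>)
  have unif: "EX M. ALL m>=M. ALL x. norm (F m x - f x) <= e" if e: "e > 0" for e
  proof -
   obtain M where M: "!!m k x. m >= M ==> k >= M ==> norm (F m x - F k x) < e" using Cx[OF e] by blast
   have "norm (F m x - f x) <= e" if "m >= M" for m x
   proof (rule LIMSEQ_le_const2)
    show "(%k. norm (F m x - F k x)) \<longlonglongrightarrow> norm (F m x - f x)"
     unfolding f_def by (intro tendsto_intros lim)
    show "EX K. ALL k>=K. norm (F m x - F k x) <= e" using M[OF that] by (meson less_imp_le)
   qed
   then show ?thesis by blast
  qed
  obtain M where M: "!!x. norm (F M x - f x) <= 1" using unif[of 1] by auto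
  have fL: "f : L"
  proof (rule LI[OF fm])
   fix x
   have "norm (f x) <= norm (F M x) + norm (F M x - f x)"
    using norm_triangle_ineq4[of "F M x" "F M x - f x"] by simp
   then show "norm (f x) <= NL (F M) + 1" using up[OF F, of M x] M[of x] by simp
  qed
  have "(%m. NL (%x. F m x - f x)) \<longlonglongrightarrow> 0"
  proof (rule LIMSEQ_I)
   fix e :: real assume "e > 0"
   then obtain M where M: "!!m x. m >= M ==> norm (F m x - f x) <= e / 2" using unif[of "e / 2"] by auto
   have "norm (NL (%x. F m x - f x) - 0) < e" if "m >= M" for m
    using least[of "%x. F m x - f x", OF M[OF that]] nonnegL[OF dL[OF F fL], of m] \<open>e > 0\<close> by simp
   then show "EX M. ALL m>=M. norm (NL (%x. F m x - f x) - 0) < e" by blast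
  qed
  then show "EX f:L. (%m. NL (%x. F m x - f x)) \<longlonglongrightarrow> 0" using fL by blast
 qed (rule addL scaleL nonnegL; assumption)+
 have mem: "(%x. m x * g x) : B" if m: "m : L" for m
 proof (rule solid[OF B.scale[OF g, of "of_real (NL m)"]])
  show "(%x. m x * g x) : Bmeas" using L_meas[OF m] measurable[OF g] by measurable
  show "AE x in mu. norm (m x * g x) <= norm (of_real (NL m) * g x)"
   using up[OF m] nonnegL[OF m] by (simp add: norm_mult mult_right_mono)
 qed
 have "EX C>=0. ALL m:L. N (%x. m x * g x) <= C * NL m"
 proof (rule L.zabreiko)
  fix a b z assume a: "a : L"
  show "0 <= N (%x. a x * g x)" by (rule norm_nonneg[OF mem[OF a]])
  show "N (%x. (z * a x) * g x) = norm z * N (%x. a x * g x)"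
   using norm_scale[OF mem[OF a], of z] by (simp add: mult.assoc)
  assume b: "b : L"
  show "N (%x. (a x + b x) * g x) <= N (%x. a x * g x) + N (%x. b x * g x)"
   using norm_triangle[OF mem[OF a] mem[OF b]] by (simp add: distrib_right)
 next
  fix F f C assume F: "!!m. F m : L" "f : L" "0 <= C" "!!m. N (%x. F m x * g x) <= C * (1 / 2) ^ m"
   and lim: "(%m. NL (%x. (\<Sum>i<m. F i x) - f x)) \<longlonglongrightarrow> 0"
  have sum: "(%x. \<Sum>i<m. F i x) : L" for m using L.sum_mem[of "{..<m}" F] F(1) by blast
  have ptw: "(%m. (\<Sum>i<m. F i x)) \<longlonglongrightarrow> f x" for x
  proof (rule Lim_null[THEN iffD2], rule Lim_null_comparison[OF _ lim])
   show "\<forall>\<^sub>F m in sequentially. norm ((\<Sum>i<m. F i x) - f x) <= NL (%x. (\<Sum>i<m. F i x) - f x)"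
    using up[OF L.diff[OF sum F(2)]] by simp
  qed
  have "(%x. f x * g x) : B & N (%x. f x * g x) <= 2 * C"
  proof (rule series_bound[OF mem[OF F(1)] F(4,3)])
   show "tends_locally (%m x. \<Sum>i<m. F i x * g x) (%x. f x * g x)"
   proof (rule tends_locally_pointwise)
    show "(%m. \<Sum>i<m. F i x * g x) \<longlonglongrightarrow> f x * g x" for x
     unfolding sum_distrib_right[symmetric] by (intro tendsto_intros ptw)
    show "(%x. \<Sum>i<m. F i x * g x) : Bmeas" for m
     using L_meas[OF F(1)] measurable[OF g] by measurable
   qed (use measurable[OF mem[OF F(2)]] in simp)
  qed (use measurable[OF mem[OF F(2)]] in simp)
  then show "N (%x. f x * g x) <= 2 * C" ..
 qed
 then obtain C where C: "C >= 0" "!!m. m : L ==> N (%x. m x * g x) <= C * NL m" by blast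
 show ?thesis
 proof (intro exI[of _ C] conjI ballI impI C(1))
  fix m :: "'g => complex" assume m: "m : Bmeas" "ALL x. norm (m x) <= 1"
  have "m : L" by (rule LI[of _ 1]) (use m in auto)
  have "N (%x. m x * g x) <= C * NL m" by (rule C(2)) fact
  also have "... <= C * 1" using m C(1) by (intro mult_left_mono least) auto
  finally show "N (%x. m x * g x) <= C" by simp
 qed
qed

text \<open>
 A second application of Zabreiko's lemma, to the supremum over all multipliers.
\<close>
lemma solid_norm:
 obtains C where "C > 0"
  "!!f g :: 'g => complex. g : B ==> f : Bmeas ==> AE x in mu. norm (f x) <= norm (g x) ==> N f <= C * N g"
proof -
 define Q :: "('g => complex) set" where "Q = {m : Bmeas. ALL x. norm (m x) <= 1}"
 have one: "(%_. 1) : Q" by (simp add: Q_def)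
 define p where "p g = (SUP m\<in>Q. N (%x. m x * g x))" for g
 have mem: "(%x. m x * g x) : B" if m: "m : Q" and g: "g : B" for m g
 proof (rule solid[OF g])
  show "(%x. m x * g x) : Bmeas" using m measurable[OF g] by (auto simp: Q_def)
  show "AE x in mu. norm (m x * g x) <= norm (g x)"
   using m by (auto simp: Q_def norm_mult mult_left_le_one_le)
 qed
 have up: "N (%x. m x * g x) <= p g" if m: "m : Q" and g: "g : B" for m g
 proof -
  obtain C where "ALL m:Q. N (%x. m x * g x) <= C" using multiplier_bound[OF g] by (auto simp: Q_def)
  then show ?thesis unfolding p_def by (intro cSUP_upper m bdd_aboveI[of _ C]) auto
 qed
 have least: "p g <= c" if "!!m. m : Q ==> N (%x. m x * g x) <= c" for g c
  unfolding p_def using one that by (intro cSUP_least) auto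
 have pnn: "0 <= p g" if "g : B" for g
  using norm_nonneg[OF mem[OF one that]] up[OF one that] by simp
 have hom: "p (%x. z * g x) <= norm z * p g" if g: "g : B" for z g
 proof (rule least)
  fix m assume m: "m : Q"
  have "N (%x. m x * (z * g x)) = norm z * N (%x. m x * g x)"
   using norm_scale[OF mem[OF m g], of z] by (simp add: mult.left_commute)
  also have "... <= norm z * p g" by (intro mult_left_mono up m g) simp
  finally show "N (%x. m x * (z * g x)) <= norm z * p g" .
 qed
 have "EX C>=0. ALL g:B. p g <= C * N g"
 proof (rule B.zabreiko)
  fix g h z assume g: "g : B"
  show "0 <= p g" by (rule pnn[OF g])
  show "p (%x. z * g x) = norm z * p g"
  proof (cases "z = 0")
   case True
   then show ?thesis using hom[OF g, of z] pnn[OF B.scale[OF g, of z]] by simp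
  next
   case False
   have "p g = p (%x. 1 / z * (z * g x))" using False by simp
   also have "... <= norm (1 / z) * p (%x. z * g x)" by (rule hom[OF B.scale[OF g]])
   finally have "norm z * p g <= p (%x. z * g x)" using False by (simp add: norm_divide field_simps)
   then show ?thesis using hom[OF g, of z] by simp
  qed
  assume h: "h : B"
  show "p (%x. g x + h x) <= p g + p h"
  proof (rule least)
   fix m assume m: "m : Q"
   have "N (%x. m x * (g x + h x)) <= N (%x. m x * g x) + N (%x. m x * h x)"
    using norm_triangle[OF mem[OF m g] mem[OF m h]] by (simp add: distrib_left)
   also have "... <= p g + p h" by (intro add_mono up m g h)
   finally show "N (%x. m x * (g x + h x)) <= p g + p h" .
  qed
 next
  fix F f C assume F: "!!m. F m : B" "f : B" "0 <= C" "!!m. p (F m) <= C * (1 / 2) ^ m"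
   and lim: "(%m. N (%x. (\<Sum>i<m. F i x) - f x)) \<longlonglongrightarrow> 0"
  have S: "(%x. \<Sum>i<m. F i x) : B" for m using B.sum_mem[of "{..<m}" F] F(1) by blast
  show "p f <= 2 * C"
  proof (rule least)
   fix m assume m: "m : Q"
   have "(%x. m x * f x) : B & N (%x. m x * f x) <= 2 * C"
   proof (rule series_bound[OF mem[OF m F(1)] order_trans[OF up[OF m F(1)] F(4)] F(3)])
    show "tends_locally (%k x. \<Sum>i<k. m x * F i x) (%x. m x * f x)"
     unfolding tends_locally_def
    proof (intro allI impI)
     fix K dlt assume K: "compact (K :: 'g set)" "0 < (dlt :: real)"
     have le: "measure mu {x : K. dlt <= norm ((\<Sum>i<k. m x * F i x) - m x * f x)}
       <= measure mu {x : K. dlt <= norm ((\<Sum>i<k. F i x) - f x)}" for k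
     proof (rule measure_mono_fmeasurable)
      show "{x : K. dlt <= norm ((\<Sum>i<k. F i x) - f x)} : fmeasurable mu"
       by (intro deviation_fmeasurable K measurable S F(2))
      have "(%x. \<Sum>i<k. m x * F i x) : Bmeas"
       using measurable[OF mem[OF m F(1)]] by measurable
      then show "{x : K. dlt <= norm ((\<Sum>i<k. m x * F i x) - m x * f x)} : sets mu"
       by (intro fmeasurableD deviation_fmeasurable K measurable[OF mem[OF m F(2)]])
      have "norm ((\<Sum>i<k. m x * F i x) - m x * f x) <= norm ((\<Sum>i<k. F i x) - f x)" for x
      proof -
       have "(\<Sum>i<k. m x * F i x) - m x * f x = m x * ((\<Sum>i<k. F i x) - f x)"
        by (simp add: sum_distrib_left right_diff_distrib)
       moreover have "norm (m x) <= 1" using m by (simp add: Q_def)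
       ultimately show ?thesis by (simp add: norm_mult mult_left_le_one_le)
      qed
      then show "{x : K. dlt <= norm ((\<Sum>i<k. m x * F i x) - m x * f x)}
       <= {x : K. dlt <= norm ((\<Sum>i<k. F i x) - f x)}"
       by (auto intro: order_trans)
     qed
     show "(%k. measure mu {x : K. dlt <= norm ((\<Sum>i<k. m x * F i x) - m x * f x)}) \<longlonglongrightarrow> 0"
      by (rule tendsto_sandwich[OF _ _ tendsto_const converges_locally_in_measure[OF S F(2) lim K]])
       (use le in auto)
    qed
    show "(%x. m x * f x) : Bmeas" by (rule measurable[OF mem[OF m F(2)]])
   qed
   then show "N (%x. m x * f x) <= 2 * C" ..
  qed
 qed
 then obtain C where C: "C >= 0" "!!g. g : B ==> p g <= C * N g" by blast
 show ?thesis
 proof (rule that[of "C + 1"])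
  fix f g :: "'g => complex" assume g: "g : B" and f [measurable]: "f : Bmeas" and le: "AE x in mu. norm (f x) <= norm (g x)"
  have [measurable]: "g : Bmeas" by (rule measurable[OF g])
  define m where "m x = (if norm (f x) <= norm (g x) then f x / g x else 0)" for x
  have "m : Bmeas" unfolding m_def[abs_def] by measurable
  moreover have "norm (m x) <= 1" for x by (simp add: m_def norm_divide divide_le_eq_1)
  ultimately have m: "m : Q" by (simp add: Q_def)
  have eq: "AE x in mu. f x = m x * g x" using le by eventually_elim (auto simp: m_def)
  have "N f = N (%x. m x * g x)"
   by (rule norm_cong_AE[OF mem_cong_AE[OF mem[OF m g] f eq] mem[OF m g] eq])
  also have "... <= C * N g" by (rule order_trans[OF up[OF m g] C(2)[OF g]])
  also have "... <= (C + 1) * N g" using norm_nonneg[OF g] by (simp add: distrib_right)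
  finally show "N f <= (C + 1) * N g" .
 qed (use C(1) in simp)
qed

end

section \<open>Domination by elements of the space\<close>

context sampling_space
begin

sublocale haar: sigma_finite_measure mu by (rule sigma_finite)

sublocale haar2: pair_sigma_finite mu mu by standard

lemma measurable_uminus_group [measurable (raw)]:
 "f : borel_measurable M ==> (%x. - f x :: 'g) : borel_measurable M"
 by (rule borel_measurable_continuous_on[of uminus]) (intro continuous_intros)

lemma integrable_left_iff:
 fixes F :: "'g => complex"
 assumes [measurable]: "F : Bmeas"
 shows "integrable mu (%z. F (y + z)) \<longleftrightarrow> integrable mu F" "(\<integral>z. F (y + z) \<partial>mu) = (\<integral>z. F z \<partial>mu)"
proof -
 have mu: "distr mu borel ((+) y) = mu" using haar by (simp add: left_haar_measure_def)
 have m: "(+) y : measurable mu borel" by (simp add: measurable_mu_iff)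
 show "integrable mu (%z. F (y + z)) \<longleftrightarrow> integrable mu F"
  using integrable_distr_eq[OF m assms] unfolding mu by simp
 show "(\<integral>z. F (y + z) \<partial>mu) = (\<integral>z. F z \<partial>mu)"
  using integral_distr[OF m assms] unfolding mu by simp
qed

definition nconv :: "('g => ennreal) => ('g => ennreal) => 'g => ennreal" where
 "nconv h k y = (\<integral>\<^sup>+x. h x * k (- x + y) \<partial>mu)"

lemma nconv_measurable [measurable]:
 assumes [measurable]: "h : Bmeas" "k : Bmeas"
 shows "nconv h k : Bmeas"
 unfolding nconv_def[abs_def] by measurable

lemma nconv_mono_AE: "AE x in mu. h x <= h' x ==> nconv h k y <= nconv h' k y"
 unfolding nconv_def by (intro nn_integral_mono_AE) (auto elim!: eventually_mono intro: mult_right_mono)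

lemma nconv_assoc:
 assumes [measurable]: "h : Bmeas" "k : Bmeas" "k' : Bmeas"
 shows "nconv (nconv h k) k' y = nconv h (nconv k k') y"
proof -
 have "nconv (nconv h k) k' y = (\<integral>\<^sup>+x. \<integral>\<^sup>+z. h z * (k (- z + x) * k' (- x + y)) \<partial>mu \<partial>mu)"
  unfolding nconv_def by (simp add: nn_integral_multc[symmetric] mult.assoc)
 also have "... = (\<integral>\<^sup>+z. \<integral>\<^sup>+x. h z * (k (- z + x) * k' (- x + y)) \<partial>mu \<partial>mu)"
  by (rule haar2.Fubini') measurable
 also have "... = (\<integral>\<^sup>+z. h z * nconv k k' (- z + y) \<partial>mu)"
 proof (intro nn_integral_cong)
  fix z
  have "(\<integral>\<^sup>+x. h z * (k (- z + x) * k' (- x + y)) \<partial>mu) = (\<integral>\<^sup>+x. h z * (k (- z + (z + x)) * k' (- (z + x) + y)) \<partial>mu)"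
   by (rule nn_integral_left[symmetric]) measurable
  also have "... = (\<integral>\<^sup>+x. h z * (k x * k' (- x + (- z + y))) \<partial>mu)"
   by (simp add: add.assoc[symmetric] minus_add del: add_uminus_conv_diff)
  also have "... = h z * nconv k k' (- z + y)"
   unfolding nconv_def by (intro nn_integral_cmult) measurable
  finally show "(\<integral>\<^sup>+x. h z * (k (- z + x) * k' (- x + y)) \<partial>mu) = h z * nconv k k' (- z + y)" .
 qed
 finally show ?thesis unfolding nconv_def[of h] .
qed

definition solidC :: real where
 "solidC = (SOME C. C > 0 & (ALL f g :: 'g => complex. g : B --> f : Bmeas -->
  (AE x in mu. norm (f x) <= norm (g x)) --> N f <= C * N g))"

lemma solidC:
 "solidC > 0"
 "g : B ==> f : Bmeas ==> AE x in mu. norm (f x) <= norm (g x) ==> N f <= solidC * N g"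
proof -
 have "EX C. C > 0 & (ALL f g :: 'g => complex. g : B --> f : Bmeas -->
  (AE x in mu. norm (f x) <= norm (g x)) --> N f <= C * N g)"
 proof (rule solid_norm)
  fix C assume "C > 0" and "!!f g :: 'g => complex. g : B ==> f : Bmeas ==>
   AE x in mu. norm (f x) <= norm (g x) ==> N f <= C * N g"
  then show ?thesis by (intro exI[of _ C] conjI allI impI)
 qed
 from someI_ex[OF this, folded solidC_def]
 have C: "solidC > 0 & (ALL f g :: 'g => complex. g : B --> f : Bmeas -->
  (AE x in mu. norm (f x) <= norm (g x)) --> N f <= solidC * N g)" .
 show "solidC > 0" by (rule C[THEN conjunct1])
 show "g : B ==> f : Bmeas ==> AE x in mu. norm (f x) <= norm (g x) ==> N f <= solidC * N g"
  by (rule C[THEN conjunct2, rule_format])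
qed

text \<open>
 All estimates are for functions with values in the extended non-negative reals; this is the
 statement that such a function belongs to \<open>B\<close> with a norm bound. The majorant makes it additive
 without loss of a constant.
\<close>
definition dominated :: "('g => ennreal) => real => bool" where
 "dominated h r \<longleftrightarrow> (EX g. (%x. cplx (g x)) : B & (ALL x. 0 <= g x) &
  N (%x. cplx (g x)) <= r & (AE x in mu. h x <= ennreal (g x)))"

lemma dominated_mono_AE:
 assumes "dominated h' r" "AE x in mu. h x <= h' x"
 shows "dominated h r"
proof -
 obtain g where g: "(%x. cplx (g x)) : B" "ALL x. 0 <= g x"
  "N (%x. cplx (g x)) <= r" "AE x in mu. h' x <= ennreal (g x)"
  using assms(1) unfolding dominated_def by (elim exE conjE)
 have "AE x in mu. h x <= ennreal (g x)"
  using assms(2) g(4) by eventually_elim (rule order_trans)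
 then show ?thesis unfolding dominated_def by (intro exI[of _ g] conjI g(1-3))
qed

lemma dominated_mono: "dominated h' r ==> (!!x. h x <= h' x) ==> r <= s ==> dominated h s"
proof -
 assume a: "dominated h' r" "!!x. h x <= h' x" "r <= s"
 have "dominated h r" by (rule dominated_mono_AE[OF a(1)]) (simp add: a(2))
 then obtain g where g: "(%x. cplx (g x)) : B" "ALL x. 0 <= g x"
  "N (%x. cplx (g x)) <= r" "AE x in mu. h x <= ennreal (g x)"
  unfolding dominated_def by (elim exE conjE)
 then show ?thesis
  unfolding dominated_def by (intro exI[of _ g] conjI g(1,2,4) order_trans[OF g(3) a(3)])
qed

lemma norm_mem: "f : B ==> (%x. cplx (norm (f x))) : B"
proof (rule solid)
 assume f: "f : B"
 then show "f : B" .
 have [measurable]: "f : Bmeas" by (rule measurable[OF f])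
 show "(%x. cplx (norm (f x))) : Bmeas" by measurable
qed simp

lemma dominated_mem: "f : B ==> dominated (%x. enorm (f x)) (solidC * N f)"
 unfolding dominated_def
proof (intro exI[of _ "%x. norm (f x)"] conjI allI)
 assume f: "f : B"
 show "(%x. cplx (norm (f x))) : B" by (rule norm_mem[OF f])
 then show "N (%x. cplx (norm (f x))) <= solidC * N f"
  by (intro solidC(2)[OF f] measurable) simp_all
qed simp_all

lemma dominated_add:
 assumes "dominated h r" "dominated h' r'"
 shows "dominated (%x. h x + h' x) (r + r')"
proof -
 obtain g g' where g: "(%x. cplx (g x)) : B" "!!x. 0 <= g x"
  "N (%x. cplx (g x)) <= r" "AE x in mu. h x <= ennreal (g x)"
  and g': "(%x. cplx (g' x)) : B" "!!x. 0 <= g' x"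
  "N (%x. cplx (g' x)) <= r'" "AE x in mu. h' x <= ennreal (g' x)"
  using assms unfolding dominated_def by blast
 show ?thesis unfolding dominated_def
 proof (intro exI[of _ "%x. g x + g' x"] conjI allI)
  show "(%x. cplx (g x + g' x)) : B" using add_mem[OF g(1) g'(1)] by simp
  show "N (%x. cplx (g x + g' x)) <= r + r'"
   using norm_triangle[OF g(1) g'(1)] g(3) g'(3) by simp
  show "AE x in mu. h x + h' x <= ennreal (g x + g' x)"
   using g(4) g'(4) by eventually_elim (simp add: g(2) g'(2) ennreal_plus add_mono)
 qed (use g(2) g'(2) in simp)
qed

lemma dominated_zero: "dominated (%_. 0) 0"
 unfolding dominated_def using zero_mem B.N_zero by (intro exI[of _ "%_. 0"]) auto

lemma dominated_sum:
 "finite I ==> (!!i. i : I ==> dominated (h i) (r i)) ==> dominated (%x. \<Sum>i\<in>I. h i x) (\<Sum>i\<in>I. r i)"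
 by (induction I rule: finite_induct) (auto intro: dominated_add dominated_zero)

lemma dominated_cmult:
 assumes "dominated h r" and c: "0 <= c"
 shows "dominated (%x. ennreal c * h x) (c * r)"
proof -
 obtain g where g: "(%x. cplx (g x)) : B" "!!x. 0 <= g x"
  "N (%x. cplx (g x)) <= r" "AE x in mu. h x <= ennreal (g x)"
  using assms(1) unfolding dominated_def by (elim exE conjE) (rule that, simp_all)
 show ?thesis unfolding dominated_def
 proof (intro exI[of _ "%x. c * g x"] conjI allI)
  show "(%x. cplx (c * g x)) : B" using scale_mem[OF g(1), of "of_real c"] by simp
  show "N (%x. cplx (c * g x)) <= c * r"
   using norm_scale[OF g(1), of "of_real c"] g(3) c by (simp add: mult_left_mono)
  show "AE x in mu. ennreal c * h x <= ennreal (c * g x)"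
   using g(4) by eventually_elim (simp add: c g(2) ennreal_mult mult_left_mono)
 qed (use g(2) c in simp)
qed

lemma dominated_bound:
 assumes "dominated h r" and F: "F : Bmeas" and le: "AE x in mu. enorm (F x) <= h x"
 shows "F : B & N F <= solidC * r"
proof -
 obtain g where g: "(%x. cplx (g x)) : B" "!!x. 0 <= g x"
  "N (%x. cplx (g x)) <= r" "AE x in mu. h x <= ennreal (g x)"
  using assms unfolding dominated_def by blast
 have le: "AE x in mu. norm (F x) <= norm (cplx (g x))"
  using le g(4)
 proof eventually_elim
  case (elim x)
  then have "enorm (F x) <= ennreal (g x)" by (rule order_trans)
  then show ?case using g(2)[of x] by simp
 qed
 have "N F <= solidC * N (%x. cplx (g x))" by (rule solidC(2)[OF g(1) F le])
 also have "... <= solidC * r" using g(3) solidC(1) by (intro mult_left_mono) auto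
 finally show ?thesis using solid[OF g(1) F le] by blast
qed

lemma dominated_nconv:
 fixes k :: "'g => real"
 assumes k: "conv_continuous mu B N (%y. of_real (k y))" "!!y. 0 <= k y"
 shows "EX C>=0. ALL h r. dominated h r --> dominated (nconv h (%x. ennreal (k x))) (C * r)"
proof -
 obtain C where C: "!!f. f : B ==> N (conv mu f (%y. of_real (k y))) <= C * N f"
  using k by (auto simp: conv_continuous_def)
 show ?thesis
 proof (intro exI[of _ "solidC * \<bar>C\<bar>"] conjI allI impI)
  fix h r assume "dominated h r"
  then obtain g where g: "(%x. cplx (g x)) : B" "!!x. 0 <= g x"
  "N (%x. cplx (g x)) <= r" "AE x in mu. h x <= ennreal (g x)"
   unfolding dominated_def by blast
  let ?c = "conv mu (%x. cplx (g x)) (%y. of_real (k y))"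
  have cB: "?c : B" using k g(1) by (auto simp: conv_continuous_def)
  have "AE y in mu. integrable mu (%x. cplx (g x) * of_real (k (- x + y)))"
   using k g(1) by (auto simp: conv_continuous_def)
  then have "AE y in mu. nconv h (%x. ennreal (k x)) y <= enorm (?c y)"
  proof eventually_elim
   case (elim y)
   then have "integrable mu (%x. cplx (g x * k (- x + y)))" by simp
   then have int: "integrable mu (%x. g x * k (- x + y))" by (simp only: complex_of_real_integrable_eq)
   have "nconv h (%x. ennreal (k x)) y <= nconv (%x. ennreal (g x)) (%x. ennreal (k x)) y"
    by (rule nconv_mono_AE[OF g(4)])
   also have "... = (\<integral>\<^sup>+x. ennreal (g x * k (- x + y)) \<partial>mu)"
    unfolding nconv_def using g(2) k(2) by (simp add: ennreal_mult)
   also have "... = ennreal (\<integral>x. g x * k (- x + y) \<partial>mu)"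
    by (rule nn_integral_eq_integral[OF int]) (simp add: g(2) k(2))
   also have "... = enorm (?c y)"
   proof -
    have "?c y = cplx (\<integral>x. g x * k (- x + y) \<partial>mu)"
     unfolding conv_def by (simp flip: of_real_mult)
    moreover have "0 <= (\<integral>x. g x * k (- x + y) \<partial>mu)" by (intro integral_nonneg_AE) (simp add: g(2) k(2))
    ultimately show ?thesis by simp
   qed
   finally show ?case .
  qed
  from dominated_mono_AE[OF dominated_mem[OF cB] this]
  have "dominated (nconv h (%x. ennreal (k x))) (solidC * N ?c)" .
  moreover have "solidC * N ?c <= solidC * \<bar>C\<bar> * r"
  proof -
   have "N ?c <= C * N (%x. cplx (g x))" by (rule C[OF g(1)])
   also have "... <= \<bar>C\<bar> * r" using g(3) norm_nonneg[OF g(1)] by (intro mult_mono) auto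
   finally show ?thesis using solidC(1) by (simp add: mult.assoc mult_left_mono)
  qed
  ultimately show "dominated (nconv h (%x. ennreal (k x))) (solidC * \<bar>C\<bar> * r)"
   using dominated_mono[OF _ order_refl] by blast
 qed (use solidC(1) in simp)
qed

text \<open>
 Null sets are invariant under right translations because their indicator functions have norm
 zero and right translation is bounded.
\<close>
lemma AE_right_translate:
 assumes "AE x in mu. Q x"
 shows "AE x in mu. Q (x + a)"
proof -
 obtain E where E: "{x. ~ Q x} <= E" "E : null_sets mu" using assms by (auto simp: eventually_ae_filter)
 let ?f = "%x. cplx (indicator E x)"
 have Eb: "E : sets borel" using E(2) by auto
 have z: "AE x in mu. ?f x = 0" using AE_not_in[OF E(2)] by eventually_elim simp
 have f: "?f : B" by (rule mem_cong_AE[OF zero_mem _ z]) (use Eb in measurable)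
 obtain C where "ALL y:{a}. ALL f:B. N (right_transl y f) <= C * N f"
  using right_transl_bound[of "{a}"] by auto
 then have "N (right_transl a ?f) <= C * N ?f" using f by blast
 moreover have "N ?f = 0" using norm_eq_zero[OF f] z by simp
 ultimately have "N (right_transl a ?f) = 0"
  using norm_nonneg[OF right_transl_mem[OF f]] by (simp add: order_antisym)
 then have "AE x in mu. right_transl a ?f x = 0" using norm_eq_zero[OF right_transl_mem[OF f]] by simp
 then show ?thesis
 proof eventually_elim
  case (elim x)
  then have "x + a ~: E" by (auto simp: right_transl_def indicator_def split: if_splits)
  then show "Q (x + a)" using E(1) by blast
 qed
qed

lemma dominated_right_translate: "EX C>=0. ALL h r. dominated h r --> dominated (%y. h (y + a)) (C * r)"
proof -
 obtain C where "ALL y:{a}. ALL f:B. N (right_transl y f) <= C * N f"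
  using right_transl_bound[of "{a}"] by auto
 then have C: "N (%y. f (y + a)) <= C * N f" if "f : B" for f using that by (simp add: right_transl_def)
 show ?thesis
 proof (intro exI[of _ "\<bar>C\<bar>"] conjI allI impI)
  fix h r assume "dominated h r"
  then obtain g where g: "(%x. cplx (g x)) : B" "!!x. 0 <= g x"
  "N (%x. cplx (g x)) <= r" "AE x in mu. h x <= ennreal (g x)"
   unfolding dominated_def by blast
  show "dominated (%y. h (y + a)) (\<bar>C\<bar> * r)"
   unfolding dominated_def
  proof (intro exI[of _ "%y. g (y + a)"] conjI allI g(2))
   show "(%y. cplx (g (y + a))) : B"
    using right_transl_mem[OF g(1), of a] by (simp add: right_transl_def)
   have "N (%y. cplx (g (y + a))) <= C * N (%y. cplx (g y))" by (rule C[OF g(1)])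
   also have "... <= \<bar>C\<bar> * r" using g(3) norm_nonneg[OF g(1)] by (intro mult_mono) auto
   finally show "N (%y. cplx (g (y + a))) <= \<bar>C\<bar> * r" .
   show "AE y in mu. h (y + a) <= ennreal (g (y + a))" by (rule AE_right_translate[OF g(4)])
  qed
 qed simp
qed

end

section \<open>Smooth reproducing kernels\<close>

text \<open>
 \<open>DR\<close> and \<open>DL\<close> are the families of right and left derivatives of the kernel, indexed by lists with
 the latest derivative first.
\<close>
locale smooth_kernel_space = sampling_space gam n mu B N
 for gam :: "nat => real => 'g::{topological_group_add, t2_space, second_countable_topology}"
  and n :: nat and mu :: "'g measure" and B :: "('g => complex) set" and N :: "('g => complex) => real" +
 fixes phi :: "'g => complex" and DR DL :: "nat list => 'g => complex"
 assumes kernel: "reproducing_kernel mu B N phi"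
  and DR: "right_tower gam n n DR" "DR [] = phi"
  and DL_measurable: "set alp <= {1..n} ==> length alp <= n ==> DL alp : Bmeas"
  and DL_deriv: "set alp <= {1..n} ==> length alp < n ==> k : {1..n} ==>
   ((%t. DL alp (gam k t + x)) has_vector_derivative DL (k # alp) x) (at 0)"
  and DL_Nil: "DL [] = phi"
  and conv_DR: "set alp <= {1..n} ==> length alp <= n ==> conv_continuous mu B N (%y. of_real (norm (DR alp y)))"
  and conv_DL: "set alp <= {1..n} ==> length alp <= n ==> conv_continuous mu B N (%y. of_real (norm (DL alp y)))"
begin

lemma phi_mem: "phi : B" using kernel by (simp add: reproducing_kernel_def)

lemma phi_measurable [measurable]: "phi : Bmeas" by (rule measurable[OF phi_mem])

lemma pairing:
 assumes f: "f : B"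
 shows "integrable mu (%x. f x * phi (- x + y))"
  and "conv mu f phi y = (\<integral>z. f (y + z) * phi (- z) \<partial>mu)"
proof -
 have [measurable]: "f : Bmeas" by (rule measurable[OF f])
 have eq: "f (y + z) * phi (- (y + z) + y) = f (y + z) * phi (- z)" for z
  by (simp add: minus_add add.assoc del: add_uminus_conv_diff)
 have m: "(%x. f x * phi (- x + y)) : Bmeas" by measurable
 have "left_transl (- y) f : B" by (rule left_transl_mem[OF f])
 then have "integrable mu (%z. f (y + z) * phi (- z))"
  using kernel by (simp add: reproducing_kernel_def left_transl_def)
 then show "integrable mu (%x. f x * phi (- x + y))"
  using integrable_left_iff(1)[OF m, of y] by (simp add: eq)
 show "conv mu f phi y = (\<integral>z. f (y + z) * phi (- z) \<partial>mu)"
  unfolding conv_def using integrable_left_iff(2)[OF m, of y] by (simp add: eq)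
qed

lemma conv_bound: "EX C. ALL f:B. norm (conv mu f phi y) <= C * N f"
proof -
 obtain C where C: "!!f. f : B ==> norm (\<integral>y. f y * phi (- y) \<partial>mu) <= C * N f"
  using kernel by (auto simp: reproducing_kernel_def)
 obtain C' where "ALL u:{- y}. ALL f:B. N (left_transl u f) <= C' * N f"
  using left_transl_bound[of "{- y}"] by auto
 then have C': "N (%z. f (y + z)) <= C' * N f" if "f : B" for f using that by (simp add: left_transl_def)
 show ?thesis
 proof (intro exI[of _ "\<bar>C\<bar> * C'"] ballI)
  fix f assume f: "f : B"
  have t: "(%z. f (y + z)) : B" using left_transl_mem[OF f, of "- y"] by (simp add: left_transl_def)
  have "norm (conv mu f phi y) <= C * N (%z. f (y + z))" unfolding pairing(2)[OF f] by (rule C[OF t])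
  also have "... <= \<bar>C\<bar> * N (%z. f (y + z))" using norm_nonneg[OF t] by (intro mult_right_mono) auto
  also have "... <= \<bar>C\<bar> * C' * N f" using C'[OF f] by (simp add: mult.assoc mult_left_mono)
  finally show "norm (conv mu f phi y) <= \<bar>C\<bar> * C' * N f" .
 qed
qed

lemma conv_add: "f : B ==> g : B ==> conv mu (%x. f x + g x) phi = (%y. conv mu f phi y + conv mu g phi y)"
 unfolding conv_def[abs_def] by (simp add: distrib_right pairing(1))

lemma conv_scale: "conv mu (%x. a * f x) phi = (%y. a * conv mu f phi y)"
 unfolding conv_def[abs_def] by (simp add: mult.assoc)

lemma conv_cong_AE:
 assumes "f : B" "g : B" "AE x in mu. f x = g x"
 shows "conv mu f phi = conv mu g phi"
proof
 fix y
 have [measurable]: "f : Bmeas" "g : Bmeas" by (intro measurable assms)+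
 show "conv mu f phi y = conv mu g phi y"
  unfolding conv_def using assms(3) by (intro integral_cong_AE) (auto simp: measurable_mu_iff elim: eventually_mono)
qed

abbreviation "E == reproducing_space mu B phi"

lemma E_iff: "f : E \<longleftrightarrow> f : B & f = conv mu f phi" by (simp add: reproducing_space_def)

lemma E_mem: "f : E ==> f : B" by (simp add: E_iff)

lemma E_conv: "f : E ==> f y = conv mu f phi y" by (metis E_iff)

lemma E_eq_AE: "f : E ==> g : E ==> AE x in mu. f x = g x ==> f = g"
 using conv_cong_AE[of f g] by (metis E_iff)

lemma E_definite: "f : E ==> N f = 0 ==> f = (%_. 0)"
 using E_eq_AE[of f "%_. 0"] norm_eq_zero[of f] zero_mem by (simp add: E_iff conv_def[abs_def])

sublocale E: complete_function_space E N
proof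
 show "(%x. f x + g x) : E" if f: "f : E" and g: "g : E" for f g
  unfolding E_iff conv_add[OF E_mem[OF f] E_mem[OF g]]
  by (intro conjI add_mem E_mem f g ext) (simp only: E_conv[OF f, symmetric] E_conv[OF g, symmetric])
 show "(%x. a * f x) : E" if f: "f : E" for a f
  unfolding E_iff conv_scale
  by (intro conjI scale_mem E_mem f ext) (simp only: E_conv[OF f, symmetric])
 show "(%_. 0) : E" using zero_mem by (simp add: E_iff conv_def[abs_def])
 fix F :: "nat => 'g => complex" assume F: "!!m. F m : E" and cauchy: "!!e. 0 < e ==> EX M. ALL m>=M. ALL k>=M. N (%x. F m x - F k x) < e"
 obtain f where f: "f : B" "(%m. N (%x. F m x - f x)) \<longlonglongrightarrow> 0"
  using complete[of F, OF E_mem[OF F] cauchy] by blast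
 define g where "g = conv mu f phi"
 have lim: "(%m. F m y) \<longlonglongrightarrow> g y" for y
 proof -
  obtain C where C: "ALL f:B. norm (conv mu f phi y) <= C * N f" using conv_bound by blast
  have "norm (F m y - g y) <= C * N (%x. F m x - f x)" for m
  proof -
   have "conv mu (%x. F m x - f x) phi y = F m y - g y"
    using conv_add[OF E_mem[OF F] scale_mem[OF f(1), of "-1"], of m] conv_scale[of "-1" f] E_conv[OF F, of m y]
    by (simp add: g_def fun_eq_iff)
   then show ?thesis using C[rule_format, OF B.diff[OF E_mem[OF F] f(1)], of m] by (simp only:)
  qed
  then have le: "\<forall>\<^sub>F m in sequentially. norm (F m y - g y) <= C * N (%x. F m x - f x)" by simp
  have "(%m. C * N (%x. F m x - f x)) \<longlonglongrightarrow> C * 0" by (intro tendsto_intros f(2))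
  then have "(%m. C * N (%x. F m x - f x)) \<longlonglongrightarrow> 0" by simp
  with le have "(%m. F m y - g y) \<longlonglongrightarrow> 0" by (rule Lim_null_comparison)
  then show ?thesis by (rule Lim_null[THEN iffD2])
 qed
 have Fm: "F m : Bmeas" for m by (rule measurable[OF E_mem[OF F]])
 have gm: "g : Bmeas" by (rule borel_measurable_LIMSEQ_metric[OF Fm lim])
 have "tends_locally F f" unfolding tends_locally_def
  using converges_locally_in_measure[of F f, OF E_mem[OF F] f] by blast
 then have eq: "AE x in mu. g x = f x"
  using tends_locally_pointwise[OF Fm gm lim] by (intro tends_locally_unique[of F] Fm gm measurable f(1))
 have gB: "g : B" by (rule mem_cong_AE[OF f(1) gm eq])
 have gE: "g : E" unfolding E_iff using gB conv_cong_AE[OF gB f(1) eq] by (simp add: g_def)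
 have eqN: "N (%x. F m x - g x) = N (%x. F m x - f x)" for m
  by (rule norm_cong_AE) (use E_mem[OF F] f(1) gB eq in \<open>auto intro: B.diff\<close>)
 show "EX f:E. (%m. N (%x. F m x - f x)) \<longlonglongrightarrow> 0"
  by (rule bexI[OF _ gE]) (simp only: eqN f(2))
qed (use norm_nonneg norm_triangle norm_scale E_mem in auto)

lemma point_evaluation: "EX C. ALL f:E. norm (f y) <= C * N f"
 using conv_bound[of y] E_conv E_mem by metis

definition indices :: "nat list set" where
 "indices = {alp. set alp <= {1..n} & length alp <= n}"

lemma finite_indices: "finite indices"
 unfolding indices_def using finite_lists_length_le[of "{1..n}" n] by simp

lemma DR_measurable: "alp : indices ==> DR alp : Bmeas"
 using DR(1) by (simp add: right_tower_def indices_def)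

definition KR :: "'g => ennreal" where "KR x = (\<Sum>alp\<in>indices. enorm (DR alp x))"
definition KL :: "'g => ennreal" where "KL x = (\<Sum>alp\<in>indices. enorm (DL alp x))"

lemma K_measurable [measurable]: "KR : Bmeas" "KL : Bmeas"
proof -
 have "(%x. enorm (DR alp x)) : Bmeas"
  "(%x. enorm (DL alp x)) : Bmeas" if "alp : indices" for alp
 proof -
  have [measurable]: "DR alp : Bmeas" "DL alp : Bmeas"
   using that DR_measurable DL_measurable unfolding indices_def by blast+
  show "(%x. enorm (DR alp x)) : Bmeas"
   "(%x. enorm (DL alp x)) : Bmeas" by measurable
 qed
 then show "KR : Bmeas" "KL : Bmeas"
  unfolding KR_def[abs_def] KL_def[abs_def] by (intro borel_measurable_sum; blast)+
qed

lemma le_K: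
 assumes "set alp <= {1..n}" "length alp <= n"
 shows "enorm (DR alp x) <= KR x" "enorm (DL alp x) <= KL x"
 using assms finite_indices unfolding KR_def KL_def
 by (intro member_le_sum[where f = "%alp. enorm (DR alp x)"]
   member_le_sum[where f = "%alp. enorm (DL alp x)"]; simp add: indices_def)+

lemma dominated_nconv_sum:
 assumes k: "!!alp. alp : indices ==> k alp : Bmeas"
  "!!alp. alp : indices ==> conv_continuous mu B N (%y. of_real (norm (k alp y :: complex)))"
 shows "EX C>=0. ALL h:Bmeas. ALL r. dominated h r -->
  dominated (nconv h (%x. \<Sum>alp\<in>indices. enorm (k alp x))) (C * r)"
proof -
 have "ALL alp:indices. EX C>=0. ALL h r. dominated h r --> dominated (nconv h (%x. enorm (k alp x))) (C * r)"
  using dominated_nconv[OF k(2)] by simp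
 from bchoice[OF this] obtain C where C: "!!alp. alp : indices ==> C alp >= 0"
  "!!alp h r. alp : indices ==> dominated h r ==> dominated (nconv h (%x. enorm (k alp x))) (C alp * r)"
  by blast
 show ?thesis
 proof (intro exI[of _ "\<Sum>alp\<in>indices. C alp"] conjI ballI allI impI)
  fix h r assume h [measurable]: "h : Bmeas" and dom: "dominated h r"
  have eq: "nconv h (%x. \<Sum>alp\<in>indices. enorm (k alp x))
   = (%y. \<Sum>alp\<in>indices. nconv h (%x. enorm (k alp x)) y)"
  proof
   fix y
   have m: "(%x. h x * enorm (k alp (- x + y))) : borel_measurable mu" if "alp : indices" for alp
   proof -
    have [measurable]: "k alp : Bmeas" by (rule k(1)[OF that])
    show ?thesis by measurable
   qed
   show "nconv h (%x. \<Sum>alp\<in>indices. enorm (k alp x)) y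
    = (\<Sum>alp\<in>indices. nconv h (%x. enorm (k alp x)) y)"
    unfolding nconv_def sum_distrib_left by (rule nn_integral_sum[OF m])
  qed
  show "dominated (nconv h (%x. \<Sum>alp\<in>indices. enorm (k alp x))) ((\<Sum>alp\<in>indices. C alp) * r)"
   unfolding eq sum_distrib_right by (intro dominated_sum finite_indices C(2) dom)
 qed (use C(1) in \<open>auto intro: sum_nonneg\<close>)
qed

lemma dominated_nconv_K:
 obtains C where "C >= 0"
  "!!h r. h : Bmeas ==> dominated h r ==> dominated (nconv h KR) (C * r)"
  "!!h r. h : Bmeas ==> dominated h r ==> dominated (nconv h KL) (C * r)"
proof -
 obtain C1 where C1: "C1 >= 0" "ALL h:Bmeas. ALL r. dominated h r --> dominated (nconv h KR) (C1 * r)"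
  using dominated_nconv_sum[of DR] DR_measurable conv_DR unfolding KR_def[abs_def] indices_def by auto
 obtain C2 where C2: "C2 >= 0" "ALL h:Bmeas. ALL r. dominated h r --> dominated (nconv h KL) (C2 * r)"
  using dominated_nconv_sum[of DL] DL_measurable conv_DL unfolding KL_def[abs_def] indices_def by auto
 have r: "r >= 0" if "dominated h r" for h r
  using that norm_nonneg unfolding dominated_def by (meson order_trans)
 have 1: "dominated (nconv h KR) ((C1 + C2) * r)" if "h : Bmeas" "dominated h r" for h r
  using C1 C2 r[OF that(2)]
  by (intro dominated_mono[OF C1(2)[rule_format, OF that] order_refl] mult_right_mono) auto
 have 2: "dominated (nconv h KL) ((C1 + C2) * r)" if "h : Bmeas" "dominated h r" for h r
  using C1 C2 r[OF that(2)]
  by (intro dominated_mono[OF C2(2)[rule_format, OF that] order_refl] mult_right_mono) auto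
 show ?thesis
  by (rule that[of "C1 + C2"]) (use C1(1) C2(1) 1 2 in auto)
qed

text \<open>
 Since \<open>phi * phi = phi ~= 0\<close>, for some \<open>y0\<close> the functions \<open>phi x\<close> and \<open>phi (- x + y0)\<close> are simultaneously
 bounded away from zero on a set of positive measure. Such a set overlaps its small translates, so
 \<open>\<bar>phi\<bar> * \<bar>phi\<bar>\<close> is bounded below near \<open>y0\<close>.
\<close>
lemma kernel_square_lower_bound:
 obtains y0 V c where "open V" "0 : V" "c > 0"
  "!!u. u : V ==> ennreal c <= nconv (%x. enorm (phi x)) (%x. enorm (phi x)) (u + y0)"
proof -
 have "~ (AE x in mu. phi x = 0)" using kernel by (simp add: reproducing_kernel_def)
 then have "~ (ALL x. phi x = 0)" by auto
 then obtain y0 where "phi y0 ~= 0" by blast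
 moreover have "phi y0 = (\<integral>x. phi x * phi (- x + y0) \<partial>mu)"
  using kernel unfolding reproducing_kernel_def conv_def[abs_def] by metis
 ultimately have ne: "~ (AE x in mu. phi x * phi (- x + y0) = 0)"
  using integral_eq_zero_AE[of "%x. phi x * phi (- x + y0)" mu] by (simp only: simp_thms not_False_eq_True) metis
 define A where "A j = {x. 1 / real (Suc j) <= norm (phi x) & 1 / real (Suc j) <= norm (phi (- x + y0))}" for j
 have A: "A j : sets borel" for j unfolding A_def by measurable
 have "EX j. emeasure mu (A j) > 0"
 proof (rule ccontr)
  assume "~ ?thesis"
  then have "A j : null_sets mu" for j using A by (intro null_setsI) (auto simp: zero_less_iff_neq_zero)
  then have "AE x in mu. ALL j. x ~: A j" by (simp add: AE_all_countable AE_not_in)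
  then have "AE x in mu. phi x * phi (- x + y0) = 0"
  proof eventually_elim
   case (elim x)
   show ?case
   proof (rule ccontr)
    assume "phi x * phi (- x + y0) ~= 0"
    then have "0 < min (norm (phi x)) (norm (phi (- x + y0)))" by simp
    from reals_Archimedean[OF this] obtain j where "inverse (real (Suc j)) < min (norm (phi x)) (norm (phi (- x + y0)))" ..
    then have "x : A j" unfolding A_def by (simp add: inverse_eq_divide del: of_nat_Suc)
    then show False using elim by blast
   qed
  qed
  then show False using ne by blast
 qed
 then obtain j where j: "emeasure mu (A j) > 0" by blast
 obtain K d V where K: "K <= A j" "K : sets borel" "d > 0" "open V" "0 : V"
  "!!u. u : V ==> ennreal d <= emeasure mu (K Int (+) u ` K)"
  using overlap[OF A j] by blast
 define s where "s = 1 / real (Suc j)"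
 have s: "s > 0" by (simp add: s_def)
 show ?thesis
 proof (rule that[OF K(4,5), of "s * s * d" y0])
  show "s * s * d > 0" using s K by simp
  fix u assume u: "u : V"
  have sets: "K Int (+) u ` K : sets mu" using sets.Int[OF K(2) left_image_sets[OF K(2), of u]] by simp
  have "ennreal (s * s * d) = ennreal (s * s) * ennreal d" using s K by (simp add: ennreal_mult)
  also have "... <= ennreal (s * s) * emeasure mu (K Int (+) u ` K)" by (intro mult_left_mono K(6) u) simp
  also have "... = (\<integral>\<^sup>+x. ennreal (s * s) * indicator (K Int (+) u ` K) x \<partial>mu)"
   by (rule nn_integral_cmult_indicator[symmetric, OF sets])
  also have "... <= (\<integral>\<^sup>+x. enorm (phi x) * enorm (phi (- x + (u + y0))) \<partial>mu)"
  proof (rule nn_integral_mono)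
   fix x
   show "ennreal (s * s) * indicator (K Int (+) u ` K) x <= enorm (phi x) * enorm (phi (- x + (u + y0)))"
   proof (cases "x : K Int (+) u ` K")
    case True
    then obtain w where w: "w : K" "x = u + w" by blast
    have "s <= norm (phi x)" using True K(1) by (auto simp: A_def s_def)
    moreover have "s <= norm (phi (- x + (u + y0)))"
    proof -
     have "- x + (u + y0) = - w + y0" unfolding w by (simp only: minus_add add.assoc minus_add_cancel)
     then show ?thesis using w(1) K(1) by (auto simp: A_def s_def)
    qed
    ultimately have "s * s <= norm (phi x) * norm (phi (- x + (u + y0)))" using s by (intro mult_mono) auto
    then show ?thesis using True by (simp add: ennreal_mult[symmetric])
   qed simp
  qed
  finally show "ennreal (s * s * d) <= nconv (%x. enorm (phi x)) (%x. enorm (phi x)) (u + y0)"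
   by (simp only: nconv_def)
 qed
qed

lemma dominated_average:
 obtains V C where "open V" "0 : V" "C >= 0"
  "!!h r. h : Bmeas ==> dominated h r ==>
   dominated (%y. \<integral>\<^sup>+x. indicator V (- x + y) * h x \<partial>mu) (C * r)"
proof -
 let ?n = "%x. enorm (phi x)"
 obtain V c y0 where V: "open V" "0 : V" "c > 0" "!!u. u : V ==> ennreal c <= nconv ?n ?n (u + y0)"
  by (rule kernel_square_lower_bound) (rule that)
 have "conv_continuous mu B N (%y. of_real (norm (phi y)))" using conv_DR[of "[]"] by (simp add: DR(2))
 from dominated_nconv[OF this norm_ge_zero]
 obtain C where C: "C >= 0" and domC: "ALL h r. dominated h r --> dominated (nconv h ?n) (C * r)" by (elim exE conjE)
 from dominated_right_translate[of y0]
 obtain C' where C': "C' >= 0" and domC': "ALL h r. dominated h r --> dominated (%y. h (y + y0)) (C' * r)"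
  by (elim exE conjE)
 show ?thesis
 proof (rule that[OF V(1,2)])
  fix h r assume h [measurable]: "h : Bmeas" and dom: "dominated h r"
  have "dominated (nconv (nconv h ?n) ?n) (C * (C * r))"
   by (intro domC[rule_format] dom)
  then have "dominated (%y. nconv (nconv h ?n) ?n (y + y0)) (C' * (C * (C * r)))" by (rule domC'[rule_format])
  then have "dominated (%y. ennreal (1 / c) * nconv (nconv h ?n) ?n (y + y0)) (1 / c * (C' * (C * (C * r))))"
   using V(3) by (intro dominated_cmult) auto
  then show "dominated (%y. \<integral>\<^sup>+x. indicator V (- x + y) * h x \<partial>mu) (1 / c * (C' * (C * C)) * r)"
  proof (rule dominated_mono)
   fix y
   have [measurable]: "V : sets borel" using V(1) by simp
   have "(\<integral>\<^sup>+x. indicator V (- x + y) * h x \<partial>mu) <= (\<integral>\<^sup>+x. ennreal (1 / c) * (h x * nconv ?n ?n (- x + (y + y0))) \<partial>mu)"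
   proof (rule nn_integral_mono)
    fix x
    show "indicator V (- x + y) * h x <= ennreal (1 / c) * (h x * nconv ?n ?n (- x + (y + y0)))"
    proof (cases "- x + y : V")
     case True
     have "1 = ennreal (1 / c) * ennreal c" using V(3) by (simp add: ennreal_mult[symmetric])
     also have "... <= ennreal (1 / c) * nconv ?n ?n (- x + (y + y0))"
      using V(4)[OF True] by (intro mult_left_mono) (simp_all add: add.assoc)
     finally have "1 * h x <= ennreal (1 / c) * nconv ?n ?n (- x + (y + y0)) * h x" by (rule mult_right_mono) simp
     then show ?thesis using True by (simp add: mult_ac)
    qed simp
   qed
   also have "... = ennreal (1 / c) * nconv h (nconv ?n ?n) (y + y0)"
    unfolding nconv_def[of h] by (rule nn_integral_cmult) measurable
   also have "nconv h (nconv ?n ?n) (y + y0) = nconv (nconv h ?n) ?n (y + y0)"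
    by (rule nconv_assoc[symmetric]) measurable
   finally show "(\<integral>\<^sup>+x. indicator V (- x + y) * h x \<partial>mu) <= ennreal (1 / c) * nconv (nconv h ?n) ?n (y + y0)" .
  qed simp
 qed (use V C C' in simp)
qed

end

section \<open>Towers of derivatives for the kernel\<close>

primrec splits :: "nat list => (nat list \<times> nat list) list" where
 "splits [] = [([], [])]"
| "splits (k # alp) = map (%p. (k # fst p, snd p)) (splits alp) @ map (%p. (fst p, k # snd p)) (splits alp)"

lemma splits_mem:
 "p : set (splits alp) ==> set (fst p) <= set alp & set (snd p) <= set alp &
  length (fst p) <= length alp & length (snd p) <= length alp"
proof (induction alp arbitrary: p)
 case (Cons k alp)
 from Cons.prems obtain q where q: "q : set (splits alp)" "p = (k # fst q, snd q) \<or> p = (fst q, k # snd q)"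
  by auto
 show ?case using Cons.IH[OF q(1)] q(2) by (elim disjE) (simp_all, blast+)
qed simp

lemma length_splits: "length (splits alp) = 2 ^ length alp"
 by (induction alp) simp_all

lemma ennreal_norm_sum_list_le:
 fixes F :: "'a => complex"
 shows "(!!p. p : set ps ==> enorm (F p) <= c) ==> enorm (\<Sum>p\<leftarrow>ps. F p) <= of_nat (length ps) * c"
proof (induction ps)
 case (Cons p ps)
 have "enorm (F p + (\<Sum>p\<leftarrow>ps. F p)) <= ennreal (norm (F p) + norm (\<Sum>p\<leftarrow>ps. F p))"
  by (intro ennreal_leI norm_triangle_ineq)
 also have "... = enorm (F p) + enorm (\<Sum>p\<leftarrow>ps. F p)" by (simp add: ennreal_plus)
 also have "... <= c + of_nat (length ps) * c" using Cons by (intro add_mono) auto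
 finally show ?case by (simp add: distrib_right)
qed simp

text \<open>The Leibniz rule for towers.\<close>
lemma (in curves) right_tower_mult:
 assumes D1: "right_tower gam n m D1" and D2: "right_tower gam n m D2"
 shows "right_tower gam n m (%alp z. \<Sum>p\<leftarrow>splits alp. D1 (fst p) z * D2 (snd p) z)"
 unfolding right_tower_def
proof (intro conjI allI impI)
 fix alp assume alp: "set alp <= {1..n}" "length alp <= m"
 have sum: "(%z. \<Sum>p\<leftarrow>ps. F p z) : Bmeas"
  if "!!p. p : set ps ==> F p : Bmeas" for ps and F :: "nat list \<times> nat list => _ => complex"
  using that by (induction ps) (auto intro: borel_measurable_add)
 show "(%z. \<Sum>p\<leftarrow>splits alp. D1 (fst p) z * D2 (snd p) z) : Bmeas"
 proof (rule sum)
  fix p assume "p : set (splits alp)"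
  from splits_mem[OF this] alp D1 D2
  have "D1 (fst p) : Bmeas" "D2 (snd p) : Bmeas"
   unfolding right_tower_def by (meson order_trans)+
  then show "(%z. D1 (fst p) z * D2 (snd p) z) : Bmeas" by (rule borel_measurable_times)
 qed
next
 fix alp k assume alp: "set alp <= {1..n}" "length alp < m" and k: "k : {1..n}"
 show "right_curve_deriv (gam k) (%z. \<Sum>p\<leftarrow>splits alp. D1 (fst p) z * D2 (snd p) z)
   (%z. \<Sum>p\<leftarrow>splits (k # alp). D1 (fst p) z * D2 (snd p) z)"
  unfolding right_curve_deriv_def
 proof
  fix z
  have sum: "((%t. \<Sum>p\<leftarrow>ps. F p t) has_vector_derivative (\<Sum>p\<leftarrow>ps. F' p)) (at 0)"
   if "!!p. p : set ps ==> (F p has_vector_derivative F' p) (at 0)"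
   for ps and F :: "nat list \<times> nat list => real => complex" and F'
   using that by (induction ps) (auto intro: has_vector_derivative_add)
  have "((%t. \<Sum>p\<leftarrow>splits alp. D1 (fst p) (z + gam k t) * D2 (snd p) (z + gam k t)) has_vector_derivative
   (\<Sum>p\<leftarrow>splits alp. D1 (fst p) z * D2 (k # snd p) z + D1 (k # fst p) z * D2 (snd p) z)) (at 0)"
  proof (rule sum)
   fix p assume "p : set (splits alp)"
   from splits_mem[OF this] alp have p: "set (fst p) <= {1..n}" "set (snd p) <= {1..n}" "length (fst p) < m" "length (snd p) < m"
    by auto
   have 1: "((%t. D1 (fst p) (z + gam k t)) has_vector_derivative D1 (k # fst p) z) (at 0)"
    using D1 p k by (auto simp: right_tower_def right_curve_deriv_def)
   have 2: "((%t. D2 (snd p) (z + gam k t)) has_vector_derivative D2 (k # snd p) z) (at 0)"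
    using D2 p k by (auto simp: right_tower_def right_curve_deriv_def)
   show "((%t. D1 (fst p) (z + gam k t) * D2 (snd p) (z + gam k t)) has_vector_derivative
    D1 (fst p) z * D2 (k # snd p) z + D1 (k # fst p) z * D2 (snd p) z) (at 0)"
    using has_vector_derivative_mult[OF 1 2] by (simp add: curve_0[OF k])
  qed
  then show "((%t. \<Sum>p\<leftarrow>splits alp. D1 (fst p) (z + gam k t) * D2 (snd p) (z + gam k t)) has_vector_derivative
   (\<Sum>p\<leftarrow>splits (k # alp). D1 (fst p) z * D2 (snd p) z)) (at 0)"
   by (simp add: sum_list_addf o_def add.commute)
 qed
qed

context smooth_kernel_space
begin

lemma right_kernel_tower: "right_tower gam n n (%alp w. DR alp (- z + w))"
 unfolding right_tower_def
proof (intro conjI allI impI)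
 fix alp assume "set alp <= {1..n}" "length alp <= n"
 then have [measurable]: "DR alp : Bmeas" using DR(1) by (simp add: right_tower_def)
 show "(%w. DR alp (- z + w)) : Bmeas" by measurable
next
 fix alp k assume "set alp <= {1..n}" "length alp < n" "k : {1..n}"
 then have "right_curve_deriv (gam k) (DR alp) (DR (k # alp))" using DR(1) by (simp add: right_tower_def)
 then show "right_curve_deriv (gam k) (%w. DR alp (- z + w)) (%w. DR (k # alp) (- z + w))"
  by (simp add: right_curve_deriv_def add.assoc[symmetric])
qed

text \<open>
 Right differentiation in \<open>w\<close> of \<open>phi (- w + y)\<close> is left differentiation of \<open>phi\<close>, with a sign.
\<close>
lemma left_kernel_tower: "right_tower gam n n (%alp w. (- 1) ^ length alp * DL alp (- w + y))"
 unfolding right_tower_def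
proof (intro conjI allI impI)
 fix alp assume "set alp <= {1..n}" "length alp <= n"
 then have [measurable]: "DL alp : Bmeas" by (rule DL_measurable)
 show "(%w. (- 1) ^ length alp * DL alp (- w + y)) : Bmeas" by measurable
next
 fix alp k assume a: "set alp <= {1..n}" "length alp < n" "k : {1..n}"
 show "right_curve_deriv (gam k) (%w. (- 1) ^ length alp * DL alp (- w + y)) (%w. (- 1) ^ length (k # alp) * DL (k # alp) (- w + y))"
  unfolding right_curve_deriv_def
 proof
  fix w
  have "((%t. DL alp (gam k t + (- w + y))) has_vector_derivative DL (k # alp) (- w + y)) (at (- 0))"
   using DL_deriv[OF a] by simp
  moreover have "((%t::real. - t) has_vector_derivative - 1) (at 0)"
   by (auto intro!: derivative_eq_intros)
  ultimately have "((%t. DL alp (gam k (- t) + (- w + y))) has_vector_derivative - DL (k # alp) (- w + y)) (at 0)"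
   using vector_diff_chain_at[of "%t::real. - t" "- 1" 0 "%t. DL alp (gam k t + (- w + y))"] by (simp add: o_def)
  moreover have "gam k (- t) + (- w + y) = - (w + gam k t) + y" for t
   by (simp only: curve_minus[OF a(3)] minus_add add.assoc)
  ultimately have "((%t. DL alp (- (w + gam k t) + y)) has_vector_derivative - DL (k # alp) (- w + y)) (at 0)"
   by (simp only:)
  from has_vector_derivative_mult_right[OF this, of "(- 1) ^ length alp"]
  show "((%t. (- 1) ^ length alp * DL alp (- (w + gam k t) + y)) has_vector_derivative
    (- 1) ^ length (k # alp) * DL (k # alp) (- w + y)) (at 0)" by simp
 qed
qed

lemma left_transl_kernel_mem: "left_transl a phi : E"
proof -
 have t: "left_transl a phi : B" by (rule left_transl_mem[OF phi_mem])
 have "conv mu (left_transl a phi) phi y = left_transl a phi y" for y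
 proof -
  have m: "(%z. phi (- a + z) * phi (- z + y)) : Bmeas" by measurable
  have e: "- (a + z) + y = - z + (- a + y)" for z by (simp only: minus_add add.assoc)
  have "conv mu (left_transl a phi) phi y = (\<integral>z. phi (- a + (a + z)) * phi (- (a + z) + y) \<partial>mu)"
   unfolding conv_def left_transl_def by (rule integrable_left_iff(2)[OF m, of a, symmetric])
  also have "... = conv mu phi phi (- a + y)" unfolding conv_def e by (simp only: minus_add_cancel)
  also have "... = phi (- a + y)" using kernel by (simp add: reproducing_kernel_def)
  finally show ?thesis by (simp add: left_transl_def)
 qed
 then show ?thesis using t by (auto simp: E_iff fun_eq_iff)
qed

end

lemma (in sampling_space) nconv_weighted:
 assumes [measurable]: "h : Bmeas" "g : Bmeas" "k : Bmeas"
 shows "(\<integral>\<^sup>+z. h z * (\<integral>\<^sup>+w. g w * k (- z + w) \<partial>mu) \<partial>mu) = (\<integral>\<^sup>+w. g w * nconv h k w \<partial>mu)"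
proof -
 have "h z * (\<integral>\<^sup>+w. g w * k (- z + w) \<partial>mu) = (\<integral>\<^sup>+w. h z * (g w * k (- z + w)) \<partial>mu)" for z
  by (rule nn_integral_cmult[symmetric]) measurable
 then have "(\<integral>\<^sup>+z. h z * (\<integral>\<^sup>+w. g w * k (- z + w) \<partial>mu) \<partial>mu) = (\<integral>\<^sup>+z. \<integral>\<^sup>+w. h z * (g w * k (- z + w)) \<partial>mu \<partial>mu)"
  by (simp only:)
 also have "... = (\<integral>\<^sup>+w. \<integral>\<^sup>+z. h z * (g w * k (- z + w)) \<partial>mu \<partial>mu)"
  by (rule haar2.Fubini') measurable
 also have "... = (\<integral>\<^sup>+w. g w * nconv h k w \<partial>mu)"
 proof (rule nn_integral_cong)
  fix w
  have "(\<integral>\<^sup>+z. g w * (h z * k (- z + w)) \<partial>mu) = g w * nconv h k w"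
   unfolding nconv_def by (rule nn_integral_cmult) measurable
  then show "(\<integral>\<^sup>+z. h z * (g w * k (- z + w)) \<partial>mu) = g w * nconv h k w" by (simp only: mult.left_commute)
 qed
 finally show ?thesis .
qed

section \<open>Operators close to the identity\<close>

text \<open>
 The Neumann series, as an iteration: \<open>f \<mapsto> f + (g - T f)\<close> halves the residual \<open>g - T f\<close>.
\<close>
lemma (in complete_function_space) near_identity_invertible:
 assumes definite: "!!f. f : V ==> N f = 0 ==> f = (%_. 0)"
  and mem: "!!f. f : V ==> T f : V"
  and T_add: "!!f g. f : V ==> g : V ==> T (%x. f x + g x) = (%y. T f y + T g y)"
  and T_scale: "!!f a. f : V ==> T (%x. a * f x) = (%y. a * T f y)"
  and near: "!!f. f : V ==> N (%y. T f y - f y) <= 1 / 2 * N f"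
 shows "bounded_operator V N V N T" "bounded_operator V N V N (inv_into V T)"
  "!!f. f : V ==> inv_into V T (T f) = f & T (inv_into V T f) = f"
proof -
 have T_diff: "T (%x. f x - g x) = (%y. T f y - T g y)" if "f : V" "g : V" for f g
  using T_add[OF that(1) uminus[OF that(2)]] T_scale[OF that(2), of "-1"] by simp
 have upper: "N (T f) <= 3 / 2 * N f" if f: "f : V" for f
 proof -
  have "N (T f) <= N (%y. T f y - f y) + N f" using triangle[OF diff[OF mem[OF f] f] f] by simp
  then show ?thesis using near[OF f] by simp
 qed
 have lower: "N f <= 2 * N (T f)" if f: "f : V" for f
 proof -
  have "N f <= N (%y. f y - T f y) + N (T f)" using triangle[OF diff[OF f mem[OF f]] mem[OF f]] by simp
  then show ?thesis using near[OF f] N_commute[OF f mem[OF f]] by simp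
 qed
 have eq0: "f = g" if f: "f : V" and g: "g : V" and "N (%x. f x - g x) = 0" for f g
  using definite[OF diff[OF f g] that(3)] by (auto simp: fun_eq_iff)
 show "bounded_operator V N V N T"
  unfolding bounded_operator_def using mem T_add T_scale upper by blast
 have inj: "inj_on T V"
 proof (rule inj_onI)
  fix f g assume f: "f : V" and g: "g : V" and eq: "T f = T g"
  have "N (%x. f x - g x) <= 2 * N (T (%x. f x - g x))" by (rule lower[OF diff[OF f g]])
  also have "T (%x. f x - g x) = (%_. 0)" unfolding T_diff[OF f g] eq by simp
  finally have "N (%x. f x - g x) = 0" using nonneg[OF diff[OF f g]] N_zero by simp
  then show "f = g" by (rule eq0[OF f g])
 qed
 have surj: "EX f:V. T f = g" if g: "g : V" for g
 proof -
  define F where "F = rec_nat (%_. 0 :: complex) (%_ f x. f x + (g x - T f x))"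
  have F_Suc: "F (Suc m) = (%x. F m x + (g x - T (F m) x))" for m by (simp add: F_def)
  have F: "F m : V" for m
  proof (induction m)
   case 0
   show ?case by (simp add: F_def zero)
  next
   case (Suc m)
   show ?case unfolding F_Suc by (intro add Suc diff g mem)
  qed
  have r: "(%x. g x - T (F m) x) : V" for m by (intro diff g mem F)
  have res: "N (%x. g x - T (F m) x) <= N g * (1 / 2) ^ m" for m
  proof (induction m)
   case 0
   have "T (F 0) = (%_. 0)" using T_scale[OF zero, of 0] by (simp add: F_def)
   then show ?case by simp
  next
   case (Suc m)
   have "(%x. g x - T (F (Suc m)) x) = (%x. (%x. g x - T (F m) x) x - T (%x. g x - T (F m) x) x)"
    unfolding F_Suc T_add[OF F r] by (simp add: algebra_simps)
   then have "N (%x. g x - T (F (Suc m)) x) = N (%x. T (%x. g x - T (F m) x) x - (g x - T (F m) x))"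
    using N_commute[OF r mem[OF r], of m] by simp
   also have "... <= 1 / 2 * N (%x. g x - T (F m) x)" by (rule near[OF r])
   also have "... <= 1 / 2 * (N g * (1 / 2) ^ m)" using Suc by simp
   finally show ?case by simp
  qed
  have "N (%x. F (Suc m) x - F m x) <= N g * (1 / 2) ^ m" for m
   using res[of m] by (simp add: F_Suc)
  from geometric_cauchy[OF F this nonneg[OF g]]
  obtain f where f: "f : V" "(%m. N (%x. F m x - f x)) \<longlonglongrightarrow> 0" by blast
  have "N (%x. g x - T f x) <= N g * (1 / 2) ^ m + 3 / 2 * N (%x. F m x - f x)" for m
  proof -
   have "N (%x. g x - T f x) <= N (%x. g x - T (F m) x) + N (%x. T (F m) x - T f x)"
    by (rule triangle3[OF g mem[OF F] mem[OF f(1)]])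
   also have "(%x. T (F m) x - T f x) = T (%x. F m x - f x)" by (rule T_diff[OF F f(1), symmetric])
   finally show ?thesis using res[of m] upper[OF diff[OF F f(1)], of m] by simp
  qed
  moreover have "(%m. N g * (1 / 2) ^ m + 3 / 2 * N (%x. F m x - f x)) \<longlonglongrightarrow> N g * 0 + 3 / 2 * 0"
   by (intro tendsto_intros f(2)) auto
  ultimately have "N (%x. g x - T f x) <= N g * 0 + 3 / 2 * 0" by (intro LIMSEQ_le_const) auto
  then have "N (%x. g x - T f x) = 0" using nonneg[OF diff[OF g mem[OF f(1)]]] by simp
  then show ?thesis using eq0[OF g mem[OF f(1)]] f(1) by metis
 qed
 have range: "g : T ` V" if "g : V" for g using surj[OF that] by blast
 have inv: "inv_into V T g : V" "T (inv_into V T g) = g" if "g : V" for g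
  using inv_into_into[OF range[OF that]] f_inv_into_f[OF range[OF that]] by auto
 show both: "inv_into V T (T f) = f & T (inv_into V T f) = f" if "f : V" for f
  using inv_into_f_f[OF inj that] inv(2)[OF that] by simp
 have inv_eq: "inv_into V T g = f" if "f : V" "T f = g" for f g
  using inv_into_f_f[OF inj that(1)] that(2) by simp
 show "bounded_operator V N V N (inv_into V T)"
  unfolding bounded_operator_def
 proof (intro conjI ballI allI exI[of _ 2])
  fix f a assume f: "f : V"
  show "inv_into V T f : V" by (rule inv[OF f])
  show "N (inv_into V T f) <= 2 * N f" using lower[OF inv(1)[OF f]] inv(2)[OF f] by simp
  show "inv_into V T (%x. a * f x) = (%y. a * inv_into V T f y)"
   by (rule inv_eq) (use T_scale[OF inv(1)[OF f]] inv(2)[OF f] in \<open>auto intro: scale inv(1)[OF f]\<close>)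
  fix g assume g: "g : V"
  show "inv_into V T (%x. f x + g x) = (%y. inv_into V T f y + inv_into V T g y)"
   by (rule inv_eq) (use T_add[OF inv(1)[OF f] inv(1)[OF g]] inv(2)[OF f] inv(2)[OF g] in
     \<open>auto intro: add inv(1)[OF f] inv(1)[OF g]\<close>)
 qed
qed

lemma ennreal_norm_suminf_le:
 fixes d :: "nat => complex"
 assumes "d sums s"
 shows "enorm s <= (\<Sum>i. enorm (d i))"
proof (cases "(\<Sum>i. enorm (d i)) = top")
 case False
 then have "summable (%i. norm (d i))" by (intro summable_suminf_not_top) auto
 then have "norm (suminf d) <= (\<Sum>i. norm (d i))" "(\<Sum>i. enorm (d i)) = ennreal (\<Sum>i. norm (d i))"
  by (rule summable_norm, intro suminf_ennreal2) auto
 then show ?thesis using sums_unique[OF assms] by (simp add: ennreal_leI)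
qed simp

text \<open>A dominated exchange of a series and an integral.\<close>
lemma integral_sums:
 fixes u :: "nat => 'a => complex"
 assumes u: "!!i. integrable M (u i)" and s: "!!z. (%i. u i z) sums s z"
  and fin: "(\<integral>\<^sup>+z. (\<Sum>i. enorm (u i z)) \<partial>M) < top"
  and abs: "!!z. (\<Sum>i. enorm (u i z)) < top"
 shows "(%i. integral\<^sup>L M (u i)) sums integral\<^sup>L M s"
proof -
 have m: "(%z. enorm (u i z)) : borel_measurable M" for i
  using borel_measurable_integrable[OF u] by measurable
 have "(\<Sum>i. ennreal (\<integral>z. norm (u i z) \<partial>M)) = (\<Sum>i. \<integral>\<^sup>+z. enorm (u i z) \<partial>M)"
  by (intro suminf_cong nn_integral_eq_integral[symmetric] integrable_norm u) auto
 also have "... = (\<integral>\<^sup>+z. (\<Sum>i. enorm (u i z)) \<partial>M)" by (rule nn_integral_suminf[OF m, symmetric])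
 finally have "(\<Sum>i. ennreal (\<integral>z. norm (u i z) \<partial>M)) ~= top" using fin by simp
 then have sum: "summable (%i. \<integral>z. norm (u i z) \<partial>M)" by (intro summable_suminf_not_top) auto
 have ptw: "AE z in M. summable (%i. norm (u i z))"
 proof (rule AE_I2)
  show "summable (%i. norm (u i z))" for z
   using abs[of z] by (intro summable_suminf_not_top) auto
 qed
 have "(%i. integral\<^sup>L M (u i)) sums (\<integral>z. (\<Sum>i. u i z) \<partial>M)"
  by (rule sums_integral[OF u ptw sum])
 also have "(%z. \<Sum>i. u i z) = s" using s by (auto simp: fun_eq_iff sums_iff)
 finally show ?thesis .
qed

section \<open>The sampling operators\<close>

text \<open>
 A fixed set of sampling points. The constants \<open>M\<close>, \<open>S\<close>, \<open>Q\<close>, \<open>A\<close> and \<open>C\<close> bound the overlaps, the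
 local averages, the local oscillations, the averaging operator and the convolutions; the last
 assumption expresses that the box is small.
\<close>
locale kernel_sampling = smooth_kernel_space gam n mu B N phi DR DL
 for gam :: "nat => real => 'g::{topological_group_add, t2_space, second_countable_topology}"
  and n :: nat and mu :: "'g measure" and B :: "('g => complex) set" and N :: "('g => complex) => real"
  and phi :: "'g => complex" and DR DL :: "nat list => 'g => complex" +
 fixes eps :: real and I :: "nat set" and x :: "nat => 'g" and M :: nat and V :: "'g set" and S Q A C :: real
 assumes overlaps: "finite {i:I. y : (+) (x i) ` U eps}" "card {i:I. y : (+) (x i) ` U eps} <= M"
  and locally_finite: "compact K ==> finite {i:I. (+) (x i) ` U eps Int K ~= {}}"
  and constants: "0 <= S" "0 <= Q" "0 <= A" "0 <= C"
  and local_bound: "right_tower gam n n D ==> J : Bmeas ==>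
   (!!alp z. set alp <= {1..n} ==> length alp <= n ==> enorm (D alp z) <= J z) ==>
   enorm (D [] p) <= ennreal S * (\<integral>\<^sup>+w. indicator ((+) p ` U eps) w * J w \<partial>mu)"
  and local_oscillation: "right_tower gam n n D ==> J : Bmeas ==>
   (!!alp z. set alp <= {1..n} ==> length alp <= n ==> enorm (D alp z) <= J z) ==>
   (\<integral>\<^sup>+w. indicator ((+) p ` U eps) w * enorm (D [] w - D [] p) \<partial>mu)
    <= ennreal Q * (\<integral>\<^sup>+w. indicator ((+) p ` U eps) w * J w \<partial>mu)"
  and V_sets: "V : sets borel" and box_V: "u : U eps ==> v : U eps ==> - u + v : V"
  and averages: "h : Bmeas ==> dominated h r ==>
   dominated (%y. \<integral>\<^sup>+w. indicator V (- w + y) * h w \<partial>mu) (A * r)"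
  and convolutions: "h : Bmeas ==> dominated h r ==> dominated (nconv h KR) (C * r)"
   "h : Bmeas ==> dominated h r ==> dominated (nconv h KL) (C * r)"
  and small: "solidC * (Q * 2 ^ n * real M * (C * (C * solidC))) <= 1 / 2"
begin

abbreviation "nphi ==  %z. enorm (phi z)"

definition cover :: "nat => 'g => ennreal" where
 "cover i y = (if i : I then indicator ((+) (x i) ` U eps) y else 0)"

lemma cover_measurable [measurable]: "cover i : Bmeas"
 unfolding cover_def[abs_def] by (cases "i : I") simp_all

lemma cover_eq_0: "i ~: {i:I. y : (+) (x i) ` U eps} ==> cover i y = 0"
 by (auto simp: cover_def)

lemma suminf_cover: "(\<Sum>i. c i * cover i y) = (\<Sum>i | i : I & y : (+) (x i) ` U eps. c i)"
proof -
 have "(\<Sum>i. c i * cover i y) = (\<Sum>i | i : I & y : (+) (x i) ` U eps. c i * cover i y)"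
  by (rule suminf_finite[OF overlaps(1)]) (simp only: cover_eq_0 mult_zero_right not_False_eq_True)
 also have "... = (\<Sum>i | i : I & y : (+) (x i) ` U eps. c i)"
  by (intro sum.cong refl) (simp add: cover_def)
 finally show ?thesis .
qed

lemma suminf_cover_le: "(!!i. i : I ==> y : (+) (x i) ` U eps ==> c i <= b) ==> (\<Sum>i. c i * cover i y) <= of_nat M * b"
proof -
 assume b: "!!i. i : I ==> y : (+) (x i) ` U eps ==> c i <= b"
 have "(\<Sum>i. c i * cover i y) <= (\<Sum>i | i : I & y : (+) (x i) ` U eps. b)"
  unfolding suminf_cover by (rule sum_mono) (use b in blast)
 also have "... <= of_nat M * b"
  using overlaps(2)[of y] by (simp add: mult_right_mono)
 finally show ?thesis .
qed

definition env :: "(nat => complex) => 'g => ennreal" where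
 "env a y = (\<Sum>i. enorm (a i) * cover i y)"

lemma env_measurable [measurable]: "env a : Bmeas"
 unfolding env_def[abs_def] by measurable

lemma seq_envelope_eq: "seq_envelope (U eps) I x a y = cplx (\<Sum>i | i : I & y : (+) (x i) ` U eps. norm (a i))"
proof -
 have "seq_envelope (U eps) I x a y
  = (\<Sum>\<^sub>\<infinity>i\<in>{i:I. y : (+) (x i) ` U eps}. of_real (norm (a i)) * indicator ((+) (x i) ` U eps) y)"
  unfolding seq_envelope_def by (rule infsum_cong_neutral) (auto simp: indicator_def)
 also have "... = (\<Sum>i | i : I & y : (+) (x i) ` U eps. of_real (norm (a i)) * indicator ((+) (x i) ` U eps) y)"
  by (rule infsum_finite[OF overlaps(1)])
 also have "... = (\<Sum>i | i : I & y : (+) (x i) ` U eps. cplx (norm (a i)))"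
  by (intro sum.cong refl) simp
 finally show ?thesis by simp
qed

lemma env_eq: "env a y = enorm (seq_envelope (U eps) I x a y)"
proof -
 have "env a y = ennreal (\<Sum>i | i : I & y : (+) (x i) ` U eps. norm (a i))"
  unfolding env_def suminf_cover by (rule sum_ennreal) simp
 moreover have "0 <= (\<Sum>i | i : I & y : (+) (x i) ` U eps. norm (a i))" by (rule sum_nonneg) simp
 ultimately show ?thesis unfolding seq_envelope_eq norm_of_real by simp
qed

lemma seq_envelope_measurable: "seq_envelope (U eps) I x a : Bmeas"
proof -
 have "seq_envelope (U eps) I x a y = cplx (enn2real (env a y))" for y
 proof -
  have "0 <= (\<Sum>i | i : I & y : (+) (x i) ` U eps. norm (a i))" by (rule sum_nonneg) simp
  then show ?thesis unfolding env_eq unfolding seq_envelope_eq by (simp del: of_real_sum)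
 qed
 then have "seq_envelope (U eps) I x a = (%y. cplx (enn2real (env a y)))" by (rule ext)
 then show ?thesis by simp
qed

abbreviation "D == seq_space B (U eps) I x"
abbreviation "ND == seq_norm N (U eps) I x"

lemma D_iff: "a : D \<longleftrightarrow> (ALL i. i ~: I --> a i = 0) & seq_envelope (U eps) I x a : B"
 by (simp add: seq_space_def)

lemma ND_nonneg: "a : D ==> 0 <= ND a"
 unfolding D_iff seq_norm_def by (blast intro: norm_nonneg)

lemma env_dominated: "a : D ==> dominated (env a) (solidC * ND a)"
 unfolding env_eq[abs_def] seq_norm_def D_iff by (blast intro: dominated_mem)

lemma D_I:
 assumes "dominated (env a) r" "!!i. i ~: I ==> a i = 0"
 shows "a : D & ND a <= solidC * r"
proof -
 have "seq_envelope (U eps) I x a : B & N (seq_envelope (U eps) I x a) <= solidC * r"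
  by (rule dominated_bound[OF assms(1) seq_envelope_measurable], rule AE_I2) (simp only: env_eq order_refl)
 then show ?thesis using assms(2) unfolding D_iff seq_norm_def by blast
qed

subsection \<open>Synthesis\<close>

definition absum :: "(nat => complex) => 'g => ennreal" where
 "absum a y = (\<Sum>i. enorm (a i) * nphi (- x i + y))"

lemma absum_measurable [measurable]: "absum a : Bmeas"
 unfolding absum_def[abs_def] by measurable

lemma kernel_local_bound: "nphi (- p + y) <= ennreal S * (\<integral>\<^sup>+w. indicator ((+) p ` U eps) w * KL (- w + y) \<partial>mu)"
proof -
 have "enorm ((- 1) ^ length alp * DL alp (- z + y)) <= KL (- z + y)"
  if "set alp <= {1..n}" "length alp <= n" for alp z
  using le_K(2)[OF that] by (simp add: norm_mult norm_power)
 from local_bound[OF left_kernel_tower[of y] _ this, of p] show ?thesis by (simp add: DL_Nil)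
qed

lemma absum_le:
 assumes a: "!!i. i ~: I ==> a i = 0"
 shows "absum a y <= ennreal S * nconv (env a) KL y"
proof -
 have "enorm (a i) * nphi (- x i + y)
   <= (\<integral>\<^sup>+w. ennreal S * (enorm (a i) * cover i w * KL (- w + y)) \<partial>mu)" for i
 proof (cases "i : I")
  case True
  have "enorm (a i) * nphi (- x i + y)
   <= enorm (a i) * (ennreal S * (\<integral>\<^sup>+w. cover i w * KL (- w + y) \<partial>mu))"
   using kernel_local_bound[of "x i" y] True by (intro mult_left_mono) (simp_all add: cover_def)
  also have "... = (enorm (a i) * ennreal S) * (\<integral>\<^sup>+w. cover i w * KL (- w + y) \<partial>mu)"
   by (simp only: mult.assoc)
  also have "... = (\<integral>\<^sup>+w. (enorm (a i) * ennreal S) * (cover i w * KL (- w + y)) \<partial>mu)"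
   by (rule nn_integral_cmult[symmetric]) measurable
  also have "... = (\<integral>\<^sup>+w. ennreal S * (enorm (a i) * cover i w * KL (- w + y)) \<partial>mu)"
   by (simp only: mult.assoc mult.left_commute)
  finally show ?thesis .
 qed (simp add: a)
 then have "absum a y <= (\<Sum>i. \<integral>\<^sup>+w. ennreal S * (enorm (a i) * cover i w * KL (- w + y)) \<partial>mu)"
  unfolding absum_def by (intro suminf_le summableI)
 also have "... = (\<integral>\<^sup>+w. (\<Sum>i. ennreal S * (enorm (a i) * cover i w * KL (- w + y))) \<partial>mu)"
  by (rule nn_integral_suminf[symmetric]) measurable
 also have "... = (\<integral>\<^sup>+w. ennreal S * (env a w * KL (- w + y)) \<partial>mu)"
  unfolding env_def by (simp only: ennreal_suminf_cmult ennreal_suminf_multc)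
 also have "... = ennreal S * nconv (env a) KL y"
  unfolding nconv_def by (rule nn_integral_cmult) measurable
 finally show ?thesis .
qed

lemma absum_dominated: "a : D ==> dominated (absum a) (S * (C * (solidC * ND a)))"
proof -
 assume a: "a : D"
 have "dominated (%y. ennreal S * nconv (env a) KL y) (S * (C * (solidC * ND a)))"
  by (intro dominated_cmult convolutions(2) env_dominated a constants env_measurable)
 then show ?thesis
  by (rule dominated_mono) (use a absum_le in \<open>auto simp: D_iff\<close>)
qed

lemma nconv_phi_finite:
 assumes "dominated h r"
 shows "nconv h nphi y < top"
proof -
 obtain g where g: "(%z. cplx (g z)) : B" "ALL z. 0 <= g z" "AE z in mu. h z <= ennreal (g z)"
  using assms unfolding dominated_def by (elim exE conjE)
 have "nconv h nphi y <= nconv (%z. ennreal (g z)) nphi y" by (rule nconv_mono_AE[OF g(3)])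
 also have "... = (\<integral>\<^sup>+z. enorm (cplx (g z) * phi (- z + y)) \<partial>mu)"
  unfolding nconv_def using g(2) by (simp add: norm_mult ennreal_mult)
 also have "... < top" using pairing(1)[OF g(1), of y] by (simp add: integrable_iff_bounded)
 finally show ?thesis .
qed

lemma absum_le_nconv: "absum a y <= nconv (absum a) nphi y"
proof -
 have rep: "nphi (- p + y) <= (\<integral>\<^sup>+z. nphi (- p + z) * nphi (- z + y) \<partial>mu)" for p
 proof -
  have e: "- (p + z) + y = - z + (- p + y)" for z by (simp only: minus_add add.assoc)
  have "phi (- p + y) = conv mu phi phi (- p + y)" using kernel by (simp add: reproducing_kernel_def)
  then have "nphi (- p + y) <= (\<integral>\<^sup>+z. enorm (phi z * phi (- z + (- p + y))) \<partial>mu)"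
   unfolding conv_def using integral_norm_bound_ennreal[OF pairing(1)[OF phi_mem, of "- p + y"]] by simp
  also have "... = (\<integral>\<^sup>+z. nphi (- p + (p + z)) * nphi (- (p + z) + y) \<partial>mu)"
   unfolding e by (simp add: norm_mult ennreal_mult minus_add_cancel)
  also have "... = (\<integral>\<^sup>+z. nphi (- p + z) * nphi (- z + y) \<partial>mu)"
   by (rule nn_integral_left) measurable
  finally show ?thesis .
 qed
 have "absum a y <= (\<Sum>i. \<integral>\<^sup>+z. enorm (a i) * nphi (- x i + z) * nphi (- z + y) \<partial>mu)"
  unfolding absum_def
 proof (intro suminf_le summableI)
  fix i
  have "enorm (a i) * nphi (- x i + y)
   <= enorm (a i) * (\<integral>\<^sup>+z. nphi (- x i + z) * nphi (- z + y) \<partial>mu)"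
   by (intro mult_left_mono rep) simp
  also have "... = (\<integral>\<^sup>+z. enorm (a i) * (nphi (- x i + z) * nphi (- z + y)) \<partial>mu)"
   by (rule nn_integral_cmult[symmetric]) measurable
  finally show "enorm (a i) * nphi (- x i + y)
   <= (\<integral>\<^sup>+z. enorm (a i) * nphi (- x i + z) * nphi (- z + y) \<partial>mu)" by (simp only: mult.assoc)
 qed
 also have "... = (\<integral>\<^sup>+z. (\<Sum>i. enorm (a i) * nphi (- x i + z) * nphi (- z + y)) \<partial>mu)"
  by (rule nn_integral_suminf[symmetric]) measurable
 also have "... = nconv (absum a) nphi y"
  unfolding nconv_def absum_def by (simp only: ennreal_suminf_multc)
 finally show ?thesis .
qed

text \<open>
 The a priori bound only gives convergence almost everywhere; the reproducing formula for the
 kernel improves it to convergence at every point.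
\<close>
lemma absum_finite: "a : D ==> absum a y < top"
 using absum_le_nconv[of a y] nconv_phi_finite[OF absum_dominated, of a y] by (rule le_less_trans)

definition Syn :: "(nat => complex) => 'g => complex" where
 "Syn a y = (\<Sum>\<^sub>\<infinity>i\<in>I. a i * left_transl (x i) phi y)"

lemma Syn_sums:
 assumes a: "a : D"
 shows "((%i. a i * left_transl (x i) phi y) has_sum Syn a y) I" "(%i. a i * phi (- x i + y)) sums Syn a y"
proof -
 let ?u = "%i. a i * phi (- x i + y)"
 have "(\<Sum>i. enorm (?u i)) ~= top"
  using absum_finite[OF a, of y] by (simp add: absum_def norm_mult ennreal_mult)
 then have sum: "summable (%i. norm (?u i))" by (intro summable_suminf_not_top) auto
 have s: "?u sums suminf ?u" by (rule summable_sums[OF summable_norm_cancel[OF sum]])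
 have "(?u has_sum suminf ?u) UNIV" by (rule norm_summable_imp_has_sum[OF sum s])
 moreover have "(?u has_sum suminf ?u) UNIV \<longleftrightarrow> ((%i. a i * left_transl (x i) phi y) has_sum suminf ?u) I"
  by (rule has_sum_cong_neutral) (use a in \<open>auto simp: D_iff left_transl_def\<close>)
 ultimately have h: "((%i. a i * left_transl (x i) phi y) has_sum suminf ?u) I" by blast
 then have "Syn a y = suminf ?u" unfolding Syn_def by (rule infsumI)
 then show "((%i. a i * left_transl (x i) phi y) has_sum Syn a y) I" "?u sums Syn a y" using h s by simp_all
qed

lemma Syn_measurable: "a : D ==> Syn a : Bmeas"
proof (rule borel_measurable_LIMSEQ_metric)
 show "(%y. \<Sum>i<m. a i * phi (- x i + y)) : Bmeas" for m by measurable
 show "a : D ==> (%m. \<Sum>i<m. a i * phi (- x i + y)) \<longlonglongrightarrow> Syn a y" for y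
  using Syn_sums(2) by (simp add: sums_def)
qed

definition synthC :: real where
 "synthC = solidC * (S * (C * solidC))"

lemma synthC_nonneg: "0 <= synthC"
 using constants solidC(1) by (simp add: synthC_def)

lemma Syn_bound:
 assumes a: "a : D"
 shows "Syn a : B" "N (Syn a) <= synthC * ND a"
proof -
 have "enorm (Syn a y) <= absum a y" for y
  using ennreal_norm_suminf_le[OF Syn_sums(2)[OF a, of y]] by (simp add: absum_def norm_mult ennreal_mult)
 then have "Syn a : B & N (Syn a) <= solidC * (S * (C * (solidC * ND a)))"
  by (intro dominated_bound[OF absum_dominated[OF a] Syn_measurable[OF a]] AE_I2)
 then show "Syn a : B" "N (Syn a) <= synthC * ND a"
  by (simp_all add: synthC_def mult.assoc)
qed

lemma Syn_mem: assumes a: "a : D" shows "Syn a : E"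
proof -
 have "conv mu (Syn a) phi y = Syn a y" for y
 proof -
  let ?u = "%i z. a i * phi (- x i + z) * phi (- z + y)"
  have int: "integrable mu (%z. phi (- x i + z) * phi (- z + y))" for i
   using pairing(1)[OF E_mem[OF left_transl_kernel_mem], of "x i" y] by (simp add: left_transl_def)
  have "(%i. integral\<^sup>L mu (?u i)) sums (\<integral>z. Syn a z * phi (- z + y) \<partial>mu)"
  proof (rule integral_sums)
   show "integrable mu (?u i)" for i using int[of i] by (simp add: mult.assoc)
   show "(%i. ?u i z) sums (Syn a z * phi (- z + y))" for z
    by (rule sums_mult2[OF Syn_sums(2)[OF a]])
   have e: "(\<Sum>i. enorm (?u i z)) = absum a z * nphi (- z + y)" for z
    by (simp add: absum_def norm_mult ennreal_mult ennreal_suminf_multc)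
   show "(\<integral>\<^sup>+z. (\<Sum>i. enorm (?u i z)) \<partial>mu) < top"
    unfolding e using nconv_phi_finite[OF absum_dominated[OF a], of y] by (simp add: nconv_def)
   show "(\<Sum>i. enorm (?u i z)) < top" for z
    unfolding e using absum_finite[OF a, of z] by (simp add: ennreal_mult_less_top)
  qed
  moreover have "integral\<^sup>L mu (?u i) = a i * phi (- x i + y)" for i
  proof -
   have "integral\<^sup>L mu (?u i) = a i * conv mu (left_transl (x i) phi) phi y"
    by (simp add: conv_def left_transl_def mult.assoc)
   also have "conv mu (left_transl (x i) phi) phi y = phi (- x i + y)"
    using E_conv[OF left_transl_kernel_mem[of "x i"], of y] by (simp add: left_transl_def)
   finally show ?thesis .
  qed
  ultimately have "(%i. a i * phi (- x i + y)) sums conv mu (Syn a) phi y" by (simp add: conv_def)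
  then show ?thesis using Syn_sums(2)[OF a, of y] by (rule sums_unique2)
 qed
 then show ?thesis using Syn_bound(1)[OF a] by (auto simp: E_iff fun_eq_iff)
qed

lemma Syn_add: "a : D ==> b : D ==> Syn (%i. a i + b i) = (%y. Syn a y + Syn b y)"
proof
 fix y assume "a : D" "b : D"
 from has_sum_add[OF Syn_sums(1)[OF this(1)] Syn_sums(1)[OF this(2)], of y y]
 show "Syn (%i. a i + b i) y = Syn a y + Syn b y"
  unfolding Syn_def[of "%i. a i + b i"] by (intro infsumI) (simp add: distrib_right)
qed

lemma Syn_scale: "Syn (%i. c * a i) = (%y. c * Syn a y)"
 unfolding Syn_def[abs_def] by (simp add: mult.assoc infsum_cmult_right')

text \<open>
 A function of compact support meets only finitely many of the sets of the cover, and outside of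
 these the envelope is dominated by its distance to that function.
\<close>
lemma Syn_norm_sum:
 assumes a: "a : D" and dense: "dense_in_space compactly_supported_continuous B N"
 shows "norm_sum N I (%i y. a i * left_transl (x i) phi y) (Syn a)"
 unfolding norm_sum_def
proof (rule tendstoI)
 fix e :: real assume e: "e > 0"
 define K where "K = synthC * solidC + 1"
 have K: "K > 0" "synthC * solidC <= K"
  using synthC_nonneg solidC(1) by (auto simp: K_def intro: add_nonneg_pos)
 let ?e = "seq_envelope (U eps) I x a"
 have eB: "?e : B" using a by (simp add: D_iff)
 have "e / K > 0" using e K by simp
 then obtain h where h: "h : compactly_supported_continuous" "N (%y. ?e y - h y) < e / K"
  using dense eB unfolding dense_in_space_def by blast
 have hB: "h : B" using dense h(1) by (auto simp: dense_in_space_def)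
 define F0 where "F0 = {i:I. (+) (x i) ` U eps Int closure {y. h y ~= 0} ~= {}}"
 have F0: "finite F0" "F0 <= I"
  unfolding F0_def using h(1) by (auto intro!: locally_finite simp: compactly_supported_continuous_def)
 have "dist (N (%y. Syn a y - (\<Sum>i\<in>F. a i * left_transl (x i) phi y))) 0 < e"
  if F: "finite F" "F0 <= F" "F <= I" for F
 proof -
  define b where "b i = (if i : F then 0 else a i)" for i
  let ?eb = "seq_envelope (U eps) I x b"
  have le: "norm (?eb y) <= norm (?e y - h y)" for y
  proof (cases "h y = 0")
   case True
   have "(\<Sum>i | i : I & y : (+) (x i) ` U eps. norm (b i)) <= (\<Sum>i | i : I & y : (+) (x i) ` U eps. norm (a i))"
    by (rule sum_mono) (simp add: b_def)
   moreover have "0 <= (\<Sum>i | i : I & y : (+) (x i) ` U eps. norm (b i))" by (rule sum_nonneg) simp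
   ultimately show ?thesis unfolding seq_envelope_eq True by (simp del: of_real_sum)
  next
   case False
   then have "y : closure {y. h y ~= 0}" by (intro subsetD[OF closure_subset]) simp
   then have "b i = 0" if "i : I & y : (+) (x i) ` U eps" for i
    using that F(2) unfolding b_def F0_def by auto
   then show ?thesis unfolding seq_envelope_eq by simp
  qed
  have d: "(%y. ?e y - h y) : B" by (rule B.diff[OF eB hB])
  have ebB: "?eb : B" by (rule solid[OF d seq_envelope_measurable AE_I2[OF le]])
  have bD: "b : D" unfolding D_iff using ebB a by (simp add: b_def D_iff)
  have eq: "Syn a y - (\<Sum>i\<in>F. a i * left_transl (x i) phi y) = Syn b y" for y
  proof -
   have "((%i. a i * left_transl (x i) phi y) has_sum (\<Sum>i\<in>F. a i * left_transl (x i) phi y)) F"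
    using F(1) by (rule has_sum_finite)
   then have "((%i. (a i - b i) * left_transl (x i) phi y) has_sum (\<Sum>i\<in>F. a i * left_transl (x i) phi y)) I"
    by (rule has_sum_cong_neutral[THEN iffD1, rotated -1]) (use F(3) in \<open>auto simp: b_def\<close>)
   from has_sum_add[OF this Syn_sums(1)[OF bD, of y]]
   have "((%i. a i * left_transl (x i) phi y) has_sum ((\<Sum>i\<in>F. a i * left_transl (x i) phi y) + Syn b y)) I"
    by (simp add: algebra_simps)
   from has_sum_unique[OF this Syn_sums(1)[OF a, of y]] show ?thesis by (metis add_diff_cancel_left')
  qed
  have "N (Syn b) <= synthC * ND b" by (rule Syn_bound(2)[OF bD])
  also have "ND b <= solidC * N (%y. ?e y - h y)"
   unfolding seq_norm_def by (rule solidC(2)[OF d seq_envelope_measurable AE_I2[OF le]])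
  then have "synthC * ND b <= synthC * solidC * N (%y. ?e y - h y)"
   using synthC_nonneg by (simp add: mult.assoc mult_left_mono)
  also have "... <= K * N (%y. ?e y - h y)" using K(2) norm_nonneg[OF d] by (rule mult_right_mono)
  also have "... < e" using h(2) K(1) by (simp add: field_simps)
  finally have "N (Syn b) < e" .
  then show ?thesis using norm_nonneg[OF Syn_bound(1)[OF bD]] unfolding eq by simp
 qed
 then show "\<forall>\<^sub>F F in finite_subsets_at_top I. dist (N (%y. Syn a y - (\<Sum>i\<in>F. a i * left_transl (x i) phi y))) 0 < e"
  unfolding eventually_finite_subsets_at_top using F0 by (intro exI[of _ F0]) blast
qed

subsection \<open>Analysis\<close>

abbreviation "absv f ==  %z. enorm (f z)"

lemma sample_bound:
 assumes f: "f : E"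
 shows "absv f p <= ennreal S * (\<integral>\<^sup>+w. indicator ((+) p ` U eps) w * nconv (absv f) KR w \<partial>mu)"
proof -
 have [measurable]: "f : Bmeas" by (rule measurable[OF E_mem[OF f]])
 have loc: "nphi (- z + p) <= ennreal S * (\<integral>\<^sup>+w. indicator ((+) p ` U eps) w * KR (- z + w) \<partial>mu)" for z
  using local_bound[OF right_kernel_tower[of z], of "%w. KR (- z + w)" p] le_K(1) by (simp add: DR(2))
 have fm: "absv f : Bmeas" by measurable
 have ind: "(indicator ((+) p ` U eps) :: 'g => ennreal) : Bmeas"
  by (rule borel_measurable_indicator[OF translated_box_sets])
 have m: "(%z. absv f z * (\<integral>\<^sup>+w. indicator ((+) p ` U eps) w * KR (- z + w) \<partial>mu)) : borel_measurable mu"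
  by measurable
 have "absv f p <= (\<integral>\<^sup>+z. enorm (f z * phi (- z + p)) \<partial>mu)"
  using integral_norm_bound_ennreal[OF pairing(1)[OF E_mem[OF f], of p]] E_conv[OF f, of p] by (simp add: conv_def)
 also have "... <= (\<integral>\<^sup>+z. ennreal S * (absv f z * (\<integral>\<^sup>+w. indicator ((+) p ` U eps) w * KR (- z + w) \<partial>mu)) \<partial>mu)"
 proof (rule nn_integral_mono)
  fix z
  have "enorm (f z * phi (- z + p)) = absv f z * nphi (- z + p)" by (simp add: norm_mult ennreal_mult)
  also have "... <= absv f z * (ennreal S * (\<integral>\<^sup>+w. indicator ((+) p ` U eps) w * KR (- z + w) \<partial>mu))"
   by (intro mult_left_mono loc) simp
  finally show "enorm (f z * phi (- z + p))
   <= ennreal S * (absv f z * (\<integral>\<^sup>+w. indicator ((+) p ` U eps) w * KR (- z + w) \<partial>mu))"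
   by (simp only: mult.left_commute)
 qed
 also have "... = ennreal S * (\<integral>\<^sup>+z. absv f z * (\<integral>\<^sup>+w. indicator ((+) p ` U eps) w * KR (- z + w) \<partial>mu) \<partial>mu)"
  by (rule nn_integral_cmult[OF m])
 also have "... = ennreal S * (\<integral>\<^sup>+w. indicator ((+) p ` U eps) w * nconv (absv f) KR w \<partial>mu)"
  by (simp only: nconv_weighted[OF fm ind K_measurable(1)])
 finally show ?thesis .
qed

lemma absv_dominated: "f : E ==> dominated (absv f) (solidC * N f)"
 by (intro dominated_mem E_mem)

lemma sampled_mem:
 assumes f: "f : E" and c: "!!i. i : I ==> norm (c i) <= m" and m: "0 <= m"
 shows "family I (%i. c i * f (x i)) : D"
  "ND (family I (%i. c i * f (x i))) <= solidC * (m * real M * S * (A * (C * solidC))) * N f"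
proof -
 have [measurable]: "f : Bmeas" by (rule measurable[OF E_mem[OF f]])
 let ?a = "family I (%i. c i * f (x i))"
 let ?h = "nconv (absv f) KR"
 have hm: "?h : Bmeas" by measurable
 have le: "env ?a y <= ennreal (m * real M * S) * (\<integral>\<^sup>+w. indicator V (- w + y) * ?h w \<partial>mu)" for y
 proof -
  have "env ?a y <= of_nat M * (ennreal m * (ennreal S * (\<integral>\<^sup>+w. indicator V (- w + y) * ?h w \<partial>mu)))"
   unfolding env_def
  proof (rule suminf_cover_le)
   fix i assume i: "i : I" "y : (+) (x i) ` U eps"
   have "enorm (?a i) = enorm (c i) * absv f (x i)"
    using i by (simp add: family_def norm_mult ennreal_mult)
   also have "... <= ennreal m * (ennreal S * (\<integral>\<^sup>+w. indicator ((+) (x i) ` U eps) w * ?h w \<partial>mu))"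
    using c[OF i(1)] by (intro mult_mono ennreal_leI sample_bound f) auto
   also have "... <= ennreal m * (ennreal S * (\<integral>\<^sup>+w. indicator V (- w + y) * ?h w \<partial>mu))"
   proof (intro mult_left_mono nn_integral_mono mult_right_mono)
    fix w
    show "(indicator ((+) (x i) ` U eps) w :: ennreal) <= indicator V (- w + y)"
    proof (cases "w : (+) (x i) ` U eps")
     case True
     then have "- (- x i + w) + (- x i + y) : V" using i(2) by (intro box_V) (simp_all only: mem_translate)
     then have "- w + y : V" by (simp add: minus_add add.assoc)
     then have "(indicator V (- w + y) :: ennreal) = 1" by (rule indicator_simps(1))
     moreover have "(indicator ((+) (x i) ` U eps) w :: ennreal) = 1" using True by (rule indicator_simps(1))
     ultimately show ?thesis by (simp only: order_refl)
    next
     case False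
     then have "(indicator ((+) (x i) ` U eps) w :: ennreal) = 0" by (rule indicator_simps(2))
     then show ?thesis by (simp only: zero_le)
    qed
   qed simp_all
   finally show "enorm (?a i) <= ennreal m * (ennreal S * (\<integral>\<^sup>+w. indicator V (- w + y) * ?h w \<partial>mu))" .
  qed
  also have "... = ennreal (m * real M * S) * (\<integral>\<^sup>+w. indicator V (- w + y) * ?h w \<partial>mu)"
   using m constants by (simp add: ennreal_mult ennreal_of_nat_eq_real_of_nat mult.assoc mult.left_commute)
  finally show ?thesis .
 qed
 have "dominated (%y. ennreal (m * real M * S) * (\<integral>\<^sup>+w. indicator V (- w + y) * ?h w \<partial>mu))
  (m * real M * S * (A * (C * (solidC * N f))))"
  using m constants by (intro dominated_cmult averages hm convolutions(1) absv_dominated f) auto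
 then have dom: "dominated (env ?a) (m * real M * S * (A * (C * (solidC * N f))))"
  by (rule dominated_mono[OF _ le order_refl])
 have "?a : D & ND ?a <= solidC * (m * real M * S * (A * (C * (solidC * N f))))"
  by (rule D_I[OF dom]) (simp only: family_def if_False)
 then show "?a : D" "ND ?a <= solidC * (m * real M * S * (A * (C * solidC))) * N f"
  by (simp_all only: mult.assoc)
qed

text \<open>
 The two values differ by \<open>H w - H (x i)\<close>, averaged with the weights, where \<open>H w = f w * phi (- w + y)\<close>.
 As \<open>f\<close> itself is reproduced by \<open>phi\<close>, \<open>H\<close> is a superposition of products of two translates of \<open>phi\<close>,
 to which the oscillation estimate applies.
\<close>
lemma sampling_error:
 assumes f: "f : E" and bupu: "bupu (U eps) I x psi"
  and mem: "family I (%i. weight mu psi i * f (x i)) : D"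
 shows "enorm (Syn (family I (%i. weight mu psi i * f (x i))) y - f y)
  <= ennreal (Q * 2 ^ n * real M) * nconv (nconv (absv f) KR) KL y"
proof -
 have [measurable]: "f : Bmeas" by (rule measurable[OF E_mem[OF f]])
 define p where "p i w = (if i : I then psi i w else 0)" for i w
 have pm [measurable]: "p i : Bmeas" for i
  using bupu unfolding p_def[abs_def] bupu_def by (cases "i : I") auto
 have p0: "0 <= p i w" for i w using bupu by (auto simp: p_def bupu_def)
 have psum: "(%i. p i w) sums 1" for w
 proof -
  have "((%i. psi i w) has_sum 1) I" using bupu by (simp add: bupu_def)
  then have "((%i. p i w) has_sum 1) UNIV"
   by (rule has_sum_cong_neutral[THEN iffD1, rotated -1]) (auto simp: p_def)
  then show ?thesis by (rule has_sum_imp_sums)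
 qed
 have p1: "p i w <= 1" for i w
  using sum_le_suminf[OF sums_summable[OF psum], of "{i}" w] p0 sums_unique[OF psum, of w] by simp
 have pcover: "ennreal (p i w) <= cover i w" for i w
 proof (cases "p i w = 0")
  case False
  then have i: "i : I" "psi i w ~= 0" by (auto simp: p_def split: if_splits)
  then have "w : closure {w. psi i w ~= 0}" by (intro subsetD[OF closure_subset]) simp
  then have "w : (+) (x i) ` U eps" using bupu i by (auto simp: bupu_def)
  then show ?thesis using i p1[of i w] by (simp add: cover_def ennreal_le_1)
 qed simp
 have pint: "integrable mu (p i)" for i
 proof (rule integrableI_bounded)
  have "(\<integral>\<^sup>+w. enorm (p i w) \<partial>mu) <= (\<integral>\<^sup>+w. indicator ((+) (x i) ` U eps) w \<partial>mu)"
  proof (rule nn_integral_mono)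
   fix w
   have "enorm (p i w) = ennreal (p i w)" using p0[of i w] by simp
   also have "... <= cover i w" by (rule pcover)
   also have "... <= indicator ((+) (x i) ` U eps) w" by (simp add: cover_def)
   finally show "enorm (p i w) <= indicator ((+) (x i) ` U eps) w" .
  qed
  also have "... = emeasure mu (U eps)" by (simp add: emeasure_left)
  also have "... < \<infinity>" by (rule emeasure_compact_finite[OF box_compact])
  finally show "(\<integral>\<^sup>+w. enorm (p i w) \<partial>mu) < \<infinity>" .
 qed (simp add: measurable_mu_iff)
 define H where "H w = f w * phi (- w + y)" for w
 have Hm [measurable]: "H : Bmeas" unfolding H_def[abs_def] by measurable
 have Hint: "integrable mu H" unfolding H_def[abs_def] by (rule pairing(1)[OF E_mem[OF f]])
 have pH: "integrable mu (%w. of_real (p i w) * H w)" for i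
  by (rule Bochner_Integration.integrable_bound[OF Hint])
   (use p0[of i] p1[of i] in \<open>auto simp: measurable_mu_iff norm_mult mult_left_le_one_le\<close>)
 have pc: "integrable mu (%w. of_real (p i w) * H (x i))" for i
  using pint[of i] by (intro integrable_mult_left) simp
 have psumH: "(\<Sum>i. enorm (of_real (p i w) * H w)) = enorm (H w)" for w
 proof -
  have "(\<Sum>i. ennreal (p i w)) = 1"
   using suminf_ennreal2[OF p0 sums_summable[OF psum], of w] sums_unique[OF psum, of w] by simp
  then show ?thesis using p0 by (simp add: norm_mult ennreal_mult ennreal_suminf_multc)
 qed
 have fy: "(%i. \<integral>w. of_real (p i w) * H w \<partial>mu) sums f y"
 proof -
  have "(%i. \<integral>w. of_real (p i w) * H w \<partial>mu) sums (\<integral>w. H w \<partial>mu)"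
  proof (rule integral_sums[OF pH])
   show "(%i. of_real (p i w) * H w) sums H w" for w
    using sums_mult2[OF sums_of_real[OF psum[of w]], of "H w"] by simp
   show "(\<integral>\<^sup>+w. (\<Sum>i. enorm (of_real (p i w) * H w)) \<partial>mu) < top"
    unfolding psumH using Hint by (simp add: integrable_iff_bounded)
   show "(\<Sum>i. enorm (of_real (p i w) * H w)) < top" for w unfolding psumH by simp
  qed
  then show ?thesis using E_conv[OF f, of y] by (simp add: conv_def H_def)
 qed
 let ?a = "family I (%i. weight mu psi i * f (x i))"
 have ai: "?a i * phi (- x i + y) = (\<integral>w. of_real (p i w) * H (x i) \<partial>mu)" for i
 proof -
  have "(\<integral>w. cplx (p i w) * H (x i) \<partial>mu) = cplx (\<integral>w. p i w \<partial>mu) * H (x i)"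
   by simp
  then show ?thesis by (simp add: family_def weight_def H_def p_def)
 qed
 have diff: "(%i. \<integral>w. of_real (p i w) * (H (x i) - H w) \<partial>mu) sums (Syn ?a y - f y)"
 proof -
  have "(\<integral>w. of_real (p i w) * (H (x i) - H w) \<partial>mu) = ?a i * phi (- x i + y) - (\<integral>w. of_real (p i w) * H w \<partial>mu)" for i
   unfolding ai right_diff_distrib by (rule Bochner_Integration.integral_diff[OF pc pH])
  then show ?thesis using sums_diff[OF Syn_sums(2)[OF mem, of y] fy] by (simp only:)
 qed
 define P where "P z w = phi (- z + w) * phi (- w + y)" for z w
 define G where "G i z = (\<integral>\<^sup>+w. (cover i w * KL (- w + y)) * KR (- z + w) \<partial>mu)" for i z
 have osc: "(\<integral>\<^sup>+w. cover i w * enorm (P z w - P z (x i)) \<partial>mu) <= ennreal (Q * 2 ^ n) * G i z" for i z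
 proof (cases "i : I")
  case True
  let ?D = "%alp w. \<Sum>s\<leftarrow>splits alp. DR (fst s) (- z + w) * ((- 1) ^ length (snd s) * DL (snd s) (- w + y))"
  let ?J = "%w. ennreal (2 ^ n) * (KR (- z + w) * KL (- w + y))"
  have tower: "right_tower gam n n ?D" by (rule right_tower_mult[OF right_kernel_tower left_kernel_tower])
  have DJ: "enorm (?D alp w) <= ?J w" if alp: "set alp <= {1..n}" "length alp <= n" for alp w
  proof -
   have "enorm (?D alp w) <= of_nat (length (splits alp)) * (KR (- z + w) * KL (- w + y))"
   proof (rule ennreal_norm_sum_list_le)
    fix s assume "s : set (splits alp)"
    from splits_mem[OF this] alp have s: "set (fst s) <= {1..n}" "length (fst s) <= n" "set (snd s) <= {1..n}" "length (snd s) <= n"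
     by auto
    have "enorm (DR (fst s) (- z + w) * ((- 1) ^ length (snd s) * DL (snd s) (- w + y)))
     = enorm (DR (fst s) (- z + w)) * enorm (DL (snd s) (- w + y))"
     by (simp add: norm_mult norm_power ennreal_mult)
    also have "... <= KR (- z + w) * KL (- w + y)"
     by (intro mult_mono le_K s) auto
    finally show "enorm (DR (fst s) (- z + w) * ((- 1) ^ length (snd s) * DL (snd s) (- w + y)))
     <= KR (- z + w) * KL (- w + y)" .
   qed
   also have "... <= ?J w"
   proof (rule mult_right_mono)
    have "real (length (splits alp)) <= 2 ^ n" using alp(2) by (simp add: length_splits)
    then show "of_nat (length (splits alp)) <= ennreal (2 ^ n)"
     unfolding ennreal_of_nat_eq_real_of_nat by (rule ennreal_leI)
   qed simp
   finally show ?thesis .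
  qed
  have Jm: "?J : Bmeas" by measurable
  have "(\<integral>\<^sup>+w. indicator ((+) (x i) ` U eps) w * enorm (?D [] w - ?D [] (x i)) \<partial>mu)
   <= ennreal Q * (\<integral>\<^sup>+w. indicator ((+) (x i) ` U eps) w * ?J w \<partial>mu)"
   by (rule local_oscillation[OF tower Jm DJ])
  then have "(\<integral>\<^sup>+w. cover i w * enorm (P z w - P z (x i)) \<partial>mu) <= ennreal Q * (\<integral>\<^sup>+w. cover i w * ?J w \<partial>mu)"
   using True by (simp add: cover_def P_def DR(2) DL_Nil)
  also have "(\<integral>\<^sup>+w. cover i w * ?J w \<partial>mu) = (\<integral>\<^sup>+w. ennreal (2 ^ n) * ((cover i w * KL (- w + y)) * KR (- z + w)) \<partial>mu)"
   by (intro nn_integral_cong) (simp only: mult.commute mult.left_commute mult.assoc)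
  also have "... = ennreal (2 ^ n) * G i z"
   unfolding G_def by (rule nn_integral_cmult) measurable
  finally show ?thesis using constants(2) by (simp add: ennreal_mult mult.assoc)
 qed (simp add: cover_def)
 have Hdiff: "enorm (H (x i) - H w) <= (\<integral>\<^sup>+z. absv f z * enorm (P z w - P z (x i)) \<partial>mu)" for i w
 proof -
  have HP: "integrable mu (%z. f z * P z w)" "H w = (\<integral>z. f z * P z w \<partial>mu)" for w
  proof -
   have 1: "(%z. f z * P z w) = (%z. (f z * phi (- z + w)) * phi (- w + y))" by (simp add: P_def mult.assoc)
   show "integrable mu (%z. f z * P z w)"
    unfolding 1 by (intro integrable_mult_left pairing(1) E_mem f)
   show "H w = (\<integral>z. f z * P z w \<partial>mu)"
    unfolding 1 H_def using E_conv[OF f, of w] by (simp add: conv_def)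
  qed
  have "H w - H (x i) = (\<integral>z. f z * P z w - f z * P z (x i) \<partial>mu)"
   unfolding HP(2) by (rule Bochner_Integration.integral_diff[OF HP(1) HP(1), symmetric])
  then have "enorm (H (x i) - H w) <= (\<integral>\<^sup>+z. enorm (f z * P z w - f z * P z (x i)) \<partial>mu)"
   using integral_norm_bound_ennreal[OF Bochner_Integration.integrable_diff[OF HP(1)[of w] HP(1)[of "x i"]]]
   by (simp add: norm_minus_commute)
  also have "... = (\<integral>\<^sup>+z. absv f z * enorm (P z w - P z (x i)) \<partial>mu)"
   by (simp add: norm_mult ennreal_mult right_diff_distrib[symmetric])
  finally show ?thesis .
 qed
 have Pm: "(%(z, w). P z w) : borel_measurable (borel \<Otimes>\<^sub>M borel)"
  unfolding P_def by measurable
 have term_le: "enorm (\<integral>w. of_real (p i w) * (H (x i) - H w) \<partial>mu)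
  <= ennreal (Q * 2 ^ n) * (\<integral>\<^sup>+w. (cover i w * KL (- w + y)) * nconv (absv f) KR w \<partial>mu)" for i
 proof -
  have int: "integrable mu (%w. of_real (p i w) * (H (x i) - H w))"
   unfolding right_diff_distrib by (rule Bochner_Integration.integrable_diff[OF pc pH])
  have Pm' [measurable]: "(%(w, z). P z w) : borel_measurable (borel \<Otimes>\<^sub>M borel)" unfolding P_def by measurable
  have Pw [measurable]: "(%z. P z (x i)) : Bmeas" unfolding P_def by measurable
  have "enorm (\<integral>w. of_real (p i w) * (H (x i) - H w) \<partial>mu)
   <= (\<integral>\<^sup>+w. enorm (of_real (p i w) * (H (x i) - H w)) \<partial>mu)"
   by (rule integral_norm_bound_ennreal[OF int])
  also have "... <= (\<integral>\<^sup>+w. (\<integral>\<^sup>+z. cover i w * (absv f z * enorm (P z w - P z (x i))) \<partial>mu) \<partial>mu)"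
  proof (rule nn_integral_mono)
   fix w
   have "enorm (of_real (p i w) * (H (x i) - H w)) = ennreal (p i w) * enorm (H (x i) - H w)"
    using p0 by (simp add: norm_mult ennreal_mult)
   also have "... <= cover i w * (\<integral>\<^sup>+z. absv f z * enorm (P z w - P z (x i)) \<partial>mu)"
    by (intro mult_mono pcover Hdiff) auto
   also have "... = (\<integral>\<^sup>+z. cover i w * (absv f z * enorm (P z w - P z (x i))) \<partial>mu)"
    unfolding P_def by (rule nn_integral_cmult[symmetric]) measurable
   finally show "enorm (of_real (p i w) * (H (x i) - H w))
    <= (\<integral>\<^sup>+z. cover i w * (absv f z * enorm (P z w - P z (x i))) \<partial>mu)" .
  qed
  also have "... = (\<integral>\<^sup>+z. (\<integral>\<^sup>+w. cover i w * (absv f z * enorm (P z w - P z (x i))) \<partial>mu) \<partial>mu)"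
   unfolding P_def by (rule haar2.Fubini') measurable
  also have "... <= (\<integral>\<^sup>+z. ennreal (Q * 2 ^ n) * (absv f z * G i z) \<partial>mu)"
  proof (rule nn_integral_mono)
   fix z
   have "(\<integral>\<^sup>+w. cover i w * (absv f z * enorm (P z w - P z (x i))) \<partial>mu)
    = (\<integral>\<^sup>+w. absv f z * (cover i w * enorm (P z w - P z (x i))) \<partial>mu)"
    by (simp only: mult.left_commute)
   also have "... = absv f z * (\<integral>\<^sup>+w. cover i w * enorm (P z w - P z (x i)) \<partial>mu)"
    unfolding P_def by (rule nn_integral_cmult) measurable
   also have "... <= absv f z * (ennreal (Q * 2 ^ n) * G i z)" by (intro mult_left_mono osc) simp
   finally show "(\<integral>\<^sup>+w. cover i w * (absv f z * enorm (P z w - P z (x i))) \<partial>mu)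
    <= ennreal (Q * 2 ^ n) * (absv f z * G i z)" by (simp only: mult.left_commute)
  qed
  also have "... = ennreal (Q * 2 ^ n) * (\<integral>\<^sup>+z. absv f z * G i z \<partial>mu)"
   unfolding G_def by (rule nn_integral_cmult) measurable
  also have "(\<integral>\<^sup>+z. absv f z * G i z \<partial>mu) = (\<integral>\<^sup>+w. (cover i w * KL (- w + y)) * nconv (absv f) KR w \<partial>mu)"
   unfolding G_def by (rule nconv_weighted) measurable
  finally show ?thesis .
 qed
 have mm: "(%w. cover i w * KL (- w + y) * nconv (absv f) KR w) : borel_measurable mu" for i
  by measurable
 have "enorm (Syn ?a y - f y) <= (\<Sum>i. enorm (\<integral>w. of_real (p i w) * (H (x i) - H w) \<partial>mu))"
  by (rule ennreal_norm_suminf_le[OF diff])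
 also have "... <= (\<Sum>i. ennreal (Q * 2 ^ n) * (\<integral>\<^sup>+w. (cover i w * KL (- w + y)) * nconv (absv f) KR w \<partial>mu))"
  by (intro suminf_le summableI term_le)
 also have "... = ennreal (Q * 2 ^ n) * (\<integral>\<^sup>+w. (\<Sum>i. (cover i w * KL (- w + y)) * nconv (absv f) KR w) \<partial>mu)"
  by (simp only: nn_integral_suminf[OF mm] ennreal_suminf_cmult)
 also have "... <= ennreal (Q * 2 ^ n) * (\<integral>\<^sup>+w. of_nat M * (nconv (absv f) KR w * KL (- w + y)) \<partial>mu)"
 proof (intro mult_left_mono nn_integral_mono)
  fix w
  have "(\<Sum>i. (cover i w * KL (- w + y)) * nconv (absv f) KR w)
   = (\<Sum>i. (nconv (absv f) KR w * KL (- w + y)) * cover i w)"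
   by (simp only: mult.commute mult.left_commute mult.assoc)
  also have "... <= of_nat M * (nconv (absv f) KR w * KL (- w + y))" by (rule suminf_cover_le) simp
  finally show "(\<Sum>i. (cover i w * KL (- w + y)) * nconv (absv f) KR w)
   <= of_nat M * (nconv (absv f) KR w * KL (- w + y))" .
 qed simp
 also have "(\<integral>\<^sup>+w. of_nat M * (nconv (absv f) KR w * KL (- w + y)) \<partial>mu)
   = of_nat M * nconv (nconv (absv f) KR) KL y"
  unfolding nconv_def[of "nconv (absv f) KR"] by (rule nn_integral_cmult) measurable
 also have "ennreal (Q * 2 ^ n) * (of_nat M * nconv (nconv (absv f) KR) KL y)
   = ennreal (Q * 2 ^ n * real M) * nconv (nconv (absv f) KR) KL y"
  using constants(2) by (simp add: ennreal_mult ennreal_of_nat_eq_real_of_nat mult.assoc)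
 finally show ?thesis .
qed

end

section \<open>Invertibility, atomic decompositions and frames\<close>

context kernel_sampling
begin

lemma bupu_bound:
 assumes "bupu (U eps) I x psi" "i : I"
 shows "0 <= psi i w" "psi i w <= indicator ((+) (x i) ` U eps) w"
proof -
 show nonneg: "0 <= psi i w" using assms by (simp add: bupu_def)
 have sum: "((%i. psi i w) has_sum 1) I" using assms by (simp add: bupu_def)
 have "sum (%i. psi i w) {i} <= 1"
  by (rule finite_sum_le_has_sum[OF sum]) (use assms in \<open>auto simp: bupu_def\<close>)
 then have le: "psi i w <= 1" by simp
 show "psi i w <= indicator ((+) (x i) ` U eps) w"
 proof (cases "psi i w = 0")
  case False
  then have "w : closure {w. psi i w ~= 0}" by (intro subsetD[OF closure_subset]) simp
  then have "w : (+) (x i) ` U eps" using assms unfolding bupu_def by blast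
  then have "(indicator ((+) (x i) ` U eps) w :: real) = 1" by (rule indicator_simps(1))
  then show ?thesis using le by simp
 qed (simp add: indicator_def)
qed

lemma weight_bound:
 assumes "bupu (U eps) I x psi" "i : I"
 shows "norm (weight mu psi i) <= measure mu (U eps)"
proof -
 have fm: "emeasure mu ((+) (x i) ` U eps) < \<infinity>"
  using emeasure_compact_finite[OF box_compact[of eps]] by (simp add: emeasure_left)
 have int: "integrable mu (indicator ((+) (x i) ` U eps) :: 'g => real)"
  using fm translated_box_sets[of "x i" eps] by (intro integrable_real_indicator) simp_all
 have "(\<integral>w. psi i w \<partial>mu) <= (\<integral>w. indicator ((+) (x i) ` U eps) w \<partial>mu)"
  by (rule integral_mono'[OF int]) (use bupu_bound[OF assms] in \<open>auto simp: indicator_def\<close>)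
 also have "... = measure mu ((+) (x i) ` U eps)" by simp
 also have "... = measure mu (U eps)" unfolding measure_def by (simp add: emeasure_left)
 finally have "(\<integral>w. psi i w \<partial>mu) <= measure mu (U eps)" .
 moreover have "0 <= (\<integral>w. psi i w \<partial>mu)" by (intro Bochner_Integration.integral_nonneg bupu_bound(1)[OF assms])
 ultimately show ?thesis by (simp add: weight_def)
qed

lemma norm_equivalentI:
 assumes "!!f. f : E ==> family I (%i. l i f) : D"
  and "!!f. f : E ==> N f <= a * ND (family I (%i. l i f))"
  and "!!f. f : E ==> ND (family I (%i. l i f)) <= b * N f"
 shows "norm_equivalent_coefficients E N D ND I l"
proof -
 define s t where "s = 1 / (\<bar>a\<bar> + 1)" and "t = \<bar>b\<bar> + 1"
 have pos: "s > 0" "t > 0" by (simp_all add: s_def t_def)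
 have "s * N f <= ND (family I (%i. l i f)) & ND (family I (%i. l i f)) <= t * N f" if f: "f : E" for f
 proof
  let ?d = "ND (family I (%i. l i f))"
  have "a * ?d <= (\<bar>a\<bar> + 1) * ?d" "b * N f <= t * N f"
   unfolding t_def using ND_nonneg[OF assms(1)[OF f]] norm_nonneg[OF E_mem[OF f]] by (auto intro!: mult_right_mono)
  then have 1: "N f <= (\<bar>a\<bar> + 1) * ?d" and 2: "?d <= t * N f" using assms(2,3)[OF f] by linarith+
  have "s * N f <= s * ((\<bar>a\<bar> + 1) * ?d)" using 1 pos(1) by (intro mult_left_mono) auto
  also have "... = ?d" by (simp add: s_def)
  finally show "s * N f <= ?d" .
  show "?d <= t * N f" by (rule 2)
 qed
 then show ?thesis unfolding norm_equivalent_coefficients_def using assms(1) pos by blast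
qed

lemma sampling_functional: "(%f. c * f y) : dual_space E N"
proof -
 obtain K where K: "ALL f:E. norm (f y) <= K * N f" using point_evaluation by blast
 have "norm (c * f y) <= norm c * K * N f" if "f : E" for f
  using K that by (simp add: norm_mult mult.assoc mult_left_mono)
 then show ?thesis unfolding dual_space_def by (auto simp: distrib_left mult.left_commute)
qed

lemma dual_compose:
 assumes l: "l : dual_space E N" and R: "bounded_operator E N E N R"
 shows "(%f. l (R f)) : dual_space E N"
proof -
 obtain K where K: "ALL f:E. norm (l f) <= K * N f" using l unfolding dual_space_def by blast
 obtain K' where K': "ALL f:E. N (R f) <= K' * N f" using R unfolding bounded_operator_def by blast
 have RE: "R f : E" if "f : E" for f using R that unfolding bounded_operator_def by blast
 have "norm (l (R f)) <= \<bar>K\<bar> * K' * N f" if f: "f : E" for f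
 proof -
  have "norm (l (R f)) <= K * N (R f)" using K RE[OF f] by blast
  also have "... <= \<bar>K\<bar> * N (R f)" using norm_nonneg[OF E_mem[OF RE[OF f]]] by (intro mult_right_mono) auto
  also have "... <= \<bar>K\<bar> * (K' * N f)" using K' f by (intro mult_left_mono) auto
  finally show ?thesis by (simp add: mult.assoc)
 qed
 moreover have "l (R (%x. f x + g x)) = l (R f) + l (R g)" if "f : E" "g : E" for f g
 proof -
  have "R (%x. f x + g x) = (%y. R f y + R g y)" using R that unfolding bounded_operator_def by blast
  then show ?thesis using l RE that unfolding dual_space_def by simp
 qed
 moreover have "l (R (%x. a * f x)) = a * l (R f)" if "f : E" for f a
 proof -
  have "R (%x. a * f x) = (%y. a * R f y)" using R that unfolding bounded_operator_def by blast
  then show ?thesis using l RE that unfolding dual_space_def by simp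
 qed
 ultimately show ?thesis unfolding dual_space_def by blast
qed

lemma sampling_theorem:
 assumes bupu: "bupu (U eps) I x psi"
 defines "c == weight mu psi" and "T == T3 mu phi I x psi" and "v ==  %i. left_transl (x i) phi"
 shows "invertible_operator E N T"
  and "ALL f:E. pointwise_sum I (%i y. c i * f (x i) * v i y) (T f)"
  and "dense_in_space compactly_supported_continuous B N ==>
   ALL f:E. norm_sum N I (%i y. c i * f (x i) * v i y) (T f)"
  and "atomic_decomposition (pointwise_sum I) E N D ND I (%i f. c i * inv_into E T f (x i)) v"
  and "dense_in_space compactly_supported_continuous B N ==>
   atomic_decomposition (norm_sum N I) E N D ND I (%i f. c i * inv_into E T f (x i)) v"
  and "banach_frame E N D ND I (%i f. c i * f (x i))"
proof -
 define Ana where "Ana f = family I (%i. c i * f (x i))" for f :: "'g => complex"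
 define b where "b = solidC * (measure mu (U eps) * real M * S * (A * (C * solidC)))"
 have Ana: "Ana f : D" "ND (Ana f) <= b * N f" if f: "f : E" for f
  unfolding Ana_def b_def c_def
  by (rule sampled_mem[OF f weight_bound[OF bupu] measure_nonneg]; assumption)+
 have b0: "0 <= b" using solidC(1) constants by (simp add: b_def)
 have Ana_add: "Ana (%x. f x + g x) = (%i. Ana f i + Ana g i)" for f g
  by (auto simp: Ana_def family_def distrib_left)
 have Ana_scale: "Ana (%x. a * f x) = (%i. a * Ana f i)" for a f
  by (auto simp: Ana_def family_def)
 have T_eq: "T f = Syn (Ana f)" for f
 proof
  fix y
  show "T f y = Syn (Ana f) y"
   unfolding T_def T3_def Syn_def by (rule infsum_cong) (simp add: Ana_def family_def c_def)
 qed
 have TE: "T f : E" if "f : E" for f unfolding T_eq by (rule Syn_mem[OF Ana(1)[OF that]])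
 have near: "N (%y. T f y - f y) <= 1 / 2 * N f" if f: "f : E" for f
 proof -
  have [measurable]: "f : Bmeas" by (rule measurable[OF E_mem[OF f]])
  have "dominated (%y. ennreal (Q * 2 ^ n * real M) * nconv (nconv (absv f) KR) KL y)
    (Q * 2 ^ n * real M * (C * (C * (solidC * N f))))"
  proof (intro dominated_cmult convolutions absv_dominated f)
   show "nconv (absv f) KR : Bmeas" "absv f : Bmeas" by measurable
  qed (use constants in simp)
  moreover have "(%y. T f y - f y) : Bmeas"
   by (rule measurable[OF B.diff[OF E_mem[OF TE[OF f]] E_mem[OF f]]])
  moreover have "AE y in mu. enorm (T f y - f y)
    <= ennreal (Q * 2 ^ n * real M) * nconv (nconv (absv f) KR) KL y"
   unfolding T_eq Ana_def c_def
   by (rule AE_I2, rule sampling_error[OF f bupu]) (use Ana(1)[OF f] in \<open>simp only: Ana_def c_def\<close>)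
  ultimately have "N (%y. T f y - f y) <= solidC * (Q * 2 ^ n * real M * (C * (C * (solidC * N f))))"
   using dominated_bound by blast
  also have "... = solidC * (Q * 2 ^ n * real M * (C * (C * solidC))) * N f" by simp
  also have "... <= 1 / 2 * N f" by (rule mult_right_mono[OF small norm_nonneg[OF E_mem[OF f]]])
  finally show ?thesis .
 qed
 have T_add: "T (%x. f x + g x) = (%y. T f y + T g y)" if "f : E" "g : E" for f g
  unfolding T_eq Ana_add by (rule Syn_add[OF Ana(1)[OF that(1)] Ana(1)[OF that(2)]])
 have T_scale: "T (%x. a * f x) = (%y. a * T f y)" for a f
  unfolding T_eq Ana_scale by (rule Syn_scale)
 define R where "R = inv_into E T"
 have opT: "bounded_operator E N E N T" and opR: "bounded_operator E N E N R"
  and inv: "!!f. f : E ==> R (T f) = f & T (R f) = f"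
  unfolding R_def using E.near_identity_invertible[OF E_definite TE T_add T_scale near] by blast+
 have RE: "R f : E" if "f : E" for f using opR that unfolding bounded_operator_def by blast
 obtain r where r: "ALL f:E. N (R f) <= r * N f" using opR unfolding bounded_operator_def by blast
 show "invertible_operator E N T"
  unfolding invertible_operator_def using opT opR inv by blast
 have sums: "pointwise_sum I (%i y. c i * f (x i) * v i y) (T f)" if f: "f : E" for f
  unfolding pointwise_sum_def
 proof
  fix y
  have "((%i. Ana f i * left_transl (x i) phi y) has_sum T f y) I" unfolding T_eq by (rule Syn_sums(1)[OF Ana(1)[OF f]])
  then show "((%i. c i * f (x i) * v i y) has_sum T f y) I"
   by (rule has_sum_cong[THEN iffD1, rotated]) (simp add: Ana_def family_def v_def)
 qed
 have norms: "norm_sum N I (%i y. c i * f (x i) * v i y) (T f)"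
  if f: "f : E" and dense: "dense_in_space compactly_supported_continuous B N" for f
 proof -
  have eq: "(\<Sum>i\<in>F. Ana f i * left_transl (x i) phi y) = (\<Sum>i\<in>F. c i * f (x i) * v i y)" if "F <= I" for F y
   by (rule sum.cong) (use that in \<open>auto simp: Ana_def family_def v_def\<close>)
  have "((%F. N (%y. T f y - (\<Sum>i\<in>F. Ana f i * left_transl (x i) phi y))) \<longlongrightarrow> 0) (finite_subsets_at_top I)"
   using Syn_norm_sum[OF Ana(1)[OF f] dense] unfolding norm_sum_def T_eq .
  moreover have "\<forall>\<^sub>F F in finite_subsets_at_top I.
    N (%y. T f y - (\<Sum>i\<in>F. Ana f i * left_transl (x i) phi y)) = N (%y. T f y - (\<Sum>i\<in>F. c i * f (x i) * v i y))"
   unfolding eventually_finite_subsets_at_top by (intro exI[of _ "{}"]) (simp add: eq)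
  ultimately show ?thesis unfolding norm_sum_def by (rule Lim_transform_eventually)
 qed
 show "ALL f:E. pointwise_sum I (%i y. c i * f (x i) * v i y) (T f)" using sums by blast
 show "dense_in_space compactly_supported_continuous B N ==>
   ALL f:E. norm_sum N I (%i y. c i * f (x i) * v i y) (T f)" using norms by blast
 have atoms: "ALL i:I. (%f. c i * inv_into E T f (x i)) : dual_space E N & v i : E"
  using dual_compose[OF sampling_functional opR] left_transl_kernel_mem unfolding R_def v_def by blast
 have equiv: "norm_equivalent_coefficients E N D ND I (%i f. c i * inv_into E T f (x i))"
 proof (rule norm_equivalentI)
  fix f assume f: "f : E"
  have fam: "family I (%i. c i * inv_into E T f (x i)) = Ana (R f)" by (simp add: Ana_def R_def)
  show "family I (%i. c i * inv_into E T f (x i)) : D" unfolding fam by (rule Ana(1)[OF RE[OF f]])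
  have "N f = N (Syn (Ana (R f)))" using inv[OF f] T_eq by simp
  also have "... <= synthC * ND (Ana (R f))" by (rule Syn_bound(2)[OF Ana(1)[OF RE[OF f]]])
  finally show "N f <= synthC * ND (family I (%i. c i * inv_into E T f (x i)))" unfolding fam .
  have "ND (Ana (R f)) <= b * N (R f)" by (rule Ana(2)[OF RE[OF f]])
  also have "... <= b * (r * N f)" using r f b0 by (intro mult_left_mono) auto
  finally show "ND (family I (%i. c i * inv_into E T f (x i))) <= b * r * N f" unfolding fam by (simp add: mult.assoc)
 qed
 have TR: "T (inv_into E T f) = f" "inv_into E T f : E" if "f : E" for f
  using inv[OF that] RE[OF that] by (simp_all add: R_def)
 show "atomic_decomposition (pointwise_sum I) E N D ND I (%i f. c i * inv_into E T f (x i)) v"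
  unfolding atomic_decomposition_def using atoms equiv sums[OF TR(2)] TR(1) by simp
 show "atomic_decomposition (norm_sum N I) E N D ND I (%i f. c i * inv_into E T f (x i)) v"
  if "dense_in_space compactly_supported_continuous B N"
  unfolding atomic_decomposition_def using atoms equiv norms[OF TR(2) that] TR(1) by simp
 have frame: "norm_equivalent_coefficients E N D ND I (%i f. c i * f (x i))"
 proof (rule norm_equivalentI)
  fix f assume f: "f : E"
  have fam: "family I (%i. c i * f (x i)) = Ana f" by (simp add: Ana_def)
  show "family I (%i. c i * f (x i)) : D" unfolding fam by (rule Ana(1)[OF f])
  show "ND (family I (%i. c i * f (x i))) <= b * N f" unfolding fam by (rule Ana(2)[OF f])
  have "N f = N (R (T f))" using inv[OF f] by simp
  also have "... <= r * N (T f)" using r TE[OF f] by blast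
  also have "... <= \<bar>r\<bar> * N (T f)" using norm_nonneg[OF E_mem[OF TE[OF f]]] by (intro mult_right_mono) auto
  also have "... <= \<bar>r\<bar> * (synthC * ND (Ana f))"
   unfolding T_eq by (intro mult_left_mono Syn_bound(2) Ana(1) f) simp
  finally show "N f <= \<bar>r\<bar> * synthC * ND (family I (%i. c i * f (x i)))"
   unfolding fam by (simp add: mult.assoc)
 qed
 have RSyn: "bounded_operator D ND E N (%a. R (Syn a))"
  unfolding bounded_operator_def
 proof (intro conjI ballI allI exI[of _ "\<bar>r\<bar> * synthC"])
  fix a assume a: "a : D"
  have sa: "Syn a : E" by (rule Syn_mem[OF a])
  show "R (Syn a) : E" by (rule RE[OF sa])
  show "R (Syn (%i. k * a i)) = (%y. k * R (Syn a) y)" for k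
   unfolding Syn_scale using opR sa unfolding bounded_operator_def by blast
  have "N (R (Syn a)) <= r * N (Syn a)" using r sa by blast
  also have "... <= \<bar>r\<bar> * N (Syn a)" using norm_nonneg[OF E_mem[OF sa]] by (intro mult_right_mono) auto
  also have "... <= \<bar>r\<bar> * (synthC * ND a)" by (intro mult_left_mono Syn_bound(2) a) simp
  finally show "N (R (Syn a)) <= \<bar>r\<bar> * synthC * ND a" by (simp add: mult.assoc)
  fix a' assume a': "a' : D"
  show "R (Syn (%i. a i + a' i)) = (%y. R (Syn a) y + R (Syn a') y)"
   unfolding Syn_add[OF a a'] using opR sa Syn_mem[OF a'] unfolding bounded_operator_def by blast
 qed
 have "ALL f:E. R (Syn (family I (%i. c i * f (x i)))) = f"
  using inv T_eq by (simp add: Ana_def)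
 then show "banach_frame E N D ND I (%i f. c i * f (x i))"
  unfolding banach_frame_def using sampling_functional frame RSyn by blast
qed

end

text \<open>
 The overlap bound and the constants of the oscillation estimate and of the convolutions do not
 depend on the size of the box, so the operator is as close to the identity as desired.
\<close>
lemma (in smooth_kernel_space) exists_kernel_sampling:
 obtains eps I x M V S Q A C where "eps > 0" "relatively_separated (U eps) I x"
  "kernel_sampling gam n mu B N phi DR DL eps I x M V S Q A C"
proof -
 have "EX C1 dlt1. 0 < C1 & 0 < dlt1 & (ALL eps D J p. 0 < eps --> eps <= dlt1 --> right_tower gam n n D --> J : Bmeas -->
   (ALL alp z. set alp <= {1..n} --> length alp <= n --> enorm (D alp z) <= J z) -->
   enorm (D [] p) <= ennreal (C1 * (1 / eps) ^ n) * (\<integral>\<^sup>+w. indicator ((+) p ` U eps) w * J w \<partial>mu) &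
   (\<integral>\<^sup>+w. indicator ((+) p ` U eps) w * enorm (D [] w - D [] p) \<partial>mu)
    <= ennreal (C1 * eps) * (\<integral>\<^sup>+w. indicator ((+) p ` U eps) w * J w \<partial>mu))"
 proof (rule local_estimates, goal_cases)
  case (1 C dlt)
  show ?case
  proof (rule exI[of _ C], rule exI[of _ dlt], rule conjI[OF 1(1)], rule conjI[OF 1(2)], intro allI impI)
   fix eps D p and J :: "'g => ennreal"
   assume h: "0 < eps" "eps <= dlt" "right_tower gam n n D" "J : Bmeas"
    "ALL alp z. set alp <= {1..n} --> length alp <= n --> enorm (D alp z) <= J z"
   show "enorm (D [] p) <= ennreal (C * (1 / eps) ^ n) * (\<integral>\<^sup>+w. indicator ((+) p ` U eps) w * J w \<partial>mu) &
   (\<integral>\<^sup>+w. indicator ((+) p ` U eps) w * enorm (D [] w - D [] p) \<partial>mu)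
    <= ennreal (C * eps) * (\<integral>\<^sup>+w. indicator ((+) p ` U eps) w * J w \<partial>mu)"
    by (rule conjI; rule 1(3) 1(4), (rule h | use h(5) in blast)+)
  qed
 qed
 then obtain C1 dlt1 where est: "0 < C1" "0 < dlt1" and bounds: "ALL eps D J p. 0 < eps --> eps <= dlt1 --> right_tower gam n n D --> J : Bmeas -->
   (ALL alp z. set alp <= {1..n} --> length alp <= n --> enorm (D alp z) <= J z) -->
   enorm (D [] p) <= ennreal (C1 * (1 / eps) ^ n) * (\<integral>\<^sup>+w. indicator ((+) p ` U eps) w * J w \<partial>mu) &
   (\<integral>\<^sup>+w. indicator ((+) p ` U eps) w * enorm (D [] w - D [] p) \<partial>mu)
    <= ennreal (C1 * eps) * (\<integral>\<^sup>+w. indicator ((+) p ` U eps) w * J w \<partial>mu)"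
  by (elim exE conjE)
 obtain M dlt2 where pts: "dlt2 > 0"
  "!!eps. 0 < eps ==> eps <= dlt2 ==> EX (I::nat set) x. relatively_separated (U eps) I x &
   (ALL y. finite {i:I. y : (+) (x i) ` U eps} & card {i:I. y : (+) (x i) ` U eps} <= M) &
   (ALL K. compact K --> finite {i:I. (+) (x i) ` U eps Int K ~= {}})"
  by (rule sampling_points) (rule that)
 obtain V A where V: "open V" "0 : V" "A >= 0"
  "!!h r. h : Bmeas ==> dominated h r ==>
   dominated (%y. \<integral>\<^sup>+x. indicator V (- x + y) * h x \<partial>mu) (A * r)"
  by (rule dominated_average) (rule that)
 obtain C where C: "C >= 0"
  "!!h r. h : Bmeas ==> dominated h r ==> dominated (nconv h KR) (C * r)"
  "!!h r. h : Bmeas ==> dominated h r ==> dominated (nconv h KL) (C * r)"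
  by (rule dominated_nconv_K) (rule that)
 have "open ((%p::'g \<times> 'g. - fst p + snd p) -` V)" by (intro open_vimage V continuous_intros)
 moreover have "(0, 0) : (%p::'g \<times> 'g. - fst p + snd p) -` V" using V(2) by simp
 ultimately obtain W1 W2 where W: "open W1" "open W2" "(0, 0) : W1 \<times> W2"
   "W1 \<times> W2 <= (%p::'g \<times> 'g. - fst p + snd p) -` V"
  by (rule open_prod_elim)
 have "open (W1 Int W2)" "0 : W1 Int W2" using W by auto
 from box_small[OF this] obtain dlt3 where dlt3: "dlt3 > 0" "ALL eps. 0 < eps --> eps <= dlt3 --> U eps <= W1 Int W2" by blast
 define Z where "Z = solidC * (C1 * 2 ^ n * real M * (C * (C * solidC)))"
 have Z: "Z >= 0" using solidC(1) est(1) C(1) by (simp add: Z_def)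
 define eps where "eps = min (min dlt1 dlt2) (min dlt3 (1 / (2 * (Z + 1))))"
 have eps: "0 < eps" "eps <= dlt1" "eps <= dlt2" "eps <= dlt3" "eps <= 1 / (2 * (Z + 1))"
  using est(2) pts(1) dlt3(1) Z by (auto simp: eps_def)
 obtain I :: "nat set" and x where I: "relatively_separated (U eps) I x"
   "ALL y. finite {i:I. y : (+) (x i) ` U eps} & card {i:I. y : (+) (x i) ` U eps} <= M"
   "ALL K. compact K --> finite {i:I. (+) (x i) ` U eps Int K ~= {}}"
  using pts(2)[OF eps(1,3)] by (elim exE conjE)
 have "kernel_sampling gam n mu B N phi DR DL eps I x M V (C1 * (1 / eps) ^ n) (C1 * eps) A C"
 proof (rule kernel_sampling.intro[OF smooth_kernel_space_axioms kernel_sampling_axioms.intro])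
  show "finite {i:I. y : (+) (x i) ` U eps}" "card {i:I. y : (+) (x i) ` U eps} <= M" for y
   using I(2) by blast+
  show "finite {i:I. (+) (x i) ` U eps Int K ~= {}}" if "compact K" for K using I(3) that by blast
  show "0 <= C1 * (1 / eps) ^ n" "0 <= C1 * eps" "0 <= A" "0 <= C" using est(1) eps(1) V(3) C(1) by simp_all
  show "V : sets borel" using V(1) by simp
  show "- u + v : V" if "u : U eps" "v : U eps" for u v
  proof -
   have "(u, v) : W1 \<times> W2" using dlt3(2) eps that by blast
   then have "(u, v) : (%p. - fst p + snd p) -` V" using W(4) by blast
   then show ?thesis by simp
  qed
  show "solidC * (C1 * eps * 2 ^ n * real M * (C * (C * solidC))) <= 1 / 2"
  proof -
   have "solidC * (C1 * eps * 2 ^ n * real M * (C * (C * solidC))) = Z * eps" by (simp add: Z_def)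
   also have "... <= Z * (1 / (2 * (Z + 1)))" using eps(5) Z by (rule mult_left_mono)
   also have "... <= 1 / 2" using Z by (simp add: field_simps)
   finally show ?thesis .
  qed
  fix D p and J :: "'g => ennreal"
  assume h: "right_tower gam n n D" "J : Bmeas"
   and "!!alp z. set alp <= {1..n} ==> length alp <= n ==> enorm (D alp z) <= J z"
  then have DJ: "ALL alp z. set alp <= {1..n} --> length alp <= n --> enorm (D alp z) <= J z" by blast
  note b = bounds[THEN spec, THEN spec, THEN spec, THEN spec, THEN mp, OF eps(1), THEN mp, OF eps(2),
    THEN mp, OF h(1), THEN mp, OF h(2), THEN mp, OF DJ]
  show "enorm (D [] p) <= ennreal (C1 * (1 / eps) ^ n) * (\<integral>\<^sup>+w. indicator ((+) p ` U eps) w * J w \<partial>mu)"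
   by (rule b[THEN conjunct1])
  show "(\<integral>\<^sup>+w. indicator ((+) p ` U eps) w * enorm (D [] w - D [] p) \<partial>mu)
    <= ennreal (C1 * eps) * (\<integral>\<^sup>+w. indicator ((+) p ` U eps) w * J w \<partial>mu)"
   by (rule b[THEN conjunct2])
 qed (fact V(4) C(2) C(3))+
 then show ?thesis by (rule that[OF eps(1) I(1)])
qed

section \<open>Derivatives along the basis as towers\<close>

lemma has_vector_derivative_if_quotient:
 fixes f :: "real => complex"
 assumes "((%t. (f t - f 0) / of_real t) \<longlongrightarrow> l) (at 0)"
 shows "(f has_vector_derivative l) (at 0)"
proof -
 have "((%t. norm ((f t - f 0) / of_real t - l)) \<longlongrightarrow> 0) (at 0)"
  by (rule tendsto_norm_zero[OF LIM_zero[OF assms]])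
 moreover have "norm ((f t - f 0) / of_real t - l) = norm (f (0 + t) - f 0 - t *\<^sub>R l) / norm t" if "t ~= 0" for t
 proof -
  have "(f t - f 0) / of_real t - l = (f (0 + t) - f 0 - t *\<^sub>R l) / of_real t"
   using that by (simp add: scaleR_conv_of_real diff_divide_distrib)
  then show ?thesis by (simp only: norm_divide norm_of_real real_norm_def)
 qed
 then have "\<forall>\<^sub>F t in at 0. norm ((f t - f 0) / of_real t - l) = norm (f (0 + t) - f 0 - t *\<^sub>R l) / norm t"
  by (simp add: eventually_at_filter)
 ultimately have "((%t. norm (f (0 + t) - f 0 - t *\<^sub>R l) / norm t) \<longlongrightarrow> 0) (at 0)"
  by (rule Lim_transform_eventually)
 then show ?thesis
  unfolding has_vector_derivative_def has_derivative_at by (simp add: bounded_linear_scaleR_left)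
qed

lemma measurable_derivative:
 fixes f :: "'g::topological_space => complex"
 assumes F: "!!t::real. F t : Bmeas" and f: "f : Bmeas"
  and lim: "!!z. ((%t. (F t z - f z) / of_real t) \<longlongrightarrow> g z) (at 0)"
 shows "g : Bmeas"
proof (rule borel_measurable_LIMSEQ_metric)
 show "(%z. (F (inverse (real (Suc m))) z - f z) / of_real (inverse (real (Suc m)))) : Bmeas" for m
  by (intro borel_measurable_divide borel_measurable_diff F f borel_measurable_const)
 have "filterlim (%m. inverse (real (Suc m))) (at 0) sequentially"
  by (rule filterlim_atI[OF LIMSEQ_inverse_real_of_nat]) simp
 then show "(%m. (F (inverse (real (Suc m))) z - f z) / of_real (inverse (real (Suc m)))) \<longlonglongrightarrow> g z" for z
  by (rule filterlim_compose[OF lim])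
qed

lemma (in sampling_space) smooth_kernel_space_if_differentiable:
 fixes A :: "('g, 'e::euclidean_space) chart set" and X :: "nat => 'g vfield"
 assumes exp: "!!k t. k : {1..n} ==> lie_exp A (vf_scale t (X k)) = gam k t"
  and kernel: "reproducing_kernel mu B N phi"
  and diff: "left_differentiable A n X n phi" "right_differentiable A n X n phi"
  and conv_left: "!!alp. alp : multi_indices n ==> length alp <= n ==>
   conv_continuous mu B N (%y. of_real (norm (left_derivs A X alp phi y)))"
  and conv_right: "!!alp. alp : multi_indices n ==> length alp <= n ==>
   conv_continuous mu B N (%y. of_real (norm (right_derivs A X alp phi y)))"
 shows "smooth_kernel_space gam n mu B N phi
  (%alp. right_derivs A X (rev alp) phi) (%alp. left_derivs A X (rev alp) phi)"
proof -
 let ?R = "%alp. right_derivs A X (rev alp) phi" and ?L = "%alp. left_derivs A X (rev alp) phi"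
 have Nil: "?R [] = phi" "?L [] = phi" by (simp_all add: right_derivs_def left_derivs_def)
 have phi: "phi : Bmeas" using kernel by (intro measurable) (simp add: reproducing_kernel_def)
 have R: "((%t. (?R alp (z + gam k t) - ?R alp z) / of_real t) \<longlongrightarrow> ?R (k # alp) z) (at 0)"
  if "set alp <= {1..n}" "length alp < n" "k : {1..n}" for alp k z
 proof -
  have "EX l. (right_quot A (X k) (?R alp) z \<longlongrightarrow> l) (at 0)"
   by (rule diff(2)[unfolded right_differentiable_def, rule_format])
    (use that in \<open>simp_all add: multi_indices_def\<close>)
  then obtain l where l: "(right_quot A (X k) (?R alp) z \<longlongrightarrow> l) (at 0)" ..
  then have "?R (k # alp) z = l"
   by (simp add: right_derivs_def right_deriv_def tendsto_Lim)
  then show ?thesis using l by (simp add: right_quot_def[abs_def] exp[OF that(3)])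
 qed
 have L: "((%t. (?L alp (gam k t + z) - ?L alp z) / of_real t) \<longlongrightarrow> ?L (k # alp) z) (at 0)"
  if "set alp <= {1..n}" "length alp < n" "k : {1..n}" for alp k z
 proof -
  have "EX l. (left_quot A (X k) (?L alp) z \<longlongrightarrow> l) (at 0)"
   by (rule diff(1)[unfolded left_differentiable_def, rule_format])
    (use that in \<open>simp_all add: multi_indices_def\<close>)
  then obtain l where l: "(left_quot A (X k) (?L alp) z \<longlongrightarrow> l) (at 0)" ..
  then have "?L (k # alp) z = l"
   by (simp add: left_derivs_def left_deriv_def tendsto_Lim)
  then show ?thesis using l by (simp add: left_quot_def[abs_def] exp[OF that(3)])
 qed
 have transl: "(%z. z + a) : borel_measurable (borel :: 'g measure)" "(%z. a + z) : borel_measurable (borel :: 'g measure)" for a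
  by (intro continuous_measurable continuous_intros)+
 have mR: "?R alp : Bmeas" if "set alp <= {1..n}" "length alp <= n" for alp
  using that
 proof (induction alp)
  case (Cons k alp)
  then have IH: "?R alp : Bmeas" by simp
  show ?case
   by (rule measurable_derivative[OF measurable_compose[OF transl(1) IH] IH R]) (use Cons.prems in auto)
 qed (simp only: Nil phi)
 have mL: "?L alp : Bmeas" if "set alp <= {1..n}" "length alp <= n" for alp
  using that
 proof (induction alp)
  case (Cons k alp)
  then have IH: "?L alp : Bmeas" by simp
  show ?case
   by (rule measurable_derivative[OF measurable_compose[OF transl(2) IH] IH L]) (use Cons.prems in auto)
 qed (simp only: Nil phi)
 show ?thesis
 proof (rule smooth_kernel_space.intro[OF sampling_space_axioms smooth_kernel_space_axioms.intro])
  show "right_tower gam n n ?R"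
   unfolding right_tower_def
  proof (intro conjI allI impI)
   fix alp k assume a: "set alp <= {1..n}" "length alp < n" "k : {1..n}"
   show "right_curve_deriv (gam k) (?R alp) (?R (k # alp))"
    unfolding right_curve_deriv_def
    by (intro allI has_vector_derivative_if_quotient) (use R[OF a] curve_0[OF a(3)] in simp)
  qed (rule mR)
  show "((%t. ?L alp (gam k t + z)) has_vector_derivative ?L (k # alp) z) (at 0)"
   if a: "set alp <= {1..n}" "length alp < n" "k : {1..n}" for alp k z
   by (rule has_vector_derivative_if_quotient) (use L[OF a] curve_0[OF a(3)] in simp)
  show "conv_continuous mu B N (%y. of_real (norm (?R alp y)))"
   "conv_continuous mu B N (%y. of_real (norm (?L alp y)))" if "set alp <= {1..n}" "length alp <= n" for alp
   using that by (auto intro!: conv_right conv_left simp: multi_indices_def)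
 qed (fact kernel Nil mL)+
qed

theorem theorem3p13:
  fixes A :: "('g::{topological_group_add, t2_space, second_countable_topology},
                'e::euclidean_space) chart set"
    and n :: nat
    and X :: "nat \<Rightarrow> 'g vfield"
    and \<mu> :: "'g measure"
    and B :: "('g \<Rightarrow> complex) set"
    and N :: "('g \<Rightarrow> complex) \<Rightarrow> real"
    and \<phi> :: "'g \<Rightarrow> complex"
  assumes lie: "lie_group A n"
    and basis: "lie_algebra_basis A n X"
    and haar: "left_haar_measure \<mu>"
    and space: "solid_translation_invariant_space \<mu> B N"
    and kernel: "reproducing_kernel \<mu> B N \<phi>"
    and differentiable:
      "left_differentiable A n X n \<phi>" "right_differentiable A n X n \<phi>"
    and conv_left: "\<And>\<alpha>. \<alpha> \<in> multi_indices n \<Longrightarrow> length \<alpha> \<le> n \<Longrightarrow>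
      conv_continuous \<mu> B N (\<lambda>y. of_real (norm (left_derivs A X \<alpha> \<phi> y)))"
    and conv_right: "\<And>\<alpha>. \<alpha> \<in> multi_indices n \<Longrightarrow> length \<alpha> \<le> n \<Longrightarrow>
      conv_continuous \<mu> B N (\<lambda>y. of_real (norm (right_derivs A X \<alpha> \<phi> y)))"
  shows "\<exists>\<epsilon>>0. \<exists>(I::nat set) x.
    relatively_separated (exp_box A n X \<epsilon>) I x \<and>
    (\<forall>\<psi>. bupu (exp_box A n X \<epsilon>) I x \<psi> \<longrightarrow>
      (let E = reproducing_space \<mu> B \<phi>;
           D = seq_space B (exp_box A n X \<epsilon>) I x;
           ND = seq_norm N (exp_box A n X \<epsilon>) I x;
           c = weight \<mu> \<psi>;
           T = T3 \<mu> \<phi> I x \<psi>;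
           l = (\<lambda>i f. c i * inv_into E T f (x i));
           v = (\<lambda>i. left_transl (x i) \<phi>);
           C_c_dense = dense_in_space compactly_supported_continuous B N
       in invertible_operator E N T \<and>
          (\<forall>f\<in>E. pointwise_sum I (\<lambda>i y. c i * f (x i) * v i y) (T f)) \<and>
          (C_c_dense \<longrightarrow> (\<forall>f\<in>E. norm_sum N I (\<lambda>i y. c i * f (x i) * v i y) (T f))) \<and>
          atomic_decomposition (pointwise_sum I) E N D ND I l v \<and>
          (C_c_dense \<longrightarrow> atomic_decomposition (norm_sum N I) E N D ND I l v) \<and>
          banach_frame E N D ND I (\<lambda>i f. c i * f (x i))))"
proof -
  obtain \<gamma> where sg: "sampling_group \<gamma> n \<mu>" and exp: "\<forall>k\<in>{1..n}. \<forall>t. lie_exp A (vf_scale t (X k)) = \<gamma> k t"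
    using lie_group_sampling_group[OF lie basis haar] by (elim exE conjE)
  have box: "exp_box A n X \<epsilon> = exp_words \<gamma> n \<epsilon>" for \<epsilon>
  proof -
    have "map (\<lambda>k. lie_exp A (vf_scale (t k) (X k))) [1..<Suc n] = map (\<lambda>k. \<gamma> k (t k)) [1..<Suc n]" for t
      by (rule map_cong) (use exp in auto)
    then show ?thesis unfolding exp_box_def exp_words_def by (simp only:)
  qed
  interpret smooth_kernel_space \<gamma> n \<mu> B N \<phi>
      "\<lambda>\<alpha>. right_derivs A X (rev \<alpha>) \<phi>" "\<lambda>\<alpha>. left_derivs A X (rev \<alpha>) \<phi>"
    by (rule sampling_space.smooth_kernel_space_if_differentiable[OF sampling_space.intro[OF sg space] _
          kernel differentiable conv_left conv_right]) (use exp in auto)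
  obtain \<epsilon> I x M V S Q A' C where \<epsilon>: "\<epsilon> > 0" "relatively_separated (exp_words \<gamma> n \<epsilon>) I x"
    and ks: "kernel_sampling \<gamma> n \<mu> B N \<phi> (\<lambda>\<alpha>. right_derivs A X (rev \<alpha>) \<phi>) (\<lambda>\<alpha>. left_derivs A X (rev \<alpha>) \<phi>)
      \<epsilon> I x M V S Q A' C"
    by (rule exists_kernel_sampling) (rule that)
  show ?thesis
    unfolding box Let_def
    by (intro exI[of _ \<epsilon>] exI[of _ I] exI[of _ x] conjI \<epsilon> allI impI kernel_sampling.sampling_theorem[OF ks]; assumption)
qed

end
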